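(* Let $k$ be a ring, $S=k[x_1,\ldots,x_n]$, and $d$ a positive integer. The functors $\mathcal{H}{\rm ilb}^\Delta_{S/k}$, where $\Delta$ runs through all standard sets in $\mathbb{N}^n$ of size $d$, form an open cover of the functor $\mathcal{H}{\rm ilb}^d_{S/k}$. Moreover, this cover is minimal in the sense that when removing any member of it, the result is no longer a cover.
   Context: All rings are commutative with $1$; $x^\alpha=x_1^{\alpha_1}\cdots x_n^{\alpha_n}$ for $\alpha\in\mathbb{N}^n$, and $B[x]=B[x_1,\ldots,x_n]$. A standard set is a subset $\Delta\subset\mathbb{N}^n$ whose complement in $\mathbb{N}^n$ is closed with respect to addition with elements of $\mathbb{N}^n$. The Hilbert functor of points $\mathcal{H}{\rm ilb}^{d}_{S/k}:(k\text{-Alg})\to({\rm Sets})$ sends $B$ to the set of surjective $B$-algebra homomorphisms $\phi:B[x]\to Q$ with $Q$ a locally free $B$-module of rank $d$ (for each prime $\mathfrak{p}\subset B$ there is $f\in B-\mathfrak{p}$ with $Q_f$ free of rank $d$ over $B_f$), where $\phi\sim\phi'$ iff $\ker\phi=\ker\phi'$; functoriality is by base change. For a standard set $\Delta$ of size $d$, $\mathcal{H}{\rm ilb}^{\Delta}_{S/k}$ is the subfunctor of those $\phi$ for which the composition $\bigoplus_{\beta\in\Delta}Bx^\beta\hookrightarrow B[x]\xrightarrow{\phi}Q$ is surjective (hence an isomorphism). A subfunctor $\mathcal{G}\subset\mathcal{F}$ of functors $(k\text{-Alg})\to({\rm Sets})$ is open if for every $k$-algebra $B$ and every $\phi\in\mathcal{F}(B)$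 there is an open subscheme $U\subset{\rm Spec}\,B$ such that, for every $k$-algebra homomorphism $B\to A$, the image of $\phi$ in $\mathcal{F}(A)$ lies in $\mathcal{G}(A)$ if and only if ${\rm Spec}\,A\to{\rm Spec}\,B$ factors through $U$. A family of open subfunctors is an open cover of $\mathcal{F}$ if for every $B$ and $\phi\in\mathcal{F}(B)$ the corresponding open subschemes $U$ cover ${\rm Spec}\,B$.
   Formalization: The ring k is assumed to be nonzero; over the zero ring all spectra are empty, so the empty family is already an open cover and the minimality claim fails. *)

theory Defs
  imports "HOL-Algebra.QuotRing" "HOL-Algebra.Module"
begin

section \<open>Algebras\<close>

text \<open>
  An algebra over a commutative ring is a record satisfying the library locale
  \<^locale>\<open>algebra\<close>. Homomorphisms are extensional, so that two homomorphisms
  are equal as soon as they agree on the carrier.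
\<close>

definition alg_hom ::
    "('r, 'l) ring_scheme \<Rightarrow> ('r, 'a) module \<Rightarrow> ('r, 'b) module \<Rightarrow> ('a \<Rightarrow> 'b) set" where
  "alg_hom R M N = {h \<in> ring_hom M N \<inter> extensional (carrier M).
     \<forall>a\<in>carrier R. \<forall>x\<in>carrier M. h (a \<odot>\<^bsub>M\<^esub> x) = a \<odot>\<^bsub>N\<^esub> h x}"

definition self_alg :: "('r, 'l) ring_scheme \<Rightarrow> ('r, 'r) module" where
  "self_alg R = \<lparr>carrier = carrier R, mult = mult R, one = \<one>\<^bsub>R\<^esub>,
     zero = \<zero>\<^bsub>R\<^esub>, add = add R, smult = mult R\<rparr>"

text \<open>
  The quotient ring \<^term>\<open>M Quot I\<close> with the induced scalar multiplication; the
  union ranges over the representatives of a coset, all of which give the same coset.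
\<close>

definition quot_alg :: "('r, 'a) module \<Rightarrow> 'a set \<Rightarrow> ('r, 'a set) module" where
  "quot_alg M I = \<lparr>carrier = carrier (M Quot I), mult = mult (M Quot I),
     one = \<one>\<^bsub>M Quot I\<^esub>, zero = \<zero>\<^bsub>M Quot I\<^esub>, add = add (M Quot I),
     smult = (\<lambda>a X. \<Union>x\<in>X. I +>\<^bsub>M\<^esub> (a \<odot>\<^bsub>M\<^esub> x))\<rparr>"


section \<open>Monoid algebras and polynomial rings\<close>

text \<open>
  Elements of the monoid algebra \<open>R[G]\<close> are finitely supported families of coefficients,
  set to zero outside the carrier of \<open>G\<close>; the product is convolution.
\<close>

definition monoid_algebra ::
    "('r, 'l) ring_scheme \<Rightarrow> ('g, 'm) monoid_scheme \<Rightarrow> ('r, 'g \<Rightarrow> 'r) module" where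
  "monoid_algebra R G =
     \<lparr>carrier = {p. (\<forall>x. p x \<in> carrier R) \<and> (\<forall>x. x \<notin> carrier G \<longrightarrow> p x = \<zero>\<^bsub>R\<^esub>)
                   \<and> finite {x. p x \<noteq> \<zero>\<^bsub>R\<^esub>}},
      mult = (\<lambda>p q x. finsum R (\<lambda>(y, z). p y \<otimes>\<^bsub>R\<^esub> q z)
                {(y, z). p y \<noteq> \<zero>\<^bsub>R\<^esub> \<and> q z \<noteq> \<zero>\<^bsub>R\<^esub> \<and> y \<otimes>\<^bsub>G\<^esub> z = x}),
      one = (\<lambda>x. if x = \<one>\<^bsub>G\<^esub> then \<one>\<^bsub>R\<^esub> else \<zero>\<^bsub>R\<^esub>),
      zero = (\<lambda>x. \<zero>\<^bsub>R\<^esub>),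
      add = (\<lambda>p q x. p x \<oplus>\<^bsub>R\<^esub> q x),
      smult = (\<lambda>a p x. a \<otimes>\<^bsub>R\<^esub> p x)\<rparr>"

definition basis_elt :: "('r, 'l) ring_scheme \<Rightarrow> 'g \<Rightarrow> 'g \<Rightarrow> 'r" where
  "basis_elt R y = (\<lambda>x. if x = y then \<one>\<^bsub>R\<^esub> else \<zero>\<^bsub>R\<^esub>)"

text \<open>
  The monoid \<open>\<nat>\<^sup>n\<close>: an exponent vector is a function on \<^typ>\<open>nat\<close> vanishing at all
  indices \<open>\<ge> n\<close>.
\<close>

definition expos :: "nat \<Rightarrow> (nat \<Rightarrow> nat) monoid" where
  "expos n = \<lparr>carrier = {\<alpha>. \<forall>i\<ge>n. \<alpha> i = 0}, mult = (\<lambda>\<alpha> \<beta> i. \<alpha> i + \<beta> i), one = (\<lambda>i. 0)\<rparr>"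

text \<open>\<open>R[x\<^sub>1, \<dots>, x\<^sub>n]\<close>; the monomial \<open>x\<^sup>\<alpha>\<close> is \<^term>\<open>basis_elt R \<alpha>\<close>.\<close>

definition mpoly :: "nat \<Rightarrow> ('r, 'l) ring_scheme \<Rightarrow> ('r, (nat \<Rightarrow> nat) \<Rightarrow> 'r) module" where
  "mpoly n R = monoid_algebra R (expos n)"

definition standard_set :: "nat \<Rightarrow> (nat \<Rightarrow> nat) set \<Rightarrow> bool" where
  "standard_set n \<Delta> \<longleftrightarrow> \<Delta> \<subseteq> carrier (expos n) \<and>
     (\<forall>\<alpha>\<in>carrier (expos n) - \<Delta>. \<forall>\<gamma>\<in>carrier (expos n). \<alpha> \<otimes>\<^bsub>expos n\<^esub> \<gamma> \<in> carrier (expos n) - \<Delta>)"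

definition standard_sets_of_size :: "nat \<Rightarrow> nat \<Rightarrow> (nat \<Rightarrow> nat) set set" where
  "standard_sets_of_size n d = {\<Delta>. standard_set n \<Delta> \<and> finite \<Delta> \<and> card \<Delta> = d}"

definition mpoly_span ::
    "nat \<Rightarrow> ('r, 'l) ring_scheme \<Rightarrow> (nat \<Rightarrow> nat) set \<Rightarrow> ((nat \<Rightarrow> nat) \<Rightarrow> 'r) set" where
  "mpoly_span n R \<Delta> = {p \<in> carrier (mpoly n R). \<forall>\<alpha>. p \<alpha> \<noteq> \<zero>\<^bsub>R\<^esub> \<longrightarrow> \<alpha> \<in> \<Delta>}"


section \<open>Localization and local freeness\<close>

text \<open>
  The pair \<open>(x, i)\<close> stands for the fraction \<open>x / f^i\<close>, so \<open>(x, i)\<close> and \<open>(y, j)\<close> are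
  identified iff \<open>f^l (f^j x - f^i y) = 0\<close> for some \<open>l\<close>.
\<close>

definition frac_rel ::
    "('b, 'l) ring_scheme \<Rightarrow> ('b, 'a) module \<Rightarrow> 'b \<Rightarrow> (('a \<times> nat) \<times> ('a \<times> nat)) set" where
  "frac_rel B M f = {((x, i), (y, j)). x \<in> carrier M \<and> y \<in> carrier M \<and>
     (\<exists>l::nat. (f [^]\<^bsub>B\<^esub> l) \<odot>\<^bsub>M\<^esub>
        (((f [^]\<^bsub>B\<^esub> j) \<odot>\<^bsub>M\<^esub> x) \<ominus>\<^bsub>M\<^esub> ((f [^]\<^bsub>B\<^esub> i) \<odot>\<^bsub>M\<^esub> y)) = \<zero>\<^bsub>M\<^esub>)}"

definition frac ::
    "('b, 'l) ring_scheme \<Rightarrow> ('b, 'a) module \<Rightarrow> 'b \<Rightarrow> 'a \<Rightarrow> nat \<Rightarrow> ('a \<times> nat) set" where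
  "frac B M f x i = frac_rel B M f `` {(x, i)}"

text \<open>
  The localization \<open>M\<^sub>f\<close> of a \<open>B\<close>-algebra \<open>M\<close> at \<open>f \<in> B\<close>. The unions in the operations
  range over representatives, all of which give the same fraction. The scalars are
  the elements of \<open>B\<^sub>f\<close>, which is the case \<open>M = B\<close>.
\<close>

definition localize ::
    "('b, 'l) ring_scheme \<Rightarrow> ('b, 'a) module \<Rightarrow> 'b \<Rightarrow> (('b \<times> nat) set, ('a \<times> nat) set) module" where
  "localize B M f =
     \<lparr>carrier = (carrier M \<times> UNIV) // frac_rel B M f,
      mult = (\<lambda>X Y. \<Union>(x, i)\<in>X. \<Union>(y, j)\<in>Y. frac B M f (x \<otimes>\<^bsub>M\<^esub> y) (i + j)),
      one = frac B M f \<one>\<^bsub>M\<^esub> 0,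
      zero = frac B M f \<zero>\<^bsub>M\<^esub> 0,
      add = (\<lambda>X Y. \<Union>(x, i)\<in>X. \<Union>(y, j)\<in>Y.
               frac B M f (((f [^]\<^bsub>B\<^esub> j) \<odot>\<^bsub>M\<^esub> x) \<oplus>\<^bsub>M\<^esub> ((f [^]\<^bsub>B\<^esub> i) \<odot>\<^bsub>M\<^esub> y)) (i + j)),
      smult = (\<lambda>C Y. \<Union>(c, i)\<in>C. \<Union>(y, j)\<in>Y. frac B M f (c \<odot>\<^bsub>M\<^esub> y) (i + j))\<rparr>"

definition free_of_rank :: "('r, 'l) ring_scheme \<Rightarrow> ('r, 'a) module \<Rightarrow> nat \<Rightarrow> bool" where
  "free_of_rank R M d \<longleftrightarrow>
     (\<exists>e \<in> {..<d} \<rightarrow> carrier M. \<forall>x\<in>carrier M.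
        \<exists>!c. c \<in> {..<d} \<rightarrow>\<^sub>E carrier R \<and> x = finsum M (\<lambda>i. c i \<odot>\<^bsub>M\<^esub> e i) {..<d})"

definition locally_free_of_rank :: "('b, 'l) ring_scheme \<Rightarrow> ('b, 'a) module \<Rightarrow> nat \<Rightarrow> bool" where
  "locally_free_of_rank B M d \<longleftrightarrow>
     (\<forall>P. primeideal P B \<longrightarrow>
        (\<exists>f\<in>carrier B - P. free_of_rank (localize B (self_alg B) f) (localize B M f) d))"


section \<open>Base change\<close>

text \<open>
  Let \<open>g : B \<rightarrow> A\<close> be a ring homomorphism and \<open>Q\<close> a \<open>B\<close>-algebra. The \<open>A\<close>-algebra
  \<open>A \<otimes>\<^sub>B Q\<close> is the free \<open>A\<close>-module on the symbols \<open>[q] = 1 \<otimes> q\<close> modulo the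
  relations \<open>[q + r] = [q] + [r]\<close> and \<open>[b q] = g(b) [q]\<close>. With \<open>[q] [r] = [q r]\<close> the free
  module is the monoid algebra of the multiplicative monoid of \<open>Q\<close>; the \<open>A\<close>-submodule
  spanned by the relations is stable under multiplication by the symbols, hence it
  is the ideal generated by them.
\<close>

definition tensor_ideal ::
    "('b, 'l) ring_scheme \<Rightarrow> ('a, 'm) ring_scheme \<Rightarrow> ('b \<Rightarrow> 'a) \<Rightarrow> ('b, 'q) module \<Rightarrow> ('q \<Rightarrow> 'a) set" where
  "tensor_ideal B A g Q = (let F = monoid_algebra A Q in genideal F
     ({basis_elt A (q \<oplus>\<^bsub>Q\<^esub> r) \<ominus>\<^bsub>F\<^esub> (basis_elt A q \<oplus>\<^bsub>F\<^esub> basis_elt A r) | q r.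
         q \<in> carrier Q \<and> r \<in> carrier Q}
      \<union> {basis_elt A (b \<odot>\<^bsub>Q\<^esub> q) \<ominus>\<^bsub>F\<^esub> (g b \<odot>\<^bsub>F\<^esub> basis_elt A q) | b q.
         b \<in> carrier B \<and> q \<in> carrier Q}))"

definition tensor_alg ::
    "('b, 'l) ring_scheme \<Rightarrow> ('a, 'm) ring_scheme \<Rightarrow> ('b \<Rightarrow> 'a) \<Rightarrow> ('b, 'q) module
      \<Rightarrow> ('a, ('q \<Rightarrow> 'a) set) module" where
  "tensor_alg B A g Q = quot_alg (monoid_algebra A Q) (tensor_ideal B A g Q)"

text \<open>
  The base change \<open>A[x] \<rightarrow> A \<otimes>\<^sub>B Q\<close>, \<open>a x\<^sup>\<alpha> \<mapsto> a \<otimes> \<phi>(x\<^sup>\<alpha>)\<close>, of \<open>\<phi> : B[x] \<rightarrow> Q\<close>.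
\<close>

definition base_change ::
    "nat \<Rightarrow> ('b, 'l) ring_scheme \<Rightarrow> ('a, 'm) ring_scheme \<Rightarrow> ('b \<Rightarrow> 'a) \<Rightarrow> ('b, 'q) module
      \<Rightarrow> (((nat \<Rightarrow> nat) \<Rightarrow> 'b) \<Rightarrow> 'q) \<Rightarrow> ((nat \<Rightarrow> nat) \<Rightarrow> 'a) \<Rightarrow> ('q \<Rightarrow> 'a) set" where
  "base_change n B A g Q \<phi> = (let F = monoid_algebra A Q in
     (\<lambda>p\<in>carrier (mpoly n A). tensor_ideal B A g Q +>\<^bsub>F\<^esub>
        finsum F (\<lambda>\<alpha>. p \<alpha> \<odot>\<^bsub>F\<^esub> basis_elt A (\<phi> (basis_elt B \<alpha>))) {\<alpha>. p \<alpha> \<noteq> \<zero>\<^bsub>A\<^esub>}))"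


section \<open>Set-valued functors on algebras\<close>

text \<open>
  The type variable \<open>'u\<close> plays the role of a universe: the base ring \<open>k\<close> and all
  objects of the category of \<open>k\<close>-algebras have their carriers in \<open>'u\<close>. A functor
  consists of an object part and a morphism part; \<open>farr F B A g\<close> is the map
  \<open>F(B) \<rightarrow> F(A)\<close> attached to \<open>g : B \<rightarrow> A\<close>.
\<close>

record ('u, 'x) alg_functor =
  fobj :: "('u, 'u) module \<Rightarrow> 'x set"
  farr :: "('u, 'u) module \<Rightarrow> ('u, 'u) module \<Rightarrow> ('u \<Rightarrow> 'u) \<Rightarrow> 'x \<Rightarrow> 'x"

definition is_functor :: "('u, 'l) ring_scheme \<Rightarrow> ('u, 'x) alg_functor \<Rightarrow> bool" where
  "is_functor k F \<longleftrightarrow>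
     (\<forall>B A. algebra k B \<and> algebra k A \<longrightarrow>
        (\<forall>g\<in>alg_hom k B A. farr F B A g \<in> fobj F B \<rightarrow> fobj F A)) \<and>
     (\<forall>B. algebra k B \<longrightarrow> (\<forall>x\<in>fobj F B. farr F B B (\<lambda>b\<in>carrier B. b) x = x)) \<and>
     (\<forall>B A C. algebra k B \<and> algebra k A \<and> algebra k C \<longrightarrow>
        (\<forall>g\<in>alg_hom k B A. \<forall>h\<in>alg_hom k A C. \<forall>x\<in>fobj F B.
           farr F B C (compose (carrier B) h g) x = farr F A C h (farr F B A g x)))"

definition is_subfunctor ::
    "('u, 'l) ring_scheme \<Rightarrow> ('u, 'x) alg_functor \<Rightarrow> ('u, 'x) alg_functor \<Rightarrow> bool" where
  "is_subfunctor k G F \<longleftrightarrow> is_functor k G \<and> is_functor k F \<and>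
     (\<forall>B. algebra k B \<longrightarrow> fobj G B \<subseteq> fobj F B) \<and>
     (\<forall>B A. algebra k B \<and> algebra k A \<longrightarrow>
        (\<forall>g\<in>alg_hom k B A. \<forall>x\<in>fobj G B. farr G B A g x = farr F B A g x))"

definition Spec :: "('b, 'l) ring_scheme \<Rightarrow> 'b set set" where
  "Spec B = {P. primeideal P B}"

definition zariski_open :: "('b, 'l) ring_scheme \<Rightarrow> 'b set set \<Rightarrow> bool" where
  "zariski_open B U \<longleftrightarrow> (\<exists>S\<subseteq>carrier B. U = {P \<in> Spec B. \<not> S \<subseteq> P})"

definition spec_map :: "('b, 'l) ring_scheme \<Rightarrow> ('b \<Rightarrow> 'a) \<Rightarrow> 'a set \<Rightarrow> 'b set" where
  "spec_map B g P = {b \<in> carrier B. g b \<in> P}"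

text \<open>
  Open subschemes of \<open>Spec B\<close> correspond to Zariski-open subsets, and a morphism
  \<open>Spec A \<rightarrow> Spec B\<close> factors through the open subscheme on \<open>U\<close> iff it maps every point
  into \<open>U\<close>.
\<close>

definition is_open_locus ::
    "('u, 'l) ring_scheme \<Rightarrow> ('u, 'x) alg_functor \<Rightarrow> ('u, 'x) alg_functor
      \<Rightarrow> ('u, 'u) module \<Rightarrow> 'x \<Rightarrow> 'u set set \<Rightarrow> bool" where
  "is_open_locus k G F B \<phi> U \<longleftrightarrow> zariski_open B U \<and>
     (\<forall>A. algebra k A \<longrightarrow> (\<forall>g\<in>alg_hom k B A.
        farr F B A g \<phi> \<in> fobj G A \<longleftrightarrow> spec_map B g ` Spec A \<subseteq> U))"

definition is_open_subfunctor ::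
    "('u, 'l) ring_scheme \<Rightarrow> ('u, 'x) alg_functor \<Rightarrow> ('u, 'x) alg_functor \<Rightarrow> bool" where
  "is_open_subfunctor k G F \<longleftrightarrow> is_subfunctor k G F \<and>
     (\<forall>B. algebra k B \<longrightarrow> (\<forall>\<phi>\<in>fobj F B. \<exists>U. is_open_locus k G F B \<phi> U))"

definition is_open_cover ::
    "('u, 'l) ring_scheme \<Rightarrow> 'i set \<Rightarrow> ('i \<Rightarrow> ('u, 'x) alg_functor) \<Rightarrow> ('u, 'x) alg_functor \<Rightarrow> bool" where
  "is_open_cover k J G F \<longleftrightarrow>
     (\<forall>i\<in>J. is_open_subfunctor k (G i) F) \<and>
     (\<forall>B. algebra k B \<longrightarrow> (\<forall>\<phi>\<in>fobj F B.
        \<exists>U. (\<forall>i\<in>J. is_open_locus k (G i) F B \<phi> (U i)) \<and> (\<Union>i\<in>J. U i) = Spec B))"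


section \<open>The Hilbert functor of points\<close>

text \<open>
  Since \<open>\<phi> \<sim> \<phi>'\<close> iff \<open>ker \<phi> = ker \<phi>'\<close>, the class of \<open>\<phi> : B[x] \<rightarrow> Q\<close> is recorded by its
  kernel. The target \<open>Q\<close> ranges over algebras whose elements are sets of polynomials;
  every class has a representative of this kind, namely \<open>B[x] \<rightarrow> B[x] / ker \<phi>\<close>.
\<close>

type_synonym 'u mpoly_ideal = "((nat \<Rightarrow> nat) \<Rightarrow> 'u) set"

definition hilb_family ::
    "nat \<Rightarrow> nat \<Rightarrow> ('u, 'l) ring_scheme \<Rightarrow> ('u, 'q) module \<Rightarrow> (((nat \<Rightarrow> nat) \<Rightarrow> 'u) \<Rightarrow> 'q) \<Rightarrow> bool" where
  "hilb_family n d B Q \<phi> \<longleftrightarrow> algebra B Q \<and> locally_free_of_rank B Q d \<and>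
     \<phi> \<in> alg_hom B (mpoly n B) Q \<and> \<phi> ` carrier (mpoly n B) = carrier Q"

definition hilb_map ::
    "nat \<Rightarrow> ('u, 'u) module \<Rightarrow> ('u, 'u) module \<Rightarrow> ('u \<Rightarrow> 'u) \<Rightarrow> 'u mpoly_ideal \<Rightarrow> 'u mpoly_ideal" where
  "hilb_map n B A g I =
     (let Q = quot_alg (mpoly n B) I;
          \<phi> = (\<lambda>p\<in>carrier (mpoly n B). I +>\<^bsub>mpoly n B\<^esub> p)
      in a_kernel (mpoly n A) (tensor_alg B A g Q) (base_change n B A g Q \<phi>))"

definition Hilb :: "nat \<Rightarrow> nat \<Rightarrow> ('u, 'u mpoly_ideal) alg_functor" where
  "Hilb n d =
     \<lparr>fobj = (\<lambda>B. {a_kernel (mpoly n B) Q \<phi> | (Q :: ('u, 'u mpoly_ideal) module) \<phi>.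
                hilb_family n d B Q \<phi>}),
      farr = hilb_map n\<rparr>"

definition Hilb_std :: "nat \<Rightarrow> (nat \<Rightarrow> nat) set \<Rightarrow> ('u, 'u mpoly_ideal) alg_functor" where
  "Hilb_std n \<Delta> =
     \<lparr>fobj = (\<lambda>B. {a_kernel (mpoly n B) Q \<phi> | (Q :: ('u, 'u mpoly_ideal) module) \<phi>.
                hilb_family n (card \<Delta>) B Q \<phi> \<and> \<phi> ` mpoly_span n B \<Delta> = carrier Q}),
      farr = hilb_map n\<rparr>"

end

theory Submission
  imports Defs "HOL-Algebra.Weak_Morphisms"
begin

text \<open>
  A family is recorded by its kernel \<open>I\<close>, and local freeness of \<open>B[x]/I\<close> amounts to the existence, near
  every prime \<open>Q\<close>, of elements \<open>e\<^sub>0, \<dots>, e\<^sub>d\<^sub>-\<^sub>1\<close> of \<open>B[x]\<close> that form a basis modulo \<open>I\<close> after inverting some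
  \<open>f \<notin> Q\<close>; base change replaces \<open>I\<close> by the ideal it generates in \<open>A[x]\<close>. If the monomials in a finite
  set \<open>\<Delta>\<close> span the fibre at \<open>Q\<close>, then by Nakayama they span the quotient after inverting some
  \<open>h \<notin> Q\<close>, and spanning after base change to \<open>A\<close> can be tested in the fibres, so the locus is open.
  In every fibre the monomials that are not leading monomials of the ideal, for the lexicographic
  order, form a basis indexed by a standard set, so the loci cover the spectrum. The monomial ideal
  of the complement of \<open>\<Delta>\<close> over a residue field of \<open>k\<close> lies in the member \<open>\<Delta>\<close> of the cover and in no
  other.
\<close>

section \<open>Monoid algebras\<close>

text \<open>The fibre arguments never form a localized ring or a residue field. Inverting the
  complement of a prime Q is replaced by the saturation \<open>sat\<close>; being zero in the
  residue field becomes membership in Q, being a unit becomes lying outside Q. The fibre at Q is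
  then B[x] modulo a saturated submodule, and Nakayama's lemma, Gaussian elimination and the
  dimension count are done by cross-multiplication in B itself. Three passages need more than this.
  Base change is given by a presentation of the tensor product as a quotient of a monoid algebra, so
  its kernel is found by constructing a map back to A[x] modulo the extended ideal. Independence of
  a basis does not survive the extension of an ideal for formal reasons: it is recovered from
  coordinate forms that are linear in the coefficients and can be transported from B to A. Openness
  compares the fibre at a prime of A with the fibre at its preimage in B, whose residue field may be
  smaller, so a span over the larger field has to be brought down.\<close>

locale mon_alg = R?: cring R + G: comm_monoid G
  for R (structure) and G
begin

abbreviation "MA \<equiv> monoid_algebra R G"

definition mon :: "'a \<Rightarrow> 'c \<Rightarrow> 'c \<Rightarrow> 'a" where
  "mon a x = (\<lambda>z. if z = x then a else \<zero>)"

definition supp :: "('c \<Rightarrow> 'a) \<Rightarrow> 'c set" where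
  "supp p = {x. p x \<noteq> \<zero>}"

lemma MA_simps [simp]:
  "\<zero>\<^bsub>MA\<^esub> = (\<lambda>x. \<zero>)"
  "p \<oplus>\<^bsub>MA\<^esub> q = (\<lambda>x. p x \<oplus> q x)"
  "a \<odot>\<^bsub>MA\<^esub> p = (\<lambda>x. a \<otimes> p x)"
  by (simp_all add: monoid_algebra_def)

lemma MA_one: "\<one>\<^bsub>MA\<^esub> = mon \<one> \<one>\<^bsub>G\<^esub>"
  by (simp add: monoid_algebra_def mon_def)

lemma basis_elt_mon: "basis_elt R x = mon \<one> x"
  by (simp add: basis_elt_def mon_def)

lemma MA_carrier_iff:
  "p \<in> carrier MA \<longleftrightarrow> (\<forall>x. p x \<in> carrier R) \<and> supp p \<subseteq> carrier G \<and> finite (supp p)"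
  by (auto simp: monoid_algebra_def supp_def)

lemma MA_coeff: "p \<in> carrier MA \<Longrightarrow> p x \<in> carrier R"
  and supp_carrier: "p \<in> carrier MA \<Longrightarrow> supp p \<subseteq> carrier G"
  and supp_finite [simp]: "p \<in> carrier MA \<Longrightarrow> finite (supp p)"
  by (auto simp: MA_carrier_iff)

lemma not_supp: "x \<notin> supp p \<Longrightarrow> p x = \<zero>"
  by (simp add: supp_def)

lemma MA_I:
  assumes "\<And>x. p x \<in> carrier R" "\<And>x. x \<notin> S \<Longrightarrow> p x = \<zero>" "finite S" "S \<subseteq> carrier G"
  shows "p \<in> carrier MA"
proof -
  have "supp p \<subseteq> S" using assms(2) by (auto simp: supp_def)
  then show ?thesis using assms(1,3,4) finite_subset[of "supp p" S] unfolding MA_carrier_iff by blast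
qed

lemma mon_apply: "mon a x z = (if z = x then a else \<zero>)"
  by (simp add: mon_def)

lemma supp_mon: "supp (mon a x) \<subseteq> {x}"
  by (auto simp: supp_def mon_apply split: if_splits)

lemma mon_closed [simp]: "a \<in> carrier R \<Longrightarrow> x \<in> carrier G \<Longrightarrow> mon a x \<in> carrier MA"
  using supp_mon by (intro MA_I[where S = "{x}"]) (auto simp: mon_apply)

lemma suppI: "(\<And>x. x \<notin> S \<Longrightarrow> p x = \<zero>) \<Longrightarrow> supp p \<subseteq> S"
  by (auto simp: supp_def)

lemma MA_abelian_group: "abelian_group MA"
proof (rule abelian_groupI)
  fix p q assume "p \<in> carrier MA" "q \<in> carrier MA"
  then show "p \<oplus>\<^bsub>MA\<^esub> q \<in> carrier MA"
    using supp_carrier by (intro MA_I[where S = "supp p \<union> supp q"]) (auto simp: not_supp MA_coeff)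
next
  show "\<zero>\<^bsub>MA\<^esub> \<in> carrier MA" by (simp add: MA_carrier_iff supp_def)
next
  fix p assume p: "p \<in> carrier MA"
  have "(\<lambda>x. \<ominus> p x) \<in> carrier MA"
    using p supp_carrier[OF p] by (intro MA_I[where S = "supp p"]) (auto simp: not_supp MA_coeff)
  then show "\<exists>q\<in>carrier MA. q \<oplus>\<^bsub>MA\<^esub> p = \<zero>\<^bsub>MA\<^esub>"
    using p by (intro bexI[of _ "\<lambda>x. \<ominus> p x"]) (auto simp: R.l_neg MA_coeff)
qed (auto simp: R.a_ac MA_coeff)

interpretation A: abelian_group MA by (rule MA_abelian_group)

lemma MA_a_inv: "p \<in> carrier MA \<Longrightarrow> \<ominus>\<^bsub>MA\<^esub> p = (\<lambda>x. \<ominus> p x)"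
proof (rule A.minus_equality)
  assume p: "p \<in> carrier MA"
  show q: "(\<lambda>x. \<ominus> p x) \<in> carrier MA"
    using p supp_carrier[OF p] by (intro MA_I[where S = "supp p"]) (auto simp: not_supp MA_coeff)
  show "p \<in> carrier MA" by fact
  show "(\<lambda>x. \<ominus> p x) \<oplus>\<^bsub>MA\<^esub> p = \<zero>\<^bsub>MA\<^esub>" using p by (auto simp: R.l_neg MA_coeff)
qed

lemma MA_minus: "p \<in> carrier MA \<Longrightarrow> q \<in> carrier MA \<Longrightarrow> p \<ominus>\<^bsub>MA\<^esub> q = (\<lambda>x. p x \<ominus> q x)"
  by (simp add: a_minus_def MA_a_inv)

lemma smult_closed_MA:
  assumes "a \<in> carrier R" "p \<in> carrier MA" shows "a \<odot>\<^bsub>MA\<^esub> p \<in> carrier MA"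
  using assms supp_carrier[OF assms(2)]
  by (intro MA_I[where S = "supp p"]) (auto simp: not_supp MA_coeff)

lemma MA_finsum_apply:
  assumes "f \<in> J \<rightarrow> carrier MA"
  shows "(\<Oplus>\<^bsub>MA\<^esub>j\<in>J. f j) x = (\<Oplus>j\<in>J. f j x)"
  using assms
proof (induction J rule: infinite_finite_induct)
  case (insert j J)
  then show ?case
    by (subst A.finsum_insert) (auto simp: Pi_iff MA_coeff intro!: R.finsum_insert[symmetric])
qed (auto simp: A.finsum_infinite R.finsum_infinite)

lemma MA_induct [consumes 1, case_names zero mon add]:
  assumes "p \<in> carrier MA"
    and "P (\<lambda>x. \<zero>)"
    and "\<And>a x. a \<in> carrier R \<Longrightarrow> x \<in> carrier G \<Longrightarrow> P (mon a x)"
    and "\<And>p q. p \<in> carrier MA \<Longrightarrow> q \<in> carrier MA \<Longrightarrow> P p \<Longrightarrow> P q \<Longrightarrow> P (\<lambda>x. p x \<oplus> q x)"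
  shows "P p"
proof -
  have "\<forall>p. supp p = S \<longrightarrow> p \<in> carrier MA \<longrightarrow> P p" if "finite S" for S
    using that
  proof (induction S rule: finite_induct)
    case empty
    have "p = (\<lambda>x. \<zero>)" if "supp p = {}" for p using that by (auto simp: supp_def)
    then show ?case using assms(2) by metis
  next
    case (insert x S)
    show ?case
    proof (intro allI impI)
      fix p assume sp: "supp p = insert x S" and p: "p \<in> carrier MA"
      let ?q = "p(x := \<zero>)"
      have sq: "supp ?q = S" using sp insert.hyps by (auto simp: supp_def)
      have q: "?q \<in> carrier MA"
        using p supp_carrier[OF p] insert.hyps sp not_supp[of _ p] by (intro MA_I[where S = S]) (auto simp: MA_coeff)
      have x: "x \<in> carrier G" using supp_carrier[OF p] sp by auto
      have "P (\<lambda>z. mon (p x) x z \<oplus> ?q z)"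
        using insert.IH sq q x p by (intro assms(4)) (auto intro: assms(3) simp: MA_coeff simp del: fun_upd_apply)
      moreover have "(\<lambda>z. mon (p x) x z \<oplus> ?q z) = p" using p by (auto simp: fun_eq_iff mon_apply MA_coeff)
      ultimately show "P p" by simp
    qed
  qed
  then show ?thesis using assms(1) supp_finite by blast
qed

text \<open>The convolution in the definition runs over pairs of nonzero coefficients, a set that
  varies with the factors. The terms added by enlarging it to a finite rectangle vanish, so products
  of different factors can be compared over one index set.\<close>

lemma MA_mult_on:
  assumes p: "p \<in> carrier MA" and q: "q \<in> carrier MA"
    and S: "finite S" "supp p \<subseteq> S" and T: "finite T" "supp q \<subseteq> T"
  shows "(p \<otimes>\<^bsub>MA\<^esub> q) x = finsum R (\<lambda>(y, z). p y \<otimes> q z) {(y, z). y \<in> S \<and> z \<in> T \<and> y \<otimes>\<^bsub>G\<^esub> z = x}"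
proof -
  note [simp] = MA_coeff[OF p] MA_coeff[OF q]
  have fin: "finite {(y, z). y \<in> S \<and> z \<in> T \<and> y \<otimes>\<^bsub>G\<^esub> z = x}"
    using S T by (auto intro: finite_subset[of _ "S \<times> T", OF _ finite_cartesian_product])
  have "finsum R (\<lambda>(y, z). p y \<otimes> q z) {(y, z). p y \<noteq> \<zero> \<and> q z \<noteq> \<zero> \<and> y \<otimes>\<^bsub>G\<^esub> z = x}
     = finsum R (\<lambda>(y, z). p y \<otimes> q z) {(y, z). y \<in> S \<and> z \<in> T \<and> y \<otimes>\<^bsub>G\<^esub> z = x}"
  proof (rule R.add.finprod_mono_neutral_cong_left[OF fin])
    show "{(y, z). p y \<noteq> \<zero> \<and> q z \<noteq> \<zero> \<and> y \<otimes>\<^bsub>G\<^esub> z = x}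
        \<subseteq> {(y, z). y \<in> S \<and> z \<in> T \<and> y \<otimes>\<^bsub>G\<^esub> z = x}"
      using S(2) T(2) by (force simp: supp_def)
  next
    fix w assume "w \<in> {(y, z). y \<in> S \<and> z \<in> T \<and> y \<otimes>\<^bsub>G\<^esub> z = x}
      - {(y, z). p y \<noteq> \<zero> \<and> q z \<noteq> \<zero> \<and> y \<otimes>\<^bsub>G\<^esub> z = x}"
    then have "p (fst w) = \<zero> \<or> q (snd w) = \<zero>" by auto
    then show "(\<lambda>(y, z). p y \<otimes> q z) w = \<zero>" by (auto simp: case_prod_beta)
  next
    show "(\<lambda>(y, z). p y \<otimes> q z) \<in> {(y, z). y \<in> S \<and> z \<in> T \<and> y \<otimes>\<^bsub>G\<^esub> z = x} \<rightarrow> carrier R"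
      by auto
  qed simp
  then show ?thesis by (simp add: monoid_algebra_def)
qed

lemma MA_mult_closed:
  assumes p: "p \<in> carrier MA" and q: "q \<in> carrier MA"
  shows "p \<otimes>\<^bsub>MA\<^esub> q \<in> carrier MA"
proof (rule MA_I)
  note [simp] = MA_coeff[OF p] MA_coeff[OF q]
  let ?S = "(\<lambda>(y, z). y \<otimes>\<^bsub>G\<^esub> z) ` (supp p \<times> supp q)"
  show "(p \<otimes>\<^bsub>MA\<^esub> q) x \<in> carrier R" for x
    using p q by (subst MA_mult_on[OF p q, of "supp p" "supp q"]) (auto intro!: R.finsum_closed)
  have "(p \<otimes>\<^bsub>MA\<^esub> q) x = \<zero>" if "x \<notin> ?S" for x
  proof -
    have "{(y, z). y \<in> supp p \<and> z \<in> supp q \<and> y \<otimes>\<^bsub>G\<^esub> z = x} = {}" using that by force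
    moreover have "(p \<otimes>\<^bsub>MA\<^esub> q) x = finsum R (\<lambda>(y, z). p y \<otimes> q z)
        {(y, z). y \<in> supp p \<and> z \<in> supp q \<and> y \<otimes>\<^bsub>G\<^esub> z = x}"
      using p q by (intro MA_mult_on) auto
    ultimately show ?thesis by (simp only: R.finsum_empty)
  qed
  then show "(p \<otimes>\<^bsub>MA\<^esub> q) x = \<zero>" if "x \<notin> ?S" for x using that .
  show "finite ?S" using p q by auto
  show "?S \<subseteq> carrier G" using supp_carrier p q by fastforce
qed

lemma MA_mult_comm:
  assumes p: "p \<in> carrier MA" and q: "q \<in> carrier MA"
  shows "p \<otimes>\<^bsub>MA\<^esub> q = q \<otimes>\<^bsub>MA\<^esub> p"
proof
  note [simp] = MA_coeff[OF p] MA_coeff[OF q]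
  fix x
  let ?A = "{(y, z). y \<in> supp p \<and> z \<in> supp q \<and> y \<otimes>\<^bsub>G\<^esub> z = x}"
  let ?B = "{(y, z). y \<in> supp q \<and> z \<in> supp p \<and> y \<otimes>\<^bsub>G\<^esub> z = x}"
  have B: "?B = prod.swap ` ?A"
    using supp_carrier[OF p] supp_carrier[OF q] G.m_comm by (auto simp: image_iff subset_eq)
  have "(q \<otimes>\<^bsub>MA\<^esub> p) x = finsum R (\<lambda>(y, z). q y \<otimes> p z) ?B"
    using p q by (intro MA_mult_on) auto
  also have "\<dots> = (\<Oplus>w\<in>?A. (\<lambda>(y, z). q y \<otimes> p z) (prod.swap w))"
    unfolding B by (rule R.finsum_reindex) (use p q in auto)
  also have "\<dots> = finsum R (\<lambda>(y, z). p y \<otimes> q z) ?A"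
    using p q by (intro R.finsum_cong) (auto simp: R.m_comm simp_implies_def)
  also have "\<dots> = (p \<otimes>\<^bsub>MA\<^esub> q) x"
    using p q by (intro MA_mult_on[symmetric]) auto
  finally show "(p \<otimes>\<^bsub>MA\<^esub> q) x = (q \<otimes>\<^bsub>MA\<^esub> p) x" by simp
qed

lemma MA_l_distr:
  assumes p: "p \<in> carrier MA" and p': "p' \<in> carrier MA" and q: "q \<in> carrier MA"
  shows "(p \<oplus>\<^bsub>MA\<^esub> p') \<otimes>\<^bsub>MA\<^esub> q = p \<otimes>\<^bsub>MA\<^esub> q \<oplus>\<^bsub>MA\<^esub> p' \<otimes>\<^bsub>MA\<^esub> q"
proof
  note [simp] = MA_coeff[OF p] MA_coeff[OF p'] MA_coeff[OF q]
  fix x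
  let ?S = "supp p \<union> supp p'"
  let ?A = "{(y, z). y \<in> ?S \<and> z \<in> supp q \<and> y \<otimes>\<^bsub>G\<^esub> z = x}"
  have "((p \<oplus>\<^bsub>MA\<^esub> p') \<otimes>\<^bsub>MA\<^esub> q) x = finsum R (\<lambda>(y, z). (p \<oplus>\<^bsub>MA\<^esub> p') y \<otimes> q z) ?A"
    using p p' q by (intro MA_mult_on A.a_closed suppI) (auto simp: not_supp)
  also have "\<dots> = (\<Oplus>w\<in>?A. (\<lambda>(y, z). p y \<otimes> q z) w \<oplus> (\<lambda>(y, z). p' y \<otimes> q z) w)"
    using p p' q by (intro R.finsum_cong) (auto simp: R.l_distr simp_implies_def)
  also have "\<dots> = finsum R (\<lambda>(y, z). p y \<otimes> q z) ?A \<oplus> finsum R (\<lambda>(y, z). p' y \<otimes> q z) ?A"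
    using p p' q by (intro R.finsum_addf) auto
  also have "finsum R (\<lambda>(y, z). p y \<otimes> q z) ?A = (p \<otimes>\<^bsub>MA\<^esub> q) x"
    using p p' q by (intro MA_mult_on[symmetric]) auto
  also have "finsum R (\<lambda>(y, z). p' y \<otimes> q z) ?A = (p' \<otimes>\<^bsub>MA\<^esub> q) x"
    using p p' q by (intro MA_mult_on[symmetric]) auto
  finally show "((p \<oplus>\<^bsub>MA\<^esub> p') \<otimes>\<^bsub>MA\<^esub> q) x = (p \<otimes>\<^bsub>MA\<^esub> q \<oplus>\<^bsub>MA\<^esub> p' \<otimes>\<^bsub>MA\<^esub> q) x" by simp
qed

lemma MA_r_distr:
  assumes "p \<in> carrier MA" "p' \<in> carrier MA" "q \<in> carrier MA"
  shows "q \<otimes>\<^bsub>MA\<^esub> (p \<oplus>\<^bsub>MA\<^esub> p') = q \<otimes>\<^bsub>MA\<^esub> p \<oplus>\<^bsub>MA\<^esub> q \<otimes>\<^bsub>MA\<^esub> p'"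
  using assms MA_l_distr MA_mult_comm A.a_closed by metis

lemma mon_mult:
  assumes "a \<in> carrier R" "b \<in> carrier R" "x \<in> carrier G" "y \<in> carrier G"
  shows "mon a x \<otimes>\<^bsub>MA\<^esub> mon b y = mon (a \<otimes> b) (x \<otimes>\<^bsub>G\<^esub> y)"
proof
  fix z
  have "(mon a x \<otimes>\<^bsub>MA\<^esub> mon b y) z
      = finsum R (\<lambda>(u, v). mon a x u \<otimes> mon b y v) {(u, v). u \<in> {x} \<and> v \<in> {y} \<and> u \<otimes>\<^bsub>G\<^esub> v = z}"
    using assms supp_mon by (intro MA_mult_on) (auto simp: mon_apply)
  also have "{(u, v). u \<in> {x} \<and> v \<in> {y} \<and> u \<otimes>\<^bsub>G\<^esub> v = z} = (if x \<otimes>\<^bsub>G\<^esub> y = z then {(x, y)} else {})"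
    by auto
  also have "finsum R (\<lambda>(u, v). mon a x u \<otimes> mon b y v) \<dots> = mon (a \<otimes> b) (x \<otimes>\<^bsub>G\<^esub> y) z"
    using assms by (auto simp: mon_apply)
  finally show "(mon a x \<otimes>\<^bsub>MA\<^esub> mon b y) z = mon (a \<otimes> b) (x \<otimes>\<^bsub>G\<^esub> y) z" .
qed

lemma MA_zero_mult: "q \<in> carrier MA \<Longrightarrow> (\<lambda>x. \<zero>) \<otimes>\<^bsub>MA\<^esub> q = (\<lambda>x. \<zero>)"
  by (auto simp: monoid_algebra_def)

lemma MA_mult_zero: "q \<in> carrier MA \<Longrightarrow> q \<otimes>\<^bsub>MA\<^esub> (\<lambda>x. \<zero>) = (\<lambda>x. \<zero>)"
  by (auto simp: monoid_algebra_def)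

lemma MA_zero_closed [simp]: "(\<lambda>x. \<zero>) \<in> carrier MA"
  using A.zero_closed by simp

lemma MA_add_closed [simp]:
  "p \<in> carrier MA \<Longrightarrow> q \<in> carrier MA \<Longrightarrow> (\<lambda>x. p x \<oplus> q x) \<in> carrier MA"
  using A.a_closed by simp

text \<open>Both sides are additive in each of the three factors, so the identity reduces to single
  terms, where it is associativity in the coefficient ring and in \<open>G\<close>.\<close>

lemma MA_mult_assoc:
  assumes p: "p \<in> carrier MA" and q: "q \<in> carrier MA" and r: "r \<in> carrier MA"
  shows "(p \<otimes>\<^bsub>MA\<^esub> q) \<otimes>\<^bsub>MA\<^esub> r = p \<otimes>\<^bsub>MA\<^esub> (q \<otimes>\<^bsub>MA\<^esub> r)"
  using p
proof (induction p rule: MA_induct)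
  note [simp] = MA_coeff[OF p] MA_coeff[OF q] MA_coeff[OF r]
  case zero then show ?case using q r by (simp add: MA_zero_mult MA_mult_closed)
next
  case (add p p')
  then show ?case using q r
    using MA_l_distr[OF add(1,2)] MA_l_distr[OF MA_mult_closed[OF add(1) q] MA_mult_closed[OF add(2) q] r]
    by (simp add: MA_mult_closed)
next
  case (mon a x)
  show ?case using q
  proof (induction q rule: MA_induct)
    case zero then show ?case using r mon by (simp add: MA_mult_zero MA_zero_mult MA_mult_closed)
  next
    case (add q q')
    note c = mon_closed[OF mon]
    show ?case
      using add r c MA_l_distr[OF add(1,2) r] MA_r_distr[OF add(1,2) c]
        MA_l_distr[OF MA_mult_closed[OF c add(1)] MA_mult_closed[OF c add(2)] r]
        MA_r_distr[OF MA_mult_closed[OF add(1) r] MA_mult_closed[OF add(2) r] c]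
      by simp
  next
    case m2: (mon b y)
    show ?case using r
    proof (induction r rule: MA_induct)
      case zero then show ?case using mon m2 by (simp add: MA_mult_zero MA_mult_closed)
    next
      case (add r r')
      note c = mon_closed[OF mon] and c2 = mon_closed[OF m2]
      show ?case
        using add MA_r_distr[OF add(1,2) c2] MA_r_distr[OF add(1,2) MA_mult_closed[OF c c2]]
          MA_r_distr[OF MA_mult_closed[OF c2 add(1)] MA_mult_closed[OF c2 add(2)] c]
        by simp
    next
      case m3: (mon c z)
      then show ?case using mon m2 by (simp add: mon_mult R.m_assoc G.m_assoc)
    qed
  qed
qed

lemma MA_one_closed: "\<one>\<^bsub>MA\<^esub> \<in> carrier MA"
  by (simp add: MA_one)

lemma MA_l_one:
  assumes "p \<in> carrier MA"
  shows "\<one>\<^bsub>MA\<^esub> \<otimes>\<^bsub>MA\<^esub> p = p"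
  using assms
proof (induction p rule: MA_induct)
  case (add p q)
  then show ?case using MA_r_distr[OF add(1,2) MA_one_closed] by simp
qed (auto simp: MA_mult_zero[OF MA_one_closed] MA_one mon_mult MA_mult_zero)

lemma MA_smult_mult:
  assumes a: "a \<in> carrier R" and p: "p \<in> carrier MA"
  shows "a \<odot>\<^bsub>MA\<^esub> p = mon a \<one>\<^bsub>G\<^esub> \<otimes>\<^bsub>MA\<^esub> p"
  using p
proof (induction p rule: MA_induct)
  note [simp] = MA_coeff[OF p]
  case zero then show ?case using a by (simp add: MA_mult_zero)
next
  case (mon b x) then show ?case using a by (simp add: mon_mult) (auto simp: fun_eq_iff mon_apply)
next
  case (add p q)
  then show ?case
    using a MA_r_distr[OF add(1,2), of "mon a \<one>\<^bsub>G\<^esub>"] by (auto simp: R.r_distr fun_eq_iff MA_coeff)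
qed

lemma MA_cring: "cring MA"
proof (rule cringI)
  show "abelian_group MA" by (rule MA_abelian_group)
  show "Group.comm_monoid MA"
    by (rule comm_monoidI)
      (auto intro: MA_mult_closed MA_mult_assoc MA_l_one MA_mult_comm MA_one_closed)
qed (rule MA_l_distr)

lemma MA_algebra: "algebra R MA"
proof (rule algebraI)
  show "a \<odot>\<^bsub>MA\<^esub> x \<otimes>\<^bsub>MA\<^esub> y = a \<odot>\<^bsub>MA\<^esub> (x \<otimes>\<^bsub>MA\<^esub> y)"
    if "a \<in> carrier R" "x \<in> carrier MA" "y \<in> carrier MA" for a x y
    using that MA_mult_assoc[of "mon a \<one>\<^bsub>G\<^esub>" x y]
    by (simp add: MA_smult_mult MA_mult_closed del: MA_simps)
qed (use R.cring_axioms MA_cring smult_closed_MA in \<open>auto simp: MA_coeff R.l_distr R.r_distr R.m_assoc\<close>)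

lemma MA_expand:
  assumes p: "p \<in> carrier MA" and S: "finite S" "supp p \<subseteq> S" "S \<subseteq> carrier G"
  shows "p = (\<Oplus>\<^bsub>MA\<^esub>x\<in>S. p x \<odot>\<^bsub>MA\<^esub> basis_elt R x)"
proof
  note [simp] = MA_coeff[OF p]
  fix z
  have c: "(\<lambda>x. p x \<odot>\<^bsub>MA\<^esub> basis_elt R x) \<in> S \<rightarrow> carrier MA"
    using p S by (intro Pi_I smult_closed_MA) (auto simp: basis_elt_mon)
  have "(\<Oplus>\<^bsub>MA\<^esub>x\<in>S. p x \<odot>\<^bsub>MA\<^esub> basis_elt R x) z = (\<Oplus>x\<in>S. (p x \<odot>\<^bsub>MA\<^esub> basis_elt R x) z)"
    by (rule MA_finsum_apply[OF c])
  also have "\<dots> = (\<Oplus>x\<in>S. if z = x then p x else \<zero>)"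
    using p by (intro R.finsum_cong) (auto simp: basis_elt_mon mon_apply simp_implies_def MA_coeff)
  also have "\<dots> = p z"
  proof (cases "z \<in> S")
    case True
    then show ?thesis using R.finsum_singleton[of z S p] S p by auto
  next
    case False
    then have "(\<Oplus>x\<in>S. if z = x then p x else \<zero>) = (\<Oplus>x\<in>S. \<zero>)"
      by (intro R.finsum_cong) (auto simp: simp_implies_def)
    moreover have "p z = \<zero>" using False S by (intro not_supp) auto
    ultimately show ?thesis by simp
  qed
  finally show "p z = (\<Oplus>\<^bsub>MA\<^esub>x\<in>S. p x \<odot>\<^bsub>MA\<^esub> basis_elt R x) z" by simp
qed

declare MA_simps [simp del]

end

text \<open>Carries the ring axioms over to records that differ from a known ring only by a scalar
  multiplication: \<open>quot_alg\<close>, \<open>self_alg\<close> and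
  \<open>alg_of_hom\<close>.\<close>

lemma cring_cong:
  assumes "cring R" "carrier S = carrier R" "mult S = mult R" "\<one>\<^bsub>S\<^esub> = \<one>\<^bsub>R\<^esub>"
    "\<zero>\<^bsub>S\<^esub> = \<zero>\<^bsub>R\<^esub>" "add S = add R"
  shows "cring S"
proof -
  interpret R: cring R by fact
  show ?thesis
  proof (intro cringI abelian_groupI comm_monoidI)
    fix x assume "x \<in> carrier S"
    then show "\<exists>y\<in>carrier S. y \<oplus>\<^bsub>S\<^esub> x = \<zero>\<^bsub>S\<^esub>"
      using R.a_inv_closed R.l_neg unfolding assms by blast
  qed (simp_all add: assms R.a_ac R.m_assoc R.l_distr, simp add: R.m_comm)
qed

section \<open>Universal property of the monoid algebra\<close>

context mon_alg
begin

text \<open>The map out of the monoid algebra determined by a ring homomorphism \<open>h\<close> on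
  the coefficients and a multiplicative map \<open>m\<close> on \<open>G\<close>. It is used both
  for polynomial rings and for the presentation of tensor products.\<close>

definition lift :: "('s, 'k) ring_scheme \<Rightarrow> ('a \<Rightarrow> 's) \<Rightarrow> ('c \<Rightarrow> 's) \<Rightarrow> ('c \<Rightarrow> 'a) \<Rightarrow> 's" where
  "lift S h m p = finsum S (\<lambda>x. h (p x) \<otimes>\<^bsub>S\<^esub> m x) (supp p)"

context
  fixes S :: "('s, 'k) ring_scheme" and h m
  assumes S: "cring S" and h: "h \<in> ring_hom R S" and m: "m \<in> carrier G \<rightarrow> carrier S"
begin

interpretation S: cring S by (rule S)
interpretation h: ring_hom_cring R S h
  by (rule ring_hom_cring.intro[OF R.is_cring S]) (simp add: ring_hom_cring_axioms_def h)

lemma lift_on: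
  assumes p: "p \<in> carrier MA" and X: "finite X" "supp p \<subseteq> X" "X \<subseteq> carrier G"
  shows "lift S h m p = finsum S (\<lambda>x. h (p x) \<otimes>\<^bsub>S\<^esub> m x) X"
  unfolding lift_def
proof (rule S.add.finprod_mono_neutral_cong_left)
  show "(\<lambda>x. h (p x) \<otimes>\<^bsub>S\<^esub> m x) \<in> X \<rightarrow> carrier S" using p X m by (auto simp: MA_coeff Pi_iff subset_eq)
  fix x assume "x \<in> X - supp p"
  then show "h (p x) \<otimes>\<^bsub>S\<^esub> m x = \<zero>\<^bsub>S\<^esub>" using not_supp[of x p] m X by (auto simp: Pi_iff subset_eq)
qed (use X in auto)

lemma lift_closed: "p \<in> carrier MA \<Longrightarrow> lift S h m p \<in> carrier S"
  using m supp_carrier[of p] unfolding lift_def by (intro S.finsum_closed) (auto simp: MA_coeff Pi_iff subset_eq)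

lemma lift_mon: "a \<in> carrier R \<Longrightarrow> x \<in> carrier G \<Longrightarrow> lift S h m (mon a x) = h a \<otimes>\<^bsub>S\<^esub> m x"
  using m supp_mon[of a x] by (subst lift_on[where X = "{x}"]) (auto simp: mon_apply Pi_iff)

lemma lift_zero: "lift S h m (\<lambda>x. \<zero>) = \<zero>\<^bsub>S\<^esub>"
  by (simp add: lift_def supp_def)

lemma lift_add:
  assumes p: "p \<in> carrier MA" and q: "q \<in> carrier MA"
  shows "lift S h m (p \<oplus>\<^bsub>MA\<^esub> q) = lift S h m p \<oplus>\<^bsub>S\<^esub> lift S h m q"
proof -
  let ?X = "supp p \<union> supp q"
  have X: "finite ?X" "?X \<subseteq> carrier G" using p q supp_carrier by auto
  have pq: "(\<lambda>x. p x \<oplus> q x) \<in> carrier MA" using p q by simp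
  have sub: "supp (\<lambda>x. p x \<oplus> q x) \<subseteq> ?X" by (rule suppI) (auto simp: not_supp)
  have c: "(\<lambda>x. h (p x) \<otimes>\<^bsub>S\<^esub> m x) \<in> ?X \<rightarrow> carrier S" "(\<lambda>x. h (q x) \<otimes>\<^bsub>S\<^esub> m x) \<in> ?X \<rightarrow> carrier S"
    using p q m X by (auto simp: MA_coeff Pi_iff subset_eq)
  have "lift S h m (\<lambda>x. p x \<oplus> q x) = finsum S (\<lambda>x. h (p x \<oplus> q x) \<otimes>\<^bsub>S\<^esub> m x) ?X"
    by (rule lift_on[OF pq X(1) sub X(2)])
  also have "\<dots> = finsum S (\<lambda>x. (h (p x) \<otimes>\<^bsub>S\<^esub> m x) \<oplus>\<^bsub>S\<^esub> (h (q x) \<otimes>\<^bsub>S\<^esub> m x)) ?X"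
    using p q m X c by (intro S.finsum_cong') (auto intro!: S.l_distr simp: MA_coeff Pi_iff subset_eq)
  also have "\<dots> = finsum S (\<lambda>x. h (p x) \<otimes>\<^bsub>S\<^esub> m x) ?X \<oplus>\<^bsub>S\<^esub> finsum S (\<lambda>x. h (q x) \<otimes>\<^bsub>S\<^esub> m x) ?X"
    by (rule S.finsum_addf[OF c])
  also have "\<dots> = lift S h m p \<oplus>\<^bsub>S\<^esub> lift S h m q"
    using lift_on[OF p X(1) _ X(2)] lift_on[OF q X(1) _ X(2)] by simp
  finally show ?thesis by (simp add: MA_simps)
qed

text \<open>Multiplicativity is additive in each factor; on two single terms it is the
  multiplicativity of \<open>h\<close> and \<open>m\<close> together with commutativity of
  \<open>S\<close>.\<close>

lemma lift_ring_hom: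
  assumes m_one: "m \<one>\<^bsub>G\<^esub> = \<one>\<^bsub>S\<^esub>"
    and m_mult: "\<And>x y. x \<in> carrier G \<Longrightarrow> y \<in> carrier G \<Longrightarrow> m (x \<otimes>\<^bsub>G\<^esub> y) = m x \<otimes>\<^bsub>S\<^esub> m y"
  shows "lift S h m \<in> ring_hom MA S"
proof (rule ring_hom_memI)
  interpret MA: algebra R MA by (rule MA_algebra)
  show "lift S h m \<one>\<^bsub>MA\<^esub> = \<one>\<^bsub>S\<^esub>" using m_one by (simp add: MA_one lift_mon)
  fix p q assume p: "p \<in> carrier MA" and q: "q \<in> carrier MA"
  show "lift S h m (p \<otimes>\<^bsub>MA\<^esub> q) = lift S h m p \<otimes>\<^bsub>S\<^esub> lift S h m q"
    using p
  proof (induction p rule: MA_induct)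
    case zero
    then show ?case using q by (simp add: MA_zero_mult lift_zero lift_closed)
  next
    case (add p p')
    have "lift S h m ((p \<oplus>\<^bsub>MA\<^esub> p') \<otimes>\<^bsub>MA\<^esub> q) = lift S h m (p \<oplus>\<^bsub>MA\<^esub> p') \<otimes>\<^bsub>S\<^esub> lift S h m q"
      using add q by (simp add: MA.l_distr lift_add lift_closed S.l_distr)
    then show ?case by (simp add: MA_simps)
  next
    case (mon a x)
    show ?case using q
    proof (induction q rule: MA_induct)
      case zero
      then show ?case using mon by (simp add: MA_mult_zero lift_zero lift_closed)
    next
      case (add q q')
      have "lift S h m (mon a x \<otimes>\<^bsub>MA\<^esub> (q \<oplus>\<^bsub>MA\<^esub> q'))
          = lift S h m (mon a x) \<otimes>\<^bsub>S\<^esub> lift S h m (q \<oplus>\<^bsub>MA\<^esub> q')"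
        using add mon by (simp add: MA.r_distr lift_add lift_closed S.r_distr)
      then show ?case by (simp add: MA_simps)
    next
      case m2: (mon b y)
      have "m x \<in> carrier S" "m y \<in> carrier S" using mon m2 m by auto
      then show ?case using mon m2 by (simp add: mon_mult lift_mon m_mult S.m_ac)
    qed
  qed
qed (auto simp: lift_closed lift_add)

end

end

section \<open>Submodules and linear combinations\<close>

context module
begin

lemma submodule_finsum:
  assumes N: "submodule N R M" and f: "f \<in> J \<rightarrow> N"
  shows "finsum M f J \<in> N"
  using f
proof (induction J rule: infinite_finite_induct)
  case (insert x J)
  then show ?case using submoduleE[OF N] by (subst M.finsum_insert) auto
qed (use submodule.axioms(1)[OF N] subgroup.one_closed in \<open>fastforce simp: M.finsum_infinite\<close>)+

lemma finsum_smult_distr: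
  assumes "a \<in> carrier R" "c \<in> {..<d::nat} \<rightarrow> carrier R" "x \<in> {..<d} \<rightarrow> carrier M"
  shows "a \<odot>\<^bsub>M\<^esub> finsum M (\<lambda>k. c k \<odot>\<^bsub>M\<^esub> x k) {..<d} = finsum M (\<lambda>k. (a \<otimes> c k) \<odot>\<^bsub>M\<^esub> x k) {..<d}"
proof -
  have "a \<odot>\<^bsub>M\<^esub> finsum M (\<lambda>k. c k \<odot>\<^bsub>M\<^esub> x k) {..<d} = finsum M (\<lambda>k. a \<odot>\<^bsub>M\<^esub> (c k \<odot>\<^bsub>M\<^esub> x k)) {..<d}"
    using assms by (intro finsum_smult_ldistr) (auto simp: Pi_iff)
  also have "\<dots> = finsum M (\<lambda>k. (a \<otimes> c k) \<odot>\<^bsub>M\<^esub> x k) {..<d}"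
    using assms by (intro M.finsum_cong') (auto simp: Pi_iff smult_assoc1)
  finally show ?thesis .
qed

lemma finsum_smult_add:
  assumes "b \<in> {..<d::nat} \<rightarrow> carrier R" "c \<in> {..<d::nat} \<rightarrow> carrier R" "x \<in> {..<d} \<rightarrow> carrier M"
  shows "finsum M (\<lambda>k. (b k \<oplus> c k) \<odot>\<^bsub>M\<^esub> x k) {..<d}
    = finsum M (\<lambda>k. b k \<odot>\<^bsub>M\<^esub> x k) {..<d} \<oplus>\<^bsub>M\<^esub> finsum M (\<lambda>k. c k \<odot>\<^bsub>M\<^esub> x k) {..<d}"
proof -
  have "finsum M (\<lambda>k. (b k \<oplus> c k) \<odot>\<^bsub>M\<^esub> x k) {..<d} = finsum M (\<lambda>k. b k \<odot>\<^bsub>M\<^esub> x k \<oplus>\<^bsub>M\<^esub> c k \<odot>\<^bsub>M\<^esub> x k) {..<d}"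
    using assms by (intro M.finsum_cong') (auto simp: Pi_iff smult_l_distr)
  then show ?thesis using assms M.finsum_addf by (auto simp: Pi_iff)
qed

lemma submodule_zero: "submodule N R M \<Longrightarrow> \<zero>\<^bsub>M\<^esub> \<in> N"
  using submodule.axioms(1) subgroup.one_closed by fastforce

lemma submodule_minus:
  "submodule N R M \<Longrightarrow> x \<in> N \<Longrightarrow> y \<in> N \<Longrightarrow> x \<ominus>\<^bsub>M\<^esub> y \<in> N"
  using submoduleE[of N] by (auto simp: a_minus_def)

lemma set_add_iff: "x \<in> N <+>\<^bsub>M\<^esub> K \<longleftrightarrow> (\<exists>u\<in>N. \<exists>k\<in>K. x = u \<oplus>\<^bsub>M\<^esub> k)"
  by (auto simp: set_add_defs)

lemma submodule_set_add:
  assumes N: "submodule N R M" and K: "submodule K R M"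
  shows "submodule (N <+>\<^bsub>M\<^esub> K) R M"
proof (rule submoduleI)
  note NE = submoduleE[OF N] and KE = submoduleE[OF K]
  note c = subsetD[OF NE(1)] subsetD[OF KE(1)]
  show "N <+>\<^bsub>M\<^esub> K \<subseteq> carrier M" using c by (auto simp: set_add_iff)
  show "\<zero>\<^bsub>M\<^esub> \<in> N <+>\<^bsub>M\<^esub> K"
    using submodule_zero[OF N] submodule_zero[OF K] by (auto simp: set_add_iff intro!: bexI)
  show "\<ominus>\<^bsub>M\<^esub> a \<in> N <+>\<^bsub>M\<^esub> K" if a: "a \<in> N <+>\<^bsub>M\<^esub> K" for a
  proof -
    obtain u k where u: "u \<in> N" "k \<in> K" "a = u \<oplus>\<^bsub>M\<^esub> k" using a by (auto simp: set_add_iff)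
    then have "\<ominus>\<^bsub>M\<^esub> a = \<ominus>\<^bsub>M\<^esub> u \<oplus>\<^bsub>M\<^esub> \<ominus>\<^bsub>M\<^esub> k" using c by (simp add: M.minus_add)
    then show ?thesis using u NE(3) KE(3) by (auto simp: set_add_iff)
  qed
  show "a \<oplus>\<^bsub>M\<^esub> b \<in> N <+>\<^bsub>M\<^esub> K" if ab: "a \<in> N <+>\<^bsub>M\<^esub> K" "b \<in> N <+>\<^bsub>M\<^esub> K" for a b
  proof -
    obtain u k where u: "u \<in> N" "k \<in> K" "a = u \<oplus>\<^bsub>M\<^esub> k" using ab by (auto simp: set_add_iff)
    obtain v l where v: "v \<in> N" "l \<in> K" "b = v \<oplus>\<^bsub>M\<^esub> l" using ab by (auto simp: set_add_iff)
    have "a \<oplus>\<^bsub>M\<^esub> b = (u \<oplus>\<^bsub>M\<^esub> v) \<oplus>\<^bsub>M\<^esub> (k \<oplus>\<^bsub>M\<^esub> l)" using u v c by (simp add: M.a_ac)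
    then show ?thesis using u v NE(5) KE(5) unfolding set_add_iff by blast
  qed
  show "a \<odot>\<^bsub>M\<^esub> x \<in> N <+>\<^bsub>M\<^esub> K" if a: "a \<in> carrier R" "x \<in> N <+>\<^bsub>M\<^esub> K" for a x
  proof -
    obtain u k where u: "u \<in> N" "k \<in> K" "x = u \<oplus>\<^bsub>M\<^esub> k" using a by (auto simp: set_add_iff)
    then have "a \<odot>\<^bsub>M\<^esub> x = a \<odot>\<^bsub>M\<^esub> u \<oplus>\<^bsub>M\<^esub> a \<odot>\<^bsub>M\<^esub> k" using a c by (simp add: smult_r_distr)
    then show ?thesis using a u NE(4) KE(4) unfolding set_add_iff by blast
  qed
qed

lemma set_add_mem1: "submodule N R M \<Longrightarrow> submodule K R M \<Longrightarrow> x \<in> N \<Longrightarrow> x \<in> N <+>\<^bsub>M\<^esub> K"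
  using submodule_zero[of K] submoduleE(1)[of N] by (force simp: set_add_iff)

lemma set_add_mem2: "submodule N R M \<Longrightarrow> submodule K R M \<Longrightarrow> x \<in> K \<Longrightarrow> x \<in> N <+>\<^bsub>M\<^esub> K"
  using submodule_zero[of N] submoduleE(1)[of K] by (force simp: set_add_iff)

end

section \<open>Ideals and quotient algebras\<close>

context algebra
begin

text \<open>The scalar \<open>a\<close> acts on the algebra as multiplication by the element
  \<open>a\<close> times one.\<close>

lemma ideal_submodule:
  assumes "ideal I M" shows "submodule I R M"
proof -
  interpret I: ideal I M by fact
  show ?thesis
  proof (rule submoduleI)
    fix a x assume a: "a \<in> carrier R" "x \<in> I"
    have "a \<odot>\<^bsub>M\<^esub> x = (a \<odot>\<^bsub>M\<^esub> \<one>\<^bsub>M\<^esub>) \<otimes>\<^bsub>M\<^esub> x" using a by (simp add: smult_assoc2)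
    then show "a \<odot>\<^bsub>M\<^esub> x \<in> I" using a by (simp add: I.I_l_closed)
  qed (auto simp: I.a_subset)
qed

end

locale algebra_ideal = algebra R M + I: ideal I M
  for R (structure) and M :: "('a, 'c) module" and I
begin

lemma quot_alg_carrier: "carrier (quot_alg M I) = {I +>\<^bsub>M\<^esub> p | p. p \<in> carrier M}"
  by (auto simp: quot_alg_def FactRing_def A_RCOSETS_def')

lemma quot_alg_simps:
  "mult (quot_alg M I) = mult (M Quot I)" "\<one>\<^bsub>quot_alg M I\<^esub> = \<one>\<^bsub>M Quot I\<^esub>"
  "\<zero>\<^bsub>quot_alg M I\<^esub> = \<zero>\<^bsub>M Quot I\<^esub>" "add (quot_alg M I) = add (M Quot I)"
  "carrier (quot_alg M I) = carrier (M Quot I)"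
  by (simp_all add: quot_alg_def)

lemma quot_eq_iff:
  "p \<in> carrier M \<Longrightarrow> q \<in> carrier M \<Longrightarrow> I +>\<^bsub>M\<^esub> p = I +>\<^bsub>M\<^esub> q \<longleftrightarrow> p \<ominus>\<^bsub>M\<^esub> q \<in> I"
  using quotient_eq_iff_same_a_r_cos[OF I.ideal_axioms] by simp

lemma quot_mem_eq: "p \<in> carrier M \<Longrightarrow> q \<in> I +>\<^bsub>M\<^esub> p \<Longrightarrow> q \<in> carrier M \<and> I +>\<^bsub>M\<^esub> q = I +>\<^bsub>M\<^esub> p"
  using I.a_elemrcos_carrier I.a_repr_independence' I.a_rcos_self by metis

text \<open>The union in the definition of the scalar multiplication runs over representatives that
  all give the same coset: their differences lie in \<open>I\<close>, and \<open>I\<close> is stable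
  under scalars.\<close>

lemma quot_alg_smult:
  assumes a: "a \<in> carrier R" and p: "p \<in> carrier M"
  shows "a \<odot>\<^bsub>quot_alg M I\<^esub> (I +>\<^bsub>M\<^esub> p) = I +>\<^bsub>M\<^esub> (a \<odot>\<^bsub>M\<^esub> p)"
proof -
  have "I +>\<^bsub>M\<^esub> (a \<odot>\<^bsub>M\<^esub> q) = I +>\<^bsub>M\<^esub> (a \<odot>\<^bsub>M\<^esub> p)" if "q \<in> I +>\<^bsub>M\<^esub> p" for q
  proof -
    have q: "q \<in> carrier M" "q \<ominus>\<^bsub>M\<^esub> p \<in> I" using quot_mem_eq[OF p that] quot_eq_iff p by auto
    have "a \<odot>\<^bsub>M\<^esub> q \<ominus>\<^bsub>M\<^esub> a \<odot>\<^bsub>M\<^esub> p = a \<odot>\<^bsub>M\<^esub> (q \<ominus>\<^bsub>M\<^esub> p)"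
      using a p q by (simp add: a_minus_def smult_r_distr smult_r_minus)
    then show ?thesis
      using a p q quot_eq_iff submoduleE(4)[OF ideal_submodule[OF I.ideal_axioms]] by simp
  qed
  then have "(\<Union>q\<in>I +>\<^bsub>M\<^esub> p. I +>\<^bsub>M\<^esub> (a \<odot>\<^bsub>M\<^esub> q)) = I +>\<^bsub>M\<^esub> (a \<odot>\<^bsub>M\<^esub> p)"
    using I.a_rcos_self[OF p] by (intro SUP_eq_const) blast+
  then show ?thesis by (simp add: quot_alg_def)
qed

lemma quot_alg_cring: "cring (quot_alg M I)"
  by (rule cring_cong[OF I.quotient_is_cring[OF M_cring]]) (simp_all add: quot_alg_simps)

lemma quot_alg_ring_hom: "(+>\<^bsub>M\<^esub>) I \<in> ring_hom M (quot_alg M I)"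
  using I.rcos_ring_hom by (simp add: ring_hom_def quot_alg_simps)

lemma quot_alg_add: "p \<in> carrier M \<Longrightarrow> q \<in> carrier M \<Longrightarrow>
    (I +>\<^bsub>M\<^esub> p) \<oplus>\<^bsub>quot_alg M I\<^esub> (I +>\<^bsub>M\<^esub> q) = I +>\<^bsub>M\<^esub> (p \<oplus>\<^bsub>M\<^esub> q)"
  using ring_hom_add[OF quot_alg_ring_hom] by simp

lemma quot_alg_mult: "p \<in> carrier M \<Longrightarrow> q \<in> carrier M \<Longrightarrow>
    (I +>\<^bsub>M\<^esub> p) \<otimes>\<^bsub>quot_alg M I\<^esub> (I +>\<^bsub>M\<^esub> q) = I +>\<^bsub>M\<^esub> (p \<otimes>\<^bsub>M\<^esub> q)"
  using ring_hom_mult[OF quot_alg_ring_hom] by simp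

lemma quot_alg_algebra: "algebra R (quot_alg M I)"
proof (rule algebraI)
  note s = quot_alg_smult quot_alg_add quot_alg_mult
  show "a \<odot>\<^bsub>quot_alg M I\<^esub> x \<in> carrier (quot_alg M I)"
    if "a \<in> carrier R" "x \<in> carrier (quot_alg M I)" for a x
    using that by (auto simp: quot_alg_carrier s)
  show "(a \<oplus> b) \<odot>\<^bsub>quot_alg M I\<^esub> x = a \<odot>\<^bsub>quot_alg M I\<^esub> x \<oplus>\<^bsub>quot_alg M I\<^esub> b \<odot>\<^bsub>quot_alg M I\<^esub> x"
    if "a \<in> carrier R" "b \<in> carrier R" "x \<in> carrier (quot_alg M I)" for a b x
    using that by (auto simp: quot_alg_carrier s smult_l_distr)
  show "a \<odot>\<^bsub>quot_alg M I\<^esub> (x \<oplus>\<^bsub>quot_alg M I\<^esub> y) = a \<odot>\<^bsub>quot_alg M I\<^esub> x \<oplus>\<^bsub>quot_alg M I\<^esub> a \<odot>\<^bsub>quot_alg M I\<^esub> y"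
    if "a \<in> carrier R" "x \<in> carrier (quot_alg M I)" "y \<in> carrier (quot_alg M I)" for a x y
    using that by (auto simp: quot_alg_carrier s smult_r_distr)
  show "(a \<otimes> b) \<odot>\<^bsub>quot_alg M I\<^esub> x = a \<odot>\<^bsub>quot_alg M I\<^esub> (b \<odot>\<^bsub>quot_alg M I\<^esub> x)"
    if "a \<in> carrier R" "b \<in> carrier R" "x \<in> carrier (quot_alg M I)" for a b x
    using that by (auto simp: quot_alg_carrier s smult_assoc1)
  show "\<one> \<odot>\<^bsub>quot_alg M I\<^esub> x = x" if "x \<in> carrier (quot_alg M I)" for x
    using that by (auto simp: quot_alg_carrier s)
  show "a \<odot>\<^bsub>quot_alg M I\<^esub> x \<otimes>\<^bsub>quot_alg M I\<^esub> y = a \<odot>\<^bsub>quot_alg M I\<^esub> (x \<otimes>\<^bsub>quot_alg M I\<^esub> y)"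
    if "a \<in> carrier R" "x \<in> carrier (quot_alg M I)" "y \<in> carrier (quot_alg M I)" for a x y
    using that by (auto simp: quot_alg_carrier s smult_assoc2)
qed (use R_cring quot_alg_cring in auto)

end

section \<open>Polynomial rings and base change\<close>

lemma expos_simps [simp]:
  "carrier (expos n) = {\<alpha>. \<forall>i\<ge>n. \<alpha> i = 0}" "\<one>\<^bsub>expos n\<^esub> = (\<lambda>i. 0)"
  "\<alpha> \<otimes>\<^bsub>expos n\<^esub> \<beta> = (\<lambda>i. \<alpha> i + \<beta> i)"
  by (simp_all add: expos_def)

lemma comm_monoid_expos: "Group.comm_monoid (expos n)"
  by (rule comm_monoidI) (auto simp: ac_simps)

locale mpoly_ring = cring R for R (structure) and n :: nat
begin

abbreviation "P \<equiv> mpoly n R"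

sublocale mon_alg R "expos n"
  rewrites "monoid_algebra R (expos n) = P"
  by (auto simp: mpoly_def mon_alg_def comm_monoid_expos is_cring)

sublocale P: algebra R "mpoly n R"
  by (rule MA_algebra)

lemma mpoly_span_iff: "p \<in> mpoly_span n R \<Delta> \<longleftrightarrow> p \<in> carrier P \<and> supp p \<subseteq> \<Delta>"
  by (auto simp: mpoly_span_def supp_def)

lemma mpoly_span_submodule: "submodule (mpoly_span n R \<Delta>) R P"
proof (rule P.submoduleI)
  show "\<ominus>\<^bsub>P\<^esub> p \<in> mpoly_span n R \<Delta>" if "p \<in> mpoly_span n R \<Delta>" for p
  proof -
    have p: "p \<in> carrier P" "supp p \<subseteq> \<Delta>" using that by (auto simp: mpoly_span_iff)
    moreover have "supp (\<ominus>\<^bsub>P\<^esub> p) \<subseteq> supp p"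
      unfolding MA_a_inv[OF p(1)] by (rule suppI) (simp add: not_supp)
    ultimately show ?thesis by (auto simp: mpoly_span_iff)
  qed
  show "p \<oplus>\<^bsub>P\<^esub> q \<in> mpoly_span n R \<Delta>" if "p \<in> mpoly_span n R \<Delta>" "q \<in> mpoly_span n R \<Delta>" for p q
  proof -
    have p: "p \<in> carrier P" "supp p \<subseteq> \<Delta>" "q \<in> carrier P" "supp q \<subseteq> \<Delta>"
      using that by (auto simp: mpoly_span_iff)
    moreover have "supp (p \<oplus>\<^bsub>P\<^esub> q) \<subseteq> supp p \<union> supp q"
      unfolding MA_simps by (rule suppI) (simp add: not_supp)
    ultimately show ?thesis by (auto simp: mpoly_span_iff)
  qed
  show "a \<odot>\<^bsub>P\<^esub> p \<in> mpoly_span n R \<Delta>" if "a \<in> carrier R" "p \<in> mpoly_span n R \<Delta>" for a p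
  proof -
    have p: "p \<in> carrier P" "supp p \<subseteq> \<Delta>" using that by (auto simp: mpoly_span_iff)
    moreover have "supp (a \<odot>\<^bsub>P\<^esub> p) \<subseteq> supp p"
      unfolding MA_simps using that by (intro suppI) (simp add: not_supp)
    ultimately show ?thesis using that by (auto simp: mpoly_span_iff)
  qed
qed (auto simp: mpoly_span_iff MA_simps supp_def)

lemma mon_in_mpoly_span:
  "a \<in> carrier R \<Longrightarrow> x \<in> carrier (expos n) \<Longrightarrow> x \<in> \<Delta> \<Longrightarrow> mon a x \<in> mpoly_span n R \<Delta>"
  using supp_mon[of a x] mon_closed[of a x] by (auto simp: mpoly_span_iff)

lemma smult_mon: "a \<in> carrier R \<Longrightarrow> b \<in> carrier R \<Longrightarrow> a \<odot>\<^bsub>P\<^esub> mon b x = mon (a \<otimes> b) x"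
  by (auto simp: MA_simps mon_apply fun_eq_iff)

lemma mon_smult_one: "a \<in> carrier R \<Longrightarrow> mon a x = a \<odot>\<^bsub>P\<^esub> mon \<one> x"
  by (simp add: smult_mon)

text \<open>The monomials generate the polynomial ring as a module. Most later spanning claims are
  proved by this test on monomials.\<close>

lemma submodule_carrierI:
  assumes N: "submodule N R P" and mon: "\<And>x. x \<in> carrier (expos n) \<Longrightarrow> mon \<one> x \<in> N"
  shows "N = carrier P"
proof
  show "N \<subseteq> carrier P" by (rule P.submoduleE(1)[OF N])
  show "carrier P \<subseteq> N"
  proof
    fix p assume "p \<in> carrier P"
    then show "p \<in> N"
    proof (induction p rule: MA_induct)
      case zero then show ?case using P.submodule_zero[OF N] by (simp add: MA_simps)
    next
      case (mon a x)
      then show ?case using assms(2) P.submoduleE(4)[OF N] by (subst mon_smult_one) auto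
    next
      case (add p q) then show ?case using P.submoduleE(5)[OF N, of p q] by (simp add: MA_simps)
    qed
  qed
qed

end

section \<open>Polynomial rings under a ring homomorphism\<close>

locale mpoly_hom = B: mpoly_ring B n + A: mpoly_ring A n for B (structure) and A n +
  fixes g
  assumes g_hom: "g \<in> ring_hom B A"
begin

sublocale g: ring_hom_cring B A g
  by (rule ring_hom_cring.intro[OF B.is_cring A.is_cring]) (simp add: ring_hom_cring_axioms_def g_hom)

definition cmap :: "((nat \<Rightarrow> nat) \<Rightarrow> 'a) \<Rightarrow> (nat \<Rightarrow> nat) \<Rightarrow> 'c" where
  "cmap p = (\<lambda>x. g (p x))"

lemma supp_cmap: "A.supp (cmap p) \<subseteq> B.supp p"
  by (rule A.suppI) (simp add: cmap_def B.not_supp)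

lemma cmap_closed [simp]: "p \<in> carrier B.P \<Longrightarrow> cmap p \<in> carrier A.P"
  using B.supp_carrier[of p]
  by (intro A.MA_I[where S = "B.supp p"]) (auto simp: cmap_def B.not_supp B.MA_coeff)

lemma cmap_mon: "a \<in> carrier B \<Longrightarrow> cmap (B.mon a x) = A.mon (g a) x"
  by (auto simp: cmap_def B.mon_apply A.mon_apply)

lemma cmap_zero: "cmap \<zero>\<^bsub>B.P\<^esub> = \<zero>\<^bsub>A.P\<^esub>"
  by (simp add: cmap_def B.MA_simps A.MA_simps)

lemma cmap_add: "p \<in> carrier B.P \<Longrightarrow> q \<in> carrier B.P \<Longrightarrow>
    cmap (p \<oplus>\<^bsub>B.P\<^esub> q) = cmap p \<oplus>\<^bsub>A.P\<^esub> cmap q"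
  by (simp add: cmap_def B.MA_simps A.MA_simps B.MA_coeff)

lemma cmap_smult: "a \<in> carrier B \<Longrightarrow> p \<in> carrier B.P \<Longrightarrow>
    cmap (a \<odot>\<^bsub>B.P\<^esub> p) = g a \<odot>\<^bsub>A.P\<^esub> cmap p"
  by (simp add: cmap_def B.MA_simps A.MA_simps B.MA_coeff)

lemma cmap_mult:
  assumes p: "p \<in> carrier B.P" and q: "q \<in> carrier B.P"
  shows "cmap (p \<otimes>\<^bsub>B.P\<^esub> q) = cmap p \<otimes>\<^bsub>A.P\<^esub> cmap q"
proof
  fix x
  let ?X = "{(y, z). y \<in> B.supp p \<and> z \<in> B.supp q \<and> y \<otimes>\<^bsub>expos n\<^esub> z = x}"
  have "cmap (p \<otimes>\<^bsub>B.P\<^esub> q) x = g (finsum B (\<lambda>(y, z). p y \<otimes> q z) ?X)"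
    using B.MA_mult_on[OF p q, of "B.supp p" "B.supp q" x] p q by (simp add: cmap_def)
  also have "\<dots> = finsum A (g \<circ> (\<lambda>(y, z). p y \<otimes> q z)) ?X"
    using p q by (subst g.hom_finsum) (auto simp: B.MA_coeff comp_def)
  also have "\<dots> = finsum A (\<lambda>(y, z). cmap p y \<otimes>\<^bsub>A\<^esub> cmap q z) ?X"
    using p q by (intro A.finsum_cong') (auto simp: B.MA_coeff cmap_def)
  also have "\<dots> = (cmap p \<otimes>\<^bsub>A.P\<^esub> cmap q) x"
    using p q supp_cmap by (intro A.MA_mult_on[symmetric]) auto
  finally show "cmap (p \<otimes>\<^bsub>B.P\<^esub> q) x = (cmap p \<otimes>\<^bsub>A.P\<^esub> cmap q) x" .
qed

lemma cmap_minus: "p \<in> carrier B.P \<Longrightarrow> q \<in> carrier B.P \<Longrightarrow>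
    cmap (p \<ominus>\<^bsub>B.P\<^esub> q) = cmap p \<ominus>\<^bsub>A.P\<^esub> cmap q"
  by (simp add: B.MA_minus A.MA_minus) (simp add: cmap_def a_minus_def B.MA_coeff)

text \<open>The \<open>A\<close>-submodule of \<open>A[x]\<close> spanned by the image of
  \<open>W\<close>. The inductive form gives an induction rule as well as representations by finite
  sums. \<open>W\<close> is an arbitrary set because submodules are extended as well as
  ideals.\<close>

inductive_set extend :: "((nat \<Rightarrow> nat) \<Rightarrow> 'a) set \<Rightarrow> ((nat \<Rightarrow> nat) \<Rightarrow> 'c) set"
  for W :: "((nat \<Rightarrow> nat) \<Rightarrow> 'a) set" where
  zero: "\<zero>\<^bsub>A.P\<^esub> \<in> extend W"
| step: "u \<in> extend W \<Longrightarrow> w \<in> W \<Longrightarrow> a \<in> carrier A \<Longrightarrow> (a \<odot>\<^bsub>A.P\<^esub> cmap w) \<oplus>\<^bsub>A.P\<^esub> u \<in> extend W"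

context
  fixes W assumes W: "W \<subseteq> carrier B.P"
begin

lemma extend_closed: "u \<in> extend W \<Longrightarrow> u \<in> carrier A.P"
  by (induction rule: extend.induct) (use W in auto)

lemma extend_add: "u \<in> extend W \<Longrightarrow> v \<in> extend W \<Longrightarrow> u \<oplus>\<^bsub>A.P\<^esub> v \<in> extend W"
proof (induction rule: extend.induct)
  case (step u w a)
  have "w \<in> carrier B.P" using step W by auto
  then have "((a \<odot>\<^bsub>A.P\<^esub> cmap w) \<oplus>\<^bsub>A.P\<^esub> u) \<oplus>\<^bsub>A.P\<^esub> v = (a \<odot>\<^bsub>A.P\<^esub> cmap w) \<oplus>\<^bsub>A.P\<^esub> (u \<oplus>\<^bsub>A.P\<^esub> v)"
    using step extend_closed by (intro A.P.a_assoc) auto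
  then show ?case using step extend.step by auto
qed (use extend_closed in auto)

lemma extend_smult: "u \<in> extend W \<Longrightarrow> b \<in> carrier A \<Longrightarrow> b \<odot>\<^bsub>A.P\<^esub> u \<in> extend W"
proof (induction rule: extend.induct)
  case zero then show ?case using extend.zero by simp
next
  case (step u w a)
  have "w \<in> carrier B.P" using step W by auto
  then have "b \<odot>\<^bsub>A.P\<^esub> ((a \<odot>\<^bsub>A.P\<^esub> cmap w) \<oplus>\<^bsub>A.P\<^esub> u)
      = ((b \<otimes>\<^bsub>A\<^esub> a) \<odot>\<^bsub>A.P\<^esub> cmap w) \<oplus>\<^bsub>A.P\<^esub> (b \<odot>\<^bsub>A.P\<^esub> u)"
    using step extend_closed by (simp add: A.P.smult_r_distr A.P.smult_assoc1)
  then show ?case using step extend.step by auto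
qed

lemma extend_submodule: "submodule (extend W) A A.P"
proof (rule A.P.submoduleI)
  fix u assume u: "u \<in> extend W"
  have "\<ominus>\<^bsub>A.P\<^esub> u = (\<ominus>\<^bsub>A\<^esub> \<one>\<^bsub>A\<^esub>) \<odot>\<^bsub>A.P\<^esub> u"
    using extend_closed[OF u] by (simp add: A.P.smult_l_minus)
  then show "\<ominus>\<^bsub>A.P\<^esub> u \<in> extend W" using extend_smult u by simp
qed (auto intro: extend_closed extend.zero extend_add extend_smult)

lemma cmap_in_extend: "w \<in> W \<Longrightarrow> cmap w \<in> extend W"
  using extend.step[OF extend.zero, of w W "\<one>\<^bsub>A\<^esub>"] W by auto

lemma extend_minimal:
  assumes N: "submodule N A A.P" and "cmap ` W \<subseteq> N"
  shows "extend W \<subseteq> N"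
proof
  fix u assume "u \<in> extend W"
  then show "u \<in> N"
    using assms(2) A.P.submoduleE(4,5)[OF N] A.P.submodule_zero[OF N]
    by (induction rule: extend.induct) auto
qed

text \<open>Each step of a derivation contributes one summand; repetitions among the
  \<open>w j\<close> are allowed.\<close>

lemma extend_rep:
  "u \<in> extend W \<Longrightarrow> \<exists>m a w. a \<in> {..<m::nat} \<rightarrow> carrier A \<and> w \<in> {..<m} \<rightarrow> W \<and>
     u = finsum A.P (\<lambda>j. a j \<odot>\<^bsub>A.P\<^esub> cmap (w j)) {..<m}"
proof (induction rule: extend.induct)
  case zero
  show ?case by (intro exI[of _ 0]) auto
next
  case (step u v b)
  then obtain m a w where *: "a \<in> {..<m::nat} \<rightarrow> carrier A" "w \<in> {..<m} \<rightarrow> W"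
    "u = finsum A.P (\<lambda>j. a j \<odot>\<^bsub>A.P\<^esub> cmap (w j)) {..<m}" by blast
  let ?a = "a(m := b)" and ?w = "w(m := v)"
  have c: "(\<lambda>j. ?a j \<odot>\<^bsub>A.P\<^esub> cmap (?w j)) \<in> {..<m} \<rightarrow> carrier A.P"
    using * W by (auto simp: Pi_iff subset_eq)
  have "finsum A.P (\<lambda>j. ?a j \<odot>\<^bsub>A.P\<^esub> cmap (?w j)) {..<Suc m}
      = (?a m \<odot>\<^bsub>A.P\<^esub> cmap (?w m)) \<oplus>\<^bsub>A.P\<^esub> finsum A.P (\<lambda>j. ?a j \<odot>\<^bsub>A.P\<^esub> cmap (?w j)) {..<m}"
    unfolding lessThan_Suc using c step W by (intro A.P.finsum_insert) auto
  also have "finsum A.P (\<lambda>j. ?a j \<odot>\<^bsub>A.P\<^esub> cmap (?w j)) {..<m} = u"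
    unfolding *(3) using * W by (intro A.P.finsum_cong') (auto simp: Pi_iff subset_eq)
  finally show ?case
    using step.hyps *(1,2)
    by (intro exI[of _ "Suc m"] exI[of _ ?a] exI[of _ ?w]) (auto simp: Pi_iff less_Suc_eq)
qed

end

lemma extend_mono: "W \<subseteq> W' \<Longrightarrow> extend W \<subseteq> extend W'"
proof
  fix u assume "W \<subseteq> W'" "u \<in> extend W"
  from this(2,1) show "u \<in> extend W'" by (induction rule: extend.induct) (auto intro: extend.intros)
qed

text \<open>The span of the image is already stable under multiplication by polynomials: a single
  term times \<open>cmap w\<close> is a scalar times the image of a monomial times \<open>w\<close>,
  and that product stays in \<open>I\<close>.\<close>

lemma extend_ideal:
  assumes "ideal I B.P"
  shows "ideal (extend I) A.P"
proof -
  interpret I: ideal I B.P by fact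
  note W = I.a_subset
  note N = extend_submodule[OF W]
  have mon: "x \<otimes>\<^bsub>A.P\<^esub> cmap w \<in> extend I" if x: "x \<in> carrier A.P" and w: "w \<in> I" for x w
    using x
  proof (induction x rule: A.MA_induct)
    case zero
    then show ?case using A.MA_zero_mult[of "cmap w"] w W extend.zero[of I] by (auto simp: A.MA_simps)
  next
    case (mon a x)
    have wc: "w \<in> carrier B.P" using w W by auto
    have "A.mon a x \<otimes>\<^bsub>A.P\<^esub> cmap w = a \<odot>\<^bsub>A.P\<^esub> cmap (B.mon \<one> x \<otimes>\<^bsub>B.P\<^esub> w)"
      using mon wc A.mon_smult_one[of a x]
      by (simp add: cmap_mult cmap_mon B.mon_closed A.mon_closed A.P.smult_assoc2 del: expos_simps)
    moreover have "B.mon \<one> x \<otimes>\<^bsub>B.P\<^esub> w \<in> I"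
      using I.I_l_closed[OF w] B.mon_closed mon by blast
    ultimately show ?case using extend_smult[OF W] cmap_in_extend[OF W] mon by auto
  next
    case (add p q)
    have "cmap w \<in> carrier A.P" using w W by auto
    then have "(p \<oplus>\<^bsub>A.P\<^esub> q) \<otimes>\<^bsub>A.P\<^esub> cmap w = p \<otimes>\<^bsub>A.P\<^esub> cmap w \<oplus>\<^bsub>A.P\<^esub> q \<otimes>\<^bsub>A.P\<^esub> cmap w"
      using add by (intro A.P.l_distr) auto
    then show ?case using extend_add[OF W add(3,4)] by (simp add: A.MA_simps)
  qed
  have mult: "x \<otimes>\<^bsub>A.P\<^esub> u \<in> extend I" if x: "x \<in> carrier A.P" and u: "u \<in> extend I" for x u
    using u
  proof (induction rule: extend.induct)
    case zero then show ?case using x extend.zero[of I] by simp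
  next
    case (step u w a)
    have "w \<in> carrier B.P" "u \<in> carrier A.P" using step W extend_closed[OF W] by auto
    then have "x \<otimes>\<^bsub>A.P\<^esub> ((a \<odot>\<^bsub>A.P\<^esub> cmap w) \<oplus>\<^bsub>A.P\<^esub> u)
        = (a \<odot>\<^bsub>A.P\<^esub> (x \<otimes>\<^bsub>A.P\<^esub> cmap w)) \<oplus>\<^bsub>A.P\<^esub> x \<otimes>\<^bsub>A.P\<^esub> u"
      using x step by (simp add: A.P.r_distr A.P.m_comm[of x] A.P.smult_assoc2)
    then show ?case using step mon x extend_add[OF W] extend_smult[OF W] by auto
  qed
  show ?thesis
  proof (rule idealI)
    show "ring A.P" by (rule A.P.ring_axioms)
    show "subgroup (extend I) (add_monoid A.P)" by (rule submodule.axioms(1)[OF N])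
    show "x \<otimes>\<^bsub>A.P\<^esub> a \<in> extend I" if "a \<in> extend I" "x \<in> carrier A.P" for a x
      using mult that by auto
    then show "a \<otimes>\<^bsub>A.P\<^esub> x \<in> extend I" if "a \<in> extend I" "x \<in> carrier A.P" for a x
      using that extend_closed[OF W] A.P.m_comm[of a x] by auto
  qed
qed

end

section \<open>Kernel of the base-changed quotient map\<close>

locale mpoly_hom_ideal = mpoly_hom B A n g for B :: "('a, 'b) ring_scheme" (structure)
    and A :: "('c, 'd) ring_scheme" and n g +
  fixes I
  assumes I: "ideal I B.P"
begin

abbreviation (input) "Q \<equiv> quot_alg B.P I"
abbreviation (input) "J \<equiv> extend I"
abbreviation (input) "S \<equiv> A.P Quot J"

interpretation I: algebra_ideal B "mpoly n B" I
  by (intro algebra_ideal.intro B.P.algebra_axioms I)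
interpretation Q: algebra B Q
  by (rule I.quot_alg_algebra)
interpretation F: mon_alg A Q
  by (simp add: mon_alg_def A.is_cring Q.comm_monoid_axioms)
interpretation FA: algebra A "monoid_algebra A Q"
  by (rule F.MA_algebra)
interpretation J: ideal J A.P
  by (rule extend_ideal[OF I])
interpretation S: cring S
  by (rule J.quotient_is_cring[OF A.P.M_cring])

abbreviation (input) "F \<equiv> monoid_algebra A Q"

definition \<phi> where "\<phi> = (\<lambda>p\<in>carrier B.P. I +>\<^bsub>B.P\<^esub> p)"

definition rels :: "(((nat \<Rightarrow> nat) \<Rightarrow> 'a) set \<Rightarrow> 'c) set" where
  "rels = {basis_elt A (q \<oplus>\<^bsub>Q\<^esub> r) \<ominus>\<^bsub>F\<^esub> (basis_elt A q \<oplus>\<^bsub>F\<^esub> basis_elt A r) | q r.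
         q \<in> carrier Q \<and> r \<in> carrier Q}
      \<union> {basis_elt A (b \<odot>\<^bsub>Q\<^esub> q) \<ominus>\<^bsub>F\<^esub> (g b \<odot>\<^bsub>F\<^esub> basis_elt A q) | b q.
         b \<in> carrier B \<and> q \<in> carrier Q}"

abbreviation (input) "T \<equiv> tensor_ideal B A g Q"

lemma tensor_ideal_rels: "T = genideal F rels"
  by (simp add: tensor_ideal_def rels_def Let_def)

lemma basis_closed: "q \<in> carrier Q \<Longrightarrow> basis_elt A q \<in> carrier F"
  by (simp add: F.basis_elt_mon)

lemma rels_carrier: "rels \<subseteq> carrier F"
  unfolding rels_def by (auto intro!: basis_closed FA.minus_closed FA.M.a_closed FA.smult_closed)

interpretation T: ideal T F
  unfolding tensor_ideal_rels by (rule FA.genideal_ideal[OF rels_carrier])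

lemma rels_T: "x \<in> rels \<Longrightarrow> x \<in> T"
  using FA.genideal_self[OF rels_carrier] by (auto simp: tensor_ideal_rels)

lemma \<phi>_ring_hom: "\<phi> \<in> ring_hom B.P Q"
  using I.quot_alg_ring_hom by (simp add: \<phi>_def ring_hom_def Pi_iff)

lemma \<phi>_closed: "p \<in> carrier B.P \<Longrightarrow> \<phi> p \<in> carrier Q"
  using ring_hom_closed[OF \<phi>_ring_hom] .

lemma \<phi>_smult: "b \<in> carrier B \<Longrightarrow> p \<in> carrier B.P \<Longrightarrow> \<phi> (b \<odot>\<^bsub>B.P\<^esub> p) = b \<odot>\<^bsub>Q\<^esub> \<phi> p"
  by (simp add: \<phi>_def I.quot_alg_smult)

definition hS where "hS a = J +>\<^bsub>A.P\<^esub> (a \<odot>\<^bsub>A.P\<^esub> \<one>\<^bsub>A.P\<^esub>)"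

text \<open>The map from \<open>B[x]/I\<close> to \<open>A[x]/J\<close> induced by
  \<open>cmap\<close>, evaluated on a chosen representative. Two representatives differ by an
  element of \<open>I\<close>, whose image lies in \<open>J\<close>, so the choice does not matter;
  see \<open>mS_coset\<close>.\<close>

definition mS where "mS X = J +>\<^bsub>A.P\<^esub> cmap (SOME p. p \<in> X)"

lemma J_hom: "(+>\<^bsub>A.P\<^esub>) J \<in> ring_hom A.P S"
  by (rule J.rcos_ring_hom)

lemma smult_J: "a \<in> carrier A \<Longrightarrow> q \<in> carrier A.P \<Longrightarrow>
    J +>\<^bsub>A.P\<^esub> (a \<odot>\<^bsub>A.P\<^esub> q) = hS a \<otimes>\<^bsub>S\<^esub> (J +>\<^bsub>A.P\<^esub> q)"
  by (simp add: hS_def ring_hom_mult[OF J_hom, symmetric] A.P.smult_assoc2)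

lemma hS_hom: "hS \<in> ring_hom A S"
proof (rule ring_hom_memI)
  fix a b assume ab: "a \<in> carrier A" "b \<in> carrier A"
  show "hS (a \<otimes>\<^bsub>A\<^esub> b) = hS a \<otimes>\<^bsub>S\<^esub> hS b"
    using ab smult_J[of a "b \<odot>\<^bsub>A.P\<^esub> \<one>\<^bsub>A.P\<^esub>"] by (simp add: hS_def A.P.smult_assoc1)
  show "hS (a \<oplus>\<^bsub>A\<^esub> b) = hS a \<oplus>\<^bsub>S\<^esub> hS b"
    using ab by (simp add: hS_def A.P.smult_l_distr ring_hom_add[OF J_hom])
qed (simp_all add: hS_def ring_hom_closed[OF J_hom] ring_hom_one[OF J_hom])

lemma mS_coset:
  assumes p: "p \<in> carrier B.P" shows "mS (I +>\<^bsub>B.P\<^esub> p) = J +>\<^bsub>A.P\<^esub> cmap p"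
proof -
  define q where "q = (SOME q. q \<in> I +>\<^bsub>B.P\<^esub> p)"
  have "q \<in> I +>\<^bsub>B.P\<^esub> p" unfolding q_def using I.I.a_rcos_self[OF p] by (rule someI[where P = "\<lambda>q. q \<in> I +>\<^bsub>B.P\<^esub> p"])
  then have q: "q \<in> carrier B.P" "q \<ominus>\<^bsub>B.P\<^esub> p \<in> I"
    using I.quot_mem_eq[OF p] I.quot_eq_iff p by blast+
  have "cmap q \<ominus>\<^bsub>A.P\<^esub> cmap p \<in> J"
    using cmap_in_extend[OF I.I.a_subset q(2)] q p by (simp add: cmap_minus)
  then have "J +>\<^bsub>A.P\<^esub> cmap q = J +>\<^bsub>A.P\<^esub> cmap p"
    using A.P.quotient_eq_iff_same_a_r_cos[OF J.ideal_axioms, of "cmap q" "cmap p"] p q by simp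
  then show ?thesis by (simp add: mS_def q_def)
qed

lemma carrier_Q_E: assumes "X \<in> carrier Q" obtains p where "p \<in> carrier B.P" "X = I +>\<^bsub>B.P\<^esub> p"
  using assms by (auto simp: I.quot_alg_carrier)

lemma mS_closed: "mS \<in> carrier Q \<rightarrow> carrier S"
  by (auto elim!: carrier_Q_E simp: mS_coset ring_hom_closed[OF J_hom])

text \<open>The candidate for an inverse of the base-change map, before dividing by the relations:
  the symbol of \<open>q\<close> with coefficient \<open>a\<close> goes to \<open>a\<close> times
  the image of \<open>q\<close> in \<open>A[x]/J\<close>.\<close>

definition \<Psi> where "\<Psi> = F.lift S hS mS"

lemma \<Psi>_hom: "\<Psi> \<in> ring_hom F S"
  unfolding \<Psi>_def
proof (rule F.lift_ring_hom[OF S.is_cring hS_hom mS_closed])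
  have "\<one>\<^bsub>Q\<^esub> = I +>\<^bsub>B.P\<^esub> \<one>\<^bsub>B.P\<^esub>" using ring_hom_one[OF I.quot_alg_ring_hom] by simp
  moreover have "cmap \<one>\<^bsub>B.P\<^esub> = \<one>\<^bsub>A.P\<^esub>" by (simp add: B.MA_one A.MA_one cmap_mon)
  ultimately show "mS \<one>\<^bsub>Q\<^esub> = \<one>\<^bsub>S\<^esub>" by (simp add: mS_coset ring_hom_one[OF J_hom])
  show "mS (x \<otimes>\<^bsub>Q\<^esub> y) = mS x \<otimes>\<^bsub>S\<^esub> mS y" if "x \<in> carrier Q" "y \<in> carrier Q" for x y
    using that
    by (auto elim!: carrier_Q_E simp: I.quot_alg_mult mS_coset cmap_mult ring_hom_mult[OF J_hom])
qed

interpretation \<Psi>: ring_hom_cring F S \<Psi>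
  by (rule ring_hom_cring.intro[OF FA.M_cring S.is_cring]) (simp add: ring_hom_cring_axioms_def \<Psi>_hom)

lemma \<Psi>_mon: "a \<in> carrier A \<Longrightarrow> q \<in> carrier Q \<Longrightarrow> \<Psi> (F.mon a q) = hS a \<otimes>\<^bsub>S\<^esub> mS q"
  unfolding \<Psi>_def by (rule F.lift_mon[OF S.is_cring hS_hom mS_closed])

lemma \<Psi>_basis: "q \<in> carrier Q \<Longrightarrow> \<Psi> (basis_elt A q) = mS q"
  using mS_closed ring_hom_one[OF hS_hom] by (auto simp: F.basis_elt_mon \<Psi>_mon Pi_iff)

lemma F_smult_basis: "a \<in> carrier A \<Longrightarrow> a \<odot>\<^bsub>F\<^esub> basis_elt A q = F.mon a q"
  by (auto simp: F.basis_elt_mon F.MA_simps F.mon_apply fun_eq_iff)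

lemma \<Psi>_rels: "x \<in> rels \<Longrightarrow> \<Psi> x = \<zero>\<^bsub>S\<^esub>"
proof -
  have minus: "\<Psi> (x \<ominus>\<^bsub>F\<^esub> y) = \<Psi> x \<ominus>\<^bsub>S\<^esub> \<Psi> y" if "x \<in> carrier F" "y \<in> carrier F" for x y
    using that by (simp add: a_minus_def)
  have "\<Psi> (basis_elt A (q \<oplus>\<^bsub>Q\<^esub> r) \<ominus>\<^bsub>F\<^esub> (basis_elt A q \<oplus>\<^bsub>F\<^esub> basis_elt A r)) = \<zero>\<^bsub>S\<^esub>"
    if qr: "q \<in> carrier Q" "r \<in> carrier Q" for q r
  proof -
    have "mS (q \<oplus>\<^bsub>Q\<^esub> r) = mS q \<oplus>\<^bsub>S\<^esub> mS r"
      using qr by (auto elim!: carrier_Q_E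
          simp: I.quot_alg_add mS_coset cmap_add ring_hom_add[OF J_hom])
    then show ?thesis
      using qr mS_closed S.r_neg
      by (simp add: minus basis_closed \<Psi>_basis Pi_iff S.minus_eq)
  qed
  moreover have "\<Psi> (basis_elt A (b \<odot>\<^bsub>Q\<^esub> q) \<ominus>\<^bsub>F\<^esub> (g b \<odot>\<^bsub>F\<^esub> basis_elt A q)) = \<zero>\<^bsub>S\<^esub>"
    if bq: "b \<in> carrier B" "q \<in> carrier Q" for b q
  proof -
    have "mS (b \<odot>\<^bsub>Q\<^esub> q) = hS (g b) \<otimes>\<^bsub>S\<^esub> mS q"
      using bq by (auto elim!: carrier_Q_E simp: I.quot_alg_smult mS_coset cmap_smult smult_J)
    then show ?thesis
      using bq mS_closed ring_hom_closed[OF hS_hom]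
      by (simp add: minus basis_closed \<Psi>_basis Pi_iff) (simp add: F_smult_basis \<Psi>_mon S.minus_eq S.r_neg)
  qed
  ultimately show "x \<in> rels \<Longrightarrow> \<Psi> x = \<zero>\<^bsub>S\<^esub>" unfolding rels_def by blast
qed

text \<open>\<open>T\<close> is the smallest ideal containing the relations, and the kernel of
  \<open>\<Psi>\<close> is an ideal containing them.\<close>

lemma \<Psi>_T: assumes "x \<in> T" shows "\<Psi> x = \<zero>\<^bsub>S\<^esub>"
proof -
  have "ideal (a_kernel F S \<Psi>) F"
    by (rule ring_hom_ring.kernel_is_ideal) (rule ring_hom_ringI2[OF FA.ring_axioms S.ring_axioms \<Psi>_hom])
  moreover have "rels \<subseteq> a_kernel F S \<Psi>"
    unfolding a_kernel_def' using \<Psi>_rels rels_carrier by blast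
  ultimately have "T \<subseteq> a_kernel F S \<Psi>"
    unfolding tensor_ideal_rels by (rule FA.genideal_minimal)
  then show ?thesis using assms unfolding a_kernel_def' by blast
qed

definition hF where "hF a = F.mon a \<one>\<^bsub>Q\<^esub>"
definition mF where "mF \<alpha> = basis_elt A (\<phi> (basis_elt B \<alpha>))"

lemma hF_hom: "hF \<in> ring_hom A F"
proof (rule ring_hom_memI)
  fix a b assume ab: "a \<in> carrier A" "b \<in> carrier A"
  show "hF (a \<otimes>\<^bsub>A\<^esub> b) = hF a \<otimes>\<^bsub>F\<^esub> hF b" using ab by (simp add: hF_def F.mon_mult)
  show "hF (a \<oplus>\<^bsub>A\<^esub> b) = hF a \<oplus>\<^bsub>F\<^esub> hF b"
    using ab by (auto simp: hF_def F.MA_simps F.mon_apply fun_eq_iff)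
qed (simp_all add: hF_def F.MA_one)

lemma mF_closed: "mF \<in> carrier (expos n) \<rightarrow> carrier F"
  using B.mon_closed[OF B.one_closed] by (auto simp: mF_def B.basis_elt_mon intro!: basis_closed \<phi>_closed)

text \<open>The base-change map lifted to the free module \<open>F\<close>; composing it with the
  quotient by \<open>T\<close> gives \<open>base_change\<close> on polynomials.\<close>

definition L where "L = A.lift F hF mF"

lemma basis_B_closed: "\<alpha> \<in> carrier (expos n) \<Longrightarrow> basis_elt B \<alpha> \<in> carrier B.P"
  using B.mon_closed[OF B.one_closed] by (simp add: B.basis_elt_mon)

lemma hF_mF: "a \<in> carrier A \<Longrightarrow> \<alpha> \<in> carrier (expos n) \<Longrightarrow>
    hF a \<otimes>\<^bsub>F\<^esub> mF \<alpha> = a \<odot>\<^bsub>F\<^esub> basis_elt A (\<phi> (basis_elt B \<alpha>))"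
  using \<phi>_closed[OF basis_B_closed[of \<alpha>]]
  by (simp add: hF_def mF_def F_smult_basis) (simp add: F.basis_elt_mon F.mon_mult)

lemma L_ring_hom: "L \<in> ring_hom A.P F"
  unfolding L_def
proof (rule A.lift_ring_hom[OF FA.M_cring hF_hom mF_closed])
  have "basis_elt B \<one>\<^bsub>expos n\<^esub> = \<one>\<^bsub>B.P\<^esub>" by (simp add: B.basis_elt_mon B.MA_one)
  then show "mF \<one>\<^bsub>expos n\<^esub> = \<one>\<^bsub>F\<^esub>"
    by (simp only: mF_def ring_hom_one[OF \<phi>_ring_hom] F.MA_one F.basis_elt_mon)
  fix x y assume xy: "x \<in> carrier (expos n)" "y \<in> carrier (expos n)"
  have "basis_elt B (x \<otimes>\<^bsub>expos n\<^esub> y) = basis_elt B x \<otimes>\<^bsub>B.P\<^esub> basis_elt B y"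
    using xy by (simp add: B.basis_elt_mon B.mon_mult del: expos_simps)
  then show "mF (x \<otimes>\<^bsub>expos n\<^esub> y) = mF x \<otimes>\<^bsub>F\<^esub> mF y"
    using \<phi>_closed[OF basis_B_closed[OF xy(1)]] \<phi>_closed[OF basis_B_closed[OF xy(2)]]
    by (simp only: mF_def ring_hom_mult[OF \<phi>_ring_hom basis_B_closed[OF xy(1)] basis_B_closed[OF xy(2)]]
        F.basis_elt_mon F.mon_mult A.one_closed A.l_one)
qed

lemma L_eq:
  assumes p: "p \<in> carrier A.P"
  shows "L p = finsum F (\<lambda>\<alpha>. p \<alpha> \<odot>\<^bsub>F\<^esub> basis_elt A (\<phi> (basis_elt B \<alpha>))) {\<alpha>. p \<alpha> \<noteq> \<zero>\<^bsub>A\<^esub>}"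
  unfolding L_def A.lift_def A.supp_def[symmetric]
  using A.supp_carrier[OF p] A.MA_coeff[OF p] basis_B_closed
  by (intro FA.finsum_cong') (auto simp: hF_mF subset_eq intro!: basis_closed \<phi>_closed)

text \<open>Yields the inclusion of the kernel in the extended ideal: if \<open>L p\<close> lies in
  \<open>T\<close>, then \<open>\<Psi>\<close> kills it, hence \<open>p\<close> lies in
  \<open>J\<close>.\<close>

lemma \<Psi>_L:
  assumes p: "p \<in> carrier A.P" shows "\<Psi> (L p) = J +>\<^bsub>A.P\<^esub> p"
  using p
proof (induction p rule: A.MA_induct)
  case zero
  have "L \<zero>\<^bsub>A.P\<^esub> = \<zero>\<^bsub>F\<^esub>"
    using ring_hom_zero[OF L_ring_hom A.P.ring_axioms FA.ring_axioms] .
  moreover have "J +>\<^bsub>A.P\<^esub> \<zero>\<^bsub>A.P\<^esub> = \<zero>\<^bsub>S\<^esub>"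
    using ring_hom_zero[OF J_hom A.P.ring_axioms S.ring_axioms] .
  ultimately show ?case by (simp add: A.MA_simps)
next
  case (mon a x)
  have c: "\<phi> (basis_elt B x) \<in> carrier Q" "basis_elt B x \<in> carrier B.P"
    using \<phi>_closed basis_B_closed mon by auto
  have "L (A.mon a x) = F.mon a (\<phi> (basis_elt B x))"
    unfolding L_def A.lift_mon[OF FA.M_cring hF_hom mF_closed mon] hF_mF[OF mon]
    using mon by (simp add: F_smult_basis)
  moreover have "mS (\<phi> (basis_elt B x)) = J +>\<^bsub>A.P\<^esub> A.mon \<one>\<^bsub>A\<^esub> x"
    using c by (simp add: \<phi>_def mS_coset) (simp add: B.basis_elt_mon cmap_mon)
  ultimately show ?case
    using mon c smult_J[of a "A.mon \<one>\<^bsub>A\<^esub> x"] A.mon_closed[OF A.one_closed, of x]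
    by (simp add: \<Psi>_mon A.smult_mon)
next
  case (add p q)
  have "\<Psi> (L (p \<oplus>\<^bsub>A.P\<^esub> q)) = J +>\<^bsub>A.P\<^esub> (p \<oplus>\<^bsub>A.P\<^esub> q)"
    using add by (simp add: ring_hom_add[OF L_ring_hom] ring_hom_add[OF J_hom] ring_hom_closed[OF L_ring_hom])
  then show ?case by (simp add: A.MA_simps)
qed

text \<open>The additivity relation for \<open>0 + 0 = 0\<close> already forces the symbol of zero
  into \<open>T\<close>.\<close>

lemma basis_zero_T: "basis_elt A \<zero>\<^bsub>Q\<^esub> \<in> T"
proof -
  let ?z = "basis_elt A \<zero>\<^bsub>Q\<^esub>"
  have z: "?z \<in> carrier F" by (intro basis_closed Q.M.zero_closed)
  have "basis_elt A (\<zero>\<^bsub>Q\<^esub> \<oplus>\<^bsub>Q\<^esub> \<zero>\<^bsub>Q\<^esub>) \<ominus>\<^bsub>F\<^esub> (?z \<oplus>\<^bsub>F\<^esub> ?z) \<in> T"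
    by (rule rels_T) (use Q.M.zero_closed in \<open>unfold rels_def, blast\<close>)
  then have "\<ominus>\<^bsub>F\<^esub> (?z \<ominus>\<^bsub>F\<^esub> (?z \<oplus>\<^bsub>F\<^esub> ?z)) \<in> T" by (simp add: T.a_inv_closed)
  moreover have "\<ominus>\<^bsub>F\<^esub> (?z \<ominus>\<^bsub>F\<^esub> (?z \<oplus>\<^bsub>F\<^esub> ?z)) = ?z"
    using z by (simp add: a_minus_def FA.M.minus_add FA.M.r_neg1 FA.M.a_assoc[symmetric] FA.M.r_neg)
  ultimately show ?thesis by simp
qed

text \<open>Modulo \<open>T\<close> the symbol of \<open>\<phi> w\<close> can be expanded along sums
  and scalars. These are the two kinds of relations; the first is used in the case
  \<open>add\<close>, the second in the case \<open>mon\<close>.\<close>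

lemma L_cmap:
  assumes w: "w \<in> carrier B.P" shows "L (cmap w) \<ominus>\<^bsub>F\<^esub> basis_elt A (\<phi> w) \<in> T"
  using w
proof (induction w rule: B.MA_induct)
  case zero
  have "L (cmap \<zero>\<^bsub>B.P\<^esub>) = \<zero>\<^bsub>F\<^esub>"
    using ring_hom_zero[OF L_ring_hom A.P.ring_axioms FA.ring_axioms] by (simp add: cmap_zero)
  moreover have "\<phi> \<zero>\<^bsub>B.P\<^esub> = \<zero>\<^bsub>Q\<^esub>"
    using ring_hom_zero[OF \<phi>_ring_hom B.P.ring_axioms Q.ring_axioms] .
  ultimately have "L (cmap \<zero>\<^bsub>B.P\<^esub>) \<ominus>\<^bsub>F\<^esub> basis_elt A (\<phi> \<zero>\<^bsub>B.P\<^esub>) \<in> T"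
    using T.a_inv_closed[OF basis_zero_T] T.a_Hcarr[OF basis_zero_T] by (simp add: a_minus_def)
  then show ?case by (simp add: B.MA_simps)
next
  case (mon b x)
  let ?q = "\<phi> (basis_elt B x)"
  have c: "?q \<in> carrier Q" "basis_elt B x \<in> carrier B.P"
    using \<phi>_closed basis_B_closed mon by auto
  have gb: "g b \<in> carrier A" using mon by simp
  have "L (cmap (B.mon b x)) = g b \<odot>\<^bsub>F\<^esub> basis_elt A ?q"
    unfolding cmap_mon[OF mon(1)] L_def A.lift_mon[OF FA.M_cring hF_hom mF_closed gb mon(2)] hF_mF[OF gb mon(2)] ..
  moreover have "\<phi> (B.mon b x) = b \<odot>\<^bsub>Q\<^esub> ?q"
    using mon c B.mon_smult_one[of b x] by (simp add: B.basis_elt_mon \<phi>_smult)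
  moreover have "basis_elt A (b \<odot>\<^bsub>Q\<^esub> ?q) \<ominus>\<^bsub>F\<^esub> (g b \<odot>\<^bsub>F\<^esub> basis_elt A ?q) \<in> T" (is "?u \<ominus>\<^bsub>F\<^esub> ?v \<in> T")
    by (rule rels_T) (use mon c in \<open>unfold rels_def, blast\<close>)
  moreover have "?v \<ominus>\<^bsub>F\<^esub> ?u = \<ominus>\<^bsub>F\<^esub> (?u \<ominus>\<^bsub>F\<^esub> ?v)"
    using basis_closed[of ?q] basis_closed[of "b \<odot>\<^bsub>Q\<^esub> ?q"] c gb mon
    by (simp add: a_minus_def FA.M.minus_add FA.M.a_comm)
  ultimately show ?case using T.a_inv_closed by simp
next
  case (add p q)
  let ?b = "\<lambda>q. basis_elt A (\<phi> q)"
  have c: "?b p \<in> carrier F" "?b q \<in> carrier F" "?b (p \<oplus>\<^bsub>B.P\<^esub> q) \<in> carrier F"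
      "L (cmap p) \<in> carrier F" "L (cmap q) \<in> carrier F"
    using add by (auto intro!: basis_closed \<phi>_closed ring_hom_closed[OF L_ring_hom])
  have "?b (p \<oplus>\<^bsub>B.P\<^esub> q) \<ominus>\<^bsub>F\<^esub> (?b p \<oplus>\<^bsub>F\<^esub> ?b q) \<in> T"
    unfolding ring_hom_add[OF \<phi>_ring_hom add(1,2)]
    by (rule rels_T) (use add \<phi>_closed in \<open>unfold rels_def, blast\<close>)
  then have "(L (cmap p) \<ominus>\<^bsub>F\<^esub> ?b p) \<oplus>\<^bsub>F\<^esub> (L (cmap q) \<ominus>\<^bsub>F\<^esub> ?b q)
      \<oplus>\<^bsub>F\<^esub> \<ominus>\<^bsub>F\<^esub> (?b (p \<oplus>\<^bsub>B.P\<^esub> q) \<ominus>\<^bsub>F\<^esub> (?b p \<oplus>\<^bsub>F\<^esub> ?b q)) \<in> T"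
    using add by (intro T.a_closed T.a_inv_closed)
  moreover have "L (cmap (p \<oplus>\<^bsub>B.P\<^esub> q)) = L (cmap p) \<oplus>\<^bsub>F\<^esub> L (cmap q)"
    using add by (simp add: cmap_add ring_hom_add[OF L_ring_hom])
  moreover have "(u \<ominus>\<^bsub>F\<^esub> x) \<oplus>\<^bsub>F\<^esub> (v \<ominus>\<^bsub>F\<^esub> y) \<oplus>\<^bsub>F\<^esub> \<ominus>\<^bsub>F\<^esub> (z \<ominus>\<^bsub>F\<^esub> (x \<oplus>\<^bsub>F\<^esub> y)) = (u \<oplus>\<^bsub>F\<^esub> v) \<ominus>\<^bsub>F\<^esub> z"
    if "u \<in> carrier F" "v \<in> carrier F" "x \<in> carrier F" "y \<in> carrier F" "z \<in> carrier F" for u v x y z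
    using that by algebra
  ultimately have "L (cmap (p \<oplus>\<^bsub>B.P\<^esub> q)) \<ominus>\<^bsub>F\<^esub> ?b (p \<oplus>\<^bsub>B.P\<^esub> q) \<in> T"
    using c by simp
  then show ?case by (simp add: B.MA_simps)
qed

text \<open>The elements that \<open>L\<close> sends into \<open>T\<close> form an ideal, in
  particular an \<open>A\<close>-submodule, so it suffices to treat the generators
  \<open>cmap w\<close>. For \<open>w\<close> in \<open>I\<close> the symbol of
  \<open>\<phi> w\<close> is the symbol of zero.\<close>

lemma L_extend: "u \<in> J \<Longrightarrow> L u \<in> T"
proof -
  have "ring_hom_ring A.P F L"
    by (rule ring_hom_ringI2[OF A.P.ring_axioms FA.ring_axioms L_ring_hom])
  then have "ideal {u \<in> carrier A.P. L u \<in> T} A.P"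
    by (rule ring_hom_ring.ideal_vimage) (rule T.ideal_axioms)
  then have N: "submodule {u \<in> carrier A.P. L u \<in> T} A A.P" by (rule A.P.ideal_submodule)
  have "L (cmap w) \<in> T" if w: "w \<in> I" for w
  proof -
    have wc: "w \<in> carrier B.P" using w by (rule I.I.Icarr)
    have "\<phi> w = \<phi> \<zero>\<^bsub>B.P\<^esub>"
      using wc w I.quot_eq_iff[of w "\<zero>\<^bsub>B.P\<^esub>"] by (simp add: \<phi>_def a_minus_def)
    also have "\<dots> = \<zero>\<^bsub>Q\<^esub>" by (rule ring_hom_zero[OF \<phi>_ring_hom B.P.ring_axioms Q.ring_axioms])
    finally have "(L (cmap w) \<ominus>\<^bsub>F\<^esub> basis_elt A \<zero>\<^bsub>Q\<^esub>) \<oplus>\<^bsub>F\<^esub> basis_elt A \<zero>\<^bsub>Q\<^esub> \<in> T"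
      using L_cmap[OF wc] basis_zero_T by auto
    moreover have "L (cmap w) \<in> carrier F" using ring_hom_closed[OF L_ring_hom] wc by simp
    ultimately show ?thesis
      using T.a_Hcarr[OF basis_zero_T] by (simp add: a_minus_def FA.M.a_assoc FA.M.l_neg)
  qed
  then show "u \<in> J \<Longrightarrow> L u \<in> T"
    using extend_minimal[OF I.I.a_subset N] I.I.Icarr by (auto simp: image_subset_iff subset_eq)
qed

theorem base_change_kernel:
  "a_kernel A.P (tensor_alg B A g Q) (base_change n B A g Q (\<lambda>p\<in>carrier B.P. I +>\<^bsub>B.P\<^esub> p)) = extend I"
proof -
  have zero: "\<zero>\<^bsub>tensor_alg B A g Q\<^esub> = T"
    by (simp add: tensor_alg_def quot_alg_def FactRing_def)
  have bc: "base_change n B A g Q (\<lambda>p\<in>carrier B.P. I +>\<^bsub>B.P\<^esub> p) p = T +>\<^bsub>F\<^esub> L p" if "p \<in> carrier A.P" for p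
    using that by (simp add: base_change_def Let_def L_eq \<phi>_def[symmetric])
  have iff: "T +>\<^bsub>F\<^esub> L p = T \<longleftrightarrow> p \<in> J" if p: "p \<in> carrier A.P" for p
  proof
    assume "T +>\<^bsub>F\<^esub> L p = T"
    then have "L p \<in> T" using T.rcos_const_imp_mem ring_hom_closed[OF L_ring_hom p] by blast
    then have "J +>\<^bsub>A.P\<^esub> p = \<zero>\<^bsub>S\<^esub>" using \<Psi>_T \<Psi>_L[OF p] by simp
    then have "J +>\<^bsub>A.P\<^esub> p = J" by (simp add: FactRing_def)
    then show "p \<in> J" using J.rcos_const_imp_mem p by blast
  next
    assume "p \<in> J"
    then show "T +>\<^bsub>F\<^esub> L p = T" using L_extend FA.a_rcos_zero[OF T.ideal_axioms] by blast
  qed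
  show ?thesis unfolding a_kernel_def' zero
  proof (rule Set.set_eqI, unfold mem_Collect_eq)
    fix p
    show "p \<in> carrier A.P \<and> base_change n B A g Q (\<lambda>p\<in>carrier B.P. I +>\<^bsub>B.P\<^esub> p) p = T \<longleftrightarrow> p \<in> J"
      using iff[of p] bc[of p] J.Icarr[of p] by argo
  qed
qed

end

section \<open>Localization and local freeness\<close>

lemma (in abelian_group) minus_eq_zero_iff:
  "x \<in> carrier G \<Longrightarrow> y \<in> carrier G \<Longrightarrow> x \<ominus> y = \<zero> \<longleftrightarrow> x = y"
  using add.inv_solve_right'[of \<zero> x y] by (auto simp: a_minus_def)

locale localization = module R M for R (structure) and M :: "('a, 'c) module" +
  fixes f assumes f_closed [simp]: "f \<in> carrier R"
begin

abbreviation "fr \<equiv> frac R M f"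
abbreviation "Loc \<equiv> localize R M f"

lemma pow_smult_add: "x \<in> carrier M \<Longrightarrow>
    f [^] (i :: nat) \<odot>\<^bsub>M\<^esub> (f [^] (j :: nat) \<odot>\<^bsub>M\<^esub> x) = f [^] (i + j) \<odot>\<^bsub>M\<^esub> x"
  by (simp add: smult_assoc1[symmetric] R.nat_pow_mult)

lemma smult_minus: "a \<in> carrier R \<Longrightarrow> x \<in> carrier M \<Longrightarrow> y \<in> carrier M \<Longrightarrow>
    a \<odot>\<^bsub>M\<^esub> (x \<ominus>\<^bsub>M\<^esub> y) = a \<odot>\<^bsub>M\<^esub> x \<ominus>\<^bsub>M\<^esub> a \<odot>\<^bsub>M\<^esub> y"
  by (simp add: a_minus_def smult_r_distr smult_r_minus)

text \<open>The powers of \<open>f\<close> are collected on the two sides, so that later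
  computations with fractions need no subtraction.\<close>

lemma frac_rel_iff:
  "((x, i), (y, j)) \<in> frac_rel R M f \<longleftrightarrow> x \<in> carrier M \<and> y \<in> carrier M \<and>
     (\<exists>l::nat. f [^] (l + j) \<odot>\<^bsub>M\<^esub> x = f [^] (l + i) \<odot>\<^bsub>M\<^esub> y)"
  by (auto simp: frac_rel_def smult_minus pow_smult_add M.minus_eq_zero_iff)

lemma frac_rel_equiv: "equiv (carrier M \<times> UNIV) (frac_rel R M f)"
proof (rule equivI)
  show "frac_rel R M f \<subseteq> (carrier M \<times> UNIV) \<times> carrier M \<times> UNIV" by (auto simp: frac_rel_def)
  show "refl_on (carrier M \<times> UNIV) (frac_rel R M f)" by (auto simp: refl_on_def frac_rel_iff)
  show "sym (frac_rel R M f)" unfolding sym_def by (metis frac_rel_iff surj_pair)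
  show "trans (frac_rel R M f)"
  proof (rule transI)
    fix u v w assume uv: "(u, v) \<in> frac_rel R M f" "(v, w) \<in> frac_rel R M f"
    obtain x i y j z k where eq: "u = (x, i)" "v = (y, j)" "w = (z, k)" by (metis surj_pair)
    obtain l m :: nat where c: "x \<in> carrier M" "y \<in> carrier M" "z \<in> carrier M"
      and lm: "f [^] (l + j) \<odot>\<^bsub>M\<^esub> x = f [^] (l + i) \<odot>\<^bsub>M\<^esub> y" "f [^] (m + k) \<odot>\<^bsub>M\<^esub> y = f [^] (m + j) \<odot>\<^bsub>M\<^esub> z"
      using uv unfolding eq frac_rel_iff by blast
    have "f [^] (l + m + j + k) \<odot>\<^bsub>M\<^esub> x = f [^] (m + k) \<odot>\<^bsub>M\<^esub> (f [^] (l + j) \<odot>\<^bsub>M\<^esub> x)"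
      using c by (simp add: pow_smult_add ac_simps)
    also have "\<dots> = f [^] (l + i) \<odot>\<^bsub>M\<^esub> (f [^] (m + k) \<odot>\<^bsub>M\<^esub> y)"
      using c unfolding lm(1) by (simp add: pow_smult_add ac_simps)
    also have "\<dots> = f [^] (l + m + j + i) \<odot>\<^bsub>M\<^esub> z"
      using c unfolding lm(2) by (simp add: pow_smult_add ac_simps)
    finally show "(u, w) \<in> frac_rel R M f" using c unfolding eq frac_rel_iff by blast
  qed
qed

lemma fr_eq_iff:
  assumes "x \<in> carrier M" "y \<in> carrier M"
  shows "fr x i = fr y j \<longleftrightarrow> (\<exists>l::nat. f [^] (l + j) \<odot>\<^bsub>M\<^esub> x = f [^] (l + i) \<odot>\<^bsub>M\<^esub> y)"
  unfolding frac_def using assms eq_equiv_class_iff[OF frac_rel_equiv, of "(x, i)" "(y, j)"]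
  by (auto simp: frac_rel_iff)

lemma fr_mem: assumes "(y, j) \<in> fr x i" shows "y \<in> carrier M" "fr y j = fr x i"
proof -
  have *: "((x, i), (y, j)) \<in> frac_rel R M f" using assms by (auto simp: frac_def)
  then show "y \<in> carrier M" by (simp add: frac_rel_iff)
  show "fr y j = fr x i" unfolding frac_def using equiv_class_eq[OF frac_rel_equiv *] by simp
qed

lemma fr_self: "x \<in> carrier M \<Longrightarrow> (x, i) \<in> fr x i"
  by (auto simp: frac_def frac_rel_iff)

lemma fr_expand: "x \<in> carrier M \<Longrightarrow> fr (f [^] k \<odot>\<^bsub>M\<^esub> x) (i + k) = fr x i"
  by (subst fr_eq_iff) (auto simp: pow_smult_add ac_simps)

lemma Loc_carrier: "X \<in> carrier Loc \<longleftrightarrow> (\<exists>x\<in>carrier M. \<exists>i. X = fr x i)"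
  by (auto simp: localize_def frac_def quotient_def)

lemma fr_closed: "x \<in> carrier M \<Longrightarrow> fr x i \<in> carrier Loc"
  by (auto simp: Loc_carrier)

lemma Loc_zero: "\<zero>\<^bsub>Loc\<^esub> = fr \<zero>\<^bsub>M\<^esub> i"
  by (auto simp: localize_def fr_eq_iff)

text \<open>Evaluates the unions in \<open>localize\<close>, whose members all coincide.\<close>

lemma Union_const2:
  assumes "X \<noteq> {}" "Y \<noteq> {}" "\<And>x i y j. (x, i) \<in> X \<Longrightarrow> (y, j) \<in> Y \<Longrightarrow> h x i y j = c"
  shows "(\<Union>(x, i)\<in>X. \<Union>(y, j)\<in>Y. h x i y j) = c"
proof -
  have "(\<Union>(y, j)\<in>Y. h x i y j) = c" if "(x, i) \<in> X" for x i
    using assms(2,3) that by (intro SUP_eq_const) auto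
  then have "(case p of (x, i) \<Rightarrow> \<Union>(y, j)\<in>Y. h x i y j) = c" if "p \<in> X" for p
    using that by (cases p) simp
  then show ?thesis using assms(1) by (intro SUP_eq_const)
qed

text \<open>Independence of representatives is established for sums over a common denominator only.
  That is enough, since any finite family of fractions can be brought to one.\<close>

lemma add_fr_same:
  assumes x: "x \<in> carrier M" and y: "y \<in> carrier M"
  shows "fr x i \<oplus>\<^bsub>Loc\<^esub> fr y i = fr (x \<oplus>\<^bsub>M\<^esub> y) i"
proof -
  have "fr (f [^] j' \<odot>\<^bsub>M\<^esub> x' \<oplus>\<^bsub>M\<^esub> f [^] i' \<odot>\<^bsub>M\<^esub> y') (i' + j') = fr (x \<oplus>\<^bsub>M\<^esub> y) i"
    if mem: "(x', i') \<in> fr x i" "(y', j') \<in> fr y i" for x' i' y' j'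
  proof -
    have c: "x' \<in> carrier M" "y' \<in> carrier M" using that fr_mem by auto
    obtain l m :: nat where lm: "f [^] (l + i) \<odot>\<^bsub>M\<^esub> x' = f [^] (l + i') \<odot>\<^bsub>M\<^esub> x"
      "f [^] (m + i) \<odot>\<^bsub>M\<^esub> y' = f [^] (m + j') \<odot>\<^bsub>M\<^esub> y"
      using fr_mem(2)[OF mem(1)] fr_mem(2)[OF mem(2)] c x y by (auto simp: fr_eq_iff)
    have "f [^] (l + m + i) \<odot>\<^bsub>M\<^esub> (f [^] j' \<odot>\<^bsub>M\<^esub> x' \<oplus>\<^bsub>M\<^esub> f [^] i' \<odot>\<^bsub>M\<^esub> y')
        = f [^] (m + j') \<odot>\<^bsub>M\<^esub> (f [^] (l + i) \<odot>\<^bsub>M\<^esub> x') \<oplus>\<^bsub>M\<^esub> f [^] (l + i') \<odot>\<^bsub>M\<^esub> (f [^] (m + i) \<odot>\<^bsub>M\<^esub> y')"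
      using c by (simp add: smult_r_distr pow_smult_add ac_simps)
    also have "\<dots> = f [^] (l + m + (i' + j')) \<odot>\<^bsub>M\<^esub> (x \<oplus>\<^bsub>M\<^esub> y)"
      unfolding lm using x y by (simp add: smult_r_distr pow_smult_add ac_simps)
    finally show ?thesis using c x y by (subst fr_eq_iff) auto
  qed
  then have "(\<Union>(x', i')\<in>fr x i. \<Union>(y', j')\<in>fr y i.
      fr (f [^] j' \<odot>\<^bsub>M\<^esub> x' \<oplus>\<^bsub>M\<^esub> f [^] i' \<odot>\<^bsub>M\<^esub> y') (i' + j')) = fr (x \<oplus>\<^bsub>M\<^esub> y) i"
    using fr_self[OF x] fr_self[OF y] by (intro Union_const2) blast+
  then show ?thesis by (simp add: localize_def)
qed

lemma common_denom2:
  assumes "X \<in> carrier Loc" "Y \<in> carrier Loc"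
  obtains x y i where "x \<in> carrier M" "y \<in> carrier M" "X = fr x i" "Y = fr y i"
proof -
  obtain x i y j where c: "x \<in> carrier M" "y \<in> carrier M" "X = fr x i" "Y = fr y j"
    using assms by (auto simp: Loc_carrier)
  then show ?thesis
    using that[of "f [^] j \<odot>\<^bsub>M\<^esub> x" "f [^] i \<odot>\<^bsub>M\<^esub> y" "i + j"] fr_expand[of x j i] fr_expand[of y i j]
    by (simp add: add.commute)
qed

lemma Loc_abelian_monoid: "abelian_monoid Loc"
proof (rule abelian_monoidI)
  fix X Y assume XY: "X \<in> carrier Loc" "Y \<in> carrier Loc"
  then obtain x y i where xy: "x \<in> carrier M" "y \<in> carrier M" "X = fr x i" "Y = fr y i"
    by (rule common_denom2)
  then show "X \<oplus>\<^bsub>Loc\<^esub> Y \<in> carrier Loc" "X \<oplus>\<^bsub>Loc\<^esub> Y = Y \<oplus>\<^bsub>Loc\<^esub> X"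
    by (auto simp: add_fr_same fr_closed M.a_comm)
  fix Z assume "Z \<in> carrier Loc"
  then obtain z k where z: "z \<in> carrier M" "Z = fr z k" by (auto simp: Loc_carrier)
  have "X = fr (f [^] k \<odot>\<^bsub>M\<^esub> x) (i + k)" "Y = fr (f [^] k \<odot>\<^bsub>M\<^esub> y) (i + k)" "Z = fr (f [^] i \<odot>\<^bsub>M\<^esub> z) (i + k)"
    using xy z fr_expand[of z i k] by (simp_all add: fr_expand add.commute)
  then show "X \<oplus>\<^bsub>Loc\<^esub> Y \<oplus>\<^bsub>Loc\<^esub> Z = X \<oplus>\<^bsub>Loc\<^esub> (Y \<oplus>\<^bsub>Loc\<^esub> Z)"
    using xy z by (simp add: add_fr_same M.a_assoc)
next
  show "\<zero>\<^bsub>Loc\<^esub> \<in> carrier Loc" using Loc_zero[of 0] by (simp add: fr_closed)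
  fix X assume "X \<in> carrier Loc"
  then obtain x i where "x \<in> carrier M" "X = fr x i" by (auto simp: Loc_carrier)
  then show "\<zero>\<^bsub>Loc\<^esub> \<oplus>\<^bsub>Loc\<^esub> X = X" by (simp add: Loc_zero[of i] add_fr_same)
qed

lemma finsum_fr:
  assumes "finite K" "x \<in> K \<rightarrow> carrier M"
  shows "finsum Loc (\<lambda>k. fr (x k) i) K = fr (finsum M x K) i"
proof -
  interpret L: abelian_monoid Loc by (rule Loc_abelian_monoid)
  show ?thesis using assms
  proof (induction K rule: finite_induct)
    case empty then show ?case by (simp add: Loc_zero[of i])
  next
    case (insert k K)
    then show ?case
      by (subst L.finsum_insert) (auto simp: Pi_iff fr_closed add_fr_same)
  qed
qed

lemma common_denom_family:
  assumes "X \<in> {..<d::nat} \<rightarrow> carrier Loc"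
  shows "\<exists>x i. x \<in> {..<d} \<rightarrow> carrier M \<and> (\<forall>k<d. X k = fr (x k) i)"
  using assms
proof (induction d)
  case (Suc d)
  obtain x i where x: "x \<in> {..<d} \<rightarrow> carrier M" "\<forall>k<d. X k = fr (x k) i"
  proof -
    have "X \<in> {..<d} \<rightarrow> carrier Loc" using Suc.prems by auto
    then show ?thesis using Suc.IH that by blast
  qed
  obtain y j where y: "y \<in> carrier M" "X d = fr y j"
  proof -
    have "X d \<in> carrier Loc" using Suc.prems by auto
    then show ?thesis using that unfolding Loc_carrier by blast
  qed
  let ?z = "\<lambda>k. if k = d then f [^] i \<odot>\<^bsub>M\<^esub> y else f [^] j \<odot>\<^bsub>M\<^esub> x k"
  have "X k = fr (?z k) (i + j)" if "k < Suc d" for k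
    using that x y fr_expand[of y i j] fr_expand[of "x k" j i] by (auto simp: less_Suc_eq Pi_iff add.commute)
  moreover have "?z \<in> {..<Suc d} \<rightarrow> carrier M" using x y by (auto simp: less_Suc_eq Pi_iff)
  ultimately show ?case by blast
qed auto

end

section \<open>Freeness of a localization in terms of elements of the module\<close>

lemma (in cring) self_alg_algebra: "algebra R (self_alg R)"
proof (rule algebraI)
  show "cring (self_alg R)" by (rule cring_cong[OF is_cring]) (simp_all add: self_alg_def)
qed (auto simp: self_alg_def is_cring l_distr r_distr m_assoc)

text \<open>A basis of the localization at \<open>f\<close> consisting of images of elements of
  \<open>M\<close>, with denominators cleared: expansions exist up to a power of \<open>f\<close>,
  and the coefficients of a relation are annihilated by a power of \<open>f\<close>.\<close>

definition loc_basis ::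
    "('r, 'l) ring_scheme \<Rightarrow> ('r, 'a) module \<Rightarrow> 'r \<Rightarrow> nat \<Rightarrow> (nat \<Rightarrow> 'a) \<Rightarrow> bool" where
  "loc_basis R M f d e \<longleftrightarrow> e \<in> {..<d} \<rightarrow> carrier M \<and>
     (\<forall>x\<in>carrier M. \<exists>l::nat. \<exists>c\<in>{..<d} \<rightarrow> carrier R.
        (f [^]\<^bsub>R\<^esub> l) \<odot>\<^bsub>M\<^esub> x = finsum M (\<lambda>i. c i \<odot>\<^bsub>M\<^esub> e i) {..<d}) \<and>
     (\<forall>c\<in>{..<d} \<rightarrow> carrier R. finsum M (\<lambda>i. c i \<odot>\<^bsub>M\<^esub> e i) {..<d} = \<zero>\<^bsub>M\<^esub> \<longrightarrow>
        (\<exists>l::nat. \<forall>i<d. f [^]\<^bsub>R\<^esub> l \<otimes>\<^bsub>R\<^esub> c i = \<zero>\<^bsub>R\<^esub>))"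

lemma loc_basisI:
  assumes "e \<in> {..<d} \<rightarrow> carrier M"
    and "\<And>x. x \<in> carrier M \<Longrightarrow> \<exists>l::nat. \<exists>c\<in>{..<d} \<rightarrow> carrier R.
        (f [^]\<^bsub>R\<^esub> l) \<odot>\<^bsub>M\<^esub> x = finsum M (\<lambda>i. c i \<odot>\<^bsub>M\<^esub> e i) {..<d}"
    and "\<And>c. c \<in> {..<d} \<rightarrow> carrier R \<Longrightarrow> finsum M (\<lambda>i. c i \<odot>\<^bsub>M\<^esub> e i) {..<d} = \<zero>\<^bsub>M\<^esub> \<Longrightarrow>
        \<exists>l::nat. \<forall>i<d. f [^]\<^bsub>R\<^esub> l \<otimes>\<^bsub>R\<^esub> c i = \<zero>\<^bsub>R\<^esub>"
  shows "loc_basis R M f d e"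
  unfolding loc_basis_def using assms by (intro conjI ballI impI)

lemma loc_basis_closed: "loc_basis R M f d e \<Longrightarrow> e \<in> {..<d} \<rightarrow> carrier M"
  unfolding loc_basis_def by (elim conjE)

lemma loc_basis_span: "loc_basis R M f d e \<Longrightarrow> x \<in> carrier M \<Longrightarrow>
    \<exists>l::nat. \<exists>c\<in>{..<d} \<rightarrow> carrier R.
      (f [^]\<^bsub>R\<^esub> l) \<odot>\<^bsub>M\<^esub> x = finsum M (\<lambda>i. c i \<odot>\<^bsub>M\<^esub> e i) {..<d}"
  unfolding loc_basis_def by (elim conjE) (rule bspec)

lemma loc_basis_indep: "loc_basis R M f d e \<Longrightarrow> c \<in> {..<d} \<rightarrow> carrier R \<Longrightarrow>
    finsum M (\<lambda>i. c i \<odot>\<^bsub>M\<^esub> e i) {..<d} = \<zero>\<^bsub>M\<^esub> \<Longrightarrow>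
    \<exists>l::nat. \<forall>i<d. f [^]\<^bsub>R\<^esub> l \<otimes>\<^bsub>R\<^esub> c i = \<zero>\<^bsub>R\<^esub>"
  unfolding loc_basis_def by (elim conjE) (drule (1) bspec, erule mp)

lemma ex1_eqD: "\<exists>!x. Q x \<Longrightarrow> Q u \<Longrightarrow> Q v \<Longrightarrow> u = v"
  by blast

context localization
begin

interpretation S: localization R "self_alg R" f
proof -
  interpret A: algebra R "self_alg R" by (rule R.self_alg_algebra)
  show "localization R (self_alg R) f" by unfold_locales simp
qed

lemma self_alg_simps [simp]:
  "carrier (self_alg R) = carrier R" "\<zero>\<^bsub>self_alg R\<^esub> = \<zero>" "a \<odot>\<^bsub>self_alg R\<^esub> b = a \<otimes> b"
  by (simp_all add: self_alg_def)

lemma smult_fr: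
  assumes c: "c \<in> carrier R" and x: "x \<in> carrier M"
  shows "S.fr c i \<odot>\<^bsub>Loc\<^esub> fr x j = fr (c \<odot>\<^bsub>M\<^esub> x) (i + j)"
proof -
  have "fr (c' \<odot>\<^bsub>M\<^esub> x') (i' + j') = fr (c \<odot>\<^bsub>M\<^esub> x) (i + j)"
    if mem: "(c', i') \<in> S.fr c i" "(x', j') \<in> fr x j" for c' i' x' j'
  proof -
    have c': "c' \<in> carrier R" "x' \<in> carrier M" using that fr_mem S.fr_mem by auto
    obtain l m :: nat where lm: "f [^] (l + i) \<otimes> c' = f [^] (l + i') \<otimes> c"
      "f [^] (m + j) \<odot>\<^bsub>M\<^esub> x' = f [^] (m + j') \<odot>\<^bsub>M\<^esub> x"
      using fr_mem(2)[OF mem(2)] S.fr_mem(2)[OF mem(1)] c c' x by (auto simp: fr_eq_iff S.fr_eq_iff)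
    have swap: "f [^] (p + q) \<odot>\<^bsub>M\<^esub> (a \<odot>\<^bsub>M\<^esub> y) = (f [^] p \<otimes> a) \<odot>\<^bsub>M\<^esub> (f [^] q \<odot>\<^bsub>M\<^esub> y)"
      if "a \<in> carrier R" "y \<in> carrier M" for a y and p q :: nat
      using that by (simp add: smult_assoc1[symmetric] R.nat_pow_mult[symmetric] R.m_ac)
    have "f [^] ((l + m) + (i + j)) \<odot>\<^bsub>M\<^esub> (c' \<odot>\<^bsub>M\<^esub> x') = (f [^] (l + i) \<otimes> c') \<odot>\<^bsub>M\<^esub> (f [^] (m + j) \<odot>\<^bsub>M\<^esub> x')"
      using c' swap[of c' x' "l + i" "m + j"] by (simp add: ac_simps)
    also have "\<dots> = f [^] ((l + m) + (i' + j')) \<odot>\<^bsub>M\<^esub> (c \<odot>\<^bsub>M\<^esub> x)"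
      unfolding lm using c x swap[of c x "l + i'" "m + j'"] by (simp add: ac_simps)
    finally show ?thesis using c c' x by (subst fr_eq_iff) auto
  qed
  then have "(\<Union>(c', i')\<in>S.fr c i. \<Union>(x', j')\<in>fr x j. fr (c' \<odot>\<^bsub>M\<^esub> x') (i' + j')) = fr (c \<odot>\<^bsub>M\<^esub> x) (i + j)"
    using fr_self[OF x] S.fr_self[of c] c by (intro Union_const2) (blast | simp)+
  then show ?thesis by (simp add: localize_def)
qed

lemma finsum_smult_fr:
  assumes "c \<in> {..<d::nat} \<rightarrow> carrier R" "x \<in> {..<d} \<rightarrow> carrier M"
  shows "finsum Loc (\<lambda>k. S.fr (c k) i \<odot>\<^bsub>Loc\<^esub> fr (x k) j) {..<d}
    = fr (finsum M (\<lambda>k. c k \<odot>\<^bsub>M\<^esub> x k) {..<d}) (i + j)"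
proof -
  interpret L: abelian_monoid Loc by (rule Loc_abelian_monoid)
  have "finsum Loc (\<lambda>k. S.fr (c k) i \<odot>\<^bsub>Loc\<^esub> fr (x k) j) {..<d}
      = finsum Loc (\<lambda>k. fr (c k \<odot>\<^bsub>M\<^esub> x k) (i + j)) {..<d}"
    using assms by (intro L.finsum_cong') (auto simp: smult_fr Pi_iff intro!: fr_closed)
  also have "\<dots> = fr (finsum M (\<lambda>k. c k \<odot>\<^bsub>M\<^esub> x k) {..<d}) (i + j)"
    using assms by (intro finsum_fr) (auto simp: Pi_iff)
  finally show ?thesis .
qed

lemma pow_bound_family:
  assumes "\<And>k. k < (d::nat) \<Longrightarrow> \<exists>l::nat. f [^] l \<otimes> c k = \<zero>" "c \<in> {..<d} \<rightarrow> carrier R"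
  shows "\<exists>l::nat. \<forall>k<d. f [^] l \<otimes> c k = \<zero>"
  using assms
proof (induction d)
  case (Suc d)
  have "\<exists>l::nat. \<forall>k<d. f [^] l \<otimes> c k = \<zero>"
    using Suc.prems by (intro Suc.IH) auto
  moreover have "\<exists>m::nat. f [^] m \<otimes> c d = \<zero>" using Suc.prems(1)[of d] by simp
  ultimately obtain l m :: nat where l: "\<forall>k<d. f [^] l \<otimes> c k = \<zero>" "f [^] m \<otimes> c d = \<zero>"
    by blast
  have "f [^] (l + m) \<otimes> c k = \<zero>" if "k < Suc d" for k
  proof -
    have ck: "c k \<in> carrier R" using Suc.prems that by auto
    have "f [^] (l + m) \<otimes> c k = f [^] l \<otimes> (f [^] m \<otimes> c k)" "f [^] (l + m) \<otimes> c k = f [^] m \<otimes> (f [^] l \<otimes> c k)"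
      using ck by (simp_all add: R.nat_pow_mult[symmetric] R.m_ac)
    moreover have "f [^] m \<otimes> c k = \<zero> \<or> f [^] l \<otimes> c k = \<zero>"
      using l that by (cases "k = d") (auto simp: less_Suc_eq)
    ultimately show ?thesis by (metis R.nat_pow_closed R.r_null f_closed)
  qed
  then show ?case by blast
qed simp

text \<open>A basis of the localization can be written with one common denominator. That denominator
  is a unit there, so the numerators alone again form a basis.\<close>

lemma free_imp_loc_basis:
  assumes "free_of_rank (localize R (self_alg R) f) Loc d"
  shows "\<exists>e. loc_basis R M f d e"
proof -
  interpret L: abelian_monoid Loc by (rule Loc_abelian_monoid)
  obtain e where e: "e \<in> {..<d} \<rightarrow> carrier Loc"
    and "\<forall>x\<in>carrier Loc. \<exists>!c. c \<in> {..<d} \<rightarrow>\<^sub>E carrier S.Loc \<and>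
        x = finsum Loc (\<lambda>i. c i \<odot>\<^bsub>Loc\<^esub> e i) {..<d}"
    using assms unfolding free_of_rank_def by (elim bexE) (rule that)
  note basis = bspec[OF this(2)]
  obtain E N where E: "E \<in> {..<d} \<rightarrow> carrier M" "\<And>k. k < d \<Longrightarrow> e k = fr (E k) N"
    using common_denom_family[OF e] by blast
  have sum: "finsum Loc (\<lambda>k. c k \<odot>\<^bsub>Loc\<^esub> e k) {..<d} = fr (finsum M (\<lambda>k. C k \<odot>\<^bsub>M\<^esub> E k) {..<d}) (m + N)"
    if C: "C \<in> {..<d} \<rightarrow> carrier R" "\<And>k. k < d \<Longrightarrow> c k = S.fr (C k) m" for c C m
  proof -
    have "finsum Loc (\<lambda>k. c k \<odot>\<^bsub>Loc\<^esub> e k) {..<d} = finsum Loc (\<lambda>k. S.fr (C k) m \<odot>\<^bsub>Loc\<^esub> fr (E k) N) {..<d}"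
      using C E by (intro L.finsum_cong') (auto simp: Pi_iff smult_fr intro!: fr_closed)
    then show ?thesis using finsum_smult_fr[OF C(1) E(1)] by simp
  qed
  have "\<exists>l::nat. \<exists>c\<in>{..<d} \<rightarrow> carrier R. f [^] l \<odot>\<^bsub>M\<^esub> x = finsum M (\<lambda>i. c i \<odot>\<^bsub>M\<^esub> E i) {..<d}"
    if x: "x \<in> carrier M" for x
  proof -
    obtain c where c: "c \<in> {..<d} \<rightarrow>\<^sub>E carrier S.Loc" "fr x 0 = finsum Loc (\<lambda>i. c i \<odot>\<^bsub>Loc\<^esub> e i) {..<d}"
      using ex1_implies_ex[OF basis[OF fr_closed[OF x, of 0]]] by (elim exE conjE) (rule that)
    have "c \<in> {..<d} \<rightarrow> carrier S.Loc" using c by auto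
    then obtain C m where C: "C \<in> {..<d} \<rightarrow> carrier R" "\<And>k. k < d \<Longrightarrow> c k = S.fr (C k) m"
      using S.common_denom_family[of c d] by auto
    have "fr x 0 = fr (finsum M (\<lambda>k. C k \<odot>\<^bsub>M\<^esub> E k) {..<d}) (m + N)" using c(2) sum[OF C] by simp
    moreover have "finsum M (\<lambda>k. C k \<odot>\<^bsub>M\<^esub> E k) {..<d} \<in> carrier M"
      using C E by (intro M.finsum_closed) (auto simp: Pi_iff)
    ultimately obtain l :: nat where
      "f [^] (l + (m + N)) \<odot>\<^bsub>M\<^esub> x = f [^] l \<odot>\<^bsub>M\<^esub> finsum M (\<lambda>k. C k \<odot>\<^bsub>M\<^esub> E k) {..<d}"
      using x by (auto simp: fr_eq_iff)
    also have "\<dots> = finsum M (\<lambda>k. (f [^] l \<otimes> C k) \<odot>\<^bsub>M\<^esub> E k) {..<d}"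
      using C(1) E(1) by (intro finsum_smult_distr) auto
    finally have "f [^] (l + (m + N)) \<odot>\<^bsub>M\<^esub> x = finsum M (\<lambda>k. (f [^] l \<otimes> C k) \<odot>\<^bsub>M\<^esub> E k) {..<d}" .
    moreover have "(\<lambda>k. f [^] l \<otimes> C k) \<in> {..<d} \<rightarrow> carrier R" using C by (auto simp: Pi_iff)
    ultimately show ?thesis by (intro exI bexI)
  qed
  moreover have "\<exists>l::nat. \<forall>i<d. f [^] l \<otimes> c i = \<zero>"
    if c: "c \<in> {..<d} \<rightarrow> carrier R" and z: "finsum M (\<lambda>i. c i \<odot>\<^bsub>M\<^esub> E i) {..<d} = \<zero>\<^bsub>M\<^esub>" for c
  proof -
    \<comment> \<open>Two expansions of zero, compared by uniqueness. Uniqueness holds among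
      functions that are \<open>undefined\<close> outside \<open>{..<d}\<close>, hence the
      restrictions.\<close>
    define u where "u = (\<lambda>k\<in>{..<d}. S.fr (c k) 0)"
    define v where "v = (\<lambda>k\<in>{..<d}. S.fr \<zero> 0)"
    have uv: "u \<in> {..<d} \<rightarrow>\<^sub>E carrier S.Loc" "v \<in> {..<d} \<rightarrow>\<^sub>E carrier S.Loc"
      using c by (auto simp: u_def v_def Pi_iff intro!: S.fr_closed)
    have zu: "finsum Loc (\<lambda>k. u k \<odot>\<^bsub>Loc\<^esub> e k) {..<d} = \<zero>\<^bsub>Loc\<^esub>"
      using sum[of c u 0] c z by (simp add: u_def Loc_zero[of N])
    have "finsum M (\<lambda>k. \<zero> \<odot>\<^bsub>M\<^esub> E k) {..<d} = \<zero>\<^bsub>M\<^esub>"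
      using E by (intro M.add.finprod_one_eqI) (auto simp: Pi_iff)
    then have zv: "finsum Loc (\<lambda>k. v k \<odot>\<^bsub>Loc\<^esub> e k) {..<d} = \<zero>\<^bsub>Loc\<^esub>"
      using sum[of "\<lambda>_. \<zero>" v 0] by (simp add: v_def Loc_zero[of N])
    have "u = v"
      by (rule ex1_eqD[OF basis[OF L.zero_closed], of u v]) (use uv zu zv in simp_all)
    have "S.fr (c k) 0 = S.fr \<zero> 0" if "k < d" for k
    proof -
      have "u k = S.fr (c k) 0" "v k = S.fr \<zero> 0" using that by (simp_all add: u_def v_def)
      with \<open>u = v\<close> show ?thesis by simp
    qed
    then have "\<exists>l::nat. f [^] l \<otimes> c k = \<zero>" if "k < d" for k
      using that c S.fr_eq_iff[of "c k" \<zero> 0 0] by (auto simp: Pi_iff)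
    then show ?thesis using c by (intro pow_bound_family)
  qed
  ultimately show ?thesis using E(1) by (intro exI[of _ E] loc_basisI)
qed

lemma loc_basis_imp_free:
  assumes "loc_basis R M f d e"
  shows "free_of_rank (localize R (self_alg R) f) Loc d"
proof -
  interpret L: abelian_monoid Loc by (rule Loc_abelian_monoid)
  have e: "e \<in> {..<d} \<rightarrow> carrier M" using assms by (simp add: loc_basis_def)
  define E where "E k = fr (e k) 0" for k
  have E: "E \<in> {..<d} \<rightarrow> carrier Loc" using e by (auto simp: E_def Pi_iff intro!: fr_closed)
  have sum: "finsum Loc (\<lambda>k. c k \<odot>\<^bsub>Loc\<^esub> E k) {..<d} = fr (finsum M (\<lambda>k. C k \<odot>\<^bsub>M\<^esub> e k) {..<d}) m"
    if C: "C \<in> {..<d} \<rightarrow> carrier R" "\<And>k. k < d \<Longrightarrow> c k = S.fr (C k) m" for c C m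
  proof -
    have "finsum Loc (\<lambda>k. c k \<odot>\<^bsub>Loc\<^esub> E k) {..<d} = finsum Loc (\<lambda>k. S.fr (C k) m \<odot>\<^bsub>Loc\<^esub> fr (e k) 0) {..<d}"
      using C e by (intro L.finsum_cong') (auto simp: E_def Pi_iff smult_fr intro!: fr_closed)
    then show ?thesis using finsum_smult_fr[OF C(1) e] by simp
  qed
  have indep: "\<exists>l::nat. \<forall>i<d. f [^] l \<otimes> c i = \<zero>"
    if "c \<in> {..<d} \<rightarrow> carrier R" "finsum M (\<lambda>i. c i \<odot>\<^bsub>M\<^esub> e i) {..<d} = \<zero>\<^bsub>M\<^esub>" for c
    using loc_basis_indep[OF assms that] .
  have "\<exists>!c. c \<in> {..<d} \<rightarrow>\<^sub>E carrier S.Loc \<and> X = finsum Loc (\<lambda>i. c i \<odot>\<^bsub>Loc\<^esub> E i) {..<d}"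
    if X: "X \<in> carrier Loc" for X
  proof (rule ex_ex1I)
    obtain x i where x: "x \<in> carrier M" "X = fr x i" using X by (auto simp: Loc_carrier)
    obtain l :: nat and c where c: "c \<in> {..<d} \<rightarrow> carrier R" "f [^] l \<odot>\<^bsub>M\<^esub> x = finsum M (\<lambda>i. c i \<odot>\<^bsub>M\<^esub> e i) {..<d}"
      using loc_basis_span[OF assms x(1)] by (elim exE bexE) (rule that)
    let ?c = "\<lambda>k\<in>{..<d}. S.fr (c k) (i + l)"
    have "X = finsum Loc (\<lambda>k. ?c k \<odot>\<^bsub>Loc\<^esub> E k) {..<d}"
      using sum[OF c(1), of ?c "i + l"] c(2) fr_expand[OF x(1), of l i] x(2) by simp
    moreover have "?c \<in> {..<d} \<rightarrow>\<^sub>E carrier S.Loc" using c by (auto simp: Pi_iff intro!: S.fr_closed)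
    ultimately show "\<exists>c. c \<in> {..<d} \<rightarrow>\<^sub>E carrier S.Loc \<and> X = finsum Loc (\<lambda>i. c i \<odot>\<^bsub>Loc\<^esub> E i) {..<d}"
      by (intro exI conjI)
  next
    fix b c assume b: "b \<in> {..<d} \<rightarrow>\<^sub>E carrier S.Loc \<and> X = finsum Loc (\<lambda>i. b i \<odot>\<^bsub>Loc\<^esub> E i) {..<d}"
      and c: "c \<in> {..<d} \<rightarrow>\<^sub>E carrier S.Loc \<and> X = finsum Loc (\<lambda>i. c i \<odot>\<^bsub>Loc\<^esub> E i) {..<d}"
    have "b \<in> {..<d} \<rightarrow> carrier S.Loc" "c \<in> {..<d} \<rightarrow> carrier S.Loc" using b c by auto
    then obtain B m C k where B: "B \<in> {..<d} \<rightarrow> carrier R" "\<And>i. i < d \<Longrightarrow> b i = S.fr (B i) m"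
      and C: "C \<in> {..<d} \<rightarrow> carrier R" "\<And>i. i < d \<Longrightarrow> c i = S.fr (C i) k"
      using S.common_denom_family[of b d] S.common_denom_family[of c d] by auto
    let ?sB = "finsum M (\<lambda>k. B k \<odot>\<^bsub>M\<^esub> e k) {..<d}" and ?sC = "finsum M (\<lambda>k. C k \<odot>\<^bsub>M\<^esub> e k) {..<d}"
    have s: "?sB \<in> carrier M" "?sC \<in> carrier M"
      using B C e by (auto intro!: M.finsum_closed simp: Pi_iff)
    have "fr ?sB m = fr ?sC k" using sum[OF B] sum[OF C] b c by simp
    then obtain l :: nat where l: "f [^] (l + k) \<odot>\<^bsub>M\<^esub> ?sB = f [^] (l + m) \<odot>\<^bsub>M\<^esub> ?sC"
      using s by (auto simp: fr_eq_iff)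
    \<comment> \<open>The two expansions of \<open>X\<close> are brought to one denominator and
      multiplied by \<open>f^l\<close>; \<open>?w\<close> is the coefficient family of their
      difference, which is a relation in \<open>M\<close> itself.\<close>
    let ?w = "\<lambda>i. f [^] (l + k) \<otimes> B i \<oplus> (\<ominus> (f [^] (l + m))) \<otimes> C i"
    have w: "?w \<in> {..<d} \<rightarrow> carrier R" using B C by (auto simp: Pi_iff)
    have "finsum M (\<lambda>i. ?w i \<odot>\<^bsub>M\<^esub> e i) {..<d}
        = f [^] (l + k) \<odot>\<^bsub>M\<^esub> ?sB \<oplus>\<^bsub>M\<^esub> (\<ominus> (f [^] (l + m))) \<odot>\<^bsub>M\<^esub> ?sC"
      using B(1) C(1) e by (subst finsum_smult_add) (auto simp: Pi_iff finsum_smult_distr)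
    also have "\<dots> = \<zero>\<^bsub>M\<^esub>" using s by (simp add: l smult_l_minus M.r_neg)
    finally obtain j :: nat where j: "\<forall>i<d. f [^] j \<otimes> ?w i = \<zero>"
      using indep[OF w] by blast
    have "b i = c i" if i: "i < d" for i
    proof -
      have cl: "B i \<in> carrier R" "C i \<in> carrier R" using B C i by auto
      have "f [^] j \<otimes> ?w i = f [^] (j + l + k) \<otimes> B i \<ominus> f [^] (j + l + m) \<otimes> C i"
        using cl by (simp add: R.r_distr a_minus_def R.l_minus R.r_minus R.m_assoc[symmetric] R.nat_pow_mult add.assoc)
      then have "f [^] (j + l + k) \<otimes> B i \<ominus> f [^] (j + l + m) \<otimes> C i = \<zero>" using j i by simp
      then have "f [^] (j + l + k) \<otimes> B i = f [^] (j + l + m) \<otimes> C i"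
        using cl by (subst (asm) R.minus_eq_zero_iff) auto
      then show "b i = c i"
        using B C i cl S.fr_eq_iff[of "B i" "C i" m k] by auto
    qed
    then show "b = c" using b c by (intro PiE_ext[of b "{..<d}" _ c]) auto
  qed
  then show ?thesis unfolding free_of_rank_def using E by (intro bexI[of _ E] ballI)
qed

end

lemma locally_free_iff:
  assumes "module B M"
  shows "locally_free_of_rank B M d \<longleftrightarrow>
    (\<forall>P. primeideal P B \<longrightarrow> (\<exists>f\<in>carrier B - P. \<exists>e. loc_basis B M f d e))"
proof -
  have "free_of_rank (localize B (self_alg B) f) (localize B M f) d \<longleftrightarrow> (\<exists>e. loc_basis B M f d e)"
    if "f \<in> carrier B" for f
  proof -
    interpret localization B M f
      using assms that by (simp add: localization_def localization_axioms_def)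
    show ?thesis using free_imp_loc_basis loc_basis_imp_free by blast
  qed
  then show ?thesis unfolding locally_free_of_rank_def by (metis DiffE)
qed

section \<open>The Hilbert functor in terms of ideals\<close>

context module
begin

text \<open>The preimage in \<open>M\<close> of the localization of \<open>N\<close> at
  \<open>T\<close>. Working with this submodule avoids forming the localized module.\<close>

definition sat :: "'a set \<Rightarrow> 'c set \<Rightarrow> 'c set" where
  "sat T N = {x \<in> carrier M. \<exists>s\<in>T. s \<odot>\<^bsub>M\<^esub> x \<in> N}"

text \<open>With \<open>C\<close> the whole ring this is the span of the \<open>e i\<close>; with
  \<open>C\<close> a prime ideal it is a part of the span that vanishes in the fibre at that
  prime.\<close>

definition lin :: "nat \<Rightarrow> (nat \<Rightarrow> 'c) \<Rightarrow> 'a set \<Rightarrow> 'c set" where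
  "lin d e C = {finsum M (\<lambda>i. c i \<odot>\<^bsub>M\<^esub> e i) {..<d} | c. c \<in> {..<d} \<rightarrow> C}"

definition mult_closed :: "'a set \<Rightarrow> bool" where
  "mult_closed T \<longleftrightarrow> T \<subseteq> carrier R \<and> \<one> \<in> T \<and> (\<forall>s\<in>T. \<forall>t\<in>T. s \<otimes> t \<in> T)"

lemma sat_mono: "N \<subseteq> K \<Longrightarrow> sat T N \<subseteq> sat T K"
  by (auto simp: sat_def)

lemma sat_submodule:
  assumes T: "mult_closed T" and N: "submodule N R M"
  shows "submodule (sat T N) R M"
proof (rule submoduleI)
  have Tc: "T \<subseteq> carrier R" using T by (simp add: mult_closed_def)
  note NE = submoduleE[OF N]
  show "sat T N \<subseteq> carrier M" by (auto simp: sat_def)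
  show "\<zero>\<^bsub>M\<^esub> \<in> sat T N"
    using T submodule_zero[OF N] by (auto simp: sat_def mult_closed_def intro!: bexI[of _ \<one>])
  show "\<ominus>\<^bsub>M\<^esub> x \<in> sat T N" if "x \<in> sat T N" for x
    using that NE(3) Tc by (auto simp: sat_def subset_eq smult_r_minus intro!: bexI)
  show "x \<oplus>\<^bsub>M\<^esub> y \<in> sat T N" if mem: "x \<in> sat T N" "y \<in> sat T N" for x y
  proof -
    obtain s t where st: "s \<in> T" "s \<odot>\<^bsub>M\<^esub> x \<in> N" "t \<in> T" "t \<odot>\<^bsub>M\<^esub> y \<in> N"
      using mem unfolding sat_def by blast
    have c: "s \<in> carrier R" "t \<in> carrier R" "x \<in> carrier M" "y \<in> carrier M"
      using st mem Tc by (auto simp: sat_def)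
    have "(s \<otimes> t) \<odot>\<^bsub>M\<^esub> (x \<oplus>\<^bsub>M\<^esub> y) = t \<odot>\<^bsub>M\<^esub> (s \<odot>\<^bsub>M\<^esub> x) \<oplus>\<^bsub>M\<^esub> s \<odot>\<^bsub>M\<^esub> (t \<odot>\<^bsub>M\<^esub> y)"
      using c by (simp add: smult_r_distr smult_assoc1[symmetric] R.m_comm)
    then have "(s \<otimes> t) \<odot>\<^bsub>M\<^esub> (x \<oplus>\<^bsub>M\<^esub> y) \<in> N" using st c NE(4,5) by auto
    then show ?thesis using T st c by (auto simp: sat_def mult_closed_def)
  qed
  show "a \<odot>\<^bsub>M\<^esub> x \<in> sat T N" if mem: "a \<in> carrier R" "x \<in> sat T N" for a x
  proof -
    obtain s where s: "s \<in> T" "s \<odot>\<^bsub>M\<^esub> x \<in> N" using mem(2) unfolding sat_def by blast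
    have c: "s \<in> carrier R" "x \<in> carrier M" using s mem Tc by (auto simp: sat_def)
    have "s \<odot>\<^bsub>M\<^esub> (a \<odot>\<^bsub>M\<^esub> x) = a \<odot>\<^bsub>M\<^esub> (s \<odot>\<^bsub>M\<^esub> x)"
      using c mem by (simp add: smult_assoc1[symmetric] R.m_comm)
    then show ?thesis using s c mem NE(4) by (auto simp: sat_def intro!: bexI[of _ s])
  qed
qed

lemma sat_superset: "mult_closed T \<Longrightarrow> N \<subseteq> carrier M \<Longrightarrow> N \<subseteq> sat T N"
  by (auto simp: sat_def mult_closed_def intro!: bexI[of _ \<one>])

lemma sat_sat:
  assumes T: "mult_closed T" and N: "submodule N R M" and x: "x \<in> sat T (sat T N)"
  shows "x \<in> sat T N"
proof -
  obtain s t where st: "x \<in> carrier M" "s \<in> T" "t \<in> T" "t \<odot>\<^bsub>M\<^esub> (s \<odot>\<^bsub>M\<^esub> x) \<in> N"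
    using x by (auto simp: sat_def)
  then have "(t \<otimes> s) \<odot>\<^bsub>M\<^esub> x \<in> N" using T by (auto simp: mult_closed_def smult_assoc1 subset_eq)
  then show ?thesis using st T by (auto simp: sat_def mult_closed_def)
qed

text \<open>The product of the finitely many denominators serves all elements of \<open>F\<close> at
  once.\<close>

lemma sat_finite:
  assumes T: "mult_closed T" and N: "submodule N R M" and F: "finite F" "F \<subseteq> sat T N"
  shows "\<exists>s\<in>T. \<forall>x\<in>F. s \<odot>\<^bsub>M\<^esub> x \<in> N"
  using F
proof (induction F rule: finite_induct)
  case empty then show ?case using T by (auto simp: mult_closed_def)
next
  case (insert x F)
  then obtain s t where st: "s \<in> T" "\<And>y. y \<in> F \<Longrightarrow> s \<odot>\<^bsub>M\<^esub> y \<in> N" "t \<in> T" "t \<odot>\<^bsub>M\<^esub> x \<in> N"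
    by (auto simp: sat_def)
  have Tc: "T \<subseteq> carrier R" using T by (simp add: mult_closed_def)
  have c: "s \<in> carrier R" "t \<in> carrier R" "x \<in> carrier M" "\<And>y. y \<in> F \<Longrightarrow> y \<in> carrier M"
    using st Tc insert.prems by (auto simp: sat_def)
  have "(s \<otimes> t) \<odot>\<^bsub>M\<^esub> y \<in> N" if "y \<in> insert x F" for y
  proof (cases "y = x")
    case True
    then show ?thesis using c st submoduleE(4)[OF N] by (simp add: smult_assoc1)
  next
    case False
    then have "y \<in> F" using that by simp
    then have "t \<odot>\<^bsub>M\<^esub> (s \<odot>\<^bsub>M\<^esub> y) \<in> N" using c st submoduleE(4)[OF N] by simp
    then show ?thesis using c \<open>y \<in> F\<close> by (simp add: smult_assoc1[symmetric] R.m_comm)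
  qed
  then show ?case using T st by (intro bexI[of _ "s \<otimes> t"]) (auto simp: mult_closed_def)
qed

lemma mult_closed_powers: "f \<in> carrier R \<Longrightarrow> mult_closed (range (\<lambda>l::nat. f [^] l))"
  by (auto simp: mult_closed_def R.nat_pow_mult intro!: range_eqI[of _ _ "0::nat"])

lemma mult_closed_prime: "primeideal Q R \<Longrightarrow> mult_closed (carrier R - Q)"
proof -
  assume "primeideal Q R"
  then interpret primeideal Q R .
  show ?thesis using I_prime one_imp_carrier I_notcarr by (auto simp: mult_closed_def)
qed

lemma lin_I: "c \<in> {..<d} \<rightarrow> C \<Longrightarrow> finsum M (\<lambda>i. c i \<odot>\<^bsub>M\<^esub> e i) {..<d} \<in> lin d e C"
  by (auto simp: lin_def)

lemma lin_submodule:
  assumes C: "ideal C R" and e: "e \<in> {..<d} \<rightarrow> carrier M"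
  shows "submodule (lin d e C) R M"
proof -
  interpret C: ideal C R by fact
  have cl: "c \<in> {..<d} \<rightarrow> carrier R" if "c \<in> {..<d} \<rightarrow> C" for c using that C.Icarr by (auto simp: Pi_iff)
  have smult: "a \<odot>\<^bsub>M\<^esub> x \<in> lin d e C" if a: "a \<in> carrier R" "x \<in> lin d e C" for a x
  proof -
    obtain c where c: "c \<in> {..<d} \<rightarrow> C" "x = finsum M (\<lambda>i. c i \<odot>\<^bsub>M\<^esub> e i) {..<d}"
      using a by (auto simp: lin_def)
    have "a \<odot>\<^bsub>M\<^esub> x = finsum M (\<lambda>i. (a \<otimes> c i) \<odot>\<^bsub>M\<^esub> e i) {..<d}"
      unfolding c(2) using a cl[OF c(1)] e by (rule_tac finsum_smult_distr)
    moreover have "(\<lambda>i. a \<otimes> c i) \<in> {..<d} \<rightarrow> C" using c a C.I_l_closed by auto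
    ultimately show ?thesis by (simp add: lin_I)
  qed
  have carr: "lin d e C \<subseteq> carrier M"
    using cl e by (auto simp: lin_def Pi_iff intro!: M.finsum_closed)
  show ?thesis
  proof (rule submoduleI)
    have "(\<Oplus>\<^bsub>M\<^esub>i\<in>{..<d}. \<zero> \<odot>\<^bsub>M\<^esub> e i) = \<zero>\<^bsub>M\<^esub>"
      using e by (intro M.add.finprod_one_eqI) (auto simp: Pi_iff)
    then show "\<zero>\<^bsub>M\<^esub> \<in> lin d e C"
      unfolding lin_def by (intro CollectI exI[of _ "\<lambda>_. \<zero>"]) auto
    fix x assume x: "x \<in> lin d e C"
    have "\<ominus>\<^bsub>M\<^esub> x = (\<ominus> \<one>) \<odot>\<^bsub>M\<^esub> x" using x carr by (simp add: smult_l_minus subset_eq)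
    then show "\<ominus>\<^bsub>M\<^esub> x \<in> lin d e C" using smult x by simp
    fix y assume y: "y \<in> lin d e C"
    obtain c b where c: "c \<in> {..<d} \<rightarrow> C" "x = finsum M (\<lambda>i. c i \<odot>\<^bsub>M\<^esub> e i) {..<d}"
      and b: "b \<in> {..<d} \<rightarrow> C" "y = finsum M (\<lambda>i. b i \<odot>\<^bsub>M\<^esub> e i) {..<d}"
      using x y by (auto simp: lin_def)
    have "x \<oplus>\<^bsub>M\<^esub> y = finsum M (\<lambda>i. (c i \<oplus> b i) \<odot>\<^bsub>M\<^esub> e i) {..<d}"
      unfolding c(2) b(2) using cl[OF c(1)] cl[OF b(1)] e by (rule finsum_smult_add[symmetric])
    moreover have "(\<lambda>i. c i \<oplus> b i) \<in> {..<d} \<rightarrow> C" using c b by auto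
    ultimately show "x \<oplus>\<^bsub>M\<^esub> y \<in> lin d e C" by (simp add: lin_I)
  qed (use carr smult in auto)
qed

lemma delta_sum:
  assumes j: "j < (d::nat)" and a: "a \<in> carrier R" and e: "e \<in> {..<d} \<rightarrow> carrier M"
  shows "finsum M (\<lambda>i. (if i = j then a else \<zero>) \<odot>\<^bsub>M\<^esub> e i) {..<d} = a \<odot>\<^bsub>M\<^esub> e j"
proof -
  have "finsum M (\<lambda>i. (if i = j then a else \<zero>) \<odot>\<^bsub>M\<^esub> e i) {..<d}
      = finsum M (\<lambda>i. if j = i then a \<odot>\<^bsub>M\<^esub> e i else \<zero>\<^bsub>M\<^esub>) {..<d}"
    using a e by (intro M.finsum_cong') (auto simp: Pi_iff)
  also have "\<dots> = a \<odot>\<^bsub>M\<^esub> e j" using j a e by (intro M.finsum_singleton) (auto simp: Pi_iff)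
  finally show ?thesis .
qed

lemma lin_mem:
  assumes C: "ideal C R" and a: "a \<in> C" and j: "j < (d::nat)" and e: "e \<in> {..<d} \<rightarrow> carrier M"
  shows "a \<odot>\<^bsub>M\<^esub> e j \<in> lin d e C"
proof -
  interpret C: ideal C R by fact
  have "finsum M (\<lambda>i. (if i = j then a else \<zero>) \<odot>\<^bsub>M\<^esub> e i) {..<d} \<in> lin d e C"
    using a by (intro lin_I) auto
  then show ?thesis using delta_sum[OF j _ e, of a] a C.Icarr by simp
qed

lemma lin_subset:
  assumes N: "submodule N R M" and e: "e \<in> {..<d} \<rightarrow> N" and C: "C \<subseteq> carrier R"
  shows "lin d e C \<subseteq> N"
proof
  fix x assume "x \<in> lin d e C"
  then obtain c where "c \<in> {..<d} \<rightarrow> C" "x = finsum M (\<lambda>i. c i \<odot>\<^bsub>M\<^esub> e i) {..<d}"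
    by (auto simp: lin_def)
  then show "x \<in> N"
    using submoduleE(4)[OF N] e C by (auto intro!: submodule_finsum[OF N] simp: Pi_iff subset_eq)
qed

lemma lincomb_finsum:
  assumes "finite E" "b \<in> E \<rightarrow> {..<d::nat} \<rightarrow> carrier R" "e \<in> {..<d} \<rightarrow> carrier M"
  shows "finsum M (\<lambda>i. finsum R (\<lambda>\<gamma>. b \<gamma> i) E \<odot>\<^bsub>M\<^esub> e i) {..<d}
    = finsum M (\<lambda>\<gamma>. finsum M (\<lambda>i. b \<gamma> i \<odot>\<^bsub>M\<^esub> e i) {..<d}) E"
  using assms(1,2)
proof (induction E rule: finite_induct)
  case empty
  then show ?case using assms(3) by (auto intro!: M.add.finprod_one_eqI simp: Pi_iff)
next
  case (insert x E)
  have cl: "b x \<in> {..<d} \<rightarrow> carrier R" "(\<lambda>i. finsum R (\<lambda>\<gamma>. b \<gamma> i) E) \<in> {..<d} \<rightarrow> carrier R"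
    using insert by (auto intro!: R.finsum_closed simp: Pi_iff)
  have cm: "(\<lambda>\<gamma>. finsum M (\<lambda>i. b \<gamma> i \<odot>\<^bsub>M\<^esub> e i) {..<d}) \<in> insert x E \<rightarrow> carrier M"
    using insert.prems assms(3) by (auto intro!: M.finsum_closed simp: Pi_iff)
  have "finsum M (\<lambda>i. finsum R (\<lambda>\<gamma>. b \<gamma> i) (insert x E) \<odot>\<^bsub>M\<^esub> e i) {..<d}
      = finsum M (\<lambda>i. (b x i \<oplus> finsum R (\<lambda>\<gamma>. b \<gamma> i) E) \<odot>\<^bsub>M\<^esub> e i) {..<d}"
    using insert.prems insert.hyps assms(3) cl by (intro M.finsum_cong') (auto simp: Pi_iff)
  also have "\<dots> = finsum M (\<lambda>i. b x i \<odot>\<^bsub>M\<^esub> e i) {..<d}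
      \<oplus>\<^bsub>M\<^esub> finsum M (\<lambda>\<gamma>. finsum M (\<lambda>i. b \<gamma> i \<odot>\<^bsub>M\<^esub> e i) {..<d}) E"
    using insert.IH insert.prems by (subst finsum_smult_add[OF cl assms(3)]) auto
  also have "\<dots> = finsum M (\<lambda>\<gamma>. finsum M (\<lambda>i. b \<gamma> i \<odot>\<^bsub>M\<^esub> e i) {..<d}) (insert x E)"
    using insert.hyps cm by (intro M.finsum_insert[symmetric]) auto
  finally show ?case .
qed

end

context mpoly_ring
begin

text \<open>\<open>loc_basis\<close> for the quotient by \<open>I\<close>, pulled back to
  polynomials: equality in the quotient becomes equality up to an element of \<open>I\<close>. This
  allows base change to be discussed inside polynomial rings.\<close>

definition ibasis :: "((nat \<Rightarrow> nat) \<Rightarrow> 'a) set \<Rightarrow> 'a \<Rightarrow> nat \<Rightarrow> (nat \<Rightarrow> (nat \<Rightarrow> nat) \<Rightarrow> 'a) \<Rightarrow> bool" where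
  "ibasis I f d e \<longleftrightarrow> e \<in> {..<d} \<rightarrow> carrier P \<and>
     carrier P \<subseteq> P.sat (range (\<lambda>l::nat. f [^] l)) (P.lin d e (carrier R) <+>\<^bsub>P\<^esub> I) \<and>
     (\<forall>c\<in>{..<d} \<rightarrow> carrier R. finsum P (\<lambda>i. c i \<odot>\<^bsub>P\<^esub> e i) {..<d} \<in> I \<longrightarrow>
        (\<exists>l::nat. \<forall>i<d. f [^] l \<otimes> c i = \<zero>))"

definition hilb_ideal :: "nat \<Rightarrow> ((nat \<Rightarrow> nat) \<Rightarrow> 'a) set \<Rightarrow> bool" where
  "hilb_ideal d I \<longleftrightarrow> ideal I P \<and>
     (\<forall>Q. primeideal Q R \<longrightarrow> (\<exists>f\<in>carrier R - Q. \<exists>e. ibasis I f d e))"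

lemma ibasis_closed: "ibasis I f d e \<Longrightarrow> e \<in> {..<d} \<rightarrow> carrier P"
  unfolding ibasis_def by (elim conjE)

lemma ibasis_span: "ibasis I f d e \<Longrightarrow>
    carrier P \<subseteq> P.sat (range (\<lambda>l::nat. f [^] l)) (P.lin d e (carrier R) <+>\<^bsub>P\<^esub> I)"
  unfolding ibasis_def by (elim conjE)

lemma ibasis_indep: "ibasis I f d e \<Longrightarrow> c \<in> {..<d} \<rightarrow> carrier R \<Longrightarrow>
    finsum P (\<lambda>i. c i \<odot>\<^bsub>P\<^esub> e i) {..<d} \<in> I \<Longrightarrow> \<exists>l::nat. \<forall>i<d. f [^] l \<otimes> c i = \<zero>"
  unfolding ibasis_def by (elim conjE) (drule (1) bspec, erule mp)

lemma ibasisI: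
  assumes "e \<in> {..<d} \<rightarrow> carrier P"
    and "carrier P \<subseteq> P.sat (range (\<lambda>l::nat. f [^] l)) (P.lin d e (carrier R) <+>\<^bsub>P\<^esub> I)"
    and "\<And>c. c \<in> {..<d} \<rightarrow> carrier R \<Longrightarrow> finsum P (\<lambda>i. c i \<odot>\<^bsub>P\<^esub> e i) {..<d} \<in> I \<Longrightarrow>
       \<exists>l::nat. \<forall>i<d. f [^] l \<otimes> c i = \<zero>"
  shows "ibasis I f d e"
  unfolding ibasis_def using assms by (intro conjI ballI impI)

end

section \<open>Surjections from a polynomial ring\<close>

locale mpoly_surj = mpoly_ring R n + Q: algebra R Q
  for R :: "('a, 'l) ring_scheme" (structure) and n and Q :: "('a, 'q) module" +
  fixes \<phi>
  assumes hom: "\<phi> \<in> alg_hom R P Q" and surj: "\<phi> ` carrier P = carrier Q"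
begin

lemma \<phi>_ring_hom: "\<phi> \<in> ring_hom P Q" and \<phi>_ext: "\<phi> \<in> extensional (carrier P)"
  and \<phi>_smult: "\<And>a x. a \<in> carrier R \<Longrightarrow> x \<in> carrier P \<Longrightarrow> \<phi> (a \<odot>\<^bsub>P\<^esub> x) = a \<odot>\<^bsub>Q\<^esub> \<phi> x"
  using hom by (auto simp: alg_hom_def)

sublocale \<phi>: ring_hom_cring P Q \<phi>
  by (rule ring_hom_cring.intro[OF P.M_cring Q.M_cring]) (simp add: ring_hom_cring_axioms_def \<phi>_ring_hom)

abbreviation "K \<equiv> a_kernel P Q \<phi>"

lemma kernel_ideal: "ideal K P"
  by (rule ring_hom_ring.kernel_is_ideal) (rule ring_hom_ringI2[OF P.ring_axioms Q.ring_axioms \<phi>_ring_hom])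

lemma kernel_iff: "x \<in> K \<longleftrightarrow> x \<in> carrier P \<and> \<phi> x = \<zero>\<^bsub>Q\<^esub>"
  unfolding a_kernel_def' by simp

lemma \<phi>_eq_iff: "x \<in> carrier P \<Longrightarrow> y \<in> carrier P \<Longrightarrow> \<phi> x = \<phi> y \<longleftrightarrow> x \<ominus>\<^bsub>P\<^esub> y \<in> K"
  by (simp add: kernel_iff a_minus_def) (simp add: Q.M.minus_eq_zero_iff[unfolded a_minus_def])

lemma \<phi>_lincomb:
  assumes "c \<in> {..<d::nat} \<rightarrow> carrier R" "e \<in> {..<d} \<rightarrow> carrier P"
  shows "\<phi> (finsum P (\<lambda>i. c i \<odot>\<^bsub>P\<^esub> e i) {..<d}) = finsum Q (\<lambda>i. c i \<odot>\<^bsub>Q\<^esub> \<phi> (e i)) {..<d}"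
proof -
  have "\<phi> (finsum P (\<lambda>i. c i \<odot>\<^bsub>P\<^esub> e i) {..<d}) = finsum Q (\<phi> \<circ> (\<lambda>i. c i \<odot>\<^bsub>P\<^esub> e i)) {..<d}"
    using assms by (intro \<phi>.hom_finsum) (auto simp: Pi_iff)
  also have "\<dots> = finsum Q (\<lambda>i. c i \<odot>\<^bsub>Q\<^esub> \<phi> (e i)) {..<d}"
    using assms by (intro Q.finsum_cong') (auto simp: Pi_iff \<phi>_smult)
  finally show ?thesis .
qed

lemma span_iff:
  assumes f: "f \<in> carrier R" and e: "e \<in> {..<d} \<rightarrow> carrier P" and p: "p \<in> carrier P"
  shows "p \<in> P.sat (range (\<lambda>l::nat. f [^] l)) (P.lin d e (carrier R) <+>\<^bsub>P\<^esub> K) \<longleftrightarrow>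
    (\<exists>l::nat. \<exists>c\<in>{..<d} \<rightarrow> carrier R. f [^] l \<odot>\<^bsub>Q\<^esub> \<phi> p = finsum Q (\<lambda>i. c i \<odot>\<^bsub>Q\<^esub> \<phi> (e i)) {..<d})"
    (is "?L \<longleftrightarrow> ?R")
proof -
  have cl: "finsum P (\<lambda>i. c i \<odot>\<^bsub>P\<^esub> e i) {..<d} \<in> carrier P" if "c \<in> {..<d} \<rightarrow> carrier R" for c
    using that e by (auto intro!: P.finsum_closed simp: Pi_iff)
  show ?thesis
  proof
    assume ?L
    then obtain l :: nat and c k where c: "c \<in> {..<d} \<rightarrow> carrier R" "k \<in> K"
      "f [^] l \<odot>\<^bsub>P\<^esub> p = finsum P (\<lambda>i. c i \<odot>\<^bsub>P\<^esub> e i) {..<d} \<oplus>\<^bsub>P\<^esub> k"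
      by (auto simp: P.sat_def P.set_add_iff P.lin_def)
    then have "\<phi> (f [^] l \<odot>\<^bsub>P\<^esub> p) = \<phi> (finsum P (\<lambda>i. c i \<odot>\<^bsub>P\<^esub> e i) {..<d})"
      using cl[OF c(1)] by (simp add: kernel_iff del: \<phi>.hom_finsum)
    then have "f [^] l \<odot>\<^bsub>Q\<^esub> \<phi> p = finsum Q (\<lambda>i. c i \<odot>\<^bsub>Q\<^esub> \<phi> (e i)) {..<d}"
      using \<phi>_lincomb[OF c(1) e] f p by (simp add: \<phi>_smult del: \<phi>.hom_finsum)
    then show ?R using c(1) by (intro exI bexI)
  next
    assume ?R
    then obtain l :: nat and c where c: "c \<in> {..<d} \<rightarrow> carrier R"
      "f [^] l \<odot>\<^bsub>Q\<^esub> \<phi> p = finsum Q (\<lambda>i. c i \<odot>\<^bsub>Q\<^esub> \<phi> (e i)) {..<d}" by (elim exE bexE) (rule that)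
    let ?s = "finsum P (\<lambda>i. c i \<odot>\<^bsub>P\<^esub> e i) {..<d}"
    have "\<phi> (f [^] l \<odot>\<^bsub>P\<^esub> p) = \<phi> ?s"
      unfolding \<phi>_lincomb[OF c(1) e] using c f p by (simp add: \<phi>_smult)
    then have k: "f [^] l \<odot>\<^bsub>P\<^esub> p \<ominus>\<^bsub>P\<^esub> ?s \<in> K" using cl[OF c(1)] f p by (subst (asm) \<phi>_eq_iff) auto
    have "f [^] l \<odot>\<^bsub>P\<^esub> p = ?s \<oplus>\<^bsub>P\<^esub> (f [^] l \<odot>\<^bsub>P\<^esub> p \<ominus>\<^bsub>P\<^esub> ?s)"
      using cl[OF c(1)] f p by (simp add: a_minus_def P.M.a_lcomm P.M.r_neg)
    then have "f [^] l \<odot>\<^bsub>P\<^esub> p \<in> P.lin d e (carrier R) <+>\<^bsub>P\<^esub> K"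
      unfolding P.set_add_iff using k P.lin_I[OF c(1)] by (intro bexI)
    then show ?L using p unfolding P.sat_def by blast
  qed
qed

lemma loc_basis_iff:
  assumes f: "f \<in> carrier R" and e: "e \<in> {..<d} \<rightarrow> carrier P"
  shows "loc_basis R Q f d (\<lambda>i. \<phi> (e i)) \<longleftrightarrow> ibasis K f d e"
proof
  assume *: "loc_basis R Q f d (\<lambda>i. \<phi> (e i))"
  show "ibasis K f d e"
  proof (rule ibasisI[OF e])
    show "carrier P \<subseteq> P.sat (range (\<lambda>l::nat. f [^] l)) (P.lin d e (carrier R) <+>\<^bsub>P\<^esub> K)"
      using loc_basis_span[OF *] span_iff[OF f e] by auto
    fix c assume c: "c \<in> {..<d} \<rightarrow> carrier R" "finsum P (\<lambda>i. c i \<odot>\<^bsub>P\<^esub> e i) {..<d} \<in> K"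
    then have "finsum Q (\<lambda>i. c i \<odot>\<^bsub>Q\<^esub> \<phi> (e i)) {..<d} = \<zero>\<^bsub>Q\<^esub>"
      using \<phi>_lincomb[OF c(1) e] by (simp add: kernel_iff del: \<phi>.hom_finsum)
    then show "\<exists>l::nat. \<forall>i<d. f [^] l \<otimes> c i = \<zero>" by (rule loc_basis_indep[OF * c(1)])
  qed
next
  assume *: "ibasis K f d e"
  show "loc_basis R Q f d (\<lambda>i. \<phi> (e i))"
  proof (rule loc_basisI)
    show "(\<lambda>i. \<phi> (e i)) \<in> {..<d} \<rightarrow> carrier Q" using e by auto
    fix x assume "x \<in> carrier Q"
    then obtain p where p: "p \<in> carrier P" "x = \<phi> p" using surj by auto
    show "\<exists>l::nat. \<exists>c\<in>{..<d} \<rightarrow> carrier R. f [^] l \<odot>\<^bsub>Q\<^esub> x = finsum Q (\<lambda>i. c i \<odot>\<^bsub>Q\<^esub> \<phi> (e i)) {..<d}"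
      unfolding p(2) using ibasis_span[OF *] span_iff[OF f e p(1)] p(1) by blast
  next
    fix c assume c: "c \<in> {..<d} \<rightarrow> carrier R" "finsum Q (\<lambda>i. c i \<odot>\<^bsub>Q\<^esub> \<phi> (e i)) {..<d} = \<zero>\<^bsub>Q\<^esub>"
    have "finsum P (\<lambda>i. c i \<odot>\<^bsub>P\<^esub> e i) {..<d} \<in> carrier P"
      using c e by (auto intro!: P.finsum_closed simp: Pi_iff)
    then have "finsum P (\<lambda>i. c i \<odot>\<^bsub>P\<^esub> e i) {..<d} \<in> K"
      using \<phi>_lincomb[OF c(1) e] c(2) by (simp add: kernel_iff del: \<phi>.hom_finsum)
    then show "\<exists>l::nat. \<forall>i<d. f [^] l \<otimes> c i = \<zero>" by (rule ibasis_indep[OF * c(1)])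
  qed
qed

text \<open>Only the values of the basis in \<open>Q\<close> matter, so arbitrary preimages under
  the surjection serve.\<close>

lemma loc_basis_lift: "loc_basis R Q f d e' \<Longrightarrow> \<exists>e. e \<in> {..<d} \<rightarrow> carrier P \<and> loc_basis R Q f d (\<lambda>i. \<phi> (e i))"
proof -
  assume *: "loc_basis R Q f d e'"
  define e where "e i = inv_into (carrier P) \<phi> (e' i)" for i
  have e': "e' i \<in> \<phi> ` carrier P" if "i < d" for i using loc_basis_closed[OF *] that surj by auto
  have e: "e i \<in> carrier P" "\<phi> (e i) = e' i" if "i < d" for i
    using inv_into_into[OF e'[OF that]] f_inv_into_f[OF e'[OF that]] by (auto simp: e_def)
  have cong: "finsum Q (\<lambda>i. c i \<odot>\<^bsub>Q\<^esub> \<phi> (e i)) {..<d} = finsum Q (\<lambda>i. c i \<odot>\<^bsub>Q\<^esub> e' i) {..<d}"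
    if "c \<in> {..<d} \<rightarrow> carrier R" for c
    using that loc_basis_closed[OF *] e by (intro Q.finsum_cong') (auto simp: Pi_iff)
  have "loc_basis R Q f d (\<lambda>i. \<phi> (e i))"
  proof (rule loc_basisI)
    show "(\<lambda>i. \<phi> (e i)) \<in> {..<d} \<rightarrow> carrier Q" using e(1) by (simp add: Pi_iff)
    fix x assume x: "x \<in> carrier Q"
    obtain l :: nat and c where c: "c \<in> {..<d} \<rightarrow> carrier R"
      "f [^] l \<odot>\<^bsub>Q\<^esub> x = finsum Q (\<lambda>i. c i \<odot>\<^bsub>Q\<^esub> e' i) {..<d}"
      using loc_basis_span[OF * x] by (elim exE bexE) (rule that)
    then have "f [^] l \<odot>\<^bsub>Q\<^esub> x = finsum Q (\<lambda>i. c i \<odot>\<^bsub>Q\<^esub> \<phi> (e i)) {..<d}" using cong by simp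
    with c(1) show "\<exists>l::nat. \<exists>c\<in>{..<d} \<rightarrow> carrier R.
        f [^] l \<odot>\<^bsub>Q\<^esub> x = finsum Q (\<lambda>i. c i \<odot>\<^bsub>Q\<^esub> \<phi> (e i)) {..<d}" by (intro exI bexI)
  next
    fix c assume c: "c \<in> {..<d} \<rightarrow> carrier R" "finsum Q (\<lambda>i. c i \<odot>\<^bsub>Q\<^esub> \<phi> (e i)) {..<d} = \<zero>\<^bsub>Q\<^esub>"
    show "\<exists>l::nat. \<forall>i<d. f [^] l \<otimes> c i = \<zero>"
      using c cong by (intro loc_basis_indep[OF *]) simp_all
  qed
  then show ?thesis using e by (intro exI[of _ e] conjI) auto
qed

theorem locally_free_iff_hilb_ideal: "locally_free_of_rank R Q d \<longleftrightarrow> hilb_ideal d K"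
proof -
  have "(\<exists>e. loc_basis R Q f d e) \<longleftrightarrow> (\<exists>e. ibasis K f d e)" if "f \<in> carrier R" for f
    using loc_basis_lift[of f d] loc_basis_iff[OF that] ibasis_closed by metis
  then show ?thesis
    unfolding locally_free_iff[OF Q.module] hilb_ideal_def using kernel_ideal by (metis DiffE)
qed

lemma mpoly_span_surj_iff:
  "\<phi> ` mpoly_span n R \<Delta> = carrier Q \<longleftrightarrow> mpoly_span n R \<Delta> <+>\<^bsub>P\<^esub> K = carrier P"
proof
  have sc: "mpoly_span n R \<Delta> \<subseteq> carrier P" by (auto simp: mpoly_span_iff)
  have kc: "K \<subseteq> carrier P" by (auto simp: kernel_iff)
  show "mpoly_span n R \<Delta> <+>\<^bsub>P\<^esub> K = carrier P" if *: "\<phi> ` mpoly_span n R \<Delta> = carrier Q"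
  proof
    show "mpoly_span n R \<Delta> <+>\<^bsub>P\<^esub> K \<subseteq> carrier P" using sc kc by (auto simp: P.set_add_iff subset_eq)
    show "carrier P \<subseteq> mpoly_span n R \<Delta> <+>\<^bsub>P\<^esub> K"
    proof
      fix p assume p: "p \<in> carrier P"
      then have "\<phi> p \<in> \<phi> ` mpoly_span n R \<Delta>" unfolding * by simp
      then obtain u where u: "u \<in> mpoly_span n R \<Delta>" "\<phi> p = \<phi> u" by auto
      then have "p \<ominus>\<^bsub>P\<^esub> u \<in> K" using \<phi>_eq_iff[of p u] p sc by auto
      moreover have "p = u \<oplus>\<^bsub>P\<^esub> (p \<ominus>\<^bsub>P\<^esub> u)"
        using p u sc by (simp add: a_minus_def P.M.a_lcomm P.M.r_neg subset_eq)
      ultimately show "p \<in> mpoly_span n R \<Delta> <+>\<^bsub>P\<^esub> K" unfolding P.set_add_iff using u by blast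
    qed
  qed
  show "\<phi> ` mpoly_span n R \<Delta> = carrier Q" if *: "mpoly_span n R \<Delta> <+>\<^bsub>P\<^esub> K = carrier P"
  proof
    show "\<phi> ` mpoly_span n R \<Delta> \<subseteq> carrier Q" using sc by auto
    show "carrier Q \<subseteq> \<phi> ` mpoly_span n R \<Delta>"
    proof
      fix x assume "x \<in> carrier Q"
      then obtain p where p: "p \<in> carrier P" "x = \<phi> p" using surj by auto
      then obtain u k where "u \<in> mpoly_span n R \<Delta>" "k \<in> K" "p = u \<oplus>\<^bsub>P\<^esub> k"
        unfolding *[symmetric] P.set_add_iff by auto
      then have "x = \<phi> u" using p sc by (auto simp: kernel_iff subset_eq)
      then show "x \<in> \<phi> ` mpoly_span n R \<Delta>" using \<open>u \<in> mpoly_span n R \<Delta>\<close> by auto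
    qed
  qed
qed

end

lemma hilb_family_iff:
  fixes B :: "('u, 'l) ring_scheme" and Q :: "('u, 'q) module"
  assumes "cring B"
  shows "hilb_family n d B Q \<phi> \<longleftrightarrow> mpoly_surj B n Q \<phi> \<and>
     mpoly_ring.hilb_ideal B n d (a_kernel (mpoly n B) Q \<phi>)"
proof -
  have "mpoly_surj B n Q \<phi> \<longleftrightarrow> algebra B Q \<and> \<phi> \<in> alg_hom B (mpoly n B) Q \<and> \<phi> ` carrier (mpoly n B) = carrier Q"
    using assms by (auto simp: mpoly_surj_def mpoly_surj_axioms_def mpoly_ring_def)
  then show ?thesis unfolding hilb_family_def using mpoly_surj.locally_free_iff_hilb_ideal[of B n Q \<phi> d] by argo
qed

text \<open>Every ideal is the kernel of its canonical projection, and the target of the projection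
  has the type over which \<open>Hilb\<close> quantifies. Membership in the functor thus becomes a
  condition on the ideal alone.\<close>

lemma (in mpoly_ring) quotient_surj:
  assumes I: "ideal I P"
  defines "\<phi> \<equiv> \<lambda>p\<in>carrier P. I +>\<^bsub>P\<^esub> p"
  shows "mpoly_surj R n (quot_alg P I) \<phi>" "a_kernel P (quot_alg P I) \<phi> = I"
proof -
  interpret I: algebra_ideal R P I by (intro algebra_ideal.intro P.algebra_axioms I)
  have "\<phi> \<in> ring_hom P (quot_alg P I)"
    using I.quot_alg_ring_hom by (simp add: \<phi>_def ring_hom_def Pi_iff)
  then have "\<phi> \<in> alg_hom R P (quot_alg P I)"
    by (auto simp: alg_hom_def \<phi>_def I.quot_alg_smult)
  moreover have "\<phi> ` carrier P = carrier (quot_alg P I)"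
    by (auto simp: \<phi>_def I.quot_alg_carrier)
  ultimately show "mpoly_surj R n (quot_alg P I) \<phi>"
    using I.quot_alg_algebra mpoly_ring_axioms by (simp add: mpoly_surj_def mpoly_surj_axioms_def)
  have iff: "I +>\<^bsub>P\<^esub> p = I \<longleftrightarrow> p \<in> I" if "p \<in> carrier P" for p
    using I.I.rcos_const_imp_mem[OF that] P.a_rcos_zero[OF I] by blast
  have "a_kernel P (quot_alg P I) \<phi> = {p \<in> carrier P. I +>\<^bsub>P\<^esub> p = I}"
    unfolding a_kernel_def' by (rule Collect_cong) (simp add: \<phi>_def quot_alg_def FactRing_def cong: conj_cong)
  also have "\<dots> = {p \<in> carrier P. p \<in> I}"
    by (rule Collect_cong) (use iff in blast)
  also have "\<dots> = I" using I.I.Icarr by blast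
  finally show "a_kernel P (quot_alg P I) \<phi> = I" .
qed

lemma Hilb_iff:
  fixes B :: "('u, 'u) module"
  assumes "cring B"
  shows "I \<in> fobj (Hilb n d) B \<longleftrightarrow> mpoly_ring.hilb_ideal B n d I" (is "_ \<longleftrightarrow> ?R")
proof -
  interpret mpoly_ring B n using assms by (simp add: mpoly_ring_def)
  have "?R \<longleftrightarrow> (\<exists>(Q :: ('u, 'u mpoly_ideal) module) \<phi>. I = a_kernel P Q \<phi> \<and> hilb_family n d B Q \<phi>)"
  proof
    assume R: ?R
    then have "ideal I P" by (simp add: hilb_ideal_def)
    note q = quotient_surj[OF this]
    show "\<exists>(Q :: ('u, 'u mpoly_ideal) module) \<phi>. I = a_kernel P Q \<phi> \<and> hilb_family n d B Q \<phi>"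
      by (intro exI[of _ "quot_alg P I"] exI[of _ "\<lambda>p\<in>carrier P. I +>\<^bsub>P\<^esub> p"])
        (simp add: hilb_family_iff[OF assms] q R)
  next
    assume "\<exists>(Q :: ('u, 'u mpoly_ideal) module) \<phi>. I = a_kernel P Q \<phi> \<and> hilb_family n d B Q \<phi>"
    then show ?R unfolding hilb_family_iff[OF assms] by blast
  qed
  then show ?thesis by (simp add: Hilb_def)
qed

lemma Hilb_std_iff:
  fixes B :: "('u, 'u) module"
  assumes "cring B"
  shows "I \<in> fobj (Hilb_std n \<Delta>) B \<longleftrightarrow> mpoly_ring.hilb_ideal B n (card \<Delta>) I \<and>
    mpoly_span n B \<Delta> <+>\<^bsub>mpoly n B\<^esub> I = carrier (mpoly n B)" (is "_ \<longleftrightarrow> ?R")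
proof -
  interpret mpoly_ring B n using assms by (simp add: mpoly_ring_def)
  have "?R \<longleftrightarrow> (\<exists>(Q :: ('u, 'u mpoly_ideal) module) \<phi>. I = a_kernel P Q \<phi> \<and>
      hilb_family n (card \<Delta>) B Q \<phi> \<and> \<phi> ` mpoly_span n B \<Delta> = carrier Q)"
  proof
    assume R: ?R
    then have "ideal I P" by (simp add: hilb_ideal_def)
    note q = quotient_surj[OF this]
    show "\<exists>(Q :: ('u, 'u mpoly_ideal) module) \<phi>. I = a_kernel P Q \<phi> \<and>
      hilb_family n (card \<Delta>) B Q \<phi> \<and> \<phi> ` mpoly_span n B \<Delta> = carrier Q"
      using q R mpoly_surj.mpoly_span_surj_iff[OF q(1), of \<Delta>]
      by (intro exI[of _ "quot_alg P I"] exI[of _ "\<lambda>p\<in>carrier P. I +>\<^bsub>P\<^esub> p"])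
        (simp add: hilb_family_iff[OF assms])
  next
    assume "\<exists>(Q :: ('u, 'u mpoly_ideal) module) \<phi>. I = a_kernel P Q \<phi> \<and>
      hilb_family n (card \<Delta>) B Q \<phi> \<and> \<phi> ` mpoly_span n B \<Delta> = carrier Q"
    then obtain Q :: "('u, 'u mpoly_ideal) module" and \<phi> where I: "I = a_kernel P Q \<phi>"
      and Q: "mpoly_surj B n Q \<phi>" "hilb_ideal (card \<Delta>) (a_kernel P Q \<phi>)"
      and span: "\<phi> ` mpoly_span n B \<Delta> = carrier Q"
      unfolding hilb_family_iff[OF assms] by (elim exE conjE) (rule that)
    show ?R using Q(2) span unfolding I mpoly_surj.mpoly_span_surj_iff[OF Q(1)] by (rule conjI)
  qed
  then show ?thesis by (simp add: Hilb_std_def)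
qed

section \<open>Base change of local bases\<close>

context cring
begin

lemma pow_zero_mono:
  assumes "f \<in> carrier R" "x \<in> carrier R" "f [^] (l::nat) \<otimes> x = \<zero>" "l \<le> l'"
  shows "f [^] l' \<otimes> x = \<zero>"
proof -
  have "f [^] l' \<otimes> x = f [^] (l' - l) \<otimes> (f [^] l \<otimes> x)"
    using assms(1,2,4) by (simp add: m_assoc[symmetric] nat_pow_mult)
  then show ?thesis using assms by simp
qed

lemma pow_zero_uniform:
  assumes f: "f \<in> carrier R" and X: "\<And>j i. j < m \<Longrightarrow> i < d \<Longrightarrow> X j i \<in> carrier R"
    and ex: "\<And>j. j < m \<Longrightarrow> \<exists>l::nat. \<forall>i<d. f [^] l \<otimes> X j i = \<zero>"
  shows "\<exists>l::nat. \<forall>j<(m::nat). \<forall>i<(d::nat). f [^] l \<otimes> X j i = \<zero>"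
proof -
  define l where "l j = (SOME l::nat. \<forall>i<d. f [^] l \<otimes> X j i = \<zero>)" for j
  have l: "\<forall>i<d. f [^] l j \<otimes> X j i = \<zero>" if "j < m" for j
    unfolding l_def by (rule someI_ex[OF ex[OF that]])
  have "f [^] (\<Sum>j<m. l j) \<otimes> X j i = \<zero>" if "j < m" "i < d" for j i
  proof (rule pow_zero_mono[OF f X[OF that]])
    show "f [^] l j \<otimes> X j i = \<zero>" using l that by blast
    show "l j \<le> (\<Sum>j<m. l j)" using that by (intro member_le_sum) auto
  qed
  then show ?thesis by blast
qed

end

context mpoly_hom
begin

lemma cmap_finsum: "u \<in> J \<rightarrow> carrier B.P \<Longrightarrow> cmap (finsum B.P u J) = finsum A.P (\<lambda>j. cmap (u j)) J"
proof (induction J rule: infinite_finite_induct)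
  case (insert j J)
  then have "finsum A.P (\<lambda>j. cmap (u j)) (insert j J) = cmap (u j) \<oplus>\<^bsub>A.P\<^esub> finsum A.P (\<lambda>j. cmap (u j)) J"
    by (intro A.P.finsum_insert) (auto simp: Pi_iff)
  then show ?case using insert by (simp add: cmap_add B.P.finsum_closed Pi_iff)
qed (simp_all add: cmap_zero B.P.finsum_infinite A.P.finsum_infinite)

lemma cmap_lincomb:
  assumes "c \<in> {..<d::nat} \<rightarrow> carrier B" "e \<in> {..<d} \<rightarrow> carrier B.P"
  shows "cmap (finsum B.P (\<lambda>i. c i \<odot>\<^bsub>B.P\<^esub> e i) {..<d})
    = finsum A.P (\<lambda>i. g (c i) \<odot>\<^bsub>A.P\<^esub> cmap (e i)) {..<d}"
proof -
  have "cmap (finsum B.P (\<lambda>i. c i \<odot>\<^bsub>B.P\<^esub> e i) {..<d}) = finsum A.P (\<lambda>i. cmap (c i \<odot>\<^bsub>B.P\<^esub> e i)) {..<d}"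
    using assms by (intro cmap_finsum) (auto simp: Pi_iff)
  also have "\<dots> = finsum A.P (\<lambda>i. g (c i) \<odot>\<^bsub>A.P\<^esub> cmap (e i)) {..<d}"
    using assms by (intro A.P.finsum_cong') (auto simp: Pi_iff cmap_smult)
  finally show ?thesis .
qed

lemma g_pow: "f \<in> carrier B \<Longrightarrow> g (f [^]\<^bsub>B\<^esub> (l::nat)) = g f [^]\<^bsub>A\<^esub> l"
  by (induction l) auto

context
  fixes I f d e
  assumes I: "ideal I B.P" and f: "f \<in> carrier B" and basis: "B.ibasis I f d e"
begin

lemma e_closed: "e \<in> {..<d} \<rightarrow> carrier B.P"
  by (rule B.ibasis_closed[OF basis])

lemma I_sub: "submodule I B B.P"
  by (rule B.P.ideal_submodule[OF I])

lemma I_carr: "I \<subseteq> carrier B.P"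
  by (rule B.P.submoduleE(1)[OF I_sub])

lemma lin_I_sub: "submodule (B.P.lin d e (carrier B) <+>\<^bsub>B.P\<^esub> I) B B.P"
  by (intro B.P.submodule_set_add B.P.lin_submodule B.oneideal e_closed I_sub)

text \<open>Only monomials have to be expanded. They come from \<open>B\<close>, where an expansion
  exists, and \<open>cmap\<close> transports it.\<close>

lemma ibasis_extend_span:
  "carrier A.P \<subseteq> A.P.sat (range (\<lambda>l::nat. g f [^]\<^bsub>A\<^esub> l))
     (A.P.lin d (\<lambda>i. cmap (e i)) (carrier A) <+>\<^bsub>A.P\<^esub> extend I)"
proof -
  let ?N = "A.P.lin d (\<lambda>i. cmap (e i)) (carrier A) <+>\<^bsub>A.P\<^esub> extend I"
  have ce: "(\<lambda>i. cmap (e i)) \<in> {..<d} \<rightarrow> carrier A.P" using e_closed by (auto simp: Pi_iff)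
  have N: "submodule ?N A A.P"
    by (intro A.P.submodule_set_add A.P.lin_submodule A.oneideal ce extend_submodule I_carr)
  have "submodule (A.P.sat (range (\<lambda>l::nat. g f [^]\<^bsub>A\<^esub> l)) ?N) A A.P"
    using f by (intro A.P.sat_submodule A.P.mult_closed_powers N) simp
  then have "A.P.sat (range (\<lambda>l::nat. g f [^]\<^bsub>A\<^esub> l)) ?N = carrier A.P"
  proof (rule A.submodule_carrierI)
    fix x assume x: "x \<in> carrier (expos n)"
    have m: "B.mon \<one>\<^bsub>B\<^esub> x \<in> carrier B.P" "A.mon \<one>\<^bsub>A\<^esub> x \<in> carrier A.P" using x by auto
    obtain l :: nat and v where lv: "v = f [^]\<^bsub>B\<^esub> l \<odot>\<^bsub>B.P\<^esub> B.mon \<one>\<^bsub>B\<^esub> x" "v \<in> B.P.lin d e (carrier B) <+>\<^bsub>B.P\<^esub> I"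
      using B.ibasis_span[OF basis] m(1) unfolding B.P.sat_def by blast
    obtain y k where yk: "y \<in> B.P.lin d e (carrier B)" "k \<in> I" "v = y \<oplus>\<^bsub>B.P\<^esub> k"
      using lv(2) unfolding B.P.set_add_iff by blast
    obtain c where c: "c \<in> {..<d} \<rightarrow> carrier B" "y = finsum B.P (\<lambda>i. c i \<odot>\<^bsub>B.P\<^esub> e i) {..<d}"
      using yk(1) unfolding B.P.lin_def by blast
    have "y \<in> carrier B.P" unfolding c(2) using c(1) e_closed by (auto intro!: B.P.finsum_closed simp: Pi_iff)
    then have "cmap v = cmap y \<oplus>\<^bsub>A.P\<^esub> cmap k" unfolding yk(3) using yk(2) I_carr by (intro cmap_add) auto
    moreover have "cmap y \<in> A.P.lin d (\<lambda>i. cmap (e i)) (carrier A)"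
      unfolding c(2) cmap_lincomb[OF c(1) e_closed] using c(1) by (intro A.P.lin_I) auto
    moreover have "cmap v = g f [^]\<^bsub>A\<^esub> l \<odot>\<^bsub>A.P\<^esub> A.mon \<one>\<^bsub>A\<^esub> x"
      unfolding lv(1) using f m by (simp add: cmap_smult cmap_mon g_pow)
    ultimately have "g f [^]\<^bsub>A\<^esub> l \<odot>\<^bsub>A.P\<^esub> A.mon \<one>\<^bsub>A\<^esub> x \<in> ?N"
      unfolding A.P.set_add_iff using cmap_in_extend[OF I_carr yk(2)] by (intro bexI) auto
    then show "A.mon \<one>\<^bsub>A\<^esub> x \<in> A.P.sat (range (\<lambda>l::nat. g f [^]\<^bsub>A\<^esub> l)) ?N"
      using m(2) unfolding A.P.sat_def by blast
  qed
  then show ?thesis by simp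
qed

text \<open>The monomials in \<open>E\<close> are expanded in the basis with one common denominator
  \<open>f^L\<close>. The coordinates of every \<open>p\<close> supported in \<open>E\<close> are
  then given by formulas linear in the coefficients of \<open>p\<close>, and such formulas make
  sense after applying \<open>g\<close>.\<close>

lemma coord_exists:
  assumes E: "finite E" "E \<subseteq> carrier (expos n)"
  shows "\<exists>(L::nat) C. C \<in> E \<rightarrow> {..<d} \<rightarrow> carrier B \<and> (\<forall>p\<in>carrier B.P. B.supp p \<subseteq> E \<longrightarrow>
    (\<exists>k\<in>I. f [^]\<^bsub>B\<^esub> L \<odot>\<^bsub>B.P\<^esub> p
      = finsum B.P (\<lambda>i. finsum B (\<lambda>\<gamma>. p \<gamma> \<otimes>\<^bsub>B\<^esub> C \<gamma> i) E \<odot>\<^bsub>B.P\<^esub> e i) {..<d} \<oplus>\<^bsub>B.P\<^esub> k))"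
proof -
  let ?T = "range (\<lambda>l::nat. f [^]\<^bsub>B\<^esub> l)" and ?N = "B.P.lin d e (carrier B) <+>\<^bsub>B.P\<^esub> I"
  have bc: "basis_elt B \<gamma> \<in> carrier B.P" if "\<gamma> \<in> E" for \<gamma> using that E by (auto simp: B.basis_elt_mon)
  have "basis_elt B ` E \<subseteq> B.P.sat ?T ?N" using bc B.ibasis_span[OF basis] by blast
  then obtain s where s: "s \<in> ?T" "\<forall>x\<in>basis_elt B ` E. s \<odot>\<^bsub>B.P\<^esub> x \<in> ?N"
    using B.P.sat_finite[OF B.P.mult_closed_powers[OF f] lin_I_sub, of "basis_elt B ` E"] E(1) by blast
  obtain L :: nat where L: "s = f [^]\<^bsub>B\<^esub> L" using s(1) by blast
  have sc: "s \<in> carrier B" using L f by simp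
  \<comment> \<open>Coefficients and remainder are packed into a pair so that one use of
    \<open>bchoice\<close> selects both.\<close>
  have "\<forall>\<gamma>\<in>E. \<exists>ck. fst ck \<in> {..<d} \<rightarrow> carrier B \<and> snd ck \<in> I \<and>
      s \<odot>\<^bsub>B.P\<^esub> basis_elt B \<gamma> = finsum B.P (\<lambda>i. fst ck i \<odot>\<^bsub>B.P\<^esub> e i) {..<d} \<oplus>\<^bsub>B.P\<^esub> snd ck"
  proof
    fix \<gamma> assume "\<gamma> \<in> E"
    then obtain y k where yk: "y \<in> B.P.lin d e (carrier B)" "k \<in> I" "s \<odot>\<^bsub>B.P\<^esub> basis_elt B \<gamma> = y \<oplus>\<^bsub>B.P\<^esub> k"
      using s(2) unfolding B.P.set_add_iff by blast
    obtain c where c: "c \<in> {..<d} \<rightarrow> carrier B" "y = finsum B.P (\<lambda>i. c i \<odot>\<^bsub>B.P\<^esub> e i) {..<d}"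
      using yk(1) unfolding B.P.lin_def by blast
    show "\<exists>ck. fst ck \<in> {..<d} \<rightarrow> carrier B \<and> snd ck \<in> I \<and>
      s \<odot>\<^bsub>B.P\<^esub> basis_elt B \<gamma> = finsum B.P (\<lambda>i. fst ck i \<odot>\<^bsub>B.P\<^esub> e i) {..<d} \<oplus>\<^bsub>B.P\<^esub> snd ck"
      using yk c by (intro exI[of _ "(c, k)"]) simp
  qed
  from bchoice[OF this] obtain D where D: "\<forall>\<gamma>\<in>E. fst (D \<gamma>) \<in> {..<d} \<rightarrow> carrier B \<and> snd (D \<gamma>) \<in> I \<and>
      s \<odot>\<^bsub>B.P\<^esub> basis_elt B \<gamma> = finsum B.P (\<lambda>i. fst (D \<gamma>) i \<odot>\<^bsub>B.P\<^esub> e i) {..<d} \<oplus>\<^bsub>B.P\<^esub> snd (D \<gamma>)"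
    by (elim exE)
  define C where "C \<gamma> = fst (D \<gamma>)" for \<gamma>
  define k where "k \<gamma> = snd (D \<gamma>)" for \<gamma>
  have C: "C \<gamma> \<in> {..<d} \<rightarrow> carrier B" and k: "k \<gamma> \<in> I"
    and Ck: "s \<odot>\<^bsub>B.P\<^esub> basis_elt B \<gamma> = finsum B.P (\<lambda>i. C \<gamma> i \<odot>\<^bsub>B.P\<^esub> e i) {..<d} \<oplus>\<^bsub>B.P\<^esub> k \<gamma>"
    if "\<gamma> \<in> E" for \<gamma> using D that unfolding C_def k_def by blast+
  have "\<exists>k\<in>I. s \<odot>\<^bsub>B.P\<^esub> p
      = finsum B.P (\<lambda>i. finsum B (\<lambda>\<gamma>. p \<gamma> \<otimes>\<^bsub>B\<^esub> C \<gamma> i) E \<odot>\<^bsub>B.P\<^esub> e i) {..<d} \<oplus>\<^bsub>B.P\<^esub> k"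
    if p: "p \<in> carrier B.P" "B.supp p \<subseteq> E" for p
  proof (rule bexI)
    note pc = B.MA_coeff[OF p(1)]
    let ?l = "\<lambda>\<gamma>. finsum B.P (\<lambda>i. C \<gamma> i \<odot>\<^bsub>B.P\<^esub> e i) {..<d}"
    have lc: "?l \<gamma> \<in> carrier B.P" if "\<gamma> \<in> E" for \<gamma>
      using C[OF that] e_closed by (auto intro!: B.P.finsum_closed simp: Pi_iff)
    have kc: "k \<gamma> \<in> carrier B.P" if "\<gamma> \<in> E" for \<gamma> using k[OF that] I_carr by auto
    have "s \<odot>\<^bsub>B.P\<^esub> p = s \<odot>\<^bsub>B.P\<^esub> finsum B.P (\<lambda>\<gamma>. p \<gamma> \<odot>\<^bsub>B.P\<^esub> basis_elt B \<gamma>) E"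
      using B.MA_expand[OF p(1) E(1) p(2) E(2)] by simp
    also have "\<dots> = finsum B.P (\<lambda>\<gamma>. s \<odot>\<^bsub>B.P\<^esub> (p \<gamma> \<odot>\<^bsub>B.P\<^esub> basis_elt B \<gamma>)) E"
      using E sc bc pc by (intro B.P.finsum_smult_ldistr) (auto simp: Pi_iff)
    also have "\<dots> = finsum B.P (\<lambda>\<gamma>. (p \<gamma> \<odot>\<^bsub>B.P\<^esub> ?l \<gamma>) \<oplus>\<^bsub>B.P\<^esub> (p \<gamma> \<odot>\<^bsub>B.P\<^esub> k \<gamma>)) E"
    proof (rule B.P.finsum_cong')
      fix \<gamma> assume \<gamma>: "\<gamma> \<in> E"
      have "s \<odot>\<^bsub>B.P\<^esub> (p \<gamma> \<odot>\<^bsub>B.P\<^esub> basis_elt B \<gamma>) = p \<gamma> \<odot>\<^bsub>B.P\<^esub> (s \<odot>\<^bsub>B.P\<^esub> basis_elt B \<gamma>)"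
        using sc pc bc[OF \<gamma>] by (simp add: B.P.smult_assoc1[symmetric] B.m_comm)
      also have "\<dots> = (p \<gamma> \<odot>\<^bsub>B.P\<^esub> ?l \<gamma>) \<oplus>\<^bsub>B.P\<^esub> (p \<gamma> \<odot>\<^bsub>B.P\<^esub> k \<gamma>)"
        unfolding Ck[OF \<gamma>] using pc lc[OF \<gamma>] kc[OF \<gamma>] by (rule B.P.smult_r_distr)
      finally show "s \<odot>\<^bsub>B.P\<^esub> (p \<gamma> \<odot>\<^bsub>B.P\<^esub> basis_elt B \<gamma>) = (p \<gamma> \<odot>\<^bsub>B.P\<^esub> ?l \<gamma>) \<oplus>\<^bsub>B.P\<^esub> (p \<gamma> \<odot>\<^bsub>B.P\<^esub> k \<gamma>)" .
    qed (use pc lc kc in auto)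
    also have "\<dots> = finsum B.P (\<lambda>\<gamma>. p \<gamma> \<odot>\<^bsub>B.P\<^esub> ?l \<gamma>) E \<oplus>\<^bsub>B.P\<^esub> finsum B.P (\<lambda>\<gamma>. p \<gamma> \<odot>\<^bsub>B.P\<^esub> k \<gamma>) E"
      using pc lc kc by (intro B.P.finsum_addf) auto
    also have "finsum B.P (\<lambda>\<gamma>. p \<gamma> \<odot>\<^bsub>B.P\<^esub> ?l \<gamma>) E
        = finsum B.P (\<lambda>\<gamma>. finsum B.P (\<lambda>i. (p \<gamma> \<otimes>\<^bsub>B\<^esub> C \<gamma> i) \<odot>\<^bsub>B.P\<^esub> e i) {..<d}) E"
    proof (rule B.P.finsum_cong')
      fix \<gamma> assume \<gamma>: "\<gamma> \<in> E"
      show "p \<gamma> \<odot>\<^bsub>B.P\<^esub> ?l \<gamma> = finsum B.P (\<lambda>i. (p \<gamma> \<otimes>\<^bsub>B\<^esub> C \<gamma> i) \<odot>\<^bsub>B.P\<^esub> e i) {..<d}"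
        by (rule B.P.finsum_smult_distr[OF pc C[OF \<gamma>] e_closed])
    next
      show "(\<lambda>\<gamma>. finsum B.P (\<lambda>i. (p \<gamma> \<otimes>\<^bsub>B\<^esub> C \<gamma> i) \<odot>\<^bsub>B.P\<^esub> e i) {..<d}) \<in> E \<rightarrow> carrier B.P"
        using pc C e_closed by (auto intro!: B.P.finsum_closed simp: Pi_iff)
    qed simp
    also have "\<dots> = finsum B.P (\<lambda>i. finsum B (\<lambda>\<gamma>. p \<gamma> \<otimes>\<^bsub>B\<^esub> C \<gamma> i) E \<odot>\<^bsub>B.P\<^esub> e i) {..<d}"
      using pc C by (intro B.P.lincomb_finsum[symmetric] E(1) e_closed) (auto simp: Pi_iff)
    finally show "s \<odot>\<^bsub>B.P\<^esub> p = finsum B.P (\<lambda>i. finsum B (\<lambda>\<gamma>. p \<gamma> \<otimes>\<^bsub>B\<^esub> C \<gamma> i) E \<odot>\<^bsub>B.P\<^esub> e i) {..<d}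
        \<oplus>\<^bsub>B.P\<^esub> finsum B.P (\<lambda>\<gamma>. p \<gamma> \<odot>\<^bsub>B.P\<^esub> k \<gamma>) E" .
    show "finsum B.P (\<lambda>\<gamma>. p \<gamma> \<odot>\<^bsub>B.P\<^esub> k \<gamma>) E \<in> I"
      using pc k by (intro B.P.submodule_finsum[OF I_sub] Pi_I B.P.submoduleE(4)[OF I_sub])
  qed
  then show ?thesis unfolding L using C by (intro exI[of _ L] exI[of _ C] conjI ballI impI) auto
qed

text \<open>A relation over \<open>A\<close> reads \<open>\<Sum> c_i e_i = \<Sum> a_j w_j\<close>
  with every \<open>w_j\<close> in \<open>I\<close>. Up to powers of \<open>f\<close> the coordinate
  forms kill the \<open>w_j\<close> and send \<open>e_j\<close> to \<open>f^L\<close> times a unit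
  vector; applying them to the relation isolates each \<open>c_i\<close>.\<close>

lemma ibasis_extend_indep:
  assumes c: "c \<in> {..<d} \<rightarrow> carrier A"
    and mem: "finsum A.P (\<lambda>i. c i \<odot>\<^bsub>A.P\<^esub> cmap (e i)) {..<d} \<in> extend I"
  shows "\<exists>l::nat. \<forall>i<d. g f [^]\<^bsub>A\<^esub> l \<otimes>\<^bsub>A\<^esub> c i = \<zero>\<^bsub>A\<^esub>"
proof -
  obtain m a w where a: "a \<in> {..<m::nat} \<rightarrow> carrier A" and w: "w \<in> {..<m} \<rightarrow> I"
    and eq: "finsum A.P (\<lambda>i. c i \<odot>\<^bsub>A.P\<^esub> cmap (e i)) {..<d} = finsum A.P (\<lambda>j. a j \<odot>\<^bsub>A.P\<^esub> cmap (w j)) {..<m}"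
    using extend_rep[OF I_carr mem] by (elim exE conjE) (rule that)
  \<comment> \<open>All polynomials over \<open>B\<close> in the relation are supported in this
    finite set, so one family of coordinate forms handles them.\<close>
  define E where "E = (\<Union>i<d. B.supp (e i)) \<union> (\<Union>j<m. B.supp (w j))"
  have ec: "e i \<in> carrier B.P" if "i < d" for i using e_closed that by auto
  have wc: "w j \<in> carrier B.P" "w j \<in> I" if "j < m" for j using w I_carr that by auto
  have E: "finite E" "E \<subseteq> carrier (expos n)"
    unfolding E_def using ec wc(1) B.supp_finite B.supp_carrier by (blast intro!: finite_UN_I)+
  obtain L :: nat and C where C: "C \<in> E \<rightarrow> {..<d} \<rightarrow> carrier B"
    and coord: "\<forall>p\<in>carrier B.P. B.supp p \<subseteq> E \<longrightarrow>
    (\<exists>k\<in>I. f [^]\<^bsub>B\<^esub> L \<odot>\<^bsub>B.P\<^esub> p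
      = finsum B.P (\<lambda>i. finsum B (\<lambda>\<gamma>. p \<gamma> \<otimes>\<^bsub>B\<^esub> C \<gamma> i) E \<odot>\<^bsub>B.P\<^esub> e i) {..<d} \<oplus>\<^bsub>B.P\<^esub> k)"
    using coord_exists[OF E] by (elim exE conjE) (rule that)
  \<comment> \<open>The coordinate forms over \<open>B\<close>: the values
    \<open>\<Lambda> p i\<close> are coefficients that represent \<open>f^L p\<close> modulo
    \<open>I\<close>.\<close>
  define \<Lambda> where "\<Lambda> p i = finsum B (\<lambda>\<gamma>. p \<gamma> \<otimes>\<^bsub>B\<^esub> C \<gamma> i) E" for p i
  have \<Lambda>c: "\<Lambda> p i \<in> carrier B" if "p \<in> carrier B.P" "i < d" for p i
    unfolding \<Lambda>_def using B.MA_coeff[OF that(1)] C that(2) by (auto intro!: B.finsum_closed simp: Pi_iff)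
  let ?lc = "\<lambda>b. finsum B.P (\<lambda>i. b i \<odot>\<^bsub>B.P\<^esub> e i) {..<d}"
  have key: "\<exists>k\<in>I. f [^]\<^bsub>B\<^esub> L \<odot>\<^bsub>B.P\<^esub> p = ?lc (\<Lambda> p) \<oplus>\<^bsub>B.P\<^esub> k"
    if "p \<in> carrier B.P" "B.supp p \<subseteq> E" for p
    unfolding \<Lambda>_def using coord that by blast
  have lcc: "?lc b \<in> carrier B.P" if "b \<in> {..<d} \<rightarrow> carrier B" for b
    using that e_closed by (auto intro!: B.P.finsum_closed simp: Pi_iff)
  have fL: "f [^]\<^bsub>B\<^esub> L \<in> carrier B" using f by simp
  \<comment> \<open>Since \<open>w j\<close> lies in \<open>I\<close>, its coordinates represent an
    element of \<open>I\<close>, so independence over \<open>B\<close> annihilates them.\<close>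
  have "\<exists>l::nat. \<forall>i<d. f [^]\<^bsub>B\<^esub> l \<otimes>\<^bsub>B\<^esub> \<Lambda> (w j) i = \<zero>\<^bsub>B\<^esub>" if j: "j < m" for j
  proof (rule B.ibasis_indep[OF basis])
    show cl: "\<Lambda> (w j) \<in> {..<d} \<rightarrow> carrier B" using \<Lambda>c wc j by auto
    obtain k where k: "k \<in> I" "f [^]\<^bsub>B\<^esub> L \<odot>\<^bsub>B.P\<^esub> w j = ?lc (\<Lambda> (w j)) \<oplus>\<^bsub>B.P\<^esub> k"
      using key[of "w j"] wc j by (auto simp: E_def)
    have "?lc (\<Lambda> (w j)) = f [^]\<^bsub>B\<^esub> L \<odot>\<^bsub>B.P\<^esub> w j \<ominus>\<^bsub>B.P\<^esub> k"
      unfolding k(2) using lcc[OF cl] k(1) I_carr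
      by (simp add: a_minus_def B.P.M.a_assoc B.P.M.r_neg subset_eq)
    then show "?lc (\<Lambda> (w j)) \<in> I"
      using B.P.submodule_minus[OF I_sub B.P.submoduleE(4)[OF I_sub fL wc(2)[OF j]] k(1)] by simp
  qed
  then obtain l1 :: nat where l1: "\<forall>j<m. \<forall>i<d. f [^]\<^bsub>B\<^esub> l1 \<otimes>\<^bsub>B\<^esub> \<Lambda> (w j) i = \<zero>\<^bsub>B\<^esub>"
    using B.pow_zero_uniform[OF f, of m d "\<lambda>j. \<Lambda> (w j)"] \<Lambda>c wc by blast
  \<comment> \<open>Two coefficient families represent \<open>f^L e_j\<close> modulo
    \<open>I\<close>: the coordinates of \<open>e j\<close>, and \<open>f^L\<close> times the unit
    vector. Their difference \<open>X j\<close> is therefore annihilated by a power of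
    \<open>f\<close>.\<close>
  define X where "X j i = \<Lambda> (e j) i \<oplus>\<^bsub>B\<^esub> (if i = j then \<ominus>\<^bsub>B\<^esub> (f [^]\<^bsub>B\<^esub> L) else \<zero>\<^bsub>B\<^esub>)" for j i
  have Xc: "X j i \<in> carrier B" if "j < d" "i < d" for j i
    unfolding X_def using \<Lambda>c[OF ec[OF that(1)] that(2)] fL by simp
  have "\<exists>l::nat. \<forall>i<d. f [^]\<^bsub>B\<^esub> l \<otimes>\<^bsub>B\<^esub> X j i = \<zero>\<^bsub>B\<^esub>" if j: "j < d" for j
  proof (rule B.ibasis_indep[OF basis])
    show "X j \<in> {..<d} \<rightarrow> carrier B" using Xc j by auto
    have cl: "\<Lambda> (e j) \<in> {..<d} \<rightarrow> carrier B" using \<Lambda>c ec j by auto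
    obtain k where k: "k \<in> I" "f [^]\<^bsub>B\<^esub> L \<odot>\<^bsub>B.P\<^esub> e j = ?lc (\<Lambda> (e j)) \<oplus>\<^bsub>B.P\<^esub> k"
      using key[of "e j"] ec j by (auto simp: E_def)
    have "?lc (X j) = ?lc (\<Lambda> (e j)) \<oplus>\<^bsub>B.P\<^esub> ?lc (\<lambda>i. if i = j then \<ominus>\<^bsub>B\<^esub> (f [^]\<^bsub>B\<^esub> L) else \<zero>\<^bsub>B\<^esub>)"
      unfolding X_def using cl fL by (intro B.P.finsum_smult_add e_closed) auto
    also have "\<dots> = ?lc (\<Lambda> (e j)) \<oplus>\<^bsub>B.P\<^esub> \<ominus>\<^bsub>B.P\<^esub> (f [^]\<^bsub>B\<^esub> L \<odot>\<^bsub>B.P\<^esub> e j)"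
      using B.P.delta_sum[OF j _ e_closed, of "\<ominus>\<^bsub>B\<^esub> (f [^]\<^bsub>B\<^esub> L)"] fL ec[OF j]
      by (simp add: B.P.smult_l_minus)
    also have "\<dots> = \<ominus>\<^bsub>B.P\<^esub> k"
      unfolding k(2) using lcc[OF cl] k(1) I_carr
      by (simp add: B.P.M.minus_add B.P.M.a_assoc[symmetric] B.P.M.r_neg subset_eq)
    finally show "?lc (X j) \<in> I" using B.P.submoduleE(3)[OF I_sub k(1)] by simp
  qed
  then obtain l2 :: nat where l2: "\<forall>j<d. \<forall>i<d. f [^]\<^bsub>B\<^esub> l2 \<otimes>\<^bsub>B\<^esub> X j i = \<zero>\<^bsub>B\<^esub>"
    using B.pow_zero_uniform[OF f, of d d X] Xc by blast
  define l where "l = l1 + l2"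
  have fl: "f [^]\<^bsub>B\<^esub> l \<in> carrier B" using f by simp
  have lw: "f [^]\<^bsub>B\<^esub> l \<otimes>\<^bsub>B\<^esub> \<Lambda> (w j) i = \<zero>\<^bsub>B\<^esub>" if "j < m" "i < d" for i j
    using B.pow_zero_mono[OF f \<Lambda>c[OF wc(1)[OF that(1)] that(2)], of l1 l] l1 that by (simp add: l_def)
  have le: "f [^]\<^bsub>B\<^esub> l \<otimes>\<^bsub>B\<^esub> \<Lambda> (e j) i = (if i = j then f [^]\<^bsub>B\<^esub> l \<otimes>\<^bsub>B\<^esub> f [^]\<^bsub>B\<^esub> L else \<zero>\<^bsub>B\<^esub>)"
    if "j < d" "i < d" for i j
  proof -
    have "f [^]\<^bsub>B\<^esub> l \<otimes>\<^bsub>B\<^esub> X j i = \<zero>\<^bsub>B\<^esub>"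
      using B.pow_zero_mono[OF f Xc[OF that], of l2 l] l2 that by (simp add: l_def)
    then show ?thesis
      using \<Lambda>c[OF ec[OF that(1)] that(2)] fL fl
      by (cases "i = j") (auto simp: X_def B.r_distr B.r_minus B.minus_eq_zero_iff[unfolded a_minus_def])
  qed
  \<comment> \<open>The same forms over \<open>A\<close>, with the coefficients \<open>C\<close>
    mapped by \<open>g\<close>. They are \<open>A\<close>-linear and agree with
    \<open>\<Lambda>\<close> on polynomials that come from \<open>B\<close>.\<close>
  define \<Lambda>A where "\<Lambda>A v i = finsum A (\<lambda>\<gamma>. v \<gamma> \<otimes>\<^bsub>A\<^esub> g (C \<gamma> i)) E" for v i
  have gC: "g (C \<gamma> i) \<in> carrier A" if "\<gamma> \<in> E" "i < d" for \<gamma> i using C that by auto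
  have \<Lambda>Ac: "\<Lambda>A v i \<in> carrier A" if "v \<in> carrier A.P" "i < d" for v i
    unfolding \<Lambda>A_def using A.MA_coeff[OF that(1)] gC that(2) by (auto intro!: A.finsum_closed)
  have gL: "g (\<Lambda> p i) = \<Lambda>A (cmap p) i" if "p \<in> carrier B.P" "i < d" for p i
  proof -
    have "g (\<Lambda> p i) = finsum A (g \<circ> (\<lambda>\<gamma>. p \<gamma> \<otimes>\<^bsub>B\<^esub> C \<gamma> i)) E"
      unfolding \<Lambda>_def using B.MA_coeff[OF that(1)] C that(2) by (intro g.hom_finsum) (auto simp: Pi_iff)
    also have "\<dots> = \<Lambda>A (cmap p) i"
      unfolding \<Lambda>A_def using B.MA_coeff[OF that(1)] C that(2)
      by (intro A.finsum_cong') (auto simp: Pi_iff cmap_def)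
    finally show ?thesis .
  qed
  have \<Lambda>A_add: "\<Lambda>A (u \<oplus>\<^bsub>A.P\<^esub> v) i = \<Lambda>A u i \<oplus>\<^bsub>A\<^esub> \<Lambda>A v i"
    if "u \<in> carrier A.P" "v \<in> carrier A.P" "i < d" for u v i
  proof -
    have "\<Lambda>A (u \<oplus>\<^bsub>A.P\<^esub> v) i
        = finsum A (\<lambda>\<gamma>. (u \<gamma> \<otimes>\<^bsub>A\<^esub> g (C \<gamma> i)) \<oplus>\<^bsub>A\<^esub> (v \<gamma> \<otimes>\<^bsub>A\<^esub> g (C \<gamma> i))) E"
      unfolding \<Lambda>A_def A.MA_simps using A.MA_coeff[OF that(1)] A.MA_coeff[OF that(2)] gC that(3)
      by (intro A.finsum_cong') (auto simp: A.l_distr)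
    then show ?thesis
      unfolding \<Lambda>A_def using A.MA_coeff[OF that(1)] A.MA_coeff[OF that(2)] gC that(3)
      by (simp add: A.finsum_addf Pi_iff)
  qed
  have \<Lambda>A_smult: "\<Lambda>A (b \<odot>\<^bsub>A.P\<^esub> v) i = b \<otimes>\<^bsub>A\<^esub> \<Lambda>A v i"
    if "b \<in> carrier A" "v \<in> carrier A.P" "i < d" for b v i
  proof -
    have "b \<otimes>\<^bsub>A\<^esub> \<Lambda>A v i = finsum A (\<lambda>\<gamma>. b \<otimes>\<^bsub>A\<^esub> (v \<gamma> \<otimes>\<^bsub>A\<^esub> g (C \<gamma> i))) E"
      unfolding \<Lambda>A_def using A.MA_coeff[OF that(2)] gC that E by (intro A.finsum_rdistr) auto
    also have "\<dots> = \<Lambda>A (b \<odot>\<^bsub>A.P\<^esub> v) i"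
      unfolding \<Lambda>A_def A.MA_simps using A.MA_coeff[OF that(2)] gC that
      by (intro A.finsum_cong') (auto simp: A.m_assoc)
    finally show ?thesis by simp
  qed
  have \<Lambda>A_sum: "\<Lambda>A (finsum A.P (\<lambda>j. b j \<odot>\<^bsub>A.P\<^esub> v j) {..<r}) i = finsum A (\<lambda>j. b j \<otimes>\<^bsub>A\<^esub> \<Lambda>A (v j) i) {..<r}"
    if "b \<in> {..<r::nat} \<rightarrow> carrier A" "v \<in> {..<r} \<rightarrow> carrier A.P" "i < d" for b v r i
    using that(1,2)
  proof (induction r)
    case 0
    have "\<Lambda>A \<zero>\<^bsub>A.P\<^esub> i = \<zero>\<^bsub>A\<^esub>"
      unfolding \<Lambda>A_def A.MA_simps using gC \<open>i < d\<close> by (intro A.add.finprod_one_eqI) auto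
    then show ?case by simp
  next
    case (Suc r)
    have cl: "b r \<in> carrier A" "v r \<in> carrier A.P" "(\<lambda>j. b j \<odot>\<^bsub>A.P\<^esub> v j) \<in> {..<r} \<rightarrow> carrier A.P"
      "(\<lambda>j. b j \<otimes>\<^bsub>A\<^esub> \<Lambda>A (v j) i) \<in> {..<r} \<rightarrow> carrier A"
      using Suc.prems \<Lambda>Ac \<open>i < d\<close> by (auto simp: Pi_iff)
    have "finsum A.P (\<lambda>j. b j \<odot>\<^bsub>A.P\<^esub> v j) {..<Suc r}
        = b r \<odot>\<^bsub>A.P\<^esub> v r \<oplus>\<^bsub>A.P\<^esub> finsum A.P (\<lambda>j. b j \<odot>\<^bsub>A.P\<^esub> v j) {..<r}"
      unfolding lessThan_Suc using cl by (intro A.P.finsum_insert) auto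
    moreover have "finsum A (\<lambda>j. b j \<otimes>\<^bsub>A\<^esub> \<Lambda>A (v j) i) {..<Suc r}
        = b r \<otimes>\<^bsub>A\<^esub> \<Lambda>A (v r) i \<oplus>\<^bsub>A\<^esub> finsum A (\<lambda>j. b j \<otimes>\<^bsub>A\<^esub> \<Lambda>A (v j) i) {..<r}"
      unfolding lessThan_Suc using cl \<Lambda>Ac \<open>i < d\<close> by (intro A.finsum_insert) auto
    moreover have "finsum A.P (\<lambda>j. b j \<odot>\<^bsub>A.P\<^esub> v j) {..<r} \<in> carrier A.P"
      using cl(3) by (rule A.P.finsum_closed)
    ultimately show ?case using Suc cl \<open>i < d\<close> by (simp add: \<Lambda>A_add \<Lambda>A_smult Pi_iff)
  qed
  \<comment> \<open>The relation is evaluated by the \<open>i\<close>-th form: the side of the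
    \<open>w j\<close> vanishes, and the side of the \<open>e j\<close> collapses to
    \<open>c i\<close> times a power of \<open>g f\<close>.\<close>
  have "g f [^]\<^bsub>A\<^esub> (l + L) \<otimes>\<^bsub>A\<^esub> c i = \<zero>\<^bsub>A\<^esub>" if i: "i < d" for i
  proof -
    let ?s = "g f [^]\<^bsub>A\<^esub> l"
    have s: "?s \<in> carrier A" "?s = g (f [^]\<^bsub>B\<^esub> l)" using f by (simp_all add: g_pow)
    have cj: "c j \<in> carrier A" if "j < d" for j using c that by auto
    have aj: "a j \<in> carrier A" if "j < m" for j using a that by auto
    have "?s \<otimes>\<^bsub>A\<^esub> finsum A (\<lambda>j. c j \<otimes>\<^bsub>A\<^esub> \<Lambda>A (cmap (e j)) i) {..<d}
        = ?s \<otimes>\<^bsub>A\<^esub> finsum A (\<lambda>j. a j \<otimes>\<^bsub>A\<^esub> \<Lambda>A (cmap (w j)) i) {..<m}"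
      using \<Lambda>A_sum[OF c _ i, of "\<lambda>j. cmap (e j)"] \<Lambda>A_sum[OF a _ i, of "\<lambda>j. cmap (w j)"] eq ec wc(1)
      by (simp add: Pi_iff)
    also have "\<dots> = finsum A (\<lambda>j. ?s \<otimes>\<^bsub>A\<^esub> (a j \<otimes>\<^bsub>A\<^esub> \<Lambda>A (cmap (w j)) i)) {..<m}"
      using s aj \<Lambda>Ac i wc(1) by (intro A.finsum_rdistr) auto
    also have "\<dots> = \<zero>\<^bsub>A\<^esub>"
    proof (rule A.add.finprod_one_eqI)
      fix j assume "j \<in> {..<m}"
      then have j: "j < m" by simp
      have "?s \<otimes>\<^bsub>A\<^esub> (a j \<otimes>\<^bsub>A\<^esub> \<Lambda>A (cmap (w j)) i) = a j \<otimes>\<^bsub>A\<^esub> g (f [^]\<^bsub>B\<^esub> l \<otimes>\<^bsub>B\<^esub> \<Lambda> (w j) i)"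
        using s aj[OF j] \<Lambda>c[OF wc(1)[OF j] i] fl
        by (simp add: gL[OF wc(1)[OF j] i, symmetric] A.m_lcomm)
      then show "?s \<otimes>\<^bsub>A\<^esub> (a j \<otimes>\<^bsub>A\<^esub> \<Lambda>A (cmap (w j)) i) = \<zero>\<^bsub>A\<^esub>"
        using lw[OF j i] aj[OF j] by simp
    qed
    finally have z: "?s \<otimes>\<^bsub>A\<^esub> finsum A (\<lambda>j. c j \<otimes>\<^bsub>A\<^esub> \<Lambda>A (cmap (e j)) i) {..<d} = \<zero>\<^bsub>A\<^esub>" .
    have "?s \<otimes>\<^bsub>A\<^esub> finsum A (\<lambda>j. c j \<otimes>\<^bsub>A\<^esub> \<Lambda>A (cmap (e j)) i) {..<d}
        = finsum A (\<lambda>j. ?s \<otimes>\<^bsub>A\<^esub> (c j \<otimes>\<^bsub>A\<^esub> \<Lambda>A (cmap (e j)) i)) {..<d}"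
      using s cj \<Lambda>Ac i ec by (intro A.finsum_rdistr) auto
    also have "\<dots> = finsum A (\<lambda>j. if i = j then c j \<otimes>\<^bsub>A\<^esub> g f [^]\<^bsub>A\<^esub> (l + L) else \<zero>\<^bsub>A\<^esub>) {..<d}"
    proof (rule A.finsum_cong')
      show "(\<lambda>j. if i = j then c j \<otimes>\<^bsub>A\<^esub> g f [^]\<^bsub>A\<^esub> (l + L) else \<zero>\<^bsub>A\<^esub>) \<in> {..<d} \<rightarrow> carrier A"
        using cj f by auto
      fix j assume "j \<in> {..<d}"
      then have j: "j < d" by simp
      have "?s \<otimes>\<^bsub>A\<^esub> (c j \<otimes>\<^bsub>A\<^esub> \<Lambda>A (cmap (e j)) i) = c j \<otimes>\<^bsub>A\<^esub> g (f [^]\<^bsub>B\<^esub> l \<otimes>\<^bsub>B\<^esub> \<Lambda> (e j) i)"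
        using s cj[OF j] \<Lambda>c[OF ec[OF j] i] fl
        by (simp add: gL[OF ec[OF j] i, symmetric] A.m_lcomm)
      then show "?s \<otimes>\<^bsub>A\<^esub> (c j \<otimes>\<^bsub>A\<^esub> \<Lambda>A (cmap (e j)) i) = (if i = j then c j \<otimes>\<^bsub>A\<^esub> g f [^]\<^bsub>A\<^esub> (l + L) else \<zero>\<^bsub>A\<^esub>)"
        using le[OF j i] cj[OF j] f by (simp add: B.nat_pow_mult g_pow)
    qed simp
    also have "\<dots> = c i \<otimes>\<^bsub>A\<^esub> g f [^]\<^bsub>A\<^esub> (l + L)"
      using i cj f by (intro A.finsum_singleton) auto
    finally have "c i \<otimes>\<^bsub>A\<^esub> g f [^]\<^bsub>A\<^esub> (l + L) = \<zero>\<^bsub>A\<^esub>" using z by simp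
    moreover have "c i \<otimes>\<^bsub>A\<^esub> g f [^]\<^bsub>A\<^esub> (l + L) = g f [^]\<^bsub>A\<^esub> (l + L) \<otimes>\<^bsub>A\<^esub> c i"
      using cj[OF i] f by (intro A.m_comm) auto
    ultimately show ?thesis by simp
  qed
  then show ?thesis by blast
qed

lemma ibasis_extend: "A.ibasis (extend I) (g f) d (\<lambda>i. cmap (e i))"
  using e_closed ibasis_extend_span ibasis_extend_indep by (intro A.ibasisI) (auto simp: Pi_iff)

end

lemma prime_vimage:
  assumes "primeideal Q A" shows "primeideal (spec_map B g Q) B"
proof -
  interpret Q: primeideal Q A by fact
  have eq: "spec_map B g Q = {b \<in> carrier B. g b \<in> Q}" by (simp add: spec_map_def)
  show ?thesis
  proof (rule primeidealI)
    show "ideal (spec_map B g Q) B"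
      unfolding eq by (rule ring_hom_ring.ideal_vimage[OF _ Q.ideal_axioms])
        (rule ring_hom_ringI2[OF B.ring_axioms A.ring_axioms g_hom])
    have "\<one>\<^bsub>A\<^esub> \<notin> Q" using Q.one_imp_carrier Q.I_notcarr by blast
    then have "\<one>\<^bsub>B\<^esub> \<notin> spec_map B g Q" by (simp add: eq)
    then show "carrier B \<noteq> spec_map B g Q" by blast
    show "a \<in> spec_map B g Q \<or> b \<in> spec_map B g Q"
      if "a \<in> carrier B" "b \<in> carrier B" "a \<otimes> b \<in> spec_map B g Q" for a b
      using that Q.I_prime[of "g a" "g b"] by (auto simp: eq)
  qed (rule B.is_cring)
qed

text \<open>A local basis near the preimage of a prime extends to one near the prime itself, because
  \<open>f\<close> lies outside the preimage exactly when \<open>g f\<close> lies outside the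
  prime.\<close>

lemma hilb_ideal_extend:
  assumes "B.hilb_ideal d I" shows "A.hilb_ideal d (extend I)"
proof -
  have I: "ideal I B.P" using assms by (simp add: B.hilb_ideal_def)
  have "\<exists>f\<in>carrier A - Q. \<exists>e. A.ibasis (extend I) f d e" if Q: "primeideal Q A" for Q
  proof -
    obtain f e where f: "f \<in> carrier B - spec_map B g Q" "B.ibasis I f d e"
      using assms prime_vimage[OF Q] unfolding B.hilb_ideal_def by blast
    then have "g f \<in> carrier A - Q" by (auto simp: spec_map_def)
    moreover have "A.ibasis (extend I) (g f) d (\<lambda>i. cmap (e i))"
      using f by (intro ibasis_extend I) auto
    ultimately show ?thesis by blast
  qed
  then show ?thesis unfolding A.hilb_ideal_def using extend_ideal[OF I] by blast
qed

lemma cmap_span: "u \<in> mpoly_span n B \<Delta> \<Longrightarrow> cmap u \<in> mpoly_span n A \<Delta>"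
  using supp_cmap by (auto simp: B.mpoly_span_iff A.mpoly_span_iff)

text \<open>Makes the spanning condition of \<open>Hilb_std\<close> stable under base change; again
  only monomials are tested, and they come from \<open>B\<close>.\<close>

lemma span_extend:
  assumes I: "ideal I B.P" and span: "mpoly_span n B \<Delta> <+>\<^bsub>B.P\<^esub> I = carrier B.P"
  shows "mpoly_span n A \<Delta> <+>\<^bsub>A.P\<^esub> extend I = carrier A.P"
proof (rule A.submodule_carrierI)
  have Is: "submodule I B B.P" by (rule B.P.ideal_submodule[OF I])
  have Ic: "I \<subseteq> carrier B.P" by (rule B.P.submoduleE(1)[OF Is])
  show "submodule (mpoly_span n A \<Delta> <+>\<^bsub>A.P\<^esub> extend I) A A.P"
    by (intro A.P.submodule_set_add A.mpoly_span_submodule extend_submodule Ic)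
  fix x assume x: "x \<in> carrier (expos n)"
  then have "B.mon \<one> x \<in> mpoly_span n B \<Delta> <+>\<^bsub>B.P\<^esub> I" unfolding span by simp
  then obtain u k where uk: "u \<in> mpoly_span n B \<Delta>" "k \<in> I" "B.mon \<one> x = u \<oplus>\<^bsub>B.P\<^esub> k"
    unfolding B.P.set_add_iff by blast
  have "A.mon \<one>\<^bsub>A\<^esub> x = cmap (B.mon \<one> x)" by (simp add: cmap_mon)
  also have "\<dots> = cmap u \<oplus>\<^bsub>A.P\<^esub> cmap k"
    unfolding uk(3) using uk Ic by (intro cmap_add) (auto simp: B.mpoly_span_iff)
  finally show "A.mon \<one>\<^bsub>A\<^esub> x \<in> mpoly_span n A \<Delta> <+>\<^bsub>A.P\<^esub> extend I"
    unfolding A.P.set_add_iff using cmap_span[OF uk(1)] cmap_in_extend[OF Ic uk(2)] by blast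
qed

end

section \<open>Functoriality\<close>

lemma alg_mpoly_hom:
  assumes "algebra k B" "algebra k A" "g \<in> alg_hom k B A"
  shows "mpoly_hom B A g"
  using assms(3) algebra.M_cring[OF assms(1)] algebra.M_cring[OF assms(2)]
  by (auto simp: mpoly_hom_def mpoly_hom_axioms_def mpoly_ring_def alg_hom_def)

lemma hilb_map_eq:
  assumes "mpoly_hom B A g" "ideal I (mpoly n B)"
  shows "hilb_map n B A g I = mpoly_hom.extend A n g I"
proof -
  interpret mpoly_hom_ideal B A n g I
    using assms by (simp add: mpoly_hom_ideal_def mpoly_hom_ideal_axioms_def)
  show ?thesis unfolding hilb_map_def Let_def by (rule base_change_kernel)
qed

lemma hilb_map_id:
  assumes B: "algebra k B" and I: "ideal I (mpoly n B)"
  shows "hilb_map n B B (\<lambda>b\<in>carrier B. b) I = I"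
proof -
  have "(\<lambda>b\<in>carrier B. b) \<in> alg_hom k B B"
  proof -
    interpret algebra k B by (rule B)
    show ?thesis by (auto simp: alg_hom_def ring_hom_def)
  qed
  then have h: "mpoly_hom B B (\<lambda>b\<in>carrier B. b)" by (rule alg_mpoly_hom[OF B B])
  then interpret mpoly_hom B B n "\<lambda>b\<in>carrier B. b" .
  have Is: "submodule I B B.P" by (rule B.P.ideal_submodule[OF I])
  have Ic: "I \<subseteq> carrier B.P" by (rule B.P.submoduleE(1)[OF Is])
  have id: "cmap p = p" if "p \<in> carrier B.P" for p
    using B.MA_coeff[OF that] by (simp add: cmap_def)
  have "extend I \<subseteq> I" using id Ic by (intro extend_minimal[OF Ic Is]) auto
  moreover have "x \<in> extend I" if "x \<in> I" for x
    using cmap_in_extend[OF Ic that] id[OF subsetD[OF Ic that]] by simp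
  ultimately have "extend I = I" by blast
  then show ?thesis using hilb_map_eq[OF h I] by simp
qed

text \<open>Extension along the composite and extension in two stages are both minimal, so each
  inclusion is checked on generators. The generators of the second stage are elements of
  \<open>g.extend I\<close>, which are reached by induction.\<close>

lemma hilb_map_compose:
  assumes B: "algebra k B" and A: "algebra k A" and C: "algebra k C"
    and g: "g \<in> alg_hom k B A" and h: "h \<in> alg_hom k A C" and I: "ideal I (mpoly n B)"
  shows "hilb_map n B C (compose (carrier B) h g) I = hilb_map n A C h (hilb_map n B A g I)"
proof -
  interpret g: mpoly_hom B A n g by (rule alg_mpoly_hom[OF B A g])
  interpret h: mpoly_hom A C n h by (rule alg_mpoly_hom[OF A C h])
  have hg: "compose (carrier B) h g \<in> alg_hom k B C"
  proof -
    interpret B: algebra k B by (rule B)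
    have "compose (carrier B) h g \<in> ring_hom B C"
      by (rule ring_hom_memI) (simp_all add: compose_def)
    then show ?thesis using g h
      by (auto simp: alg_hom_def compose_def B.smult_closed)
  qed
  interpret c: mpoly_hom B C n "compose (carrier B) h g" by (rule alg_mpoly_hom[OF B C hg])
  have Ic: "I \<subseteq> carrier (mpoly n B)"
    using g.B.P.submoduleE(1)[OF g.B.P.ideal_submodule[OF I]] .
  have gI: "ideal (g.extend I) (mpoly n A)" by (rule g.extend_ideal[OF I])
  have gIc: "g.extend I \<subseteq> carrier (mpoly n A)"
    using g.A.P.submoduleE(1)[OF g.A.P.ideal_submodule[OF gI]] .
  have cmap: "c.cmap p = h.cmap (g.cmap p)" if "p \<in> carrier (mpoly n B)" for p
    unfolding c.cmap_def g.cmap_def h.cmap_def using g.B.MA_coeff[OF that] by (simp add: compose_def)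
  have "c.extend I \<subseteq> h.extend (g.extend I)"
  proof (rule c.extend_minimal[OF Ic])
    show "submodule (h.extend (g.extend I)) C (mpoly n C)" by (rule h.extend_submodule[OF gIc])
    show "c.cmap ` I \<subseteq> h.extend (g.extend I)"
      using cmap Ic h.cmap_in_extend[OF gIc] g.cmap_in_extend[OF Ic] by auto
  qed
  moreover have "h.extend (g.extend I) \<subseteq> c.extend I"
  proof (rule h.extend_minimal[OF gIc])
    show N: "submodule (c.extend I) C (mpoly n C)" by (rule c.extend_submodule[OF Ic])
    have "h.cmap u \<in> c.extend I" if "u \<in> g.extend I" for u
      using that
    proof (induction rule: g.extend.induct)
      case zero
      then show ?case using h.cmap_zero c.extend.zero by metis
    next
      case (step u w a)
      have w: "w \<in> carrier (mpoly n B)" "u \<in> carrier (mpoly n A)"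
        using step Ic g.extend_closed[OF Ic] by auto
      have "h.cmap ((a \<odot>\<^bsub>mpoly n A\<^esub> g.cmap w) \<oplus>\<^bsub>mpoly n A\<^esub> u)
          = h a \<odot>\<^bsub>mpoly n C\<^esub> c.cmap w \<oplus>\<^bsub>mpoly n C\<^esub> h.cmap u"
        using w step by (simp add: h.cmap_add h.cmap_smult cmap)
      then show ?case using step c.extend.step[of "h.cmap u" I w "h a"] by simp
    qed
    then show "h.cmap ` g.extend I \<subseteq> c.extend I" by blast
  qed
  ultimately show ?thesis
    using hilb_map_eq[OF c.mpoly_hom_axioms I] hilb_map_eq[OF g.mpoly_hom_axioms I]
      hilb_map_eq[OF h.mpoly_hom_axioms gI] by auto
qed

lemma Hilb_ideal:
  assumes "algebra k B" "I \<in> fobj (Hilb n d) B"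
  shows "ideal I (mpoly n B)"
proof -
  have c: "cring B" using assms by (simp add: algebra.M_cring)
  interpret mpoly_ring B n by (simp add: mpoly_ring_def c)
  show ?thesis using assms(2) unfolding Hilb_iff[OF c] by (simp add: hilb_ideal_def)
qed

lemma Hilb_farr:
  assumes B: "algebra k B" and A: "algebra k A" and g: "g \<in> alg_hom k B A"
    and x: "I \<in> fobj (Hilb n d) B"
  shows "hilb_map n B A g I \<in> fobj (Hilb n d) A"
    and "hilb_map n B A g I = mpoly_hom.extend A n g I"
proof -
  have c: "cring B" "cring A" using assms by (simp_all add: algebra.M_cring)
  interpret mpoly_hom B A n g by (rule alg_mpoly_hom[OF B A g])
  show eq: "hilb_map n B A g I = extend I"
    by (rule hilb_map_eq[OF mpoly_hom_axioms Hilb_ideal[OF B x]])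
  show "hilb_map n B A g I \<in> fobj (Hilb n d) A"
    using x unfolding eq Hilb_iff[OF c(1)] Hilb_iff[OF c(2)] by (rule hilb_ideal_extend)
qed

lemma Hilb_std_subset: "algebra k B \<Longrightarrow> fobj (Hilb_std n \<Delta>) B \<subseteq> fobj (Hilb n (card \<Delta>)) B"
proof
  fix I assume B: "algebra k B" and "I \<in> fobj (Hilb_std n \<Delta>) B"
  then show "I \<in> fobj (Hilb n (card \<Delta>)) B"
    unfolding Hilb_iff[OF algebra.M_cring[OF B]] Hilb_std_iff[OF algebra.M_cring[OF B]]
    by (elim conjE)
qed

lemma Hilb_std_farr:
  assumes B: "algebra k B" and A: "algebra k A" and g: "g \<in> alg_hom k B A"
    and x: "I \<in> fobj (Hilb_std n \<Delta>) B"
  shows "hilb_map n B A g I \<in> fobj (Hilb_std n \<Delta>) A"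
proof -
  have c: "cring B" "cring A" using assms by (simp_all add: algebra.M_cring)
  interpret mpoly_hom B A n g by (rule alg_mpoly_hom[OF B A g])
  have x': "I \<in> fobj (Hilb n (card \<Delta>)) B" by (rule subsetD[OF Hilb_std_subset[OF B] x])
  have "mpoly_span n B \<Delta> <+>\<^bsub>mpoly n B\<^esub> I = carrier (mpoly n B)"
    using x unfolding Hilb_std_iff[OF c(1)] by (rule conjunct2)
  then have "mpoly_span n A \<Delta> <+>\<^bsub>mpoly n A\<^esub> extend I = carrier (mpoly n A)"
    by (rule span_extend[OF Hilb_ideal[OF B x']])
  moreover have "A.hilb_ideal (card \<Delta>) (extend I)"
    using Hilb_farr(1)[OF B A g x'] unfolding Hilb_iff[OF c(2)] Hilb_farr(2)[OF B A g x'] .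
  ultimately show ?thesis
    unfolding Hilb_std_iff[OF c(2)] Hilb_farr(2)[OF B A g x'] by (intro conjI)
qed

lemma farr_simps [simp]: "farr (Hilb n d) = hilb_map n" "farr (Hilb_std n \<Delta>) = hilb_map n"
  by (simp_all add: Hilb_def Hilb_std_def)

lemma Hilb_functor: "is_functor k (Hilb n d)"
  unfolding is_functor_def farr_simps
proof (intro conjI allI impI ballI)
  show "hilb_map n B B (\<lambda>b\<in>carrier B. b) x = x" if "algebra k B" "x \<in> fobj (Hilb n d) B" for B x
    using hilb_map_id[OF that(1) Hilb_ideal[OF that]] .
  show "hilb_map n B C (compose (carrier B) h g) x = hilb_map n A C h (hilb_map n B A g x)"
    if "algebra k B \<and> algebra k A \<and> algebra k C" "g \<in> alg_hom k B A" "h \<in> alg_hom k A C"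
      "x \<in> fobj (Hilb n d) B" for B A C g h x
    using that Hilb_ideal[of k B x n d] by (intro hilb_map_compose) auto
qed (auto intro: Hilb_farr)

lemma Hilb_std_functor: "is_functor k (Hilb_std n \<Delta>)"
  unfolding is_functor_def farr_simps
proof (intro conjI allI impI ballI)
  have id: "ideal x (mpoly n B)" if "algebra k B" "x \<in> fobj (Hilb_std n \<Delta>) B" for B x
    by (rule Hilb_ideal[OF that(1) subsetD[OF Hilb_std_subset[OF that(1)] that(2)]])
  show "hilb_map n B B (\<lambda>b\<in>carrier B. b) x = x"
    if "algebra k B" "x \<in> fobj (Hilb_std n \<Delta>) B" for B x
    using hilb_map_id[OF that(1) id[OF that]] .
  show "hilb_map n B C (compose (carrier B) h g) x = hilb_map n A C h (hilb_map n B A g x)"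
    if "algebra k B \<and> algebra k A \<and> algebra k C" "g \<in> alg_hom k B A" "h \<in> alg_hom k A C"
      "x \<in> fobj (Hilb_std n \<Delta>) B" for B A C g h x
    using that id by (intro hilb_map_compose) auto
qed (auto intro: Hilb_std_farr)

lemma Hilb_std_subfunctor: "is_subfunctor k (Hilb_std n \<Delta>) (Hilb n (card \<Delta>))"
  unfolding is_subfunctor_def farr_simps
  by (intro conjI allI impI ballI Hilb_functor Hilb_std_functor Hilb_std_subset refl)

section \<open>Fibres and Nakayama's lemma\<close>

context module
begin

lemma set_add_subset:
  assumes "submodule N R M" "A \<subseteq> N" "B \<subseteq> N" shows "A <+>\<^bsub>M\<^esub> B \<subseteq> N"
  using assms(2,3) submoduleE(5)[OF assms(1)] by (auto simp: set_add_iff subset_eq)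

lemma lin_subset':
  assumes N: "submodule N R M" and mem: "\<And>a i. a \<in> C \<Longrightarrow> i < d \<Longrightarrow> a \<odot>\<^bsub>M\<^esub> e i \<in> N"
  shows "lin d e C \<subseteq> N"
proof
  fix x assume "x \<in> lin d e C"
  then obtain c where "c \<in> {..<d} \<rightarrow> C" "x = finsum M (\<lambda>i. c i \<odot>\<^bsub>M\<^esub> e i) {..<d}"
    unfolding lin_def by blast
  then show "x \<in> N" using mem by (auto intro!: submodule_finsum[OF N] simp: Pi_iff)
qed

lemma lin_Suc:
  assumes C: "C \<subseteq> carrier R" and e: "e \<in> {..<Suc m} \<rightarrow> carrier M" and x: "x \<in> lin (Suc m) e C"
  shows "\<exists>p\<in>C. \<exists>y\<in>lin m e C. x = p \<odot>\<^bsub>M\<^esub> e m \<oplus>\<^bsub>M\<^esub> y"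
proof -
  obtain c where c: "c \<in> {..<Suc m} \<rightarrow> C" "x = finsum M (\<lambda>i. c i \<odot>\<^bsub>M\<^esub> e i) {..<Suc m}"
    using x unfolding lin_def by blast
  have "x = c m \<odot>\<^bsub>M\<^esub> e m \<oplus>\<^bsub>M\<^esub> finsum M (\<lambda>i. c i \<odot>\<^bsub>M\<^esub> e i) {..<m}"
    unfolding c(2) lessThan_Suc using c(1) e C by (intro M.finsum_insert) (auto simp: Pi_iff subset_eq)
  moreover have "c \<in> {..<m} \<rightarrow> C" "c m \<in> C" using c(1) by auto
  ultimately show ?thesis using lin_I[of c m C e] by blast
qed

lemma lin_0: "lin 0 e C = {\<zero>\<^bsub>M\<^esub>}"
  by (auto simp: lin_def)

text \<open>Nakayama's lemma without determinants: the generators that occur in the error term are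
  removed one at a time. A relation \<open>s e_m = w + p e_m + y\<close> with \<open>p\<close> in
  \<open>Q\<close> is solved for \<open>e_m\<close>, and the result is substituted into the other
  relations.\<close>

lemma nakayama_step:
  assumes Q: "primeideal Q R" and W: "submodule W R M" and e: "e \<in> {..<d} \<rightarrow> carrier M"
  shows "m \<le> d \<Longrightarrow> (\<And>i. i < d \<Longrightarrow> e i \<in> sat (carrier R - Q) (W <+>\<^bsub>M\<^esub> lin m e Q)) \<Longrightarrow>
    i < d \<Longrightarrow> e i \<in> sat (carrier R - Q) W"
proof (induction m)
  case 0
  have "W <+>\<^bsub>M\<^esub> {\<zero>\<^bsub>M\<^esub>} \<subseteq> W"
    using submodule_zero[OF W] by (intro set_add_subset[OF W]) auto
  then show ?case using 0(2)[OF 0(3)] sat_mono[of "W <+>\<^bsub>M\<^esub> {\<zero>\<^bsub>M\<^esub>}" W] unfolding lin_0 by blast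
next
  case (Suc m)
  interpret Q: primeideal Q R by fact
  let ?T = "carrier R - Q"
  let ?N = "W <+>\<^bsub>M\<^esub> lin m e Q"
  note T = mult_closed_prime[OF Q]
  have em: "e \<in> {..<m} \<rightarrow> carrier M" "e \<in> {..<Suc m} \<rightarrow> carrier M" "e m \<in> carrier M"
    using e Suc.prems(1) by (auto simp: Pi_iff)
  have lin: "submodule (lin m e Q) R M" by (rule lin_submodule[OF Q.ideal_axioms em(1)])
  have N: "submodule ?N R M" by (intro submodule_set_add W lin)
  note S = sat_submodule[OF T N]
  have NS: "?N \<subseteq> sat ?T ?N" by (rule sat_superset[OF T submoduleE(1)[OF N]])
  have QR: "Q \<subseteq> carrier R" by (rule Q.a_subset)
  have e_mem: "e m \<in> sat ?T ?N"
  proof -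
    have "e m \<in> sat ?T (W <+>\<^bsub>M\<^esub> lin (Suc m) e Q)" using Suc.prems by simp
    then obtain s w x where s: "s \<in> ?T" "w \<in> W" "x \<in> lin (Suc m) e Q" "s \<odot>\<^bsub>M\<^esub> e m = w \<oplus>\<^bsub>M\<^esub> x"
      unfolding sat_def set_add_iff by blast
    obtain p y where p: "p \<in> Q" "y \<in> lin m e Q" "x = p \<odot>\<^bsub>M\<^esub> e m \<oplus>\<^bsub>M\<^esub> y"
      using lin_Suc[OF QR em(2) s(3)] by blast
    have c: "w \<in> carrier M" "y \<in> carrier M" "p \<in> carrier R" "s \<in> carrier R"
      using s p QR submoduleE(1)[OF W] submoduleE(1)[OF lin] by auto
    have "(s \<ominus> p) \<odot>\<^bsub>M\<^esub> e m = s \<odot>\<^bsub>M\<^esub> e m \<oplus>\<^bsub>M\<^esub> \<ominus>\<^bsub>M\<^esub> (p \<odot>\<^bsub>M\<^esub> e m)"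
      using c em by (simp add: a_minus_def smult_l_distr smult_l_minus)
    also have "\<dots> = w \<oplus>\<^bsub>M\<^esub> y"
      unfolding s(4) p(3) using c em
      by (simp add: M.a_assoc M.a_comm[of "p \<odot>\<^bsub>M\<^esub> e m"]) (simp add: M.r_neg M.l_neg)
    finally have "(s \<ominus> p) \<odot>\<^bsub>M\<^esub> e m \<in> ?N" unfolding set_add_iff using s p by blast
    \<comment> \<open>The new coefficient of \<open>e m\<close> is still an admissible denominator:
      subtracting an element of \<open>Q\<close> cannot bring \<open>s\<close> into
      \<open>Q\<close>.\<close>
    moreover have "s \<ominus> p \<in> ?T"
    proof -
      have "s \<in> Q" if "s \<ominus> p \<in> Q"
      proof -
        have "(s \<ominus> p) \<oplus> p \<in> Q" using that p by blast
        moreover have "(s \<ominus> p) \<oplus> p = s" using c by (simp add: a_minus_def R.a_assoc R.l_neg)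
        ultimately show ?thesis by simp
      qed
      then show ?thesis using s c by auto
    qed
    ultimately show ?thesis unfolding sat_def using em by blast
  qed
  have "lin (Suc m) e Q \<subseteq> sat ?T ?N"
  proof
    fix x assume "x \<in> lin (Suc m) e Q"
    then obtain p y where p: "p \<in> Q" "y \<in> lin m e Q" "x = p \<odot>\<^bsub>M\<^esub> e m \<oplus>\<^bsub>M\<^esub> y"
      using lin_Suc[OF QR em(2)] by blast
    have "y \<in> sat ?T ?N" using set_add_mem2[OF W lin p(2)] NS by blast
    then show "x \<in> sat ?T ?N"
      unfolding p(3) using submoduleE(4,5)[OF S] e_mem p QR by blast
  qed
  moreover have "W \<subseteq> sat ?T ?N" using set_add_mem1[OF W lin] NS by blast
  ultimately have sub: "W <+>\<^bsub>M\<^esub> lin (Suc m) e Q \<subseteq> sat ?T ?N" by (intro set_add_subset[OF S])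
  \<comment> \<open>The denominator of the original relation and the one introduced by the
    substitution are merged by \<open>sat_sat\<close>.\<close>
  have "e i \<in> sat ?T ?N" if "i < d" for i
    using Suc.prems(2)[OF that] sat_mono[OF sub] by (intro sat_sat[OF T N]) blast
  then show ?case using Suc.IH Suc.prems by simp
qed

lemma nakayama:
  assumes Q: "primeideal Q R" and W: "submodule W R M" and e: "e \<in> {..<d} \<rightarrow> carrier M"
    and mem: "\<And>i. i < d \<Longrightarrow> e i \<in> sat (carrier R - Q) (W <+>\<^bsub>M\<^esub> lin d e Q)"
  shows "\<exists>s\<in>carrier R - Q. \<forall>i<d. s \<odot>\<^bsub>M\<^esub> e i \<in> W"
proof -
  have "e ` {..<d} \<subseteq> sat (carrier R - Q) W"
    using nakayama_step[OF Q W e le_refl mem] by blast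
  then show ?thesis
    using sat_finite[OF mult_closed_prime[OF Q] W, of "e ` {..<d}"] by auto
qed

end

lemma (in primeideal) pow_prime: "a \<in> carrier R \<Longrightarrow> a [^] (l::nat) \<in> I \<Longrightarrow> a \<in> I"
proof (induction l)
  case 0
  then show ?case using one_imp_carrier I_notcarr by simp
next
  case (Suc l)
  then show ?case using I_prime[of "a [^] l" a] by auto
qed

section \<open>The fibre at a prime\<close>

locale mpoly_basis = mpoly_ring R n + Q: primeideal Q R for R (structure) and n and Q +
  fixes I f d e
  assumes I: "ideal I P" and f: "f \<in> carrier R - Q" and basis: "ibasis I f d e"
begin

abbreviation "T \<equiv> carrier R - Q"

text \<open>The saturation of \<open>K0\<close> at \<open>T\<close> is the kernel of the map from
  \<open>P\<close> to the fibre at \<open>Q\<close>. Only multiples of the \<open>e i\<close> by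
  \<open>Q\<close> are put in, because this is the shape of the error term in
  \<open>nakayama\<close>; all other multiples by \<open>Q\<close> lie in the saturation anyway, by
  \<open>Q_smult_L\<close>.\<close>

definition K0 where "K0 = P.lin d e Q <+>\<^bsub>P\<^esub> I"

lemma e_closed: "e \<in> {..<d} \<rightarrow> carrier P" by (rule ibasis_closed[OF basis])
lemma e_carr: "i < d \<Longrightarrow> e i \<in> carrier P" using e_closed by auto
lemma I_sub: "submodule I R P" by (rule P.ideal_submodule[OF I])
lemma T_mult: "P.mult_closed T" by (rule P.mult_closed_prime[OF Q.primeideal_axioms])
lemma lin_Q_sub: "submodule (P.lin d e Q) R P" by (rule P.lin_submodule[OF Q.ideal_axioms e_closed])
lemma K0_sub: "submodule K0 R P" unfolding K0_def by (intro P.submodule_set_add lin_Q_sub I_sub)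
lemma f_pow: "f [^] (l::nat) \<in> T" using f Q.pow_prime[of f l] by auto

lemma satT_sub: "submodule N R P \<Longrightarrow> submodule (P.sat T N) R P" by (rule P.sat_submodule[OF T_mult])
lemma satT_sup: "submodule N R P \<Longrightarrow> N \<subseteq> P.sat T N"
  by (rule P.sat_superset[OF T_mult P.submoduleE(1)])
lemma span: "x \<in> carrier P \<Longrightarrow> \<exists>l::nat. \<exists>c\<in>{..<d} \<rightarrow> carrier R. \<exists>k\<in>I.
    f [^] l \<odot>\<^bsub>P\<^esub> x = finsum P (\<lambda>i. c i \<odot>\<^bsub>P\<^esub> e i) {..<d} \<oplus>\<^bsub>P\<^esub> k"
proof -
  assume "x \<in> carrier P"
  then obtain l :: nat and y k where "y \<in> P.lin d e (carrier R)" "k \<in> I" "f [^] l \<odot>\<^bsub>P\<^esub> x = y \<oplus>\<^bsub>P\<^esub> k"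
    using ibasis_span[OF basis] unfolding P.sat_def P.set_add_iff by blast
  moreover then obtain c where "c \<in> {..<d} \<rightarrow> carrier R" "y = finsum P (\<lambda>i. c i \<odot>\<^bsub>P\<^esub> e i) {..<d}"
    unfolding P.lin_def by blast
  ultimately show ?thesis by (intro exI[of _ l] bexI[of _ c] bexI[of _ k]) simp_all
qed

text \<open>A power of \<open>f\<close> turns \<open>x\<close> into a combination of the
  \<open>e i\<close> modulo \<open>I\<close>, and multiplying by \<open>p\<close> puts its
  coefficients into \<open>Q\<close>.\<close>

lemma Q_smult_L:
  assumes p: "p \<in> Q" and x: "x \<in> carrier P" shows "p \<odot>\<^bsub>P\<^esub> x \<in> P.sat T K0"
proof -
  obtain l :: nat and c k where c: "c \<in> {..<d} \<rightarrow> carrier R" "k \<in> I"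
    "f [^] l \<odot>\<^bsub>P\<^esub> x = finsum P (\<lambda>i. c i \<odot>\<^bsub>P\<^esub> e i) {..<d} \<oplus>\<^bsub>P\<^esub> k"
    using span[OF x] by (elim exE bexE) (rule that)
  let ?y = "finsum P (\<lambda>i. c i \<odot>\<^bsub>P\<^esub> e i) {..<d}"
  have pc: "p \<in> carrier R" by (rule Q.Icarr[OF p])
  have yc: "?y \<in> carrier P" using c(1) e_closed by (auto intro!: P.finsum_closed simp: Pi_iff)
  have kc: "k \<in> carrier P" using c(2) P.submoduleE(1)[OF I_sub] by blast
  have fl: "f [^] l \<in> carrier R" using f by simp
  have "p \<odot>\<^bsub>P\<^esub> ?y = finsum P (\<lambda>i. (p \<otimes> c i) \<odot>\<^bsub>P\<^esub> e i) {..<d}"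
    by (rule P.finsum_smult_distr[OF pc c(1) e_closed])
  moreover have "(\<lambda>i. p \<otimes> c i) \<in> {..<d} \<rightarrow> Q" using p c(1) by (auto intro: Q.I_r_closed)
  ultimately have py: "p \<odot>\<^bsub>P\<^esub> ?y \<in> P.lin d e Q" by (simp add: P.lin_I)
  have "f [^] l \<odot>\<^bsub>P\<^esub> (p \<odot>\<^bsub>P\<^esub> x) = p \<odot>\<^bsub>P\<^esub> (f [^] l \<odot>\<^bsub>P\<^esub> x)"
    using fl pc x by (simp add: P.smult_assoc1[symmetric] m_comm)
  also have "\<dots> = p \<odot>\<^bsub>P\<^esub> ?y \<oplus>\<^bsub>P\<^esub> p \<odot>\<^bsub>P\<^esub> k" unfolding c(3) by (rule P.smult_r_distr[OF pc yc kc])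
  finally have "f [^] l \<odot>\<^bsub>P\<^esub> (p \<odot>\<^bsub>P\<^esub> x) \<in> K0"
    unfolding K0_def P.set_add_iff using py P.submoduleE(4)[OF I_sub pc c(2)] by blast
  then show ?thesis unfolding P.sat_def using f_pow pc x by blast
qed

lemma coeffs_Q_L:
  assumes p: "p \<in> carrier P" and co: "\<And>x. p x \<in> Q" shows "p \<in> P.sat T K0"
proof -
  have "p = finsum P (\<lambda>x. p x \<odot>\<^bsub>P\<^esub> basis_elt R x) (supp p)"
    by (rule MA_expand[OF p]) (use p supp_carrier in auto)
  also have "\<dots> \<in> P.sat T K0"
  proof (rule P.submodule_finsum[OF satT_sub[OF K0_sub]], rule Pi_I, rule Q_smult_L[OF co])
    show "basis_elt R x \<in> carrier P" if "x \<in> supp p" for x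
      using supp_carrier[OF p] that by (auto simp: basis_elt_mon)
  qed
  finally show ?thesis .
qed

text \<open>A combination that vanishes in the fibre yields a relation modulo \<open>I\<close> with
  coefficients \<open>s c_i - b_i\<close>, where \<open>b_i\<close> is in \<open>Q\<close>. A power
  of \<open>f\<close> kills these, and neither \<open>f\<close> nor \<open>s\<close> lies in
  \<open>Q\<close>, so \<open>c_i\<close> does.\<close>

lemma L_indep:
  assumes c: "c \<in> {..<d} \<rightarrow> carrier R" and mem: "finsum P (\<lambda>i. c i \<odot>\<^bsub>P\<^esub> e i) {..<d} \<in> P.sat T K0" and i: "i < d"
  shows "c i \<in> Q"
proof -
  let ?lc = "\<lambda>b. finsum P (\<lambda>i. b i \<odot>\<^bsub>P\<^esub> e i) {..<d}"
  obtain s y k where s: "s \<in> T" "y \<in> P.lin d e Q" "k \<in> I" "s \<odot>\<^bsub>P\<^esub> ?lc c = y \<oplus>\<^bsub>P\<^esub> k"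
    using mem unfolding P.sat_def K0_def P.set_add_iff by blast
  obtain b where b: "b \<in> {..<d} \<rightarrow> Q" "y = ?lc b" using s(2) unfolding P.lin_def by blast
  have bc: "b \<in> {..<d} \<rightarrow> carrier R" using b(1) Q.Icarr by (auto simp: Pi_iff)
  have lcc: "?lc b \<in> carrier P" if "b \<in> {..<d} \<rightarrow> carrier R" for b
    using that e_closed by (auto intro!: P.finsum_closed simp: Pi_iff)
  have kc: "k \<in> carrier P" using s(3) P.submoduleE(1)[OF I_sub] by blast
  have sc: "s \<in> carrier R" using s by simp
  let ?w = "\<lambda>i. s \<otimes> c i \<oplus> (\<ominus> \<one>) \<otimes> b i"
  have "?lc ?w = ?lc (\<lambda>i. s \<otimes> c i) \<oplus>\<^bsub>P\<^esub> ?lc (\<lambda>i. (\<ominus> \<one>) \<otimes> b i)"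
    using c bc sc by (intro P.finsum_smult_add e_closed) (auto simp: Pi_iff)
  also have "\<dots> = s \<odot>\<^bsub>P\<^esub> ?lc c \<oplus>\<^bsub>P\<^esub> (\<ominus> \<one>) \<odot>\<^bsub>P\<^esub> ?lc b"
    using P.finsum_smult_distr[OF sc c e_closed] P.finsum_smult_distr[OF _ bc e_closed, of "\<ominus> \<one>"] by simp
  also have "\<dots> = k"
    unfolding s(4) b(2) using lcc[OF bc] kc
    by (simp add: P.smult_l_minus P.M.a_assoc P.M.a_comm[of k]) (simp add: P.M.a_assoc[symmetric] P.M.r_neg)
  finally have "?lc ?w \<in> I" using s(3) by simp
  moreover have wc: "?w \<in> {..<d} \<rightarrow> carrier R" using c bc sc by (auto simp: Pi_iff)
  ultimately obtain l :: nat where l: "f [^] l \<otimes> ?w i = \<zero>" using ibasis_indep[OF basis wc] i by blast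
  have ci: "c i \<in> carrier R" "b i \<in> Q" "b i \<in> carrier R" using c b bc i by auto
  have "f [^] l \<otimes> ?w i \<in> Q" unfolding l by simp
  then have "?w i \<in> Q" using f_pow[of l] ci sc Q.I_prime[of "f [^] l" "?w i"] by auto
  then have "?w i \<oplus> b i \<in> Q" using ci by blast
  moreover have "?w i \<oplus> b i = s \<otimes> c i"
    using ci sc by (simp add: l_minus a_assoc l_neg)
  ultimately have "s \<otimes> c i \<in> Q" by simp
  then show ?thesis using s(1) ci Q.I_prime[of s "c i"] by auto
qed

text \<open>If \<open>W\<close> spans the fibre at \<open>Q\<close>, it spans the quotient after inverting some \<open>h \<notin> Q\<close>.\<close>

lemma spans_nearby:
  assumes W: "submodule W R P" and IW: "I \<subseteq> W"
    and mem: "\<And>i. i < d \<Longrightarrow> e i \<in> P.sat T (W <+>\<^bsub>P\<^esub> P.lin d e Q)"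
  shows "\<exists>h\<in>T. carrier P \<subseteq> P.sat (range (\<lambda>l::nat. h [^] l)) W"
proof -
  obtain s where s: "s \<in> T" "\<And>i. i < d \<Longrightarrow> s \<odot>\<^bsub>P\<^esub> e i \<in> W"
    using P.nakayama[OF Q.primeideal_axioms W e_closed mem] by blast
  have sc: "s \<in> carrier R" "f \<in> carrier R" using s f by auto
  \<comment> \<open>The witness is \<open>s f\<close>: powers of \<open>f\<close> express an element
    by the \<open>e i\<close>, and \<open>s\<close> moves these into \<open>W\<close>.\<close>
  have "carrier P \<subseteq> P.sat (range (\<lambda>l::nat. (s \<otimes> f) [^] l)) W"
  proof
    fix x assume x: "x \<in> carrier P"
    obtain l :: nat and c k where c: "c \<in> {..<d} \<rightarrow> carrier R" "k \<in> I"
      "f [^] l \<odot>\<^bsub>P\<^esub> x = finsum P (\<lambda>i. c i \<odot>\<^bsub>P\<^esub> e i) {..<d} \<oplus>\<^bsub>P\<^esub> k"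
      using span[OF x] by (elim exE bexE) (rule that)
    let ?y = "finsum P (\<lambda>i. c i \<odot>\<^bsub>P\<^esub> e i) {..<d}"
    have yc: "?y \<in> carrier P" using c(1) e_closed by (auto intro!: P.finsum_closed simp: Pi_iff)
    have kc: "k \<in> carrier P" using c(2) P.submoduleE(1)[OF I_sub] by blast
    have "s \<odot>\<^bsub>P\<^esub> ?y = finsum P (\<lambda>i. s \<odot>\<^bsub>P\<^esub> (c i \<odot>\<^bsub>P\<^esub> e i)) {..<d}"
      using sc c(1) e_closed by (intro P.finsum_smult_ldistr) (auto simp: Pi_iff)
    also have "\<dots> \<in> W"
    proof (rule P.submodule_finsum[OF W], rule Pi_I)
      fix i assume "i \<in> {..<d}"
      then have i: "i < d" "c i \<in> carrier R" using c(1) by auto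
      have "s \<odot>\<^bsub>P\<^esub> (c i \<odot>\<^bsub>P\<^esub> e i) = c i \<odot>\<^bsub>P\<^esub> (s \<odot>\<^bsub>P\<^esub> e i)"
        using i sc e_carr[OF i(1)] by (simp add: P.smult_assoc1[symmetric] m_comm)
      then show "s \<odot>\<^bsub>P\<^esub> (c i \<odot>\<^bsub>P\<^esub> e i) \<in> W" using P.submoduleE(4)[OF W i(2) s(2)[OF i(1)]] by simp
    qed
    finally have "s \<odot>\<^bsub>P\<^esub> ?y \<in> W" .
    moreover have "s \<odot>\<^bsub>P\<^esub> k \<in> W" using P.submoduleE(4)[OF I_sub sc(1) c(2)] IW by blast
    ultimately have "s \<odot>\<^bsub>P\<^esub> (f [^] l \<odot>\<^bsub>P\<^esub> x) \<in> W"
      unfolding c(3) P.smult_r_distr[OF sc(1) yc kc] by (rule P.submoduleE(5)[OF W])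
    from P.submoduleE(4)[OF W _ this, of "s [^] l \<otimes> f"]
    have *: "(s [^] l \<otimes> f) \<odot>\<^bsub>P\<^esub> (s \<odot>\<^bsub>P\<^esub> (f [^] l \<odot>\<^bsub>P\<^esub> x)) \<in> W"
      using sc by simp
    \<comment> \<open>Only one factor \<open>s\<close> and \<open>l\<close> factors \<open>f\<close>
      are called for; multiplying by \<open>s^l f\<close> completes them to a power of
      \<open>s f\<close>.\<close>
    have "(s \<otimes> f) [^] Suc l = (s [^] l \<otimes> f) \<otimes> (s \<otimes> f [^] l)"
      using sc by (simp add: nat_pow_distrib m_ac)
    then have "(s \<otimes> f) [^] Suc l \<odot>\<^bsub>P\<^esub> x = (s [^] l \<otimes> f) \<odot>\<^bsub>P\<^esub> (s \<odot>\<^bsub>P\<^esub> (f [^] l \<odot>\<^bsub>P\<^esub> x))"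
      using sc x by (simp add: P.smult_assoc1)
    with * have "(s \<otimes> f) [^] Suc l \<odot>\<^bsub>P\<^esub> x \<in> W" by simp
    then show "x \<in> P.sat (range (\<lambda>l::nat. (s \<otimes> f) [^] l)) W"
      unfolding P.sat_def using x by blast
  qed
  moreover have "s \<otimes> f \<in> T" using s f Q.I_prime[of s f] sc by auto
  ultimately show ?thesis by blast
qed

end

section \<open>Descent of spans along extensions of residue fields\<close>

context mpoly_hom
begin

text \<open>Gaussian elimination on the coordinates in \<open>E\<close>, with cross-multiplication
  in place of division. The underlying fact: if a vector over a subfield is a combination over the
  larger field of vectors over the subfield, it is one over the subfield. \<open>W\<close>,
  \<open>v\<close> and \<open>u\<close> vary in the induction because each pivot step replaces
  them.\<close>

lemma descent:
  assumes p: "primeideal p A" and E: "finite E"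
  shows "W \<subseteq> carrier B.P \<Longrightarrow> submodule W B B.P \<Longrightarrow> v \<in> carrier B.P \<Longrightarrow> u \<in> extend W \<Longrightarrow>
    (\<And>\<alpha>. \<alpha> \<in> E \<Longrightarrow> g (v \<alpha>) \<ominus>\<^bsub>A\<^esub> u \<alpha> \<in> p) \<Longrightarrow>
    \<exists>s\<in>carrier B - spec_map B g p. \<exists>w\<in>W. \<forall>\<alpha>\<in>E. s \<otimes>\<^bsub>B\<^esub> v \<alpha> \<ominus>\<^bsub>B\<^esub> w \<alpha> \<in> spec_map B g p"
  using E
proof (induction E arbitrary: W v u rule: finite_induct)
  case (empty W v u)
  interpret p': primeideal "spec_map B g p" B by (rule prime_vimage[OF p])
  have "\<one>\<^bsub>B\<^esub> \<in> carrier B - spec_map B g p" using p'.one_imp_carrier p'.I_notcarr by blast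
  show ?case
  proof (rule bexI)
    show "\<one>\<^bsub>B\<^esub> \<in> carrier B - spec_map B g p" by fact
    show "\<exists>w\<in>W. \<forall>\<alpha>\<in>{}. \<one>\<^bsub>B\<^esub> \<otimes>\<^bsub>B\<^esub> v \<alpha> \<ominus>\<^bsub>B\<^esub> w \<alpha> \<in> spec_map B g p"
      using B.P.submodule_zero[OF empty(2)] by (simp only: ball_empty bex_triv_one_point2 bex_simps) blast
  qed
next
  case (insert \<gamma> E W v u)
  have p'_iff: "b \<in> spec_map B g p \<longleftrightarrow> g b \<in> p" if "b \<in> carrier B" for b
    unfolding spec_map_def mem_Collect_eq using that by blast
  interpret p: primeideal p A by (rule p)
  interpret p': primeideal "spec_map B g p" B by (rule prime_vimage[OF p])
  note WE = B.P.submoduleE[OF insert.prems(2)]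
  have yc: "y \<alpha> \<in> carrier B" if "y \<in> W" for y \<alpha> by (rule B.MA_coeff[OF subsetD[OF insert.prems(1) that]])
  have vc: "v \<alpha> \<in> carrier B" for \<alpha> using insert.prems(3) by (rule B.MA_coeff)
  have uc: "u \<in> carrier A.P" by (rule extend_closed[OF insert.prems(1,4)])
  have uac: "u \<alpha> \<in> carrier A" for \<alpha> using uc by (rule A.MA_coeff)
  show ?case
  proof (cases "\<forall>y\<in>W. y \<gamma> \<in> spec_map B g p")
    case True
    \<comment> \<open>No element of \<open>W\<close> has a pivot at \<open>\<gamma>\<close>. Then
      \<open>u\<close> and hence \<open>v\<close> vanish there modulo the primes, and the coordinate
      imposes no condition.\<close>
    have "u \<gamma> \<in> p" using insert.prems(4)
    proof (induction rule: extend.induct)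
      case zero show ?case by (simp add: A.MA_simps)
    next
      case (step u y a)
      have "g (y \<gamma>) \<in> p" using bspec[OF True step(2)] p'_iff[OF yc[OF step(2)]] by simp
      then have "a \<otimes>\<^bsub>A\<^esub> g (y \<gamma>) \<in> p" using step by (intro p.I_l_closed)
      then show ?case using step by (simp add: A.MA_simps cmap_def)
    qed
    moreover have "g (v \<gamma>) \<ominus>\<^bsub>A\<^esub> u \<gamma> \<in> p" using insert.prems(5) by simp
    ultimately have "(g (v \<gamma>) \<ominus>\<^bsub>A\<^esub> u \<gamma>) \<oplus>\<^bsub>A\<^esub> u \<gamma> \<in> p" by blast
    then have "g (v \<gamma>) \<in> p"
      using vc[of \<gamma>] uac[of \<gamma>] by (simp add: a_minus_def A.a_assoc A.l_neg)
    then have v\<gamma>: "v \<gamma> \<in> spec_map B g p" using p'_iff vc by simp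
    obtain s w where s: "s \<in> carrier B - spec_map B g p" "w \<in> W"
      "\<forall>\<alpha>\<in>E. s \<otimes>\<^bsub>B\<^esub> v \<alpha> \<ominus>\<^bsub>B\<^esub> w \<alpha> \<in> spec_map B g p"
    proof -
      have "\<exists>s\<in>carrier B - spec_map B g p. \<exists>w\<in>W. \<forall>\<alpha>\<in>E. s \<otimes>\<^bsub>B\<^esub> v \<alpha> \<ominus>\<^bsub>B\<^esub> w \<alpha> \<in> spec_map B g p"
        by (rule insert.IH[OF insert.prems(1-4)]) (rule insert.prems(5), rule insertI2)
      then show ?thesis by (elim bexE) (rule that)
    qed
    have "s \<otimes>\<^bsub>B\<^esub> v \<gamma> \<in> spec_map B g p" "w \<gamma> \<in> spec_map B g p"
      using p'.I_l_closed[OF v\<gamma>] s True by auto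
    then have "s \<otimes>\<^bsub>B\<^esub> v \<gamma> \<ominus>\<^bsub>B\<^esub> w \<gamma> \<in> spec_map B g p" unfolding a_minus_def by blast
    then show ?thesis using s by (intro bexI[of _ s] bexI[of _ w]) auto
  next
    case False
    then obtain w0 where w0: "w0 \<in> W" "w0 \<gamma> \<notin> spec_map B g p" by blast
    let ?c = "w0 \<gamma>"
    have cc: "?c \<in> carrier B" by (rule yc[OF w0(1)])
    have w0c: "w0 \<in> carrier B.P" using w0 insert.prems(1) by blast
    \<comment> \<open>Elimination with pivot \<open>w0\<close>: the coefficient of
      \<open>t y\<close> at \<open>\<gamma>\<close> is zero. The version \<open>tA\<close> over
      \<open>A\<close> is applied to \<open>u\<close>, which need not come from
      \<open>B\<close>.\<close>
    define t where "t y = ?c \<odot>\<^bsub>B.P\<^esub> y \<ominus>\<^bsub>B.P\<^esub> y \<gamma> \<odot>\<^bsub>B.P\<^esub> w0" for y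
    define tA where "tA z = g ?c \<odot>\<^bsub>A.P\<^esub> z \<ominus>\<^bsub>A.P\<^esub> z \<gamma> \<odot>\<^bsub>A.P\<^esub> cmap w0" for z
    have t_apply: "t y \<alpha> = ?c \<otimes>\<^bsub>B\<^esub> y \<alpha> \<ominus>\<^bsub>B\<^esub> y \<gamma> \<otimes>\<^bsub>B\<^esub> w0 \<alpha>" and t_closed: "t y \<in> carrier B.P"
      if "y \<in> carrier B.P" for y \<alpha>
    proof -
      have c: "?c \<odot>\<^bsub>B.P\<^esub> y \<in> carrier B.P" "y \<gamma> \<odot>\<^bsub>B.P\<^esub> w0 \<in> carrier B.P"
        using that cc w0c B.MA_coeff[OF that] by auto
      show "t y \<in> carrier B.P" using c by (simp add: t_def)
      show "t y \<alpha> = ?c \<otimes>\<^bsub>B\<^esub> y \<alpha> \<ominus>\<^bsub>B\<^esub> y \<gamma> \<otimes>\<^bsub>B\<^esub> w0 \<alpha>"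
        unfolding t_def B.MA_minus[OF c] by (simp add: B.MA_simps)
    qed
    have tA_apply: "tA z \<alpha> = g ?c \<otimes>\<^bsub>A\<^esub> z \<alpha> \<ominus>\<^bsub>A\<^esub> z \<gamma> \<otimes>\<^bsub>A\<^esub> g (w0 \<alpha>)"
      and tA_closed: "tA z \<in> carrier A.P" if "z \<in> carrier A.P" for z \<alpha>
    proof -
      have c: "g ?c \<odot>\<^bsub>A.P\<^esub> z \<in> carrier A.P" "z \<gamma> \<odot>\<^bsub>A.P\<^esub> cmap w0 \<in> carrier A.P"
        using that cc w0c A.MA_coeff[OF that] by auto
      show "tA z \<in> carrier A.P" using c by (simp add: tA_def)
      show "tA z \<alpha> = g ?c \<otimes>\<^bsub>A\<^esub> z \<alpha> \<ominus>\<^bsub>A\<^esub> z \<gamma> \<otimes>\<^bsub>A\<^esub> g (w0 \<alpha>)"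
        unfolding tA_def A.MA_minus[OF c] by (simp add: A.MA_simps cmap_def)
    qed
    have g_minus: "g (a \<ominus>\<^bsub>B\<^esub> b) = g a \<ominus>\<^bsub>A\<^esub> g b" if "a \<in> carrier B" "b \<in> carrier B" for a b
      using that by (simp add: a_minus_def)
    have tW: "t ` W \<subseteq> W"
      unfolding t_def using WE(4) w0 cc yc by (auto intro!: B.P.submodule_minus[OF insert.prems(2)])
    have tWc: "t ` W \<subseteq> carrier B.P" using tW insert.prems(1) by blast
    \<comment> \<open>The induction hypothesis asks for a submodule again; the image of
      \<open>W\<close> under \<open>t\<close> is one because \<open>t\<close> is linear on
      \<open>W\<close>.\<close>
    have t_sub: "submodule (t ` W) B B.P"
    proof (rule B.P.submoduleI)
      show "t ` W \<subseteq> carrier B.P" by fact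
      have lin: "t (a \<odot>\<^bsub>B.P\<^esub> x \<oplus>\<^bsub>B.P\<^esub> y) = a \<odot>\<^bsub>B.P\<^esub> t x \<oplus>\<^bsub>B.P\<^esub> t y"
        if "a \<in> carrier B" "x \<in> W" "y \<in> W" for a x y
      proof
        fix \<alpha>
        have c: "x \<in> carrier B.P" "y \<in> carrier B.P" "a \<odot>\<^bsub>B.P\<^esub> x \<oplus>\<^bsub>B.P\<^esub> y \<in> carrier B.P"
          using that insert.prems(1) by auto
        have "?c \<otimes>\<^bsub>B\<^esub> (a \<otimes>\<^bsub>B\<^esub> x \<alpha> \<oplus>\<^bsub>B\<^esub> y \<alpha>) \<ominus>\<^bsub>B\<^esub> (a \<otimes>\<^bsub>B\<^esub> x \<gamma> \<oplus>\<^bsub>B\<^esub> y \<gamma>) \<otimes>\<^bsub>B\<^esub> w0 \<alpha>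
          = a \<otimes>\<^bsub>B\<^esub> (?c \<otimes>\<^bsub>B\<^esub> x \<alpha> \<ominus>\<^bsub>B\<^esub> x \<gamma> \<otimes>\<^bsub>B\<^esub> w0 \<alpha>) \<oplus>\<^bsub>B\<^esub> (?c \<otimes>\<^bsub>B\<^esub> y \<alpha> \<ominus>\<^bsub>B\<^esub> y \<gamma> \<otimes>\<^bsub>B\<^esub> w0 \<alpha>)"
          using yc[OF that(2), of \<alpha>] yc[OF that(2), of \<gamma>] yc[OF that(3), of \<alpha>] yc[OF that(3), of \<gamma>]
            yc[OF w0(1), of \<alpha>] cc that(1) by algebra
        then show "t (a \<odot>\<^bsub>B.P\<^esub> x \<oplus>\<^bsub>B.P\<^esub> y) \<alpha> = (a \<odot>\<^bsub>B.P\<^esub> t x \<oplus>\<^bsub>B.P\<^esub> t y) \<alpha>"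
          unfolding t_apply[OF c(3)] by (simp add: B.MA_simps t_apply[OF c(1)] t_apply[OF c(2)])
      qed
      have W0: "\<zero>\<^bsub>B.P\<^esub> \<in> W" by (rule B.P.submodule_zero[OF insert.prems(2)])
      have t0: "t \<zero>\<^bsub>B.P\<^esub> = \<zero>\<^bsub>B.P\<^esub>"
        unfolding t_def using w0c cc by (simp add: B.MA_simps(1)[THEN fun_cong]) (simp add: a_minus_def)
      then show "\<zero>\<^bsub>B.P\<^esub> \<in> t ` W" using W0 by (intro image_eqI[of _ t "\<zero>\<^bsub>B.P\<^esub>"]) auto
      have xc: "x \<in> carrier B.P" if "x \<in> W" for x using that insert.prems(1) by blast
      show smult: "a \<odot>\<^bsub>B.P\<^esub> z \<in> t ` W" if az: "a \<in> carrier B" "z \<in> t ` W" for a z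
      proof -
        obtain x where x: "x \<in> W" "z = t x" using az by blast
        have "a \<odot>\<^bsub>B.P\<^esub> z = t (a \<odot>\<^bsub>B.P\<^esub> x)"
          using lin[OF az(1) x(1) W0] t0 az(1) xc[OF x(1)] t_closed[OF xc[OF x(1)]] x(2) by simp
        then show ?thesis using WE(4)[OF az(1) x(1)] by blast
      qed
      show "a \<oplus>\<^bsub>B.P\<^esub> b \<in> t ` W" if ab: "a \<in> t ` W" "b \<in> t ` W" for a b
      proof -
        obtain x y where x: "x \<in> W" "a = t x" "y \<in> W" "b = t y" using ab by blast
        have "a \<oplus>\<^bsub>B.P\<^esub> b = t (x \<oplus>\<^bsub>B.P\<^esub> y)"
          using lin[OF B.one_closed x(1,3)] xc[OF x(1)] t_closed[OF xc[OF x(1)]] x by simp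
        then show ?thesis using WE(5)[OF x(1,3)] by blast
      qed
      show "\<ominus>\<^bsub>B.P\<^esub> a \<in> t ` W" if a: "a \<in> t ` W" for a
      proof -
        have "a \<in> carrier B.P" using a tWc by blast
        then have "\<ominus>\<^bsub>B.P\<^esub> a = (\<ominus>\<^bsub>B\<^esub> \<one>\<^bsub>B\<^esub>) \<odot>\<^bsub>B.P\<^esub> a" by (simp add: B.P.smult_l_minus)
        then show ?thesis using smult a by simp
      qed
    qed
    \<comment> \<open>\<open>tA\<close> respects the generating steps of \<open>extend\<close>,
      since on the image of \<open>W\<close> it acts as \<open>t\<close> followed by
      \<open>cmap\<close>.\<close>
    have tAu: "tA u \<in> extend (t ` W)" using insert.prems(4)
    proof (induction rule: extend.induct)
      case zero
      have "tA \<zero>\<^bsub>A.P\<^esub> = \<zero>\<^bsub>A.P\<^esub>"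
        unfolding tA_def using w0c cc by (simp add: A.MA_simps(1)[THEN fun_cong]) (simp add: a_minus_def)
      then show ?case using extend.zero by simp
    next
      case (step u y a)
      have c: "u \<in> carrier A.P" "y \<in> carrier B.P" "cmap y \<in> carrier A.P"
        "a \<odot>\<^bsub>A.P\<^esub> cmap y \<oplus>\<^bsub>A.P\<^esub> u \<in> carrier A.P"
        using step extend_closed[OF insert.prems(1)] insert.prems(1) by auto
      have "tA (a \<odot>\<^bsub>A.P\<^esub> cmap y \<oplus>\<^bsub>A.P\<^esub> u) = a \<odot>\<^bsub>A.P\<^esub> cmap (t y) \<oplus>\<^bsub>A.P\<^esub> tA u"
      proof
        fix \<alpha>
        have gc: "g (y \<alpha>) \<in> carrier A" "g (y \<gamma>) \<in> carrier A" "g (w0 \<alpha>) \<in> carrier A" "g ?c \<in> carrier A"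
          "u \<alpha> \<in> carrier A" "u \<gamma> \<in> carrier A"
          using B.MA_coeff[OF c(2)] B.MA_coeff[OF w0c] A.MA_coeff[OF c(1)] by auto
        have "g ?c \<otimes>\<^bsub>A\<^esub> (a \<otimes>\<^bsub>A\<^esub> g (y \<alpha>) \<oplus>\<^bsub>A\<^esub> u \<alpha>) \<ominus>\<^bsub>A\<^esub> (a \<otimes>\<^bsub>A\<^esub> g (y \<gamma>) \<oplus>\<^bsub>A\<^esub> u \<gamma>) \<otimes>\<^bsub>A\<^esub> g (w0 \<alpha>)
          = a \<otimes>\<^bsub>A\<^esub> (g ?c \<otimes>\<^bsub>A\<^esub> g (y \<alpha>) \<ominus>\<^bsub>A\<^esub> g (y \<gamma>) \<otimes>\<^bsub>A\<^esub> g (w0 \<alpha>))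
            \<oplus>\<^bsub>A\<^esub> (g ?c \<otimes>\<^bsub>A\<^esub> u \<alpha> \<ominus>\<^bsub>A\<^esub> u \<gamma> \<otimes>\<^bsub>A\<^esub> g (w0 \<alpha>))"
          using gc step(3) by algebra
        moreover have "cmap (t y) \<alpha> = g ?c \<otimes>\<^bsub>A\<^esub> g (y \<alpha>) \<ominus>\<^bsub>A\<^esub> g (y \<gamma>) \<otimes>\<^bsub>A\<^esub> g (w0 \<alpha>)"
          using B.MA_coeff[OF c(2)] B.MA_coeff[OF w0c] by (simp add: cmap_def t_apply[OF c(2)] g_minus)
        ultimately show "tA (a \<odot>\<^bsub>A.P\<^esub> cmap y \<oplus>\<^bsub>A.P\<^esub> u) \<alpha> = (a \<odot>\<^bsub>A.P\<^esub> cmap (t y) \<oplus>\<^bsub>A.P\<^esub> tA u) \<alpha>"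
          unfolding tA_apply[OF c(4)] by (simp add: A.MA_simps tA_apply[OF c(1)]) (simp add: cmap_def)
      qed
      then show ?case using extend.step[OF step.IH, of "t y" a] step by auto
    qed
    have tv: "g (t v \<alpha>) \<ominus>\<^bsub>A\<^esub> tA u \<alpha> \<in> p" if \<alpha>: "\<alpha> \<in> E" for \<alpha>
    proof -
      have gc: "g (v \<alpha>) \<in> carrier A" "g (v \<gamma>) \<in> carrier A" "g (w0 \<alpha>) \<in> carrier A" "g ?c \<in> carrier A"
        using vc B.MA_coeff[OF w0c] by auto
      have "g (t v \<alpha>) \<ominus>\<^bsub>A\<^esub> tA u \<alpha>
          = (g ?c \<otimes>\<^bsub>A\<^esub> g (v \<alpha>) \<ominus>\<^bsub>A\<^esub> g (v \<gamma>) \<otimes>\<^bsub>A\<^esub> g (w0 \<alpha>)) \<ominus>\<^bsub>A\<^esub> (g ?c \<otimes>\<^bsub>A\<^esub> u \<alpha> \<ominus>\<^bsub>A\<^esub> u \<gamma> \<otimes>\<^bsub>A\<^esub> g (w0 \<alpha>))"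
        using vc B.MA_coeff[OF w0c] by (simp add: t_apply[OF insert.prems(3)] tA_apply[OF uc] g_minus)
      also have "\<dots> = g ?c \<otimes>\<^bsub>A\<^esub> (g (v \<alpha>) \<ominus>\<^bsub>A\<^esub> u \<alpha>) \<oplus>\<^bsub>A\<^esub> (\<ominus>\<^bsub>A\<^esub> g (w0 \<alpha>)) \<otimes>\<^bsub>A\<^esub> (g (v \<gamma>) \<ominus>\<^bsub>A\<^esub> u \<gamma>)"
        using gc uac[of \<alpha>] uac[of \<gamma>] by algebra
      also have "\<dots> \<in> p"
        using p.I_l_closed[OF insert.prems(5)[of \<alpha>], of "g ?c"] p.I_l_closed[OF insert.prems(5)[of \<gamma>], of "\<ominus>\<^bsub>A\<^esub> g (w0 \<alpha>)"]
          \<alpha> gc by (intro p.a_closed) auto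
      finally show ?thesis .
    qed
    obtain s w' where s: "s \<in> carrier B - spec_map B g p" "w' \<in> t ` W"
      "\<forall>\<alpha>\<in>E. s \<otimes>\<^bsub>B\<^esub> t v \<alpha> \<ominus>\<^bsub>B\<^esub> w' \<alpha> \<in> spec_map B g p"
    proof -
      have "\<exists>s\<in>carrier B - spec_map B g p. \<exists>w\<in>t ` W. \<forall>\<alpha>\<in>E. s \<otimes>\<^bsub>B\<^esub> t v \<alpha> \<ominus>\<^bsub>B\<^esub> w \<alpha> \<in> spec_map B g p"
        by (rule insert.IH[OF tWc t_sub t_closed[OF insert.prems(3)] tAu]) (rule tv)
      then show ?thesis by (elim bexE) (rule that)
    qed
    obtain y where y: "y \<in> W" "w' = t y" using s(2) by blast
    have ycc: "y \<in> carrier B.P" using y insert.prems(1) by blast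
    have sc: "s \<in> carrier B" using s by simp
    \<comment> \<open>Undoing the elimination: this multiple of \<open>w0\<close> is chosen so that
      the coordinate at \<open>\<gamma>\<close> agrees exactly, not only modulo the prime.\<close>
    let ?r = "s \<otimes>\<^bsub>B\<^esub> v \<gamma> \<ominus>\<^bsub>B\<^esub> y \<gamma>"
    have rc: "?r \<in> carrier B" using sc vc yc[OF y(1)] by simp
    let ?w = "?c \<odot>\<^bsub>B.P\<^esub> y \<oplus>\<^bsub>B.P\<^esub> ?r \<odot>\<^bsub>B.P\<^esub> w0"
    have wW: "?w \<in> W" using WE(4)[OF cc y(1)] WE(4)[OF rc w0(1)] by (rule WE(5))
    have "(s \<otimes>\<^bsub>B\<^esub> ?c) \<otimes>\<^bsub>B\<^esub> v \<alpha> \<ominus>\<^bsub>B\<^esub> ?w \<alpha> \<in> spec_map B g p" if "\<alpha> \<in> insert \<gamma> E" for \<alpha>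
    proof -
      have co: "v \<alpha> \<in> carrier B" "v \<gamma> \<in> carrier B" "y \<alpha> \<in> carrier B" "y \<gamma> \<in> carrier B" "w0 \<alpha> \<in> carrier B"
        using vc yc y w0 by auto
      have eq: "(s \<otimes>\<^bsub>B\<^esub> ?c) \<otimes>\<^bsub>B\<^esub> v \<alpha> \<ominus>\<^bsub>B\<^esub> ?w \<alpha>
          = (s \<otimes>\<^bsub>B\<^esub> ?c) \<otimes>\<^bsub>B\<^esub> v \<alpha> \<ominus>\<^bsub>B\<^esub> (?c \<otimes>\<^bsub>B\<^esub> y \<alpha> \<oplus>\<^bsub>B\<^esub> ?r \<otimes>\<^bsub>B\<^esub> w0 \<alpha>)"
        by (simp add: B.MA_simps)
      show ?thesis
      proof (cases "\<alpha> = \<gamma>")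
        case True
        have "(s \<otimes>\<^bsub>B\<^esub> ?c) \<otimes>\<^bsub>B\<^esub> v \<gamma> \<ominus>\<^bsub>B\<^esub> (?c \<otimes>\<^bsub>B\<^esub> y \<gamma> \<oplus>\<^bsub>B\<^esub> ?r \<otimes>\<^bsub>B\<^esub> ?c) = \<zero>\<^bsub>B\<^esub>"
          using co(2,4) cc sc by algebra
        then show ?thesis using eq True by simp
      next
        case False
        then have "\<alpha> \<in> E" using that by simp
        have "(s \<otimes>\<^bsub>B\<^esub> ?c) \<otimes>\<^bsub>B\<^esub> v \<alpha> \<ominus>\<^bsub>B\<^esub> (?c \<otimes>\<^bsub>B\<^esub> y \<alpha> \<oplus>\<^bsub>B\<^esub> ?r \<otimes>\<^bsub>B\<^esub> w0 \<alpha>)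
            = s \<otimes>\<^bsub>B\<^esub> (?c \<otimes>\<^bsub>B\<^esub> v \<alpha> \<ominus>\<^bsub>B\<^esub> v \<gamma> \<otimes>\<^bsub>B\<^esub> w0 \<alpha>) \<ominus>\<^bsub>B\<^esub> (?c \<otimes>\<^bsub>B\<^esub> y \<alpha> \<ominus>\<^bsub>B\<^esub> y \<gamma> \<otimes>\<^bsub>B\<^esub> w0 \<alpha>)"
          using co cc sc by algebra
        also have "\<dots> = s \<otimes>\<^bsub>B\<^esub> t v \<alpha> \<ominus>\<^bsub>B\<^esub> w' \<alpha>"
          unfolding y(2) t_apply[OF insert.prems(3)] t_apply[OF ycc] ..
        finally show ?thesis using eq s(3) \<open>\<alpha> \<in> E\<close> by simp
      qed
    qed
    moreover have "s \<otimes>\<^bsub>B\<^esub> ?c \<in> carrier B - spec_map B g p"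
      using s(1) w0(2) cc p'.I_prime[of s ?c] by auto
    ultimately show ?thesis using wW by (intro bexI[of _ "s \<otimes>\<^bsub>B\<^esub> ?c"] bexI[of _ ?w] ballI)
  qed
qed

end

section \<open>Standard sets and the lexicographic order\<close>

text \<open>A monomial order. The properties used below are that it is a total order, compatible
  with addition, and well-founded on exponents in \<open>n\<close> variables.\<close>

definition lex_less :: "(nat \<Rightarrow> nat) \<Rightarrow> (nat \<Rightarrow> nat) \<Rightarrow> bool" where
  "lex_less \<alpha> \<beta> \<longleftrightarrow> (\<exists>k. \<alpha> k < \<beta> k \<and> (\<forall>i<k. \<alpha> i = \<beta> i))"

lemma lex_less_irrefl: "\<not> lex_less \<alpha> \<alpha>"
  by (simp add: lex_less_def)

lemma lex_less_trans: "lex_less \<alpha> \<beta> \<Longrightarrow> lex_less \<beta> \<gamma> \<Longrightarrow> lex_less \<alpha> \<gamma>"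
proof -
  assume "lex_less \<alpha> \<beta>" "lex_less \<beta> \<gamma>"
  then obtain k l where "\<alpha> k < \<beta> k" "\<forall>i<k. \<alpha> i = \<beta> i" "\<beta> l < \<gamma> l" "\<forall>i<l. \<beta> i = \<gamma> i"
    unfolding lex_less_def by blast
  then have "\<alpha> (min k l) < \<gamma> (min k l) \<and> (\<forall>i<min k l. \<alpha> i = \<gamma> i)"
    by (cases k l rule: linorder_cases) (auto simp: min_def)
  then show ?thesis unfolding lex_less_def by blast
qed

lemma lex_less_total: "\<alpha> \<noteq> \<beta> \<Longrightarrow> lex_less \<alpha> \<beta> \<or> lex_less \<beta> \<alpha>"
proof -
  assume "\<alpha> \<noteq> \<beta>"
  then have ex: "\<exists>k. \<alpha> k \<noteq> \<beta> k" by auto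
  define k where "k = (LEAST k. \<alpha> k \<noteq> \<beta> k)"
  have k: "\<alpha> k \<noteq> \<beta> k" unfolding k_def by (rule LeastI_ex[OF ex])
  have eq: "\<alpha> i = \<beta> i" if "i < k" for i
    using not_less_Least[of i "\<lambda>k. \<alpha> k \<noteq> \<beta> k"] that unfolding k_def by blast
  show ?thesis
  proof (cases "\<alpha> k < \<beta> k")
    case True then show ?thesis unfolding lex_less_def using eq by blast
  next
    case False
    then have "\<beta> k < \<alpha> k" using k by simp
    then show ?thesis unfolding lex_less_def using eq by metis
  qed
qed

lemma lex_less_add: "lex_less \<alpha> \<beta> \<Longrightarrow> lex_less (\<lambda>i. \<alpha> i + \<gamma> i) (\<lambda>i. \<beta> i + \<gamma> i)"
  by (auto simp: lex_less_def)

text \<open>Listing the first \<open>n\<close> entries turns the order into the lexicographic order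
  on lists of fixed length, which is well-founded. Restricting to \<open>expos n\<close> ensures
  that the deciding index is below \<open>n\<close>.\<close>

lemma lex_less_wf: "wf {(\<alpha>, \<beta>). \<alpha> \<in> carrier (expos n) \<and> \<beta> \<in> carrier (expos n) \<and> lex_less \<alpha> \<beta>}"
proof (rule wf_subset[OF wf_inv_image[OF wf_lexn[OF wf_less_than], of n "\<lambda>\<alpha>. map \<alpha> [0..<n]"]])
  show "{(\<alpha>, \<beta>). \<alpha> \<in> carrier (expos n) \<and> \<beta> \<in> carrier (expos n) \<and> lex_less \<alpha> \<beta>}
      \<subseteq> inv_image (lexn less_than n) (\<lambda>\<alpha>. map \<alpha> [0..<n])"
  proof (clarify)
    fix \<alpha> \<beta> assume c: "\<alpha> \<in> carrier (expos n)" "\<beta> \<in> carrier (expos n)" "lex_less \<alpha> \<beta>"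
    obtain k where k: "\<alpha> k < \<beta> k" "\<forall>i<k. \<alpha> i = \<beta> i" using c(3) unfolding lex_less_def by blast
    have kn: "k < n"
    proof (rule ccontr)
      assume "\<not> k < n"
      then show False using k(1) c(2) by simp
    qed
    have split: "[0..<n] = [0..<k] @ k # [Suc k..<n]"
      using kn upt_add_eq_append[of 0 k "n - k"] upt_conv_Cons[of k n] by simp
    have "map \<alpha> [0..<k] = map \<beta> [0..<k]" using k(2) by simp
    then have "map \<alpha> [0..<n] = map \<beta> [0..<k] @ \<alpha> k # map \<alpha> [Suc k..<n]"
      "map \<beta> [0..<n] = map \<beta> [0..<k] @ \<beta> k # map \<beta> [Suc k..<n]"
      unfolding split by simp_all
    then have "\<exists>xys x y xs' ys'. map \<alpha> [0..<n] = xys @ x # xs' \<and> map \<beta> [0..<n] = xys @ y # ys' \<and>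
        (x, y) \<in> less_than"
      using k(1) by (intro exI conjI) auto
    then show "(\<alpha>, \<beta>) \<in> inv_image (lexn less_than n) (\<lambda>\<alpha>. map \<alpha> [0..<n])"
      unfolding in_inv_image lexn_conv by simp
  qed
qed

lemma lex_max: "finite Z \<Longrightarrow> Z \<noteq> {} \<Longrightarrow> \<exists>m\<in>Z. \<forall>z\<in>Z. z = m \<or> lex_less z m"
proof (induction Z rule: finite_ne_induct)
  case (insert x F)
  then obtain m where m: "m \<in> F" "\<forall>z\<in>F. z = m \<or> lex_less z m" by blast
  show ?case
  proof (cases "lex_less x m")
    case True
    then show ?thesis using m by (intro bexI[of _ m]) auto
  next
    case False
    then have "lex_less m x" using lex_less_total[of x m] m insert.hyps by blast
    then have "z = x \<or> lex_less z x" if "z \<in> insert x F" for z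
      using m(2) lex_less_trans[of z m x] that by (cases "z = x") auto
    then show ?thesis by (intro bexI[of _ x]) auto
  qed
qed auto

section \<open>Elimination modulo a prime ideal, and maximal ideals\<close>

context cring
begin

text \<open>The bookkeeping for one elimination step in \<open>underdetermined\<close>, with
  \<open>w\<close> as the pivot.\<close>

lemma finsum_elim:
  assumes "finite M" "c \<in> M \<rightarrow> carrier R" "x \<in> M \<rightarrow> carrier R" "y \<in> M \<rightarrow> carrier R"
    and wd: "w \<in> carrier R" "d \<in> carrier R"
  shows "finsum R (\<lambda>i. c i \<otimes> (w \<otimes> x i \<ominus> y i \<otimes> d)) M
    = finsum R (\<lambda>i. (w \<otimes> c i) \<otimes> x i) M \<oplus> (\<ominus> finsum R (\<lambda>i. c i \<otimes> y i) M) \<otimes> d"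
  using assms(1-4)
proof (induction M rule: finite_induct)
  case empty then show ?case using wd by simp
next
  case (insert j M)
  have cl: "c j \<in> carrier R" "x j \<in> carrier R" "y j \<in> carrier R"
    "finsum R (\<lambda>i. (w \<otimes> c i) \<otimes> x i) M \<in> carrier R" "finsum R (\<lambda>i. c i \<otimes> y i) M \<in> carrier R"
    using insert.prems wd by (auto intro!: finsum_closed simp: Pi_iff)
  have "c j \<otimes> (w \<otimes> x j \<ominus> y j \<otimes> d) \<oplus> (u \<oplus> (\<ominus> v) \<otimes> d) = ((w \<otimes> c j) \<otimes> x j \<oplus> u) \<oplus> (\<ominus> (c j \<otimes> y j \<oplus> v)) \<otimes> d"
    if "u \<in> carrier R" "v \<in> carrier R" for u v
    using cl wd that by algebra
  from this[OF cl(4,5)] insert show ?case using wd cl by (simp add: Pi_iff)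
qed

text \<open>Zorn's lemma for the ideals that contain \<open>J\<close> and avoid one; the union of a
  nonempty chain of such ideals is again one.\<close>

lemma ex_maximalideal:
  assumes J: "ideal J R" and one: "\<one> \<notin> J"
  shows "\<exists>M. maximalideal M R \<and> J \<subseteq> M"
proof -
  let ?A = "{Q. ideal Q R \<and> J \<subseteq> Q \<and> \<one> \<notin> Q}"
  have "\<exists>M\<in>?A. \<forall>X\<in>?A. M \<subseteq> X \<longrightarrow> X = M"
  proof (rule subset_Zorn_nonempty)
    show "?A \<noteq> {}" using assms by blast
    fix C assume C: "C \<noteq> {}" "subset.chain ?A C"
    then have id: "\<And>Q. Q \<in> C \<Longrightarrow> ideal Q R" and sub: "\<And>Q. Q \<in> C \<Longrightarrow> J \<subseteq> Q" "\<And>Q. Q \<in> C \<Longrightarrow> \<one> \<notin> Q"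
      and chain: "\<And>X Y. X \<in> C \<Longrightarrow> Y \<in> C \<Longrightarrow> X \<subseteq> Y \<or> Y \<subseteq> X"
      unfolding pred_on.chain_def by blast+
    note sg = ideal.axioms(1)[OF id]
    have "ideal (\<Union>C) R"
    proof (rule idealI[OF ring_axioms])
      show "subgroup (\<Union>C) (add_monoid R)"
      proof (rule add.subgroupI)
        show "\<Union>C \<subseteq> carrier R" using ideal.Icarr[OF id] by blast
        show "\<Union>C \<noteq> {}" using C(1) additive_subgroup.zero_closed[OF sg] by blast
        show "\<ominus> a \<in> \<Union>C" if "a \<in> \<Union>C" for a
          using that additive_subgroup.a_inv_closed[OF sg] by blast
        show "a \<oplus> b \<in> \<Union>C" if ab: "a \<in> \<Union>C" "b \<in> \<Union>C" for a b
        proof -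
          obtain X where "X \<in> C" "a \<in> X" "b \<in> X" using ab chain by blast
          then show ?thesis using additive_subgroup.a_closed[OF sg] by blast
        qed
      qed
    qed (use ideal.I_l_closed[OF id] ideal.I_r_closed[OF id] in blast)+
    then show "\<Union>C \<in> ?A" using C(1) sub by blast
  qed
  then obtain M where MA: "M \<in> ?A" and max: "\<forall>X\<in>?A. M \<subseteq> X \<longrightarrow> X = M"
    by (elim bexE) (rule that)
  have M: "ideal M R" "J \<subseteq> M" "\<one> \<notin> M" using MA by simp_all
  have "maximalideal M R"
  proof (rule maximalidealI[OF M(1)])
    show "carrier R \<noteq> M" using M(3) by blast
    show "X = M \<or> X = carrier R" if X: "ideal X R" "M \<subseteq> X" "X \<subseteq> carrier R" for X
    proof (cases "\<one> \<in> X")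
      case True
      then show ?thesis using ideal.one_imp_carrier[OF X(1)] by simp
    next
      case False
      then have "X \<in> ?A" using X M(2) by simp
      then show ?thesis using bspec[OF max] X(2) by simp
    qed
  qed
  then show ?thesis using M(2) by (intro exI[of _ M] conjI)
qed

lemma prime_avoiding_one: "ideal J R \<Longrightarrow> \<one> \<notin> J \<Longrightarrow> \<exists>Q. primeideal Q R \<and> J \<subseteq> Q"
  using ex_maximalideal maximalideal_prime by blast

end

lemma (in ideal) finsum_mem: "u \<in> J \<rightarrow> I \<Longrightarrow> finsum R u J \<in> I"
proof (induction J rule: infinite_finite_induct)
  case (insert j J)
  then have "finsum R u (insert j J) = u j \<oplus> finsum R u J"
    using Icarr by (intro finsum_insert) (auto simp: Pi_iff)
  then show ?case using insert by (auto simp: Pi_iff)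
qed (auto simp: finsum_infinite)

text \<open>Equations are removed one at a time, each at the cost of at most one unknown, by
  cross-multiplication. Over the fraction field of \<open>R/I\<close> this is the nontrivial
  solution of a homogeneous system with fewer equations than unknowns.\<close>

lemma (in primeideal) underdetermined:
  assumes "finite J"
  shows "finite M \<Longrightarrow> card J < card M \<Longrightarrow> (\<And>i j. i \<in> M \<Longrightarrow> j \<in> J \<Longrightarrow> a i j \<in> carrier R) \<Longrightarrow>
    \<exists>c. c \<in> M \<rightarrow> carrier R \<and> (\<exists>i\<in>M. c i \<notin> I) \<and> (\<forall>j\<in>J. finsum R (\<lambda>i. c i \<otimes> a i j) M \<in> I)"
  using assms
proof (induction J arbitrary: M a rule: finite_induct)
  case (empty M a)
  have "\<one> \<notin> I" using one_imp_carrier I_notcarr by blast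
  moreover have "M \<noteq> {}" using empty by auto
  ultimately show ?case by (intro exI[of _ "\<lambda>_. \<one>"]) auto
next
  case (insert j J M a)
  show ?case
  proof (cases "\<forall>i\<in>M. a i j \<in> I")
    case True
    have "card J < card M" using insert by simp
    then obtain c where c: "c \<in> M \<rightarrow> carrier R" "\<exists>i\<in>M. c i \<notin> I"
      "\<forall>j\<in>J. finsum R (\<lambda>i. c i \<otimes> a i j) M \<in> I"
      using insert.IH[OF insert.prems(1), of a] insert.prems(3) by auto
    have "finsum R (\<lambda>i. c i \<otimes> a i j) M \<in> I"
      using c(1) True by (intro finsum_mem) (auto intro: I_l_closed)
    then show ?thesis using c by (intro exI[of _ c]) auto
  next
    case False
    then obtain i0 where i0: "i0 \<in> M" "a i0 j \<notin> I" by blast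
    let ?M = "M - {i0}" and ?w = "a i0 j"
    \<comment> \<open>Cross-multiplication with the pivot row \<open>i0\<close>, which makes all
      entries in column \<open>j\<close> vanish.\<close>
    define a' where "a' i k = ?w \<otimes> a i k \<ominus> a i j \<otimes> a i0 k" for i k
    have ac: "a i k \<in> carrier R" if "i \<in> M" "k \<in> insert j J" for i k
      using insert.prems(3) that by blast
    have M: "finite ?M" "card J < card ?M"
      using insert.prems(1,2) insert.hyps i0(1) by auto
    have a'c: "a' i k \<in> carrier R" if "i \<in> ?M" "k \<in> J" for i k
      unfolding a'_def using ac i0(1) that by simp
    have "\<exists>c. c \<in> ?M \<rightarrow> carrier R \<and> (\<exists>i\<in>?M. c i \<notin> I) \<and>
        (\<forall>k\<in>J. finsum R (\<lambda>i. c i \<otimes> a' i k) ?M \<in> I)"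
      by (rule insert.IH[OF M]) (rule a'c)
    then obtain c where c: "c \<in> ?M \<rightarrow> carrier R" "\<exists>i\<in>?M. c i \<notin> I"
      "\<forall>k\<in>J. finsum R (\<lambda>i. c i \<otimes> a' i k) ?M \<in> I" by (elim exE conjE) (rule that)
    define s where "s = finsum R (\<lambda>i. c i \<otimes> a i j) ?M"
    \<comment> \<open>The unknown \<open>i0\<close> receives the value that makes equation
      \<open>j\<close> hold exactly. The others are multiplied by the pivot, which lies outside the
      prime \<open>I\<close> and so keeps the solution nontrivial.\<close>
    define b where "b i = (if i = i0 then \<ominus> s else ?w \<otimes> c i)" for i
    have sc: "s \<in> carrier R" unfolding s_def using c(1) ac by (auto intro!: finsum_closed simp: Pi_iff)
    have wc: "?w \<in> carrier R" using ac i0(1) by blast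
    have bc: "b \<in> M \<rightarrow> carrier R" using c(1) sc wc by (auto simp: b_def Pi_iff)
    have sum: "finsum R (\<lambda>i. b i \<otimes> a i k) M = finsum R (\<lambda>i. c i \<otimes> a' i k) ?M" if k: "k \<in> insert j J" for k
    proof -
      have "finsum R (\<lambda>i. b i \<otimes> a i k) M = finsum R (\<lambda>i. b i \<otimes> a i k) (insert i0 ?M)"
        using i0(1) by (simp add: insert_absorb)
      also have "\<dots> = b i0 \<otimes> a i0 k \<oplus> finsum R (\<lambda>i. b i \<otimes> a i k) ?M"
        using M(1) bc ac[OF _ k] i0(1) by (intro finsum_insert) (auto simp: Pi_iff)
      also have "finsum R (\<lambda>i. b i \<otimes> a i k) ?M = finsum R (\<lambda>i. (?w \<otimes> c i) \<otimes> a i k) ?M"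
        using c(1) wc ac[OF _ k] by (intro finsum_cong') (auto simp: b_def Pi_iff)
      also have "b i0 \<otimes> a i0 k \<oplus> finsum R (\<lambda>i. (?w \<otimes> c i) \<otimes> a i k) ?M
          = finsum R (\<lambda>i. (?w \<otimes> c i) \<otimes> a i k) ?M \<oplus> (\<ominus> s) \<otimes> a i0 k"
        unfolding b_def using c(1) wc sc ac[OF _ k] i0(1)
        by (subst a_comm) (auto intro!: finsum_closed simp: Pi_iff)
      also have "\<dots> = finsum R (\<lambda>i. c i \<otimes> a' i k) ?M"
        unfolding s_def a'_def using M(1) c(1) ac k i0(1)
        by (intro finsum_elim[symmetric]) (auto simp: Pi_iff)
      finally show ?thesis .
    qed
    have "finsum R (\<lambda>i. b i \<otimes> a i j) M = \<zero>"
    proof -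
      have "finsum R (\<lambda>i. c i \<otimes> a' i j) ?M = \<zero>"
      proof (rule add.finprod_one_eqI)
        fix i assume i: "i \<in> ?M"
        have "a i j \<in> carrier R" "c i \<in> carrier R" using ac i c(1) by auto
        then show "c i \<otimes> a' i j = \<zero>"
          unfolding a'_def using wc by (simp add: m_comm[of "a i j"] a_minus_def r_neg)
      qed
      then show ?thesis using sum[of j] by simp
    qed
    moreover have "\<exists>i\<in>M. b i \<notin> I"
    proof -
      obtain i where i: "i \<in> ?M" "c i \<notin> I" using c(2) by blast
      then have "?w \<otimes> c i \<notin> I" using I_prime[of ?w "c i"] i0(2) wc c(1) by auto
      then show ?thesis using i by (intro bexI[of _ i]) (auto simp: b_def)
    qed
    ultimately show ?thesis
      using bc c(3) sum by (intro exI[of _ b] conjI ballI) auto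
  qed
qed

context mpoly_ring
begin

lemma mpoly_span_minimal:
  assumes N: "submodule N R P" and mem: "\<And>x. x \<in> Y \<Longrightarrow> x \<in> carrier (expos n) \<Longrightarrow> mon \<one> x \<in> N"
  shows "mpoly_span n R Y \<subseteq> N"
proof
  fix p assume "p \<in> mpoly_span n R Y"
  then have p: "p \<in> carrier P" "supp p \<subseteq> Y" by (auto simp: mpoly_span_iff)
  have "p = finsum P (\<lambda>x. p x \<odot>\<^bsub>P\<^esub> basis_elt R x) (supp p)"
    by (rule MA_expand[OF p(1)]) (use p(1) supp_carrier in auto)
  also have "\<dots> \<in> N"
  proof (rule P.submodule_finsum[OF N], rule Pi_I)
    fix x assume "x \<in> supp p"
    then have "basis_elt R x \<in> N" using mem[of x] p(2) supp_carrier[OF p(1)] by (auto simp: basis_elt_mon)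
    then show "p x \<odot>\<^bsub>P\<^esub> basis_elt R x \<in> N" by (rule P.submoduleE(4)[OF N MA_coeff[OF p(1)]])
  qed
  finally show "p \<in> N" .
qed

end

section \<open>The standard set of a fibre\<close>

context mpoly_basis
begin

abbreviation "L \<equiv> P.sat T K0"

text \<open>The polynomials whose image in the fibre lies in the span of the monomials from
  \<open>Y\<close>.\<close>

definition cl :: "(nat \<Rightarrow> nat) set \<Rightarrow> ((nat \<Rightarrow> nat) \<Rightarrow> 'a) set" where
  "cl Y = P.sat T (mpoly_span n R Y <+>\<^bsub>P\<^esub> K0)"

lemma sum_sub: "submodule (mpoly_span n R Y <+>\<^bsub>P\<^esub> K0) R P"
  by (intro P.submodule_set_add mpoly_span_submodule K0_sub)

lemma cl_sub: "submodule (cl Y) R P"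
  unfolding cl_def by (rule satT_sub[OF sum_sub])

lemma span_cl: "mpoly_span n R Y \<subseteq> cl Y"
  using P.set_add_mem1[OF mpoly_span_submodule K0_sub] satT_sup[OF sum_sub] unfolding cl_def by blast

lemma K0_cl: "K0 \<subseteq> cl Y"
  using P.set_add_mem2[OF mpoly_span_submodule K0_sub] satT_sup[OF sum_sub] unfolding cl_def by blast

lemma cl_sat: "x \<in> P.sat T (cl Y) \<Longrightarrow> x \<in> cl Y"
  unfolding cl_def by (rule P.sat_sat[OF T_mult sum_sub])

lemma L_cl: "L \<subseteq> cl Y"
  using P.sat_mono[OF K0_cl, of T Y] cl_sat by blast

lemma cl_minimal: "mpoly_span n R Y \<subseteq> cl Z \<Longrightarrow> cl Y \<subseteq> cl Z"
  unfolding cl_def[of Y]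
  using P.sat_mono[OF P.set_add_subset[OF cl_sub[of Z] _ K0_cl[of Z]], of "mpoly_span n R Y" T] cl_sat by blast

lemma L_sub: "submodule L R P" by (rule satT_sub[OF K0_sub])

text \<open>\<open>K0\<close> need not be an ideal, since the multiples of the \<open>e i\<close> by
  \<open>Q\<close> need not be stable under multiplication by polynomials. The product still
  vanishes in the fibre, because \<open>Q\<close> times any polynomial does.\<close>

lemma K0_mult_L:
  assumes y: "y \<in> K0" and r: "r \<in> carrier P" shows "y \<otimes>\<^bsub>P\<^esub> r \<in> L"
proof -
  interpret I: ideal I P by (rule I)
  let ?N = "{y \<in> carrier P. y \<otimes>\<^bsub>P\<^esub> r \<in> L}"
  note LE = P.submoduleE[OF L_sub]
  have N: "submodule ?N R P"
  proof (rule P.submoduleI)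
    show "\<zero>\<^bsub>P\<^esub> \<in> ?N" using r P.submodule_zero[OF L_sub] by simp
    show "\<ominus>\<^bsub>P\<^esub> a \<in> ?N" if "a \<in> ?N" for a using that r LE(3) by (simp add: P.l_minus)
    show "a \<oplus>\<^bsub>P\<^esub> b \<in> ?N" if "a \<in> ?N" "b \<in> ?N" for a b using that r LE(5) by (simp add: P.l_distr)
    show "a \<odot>\<^bsub>P\<^esub> x \<in> ?N" if "a \<in> carrier R" "x \<in> ?N" for a x
      using that r LE(4) by (simp add: P.smult_assoc2)
  qed auto
  have "P.lin d e Q \<subseteq> ?N"
  proof (rule P.lin_subset'[OF N])
    fix a i assume ai: "a \<in> Q" "i < d"
    have ac: "a \<in> carrier R" by (rule Q.Icarr[OF ai(1)])
    show "a \<odot>\<^bsub>P\<^esub> e i \<in> ?N"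
      using Q_smult_L[OF ai(1), of "e i \<otimes>\<^bsub>P\<^esub> r"] ac e_carr[OF ai(2)] r by (simp add: P.smult_assoc2)
  qed
  moreover have "I \<subseteq> L"
    using P.set_add_mem2[OF lin_Q_sub I_sub] satT_sup[OF K0_sub] unfolding K0_def by blast
  then have "I \<subseteq> ?N" using I.I_r_closed r I.Icarr by blast
  ultimately have "P.lin d e Q <+>\<^bsub>P\<^esub> I \<subseteq> ?N" by (rule P.set_add_subset[OF N])
  moreover have "y \<in> P.lin d e Q <+>\<^bsub>P\<^esub> I" using y unfolding K0_def .
  ultimately show ?thesis by blast
qed

abbreviation "X \<equiv> carrier (expos n)"

text \<open>The exponents whose monomial does not reduce to lexicographically smaller ones in the fibre
  over \<open>Q\<close>: the complement of the leading exponents.\<close>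

definition \<Delta> where "\<Delta> = {\<gamma> \<in> X. mon \<one> \<gamma> \<notin> cl {\<delta> \<in> X. lex_less \<delta> \<gamma>}}"

text \<open>A reduction of the monomial of \<open>\<alpha>\<close> to smaller ones, multiplied by
  the monomial of \<open>\<gamma>\<close>, is a reduction for \<open>\<alpha> + \<gamma>\<close>:
  the order is compatible with addition, and what vanishes in the fibre is stable under
  multiplication.\<close>

lemma \<Delta>_standard: "standard_set n \<Delta>"
  unfolding standard_set_def
proof (intro conjI ballI)
  show "\<Delta> \<subseteq> X" by (auto simp: \<Delta>_def)
  fix \<alpha> \<gamma> assume \<alpha>: "\<alpha> \<in> X - \<Delta>" and \<gamma>: "\<gamma> \<in> X"
  let ?Y = "{\<delta> \<in> X. lex_less \<delta> \<alpha>}" and ?Z = "{\<delta> \<in> X. lex_less \<delta> (\<alpha> \<otimes>\<^bsub>expos n\<^esub> \<gamma>)}"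
  let ?m = "mon \<one> \<gamma>"
  have m: "?m \<in> carrier P" using \<gamma> by simp
  have sum: "\<alpha> \<otimes>\<^bsub>expos n\<^esub> \<gamma> \<in> X" using \<alpha> \<gamma> by simp
  have \<alpha>X: "\<alpha> \<in> X" using \<alpha> by blast
  have "mon \<one> \<alpha> \<in> cl ?Y" using \<alpha> unfolding \<Delta>_def by blast
  then obtain s u k where s: "s \<in> T" "u \<in> mpoly_span n R ?Y" "k \<in> K0" "s \<odot>\<^bsub>P\<^esub> mon \<one> \<alpha> = u \<oplus>\<^bsub>P\<^esub> k"
    unfolding cl_def P.sat_def P.set_add_iff by blast
  note CE = P.submoduleE[OF cl_sub[of ?Z]]
  let ?N = "{y \<in> carrier P. y \<otimes>\<^bsub>P\<^esub> ?m \<in> cl ?Z}"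
  have N: "submodule ?N R P"
  proof (rule P.submoduleI)
    show "\<zero>\<^bsub>P\<^esub> \<in> ?N" using m P.submodule_zero[OF cl_sub] by simp
    show "\<ominus>\<^bsub>P\<^esub> a \<in> ?N" if "a \<in> ?N" for a using that m CE(3) by (simp add: P.l_minus)
    show "a \<oplus>\<^bsub>P\<^esub> b \<in> ?N" if "a \<in> ?N" "b \<in> ?N" for a b using that m CE(5) by (simp add: P.l_distr)
    show "a \<odot>\<^bsub>P\<^esub> x \<in> ?N" if "a \<in> carrier R" "x \<in> ?N" for a x
      using that m CE(4) by (simp add: P.smult_assoc2)
  qed auto
  have "mpoly_span n R ?Y \<subseteq> ?N"
  proof (rule mpoly_span_minimal[OF N])
    fix \<delta> assume \<delta>: "\<delta> \<in> ?Y" "\<delta> \<in> X"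
    have "\<delta> \<otimes>\<^bsub>expos n\<^esub> \<gamma> \<in> ?Z" using \<delta> \<gamma> lex_less_add[of \<delta> \<alpha> \<gamma>] by simp
    then have "mon \<one> (\<delta> \<otimes>\<^bsub>expos n\<^esub> \<gamma>) \<in> cl ?Z"
      using mon_in_mpoly_span[of \<one> "\<delta> \<otimes>\<^bsub>expos n\<^esub> \<gamma>" ?Z] span_cl by blast
    then show "mon \<one> \<delta> \<in> ?N"
      using \<delta>(2) \<gamma> mon_mult[OF one_closed one_closed \<delta>(2) \<gamma>] mon_closed[OF one_closed \<delta>(2)] by simp
  qed
  then have "u \<otimes>\<^bsub>P\<^esub> ?m \<in> cl ?Z" using s(2) by blast
  moreover have "k \<otimes>\<^bsub>P\<^esub> ?m \<in> cl ?Z" using K0_mult_L[OF s(3) m] L_cl by blast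
  moreover have "s \<odot>\<^bsub>P\<^esub> mon \<one> (\<alpha> \<otimes>\<^bsub>expos n\<^esub> \<gamma>) = u \<otimes>\<^bsub>P\<^esub> ?m \<oplus>\<^bsub>P\<^esub> k \<otimes>\<^bsub>P\<^esub> ?m"
  proof -
    have c: "u \<in> carrier P" "k \<in> carrier P" "mon \<one> \<alpha> \<in> carrier P"
      using s(2,3) P.submoduleE(1)[OF K0_sub] mon_closed[OF one_closed \<alpha>X] by (auto simp: mpoly_span_iff)
    have "mon \<one> (\<alpha> \<otimes>\<^bsub>expos n\<^esub> \<gamma>) = mon \<one> \<alpha> \<otimes>\<^bsub>P\<^esub> ?m"
      using mon_mult[OF one_closed one_closed \<alpha>X \<gamma>] by simp
    then have "s \<odot>\<^bsub>P\<^esub> mon \<one> (\<alpha> \<otimes>\<^bsub>expos n\<^esub> \<gamma>) = (s \<odot>\<^bsub>P\<^esub> mon \<one> \<alpha>) \<otimes>\<^bsub>P\<^esub> ?m"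
      using s(1) c m by (simp add: P.smult_assoc2)
    then show ?thesis unfolding s(4) using P.l_distr[OF c(1,2) m] by simp
  qed
  ultimately have "s \<odot>\<^bsub>P\<^esub> mon \<one> (\<alpha> \<otimes>\<^bsub>expos n\<^esub> \<gamma>) \<in> cl ?Z" using CE(5) by simp
  then have "mon \<one> (\<alpha> \<otimes>\<^bsub>expos n\<^esub> \<gamma>) \<in> P.sat T (cl ?Z)"
    unfolding P.sat_def using s(1) mon_closed[OF one_closed sum] by blast
  then have "mon \<one> (\<alpha> \<otimes>\<^bsub>expos n\<^esub> \<gamma>) \<in> cl ?Z" by (rule cl_sat)
  then have "\<alpha> \<otimes>\<^bsub>expos n\<^esub> \<gamma> \<notin> \<Delta>" unfolding \<Delta>_def by blast
  then show "\<alpha> \<otimes>\<^bsub>expos n\<^esub> \<gamma> \<in> X - \<Delta>" using sum by blast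
qed

text \<open>Well-founded induction along the order: a monomial outside \<open>\<Delta>\<close>
  reduces to smaller ones, which already lie in the span.\<close>

lemma \<Delta>_spans: "cl \<Delta> = carrier P"
proof (rule submodule_carrierI[OF cl_sub])
  fix \<gamma> assume "\<gamma> \<in> X"
  with lex_less_wf[of n] show "mon \<one> \<gamma> \<in> cl \<Delta>"
  proof (induction \<gamma> rule: wf_induct_rule)
    case (less \<gamma>)
    show ?case
    proof (cases "\<gamma> \<in> \<Delta>")
      case True
      then show ?thesis using mon_in_mpoly_span[OF one_closed less.prems] span_cl by blast
    next
      case False
      then have "mon \<one> \<gamma> \<in> cl {\<delta> \<in> X. lex_less \<delta> \<gamma>}" using less.prems unfolding \<Delta>_def by blast
      moreover have "mpoly_span n R {\<delta> \<in> X. lex_less \<delta> \<gamma>} \<subseteq> cl \<Delta>"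
        using less by (intro mpoly_span_minimal[OF cl_sub]) blast
      ultimately show ?thesis using cl_minimal by blast
    qed
  qed
qed

text \<open>If some coefficient were outside \<open>Q\<close>, the largest monomial with such a
  coefficient could be expressed by smaller ones in the fibre, which contradicts its membership in
  \<open>\<Delta>\<close>.\<close>

lemma \<Delta>_indep:
  assumes u: "u \<in> mpoly_span n R \<Delta>" "u \<in> L"
  shows "u \<beta> \<in> Q"
proof (rule ccontr)
  assume "u \<beta> \<notin> Q"
  have uc: "u \<in> carrier P" and us: "supp u \<subseteq> \<Delta>" using u(1) by (auto simp: mpoly_span_iff)
  note co = MA_coeff[OF uc]
  let ?Z = "{\<gamma>. u \<gamma> \<notin> Q}"
  have "?Z \<subseteq> supp u" using not_supp[of _ u] Q.zero_closed by fastforce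
  then have Z: "finite ?Z" "?Z \<subseteq> \<Delta>" using supp_finite[OF uc] us finite_subset by blast+
  moreover have "?Z \<noteq> {}" using \<open>u \<beta> \<notin> Q\<close> by blast
  ultimately obtain \<gamma> where \<gamma>: "u \<gamma> \<notin> Q" "\<And>z. u z \<notin> Q \<Longrightarrow> z = \<gamma> \<or> lex_less z \<gamma>"
    using lex_max[of ?Z] by blast
  have \<gamma>\<Delta>: "\<gamma> \<in> \<Delta>" "\<gamma> \<in> X" using \<gamma>(1) Z(2) by (auto simp: \<Delta>_def)
  let ?Y = "{\<delta> \<in> X. lex_less \<delta> \<gamma>}"
  \<comment> \<open>\<open>u\<close> is split at \<open>\<gamma>\<close>: \<open>v\<close> collects
    the smaller terms, and \<open>z\<close> the larger ones, whose coefficients all lie in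
    \<open>Q\<close>, so that \<open>z\<close> vanishes in the fibre.\<close>
  define v where "v x = (if lex_less x \<gamma> then u x else \<zero>)" for x
  define z where "z x = (if lex_less x \<gamma> \<or> x = \<gamma> then \<zero> else u x)" for x
  have vc: "v \<in> carrier P" and zc: "z \<in> carrier P"
    using supp_carrier[OF uc] supp_finite[OF uc] co
    by (auto intro!: MA_I[where S = "supp u"] simp: v_def z_def not_supp)
  have "supp v \<subseteq> ?Y" using supp_carrier[OF uc] by (auto simp: supp_def v_def)
  with vc have "v \<in> mpoly_span n R ?Y" unfolding mpoly_span_iff by (rule conjI)
  then have v: "v \<in> cl ?Y" using span_cl by blast
  have "z x \<in> Q" for x using \<gamma>(2)[of x] Q.zero_closed by (auto simp: z_def)
  then have z: "z \<in> cl ?Y" using coeffs_Q_L[OF zc] L_cl by blast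
  have m: "mon \<one> \<gamma> \<in> carrier P" using mon_closed[OF one_closed \<gamma>\<Delta>(2)] .
  have "u \<gamma> \<odot>\<^bsub>P\<^esub> mon \<one> \<gamma> = u \<ominus>\<^bsub>P\<^esub> (v \<oplus>\<^bsub>P\<^esub> z)"
  proof
    fix x
    have vz: "v \<oplus>\<^bsub>P\<^esub> z \<in> carrier P" using vc zc by simp
    show "(u \<gamma> \<odot>\<^bsub>P\<^esub> mon \<one> \<gamma>) x = (u \<ominus>\<^bsub>P\<^esub> (v \<oplus>\<^bsub>P\<^esub> z)) x"
      unfolding MA_minus[OF uc vz] using co[of x] co[of \<gamma>] lex_less_irrefl[of \<gamma>]
      by (auto simp: MA_simps mon_apply v_def z_def a_minus_def r_neg)
  qed
  also have "\<dots> \<in> cl ?Y"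
    using u(2) L_cl[of ?Y] P.submoduleE(5)[OF cl_sub v z] by (intro P.submodule_minus[OF cl_sub]) blast+
  finally have "mon \<one> \<gamma> \<in> P.sat T (cl ?Y)" unfolding P.sat_def using m \<gamma>(1) co by blast
  then have "mon \<one> \<gamma> \<in> cl ?Y" by (rule cl_sat)
  then show False using \<gamma>\<Delta> unfolding \<Delta>_def by blast
qed

text \<open>More than \<open>d\<close> monomials of \<open>\<Delta>\<close>, expanded in the
  \<open>d\<close> elements \<open>e i\<close>, would satisfy a relation in the fibre with a
  coefficient outside \<open>Q\<close>, against \<open>\<Delta>_indep\<close>. The form with finite
  subsets also yields the finiteness of \<open>\<Delta>\<close>.\<close>

lemma card_\<Delta>_le:
  assumes M: "M \<subseteq> \<Delta>" "finite M" shows "card M \<le> d"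
proof (rule ccontr)
  assume "\<not> card M \<le> d"
  then have card: "card {..<d} < card M" by simp
  have MX: "M \<subseteq> X" using M(1) by (auto simp: \<Delta>_def)
  have bc: "basis_elt R \<beta> \<in> carrier P" if "\<beta> \<in> M" for \<beta>
    using MX that mon_closed[OF one_closed] by (auto simp: basis_elt_mon)
  \<comment> \<open>The triple \<open>w\<close> holds the denominator, the coefficients and the
    remainder of one expansion, so that they are chosen together.\<close>
  define \<Phi> where "\<Phi> \<beta> w \<longleftrightarrow> fst w \<in> T \<and> fst (snd w) \<in> {..<d} \<rightarrow> carrier R \<and> snd (snd w) \<in> I \<and>
      fst w \<odot>\<^bsub>P\<^esub> basis_elt R \<beta> = finsum P (\<lambda>i. fst (snd w) i \<odot>\<^bsub>P\<^esub> e i) {..<d} \<oplus>\<^bsub>P\<^esub> snd (snd w)" for \<beta> w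
  have ex: "\<exists>w. \<Phi> \<beta> w" if "\<beta> \<in> M" for \<beta>
  proof -
    obtain l :: nat and c k where c: "c \<in> {..<d} \<rightarrow> carrier R" "k \<in> I"
      "f [^] l \<odot>\<^bsub>P\<^esub> basis_elt R \<beta> = finsum P (\<lambda>i. c i \<odot>\<^bsub>P\<^esub> e i) {..<d} \<oplus>\<^bsub>P\<^esub> k"
      using span[OF bc[OF \<open>\<beta> \<in> M\<close>]] by (elim exE bexE) (rule that)
    have "\<Phi> \<beta> (f [^] l, c, k)" unfolding \<Phi>_def fst_conv snd_conv using c f_pow by (intro conjI)
    then show ?thesis by (rule exI)
  qed
  define D where "D \<beta> = (SOME w. \<Phi> \<beta> w)" for \<beta>
  have D: "\<Phi> \<beta> (D \<beta>)" if "\<beta> \<in> M" for \<beta>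
    unfolding D_def by (rule someI_ex[OF ex[OF that]])
  define s where "s \<beta> = fst (D \<beta>)" for \<beta>
  define a where "a \<beta> = fst (snd (D \<beta>))" for \<beta>
  define k where "k \<beta> = snd (snd (D \<beta>))" for \<beta>
  have s: "s \<beta> \<in> T" and a: "a \<beta> \<in> {..<d} \<rightarrow> carrier R" and k: "k \<beta> \<in> I"
    and eq: "s \<beta> \<odot>\<^bsub>P\<^esub> basis_elt R \<beta> = finsum P (\<lambda>i. a \<beta> i \<odot>\<^bsub>P\<^esub> e i) {..<d} \<oplus>\<^bsub>P\<^esub> k \<beta>"
    if "\<beta> \<in> M" for \<beta> using D[OF that] unfolding \<Phi>_def s_def a_def k_def by simp_all
  have ac: "a \<beta> i \<in> carrier R" if "\<beta> \<in> M" "i \<in> {..<d}" for \<beta> i using a[OF that(1)] that(2) by auto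
  obtain c where c: "c \<in> M \<rightarrow> carrier R" "\<exists>\<beta>\<in>M. c \<beta> \<notin> Q"
    "\<forall>i\<in>{..<d}. finsum R (\<lambda>\<beta>. c \<beta> \<otimes> a \<beta> i) M \<in> Q"
  proof -
    have "\<exists>c. c \<in> M \<rightarrow> carrier R \<and> (\<exists>\<beta>\<in>M. c \<beta> \<notin> Q) \<and>
        (\<forall>i\<in>{..<d}. finsum R (\<lambda>\<beta>. c \<beta> \<otimes> a \<beta> i) M \<in> Q)"
      by (rule Q.underdetermined[OF finite_lessThan M(2) card]) (rule ac)
    then show ?thesis by (elim exE conjE) (rule that)
  qed
  have cc: "c \<beta> \<in> carrier R" if "\<beta> \<in> M" for \<beta> using c(1) that by auto
  have sc: "s \<beta> \<in> carrier R" if "\<beta> \<in> M" for \<beta> using s[OF that] by simp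
  have kc: "k \<beta> \<in> carrier P" if "\<beta> \<in> M" for \<beta> using k[OF that] P.submoduleE(1)[OF I_sub] by blast
  let ?lc = "\<lambda>\<beta>. finsum P (\<lambda>i. a \<beta> i \<odot>\<^bsub>P\<^esub> e i) {..<d}"
  have lcc: "?lc \<beta> \<in> carrier P" if "\<beta> \<in> M" for \<beta>
    using a[OF that] e_closed by (auto intro!: P.finsum_closed simp: Pi_iff)
  \<comment> \<open>The solution \<open>c\<close> concerns the expansions of
    \<open>s \<beta>\<close> times the monomial, so the denominators enter the coefficients of the
    relation.\<close>
  define u where "u \<beta> = (if \<beta> \<in> M then c \<beta> \<otimes> s \<beta> else \<zero>)" for \<beta>
  have su: "supp u \<subseteq> M" by (auto simp: supp_def u_def)
  have uc: "u \<in> carrier P"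
    using cc sc M(2) MX by (intro MA_I[where S = M]) (auto simp: u_def)
  have "u = finsum P (\<lambda>\<beta>. u \<beta> \<odot>\<^bsub>P\<^esub> basis_elt R \<beta>) M" by (rule MA_expand[OF uc M(2) su MX])
  also have "\<dots> = finsum P (\<lambda>\<beta>. (c \<beta> \<odot>\<^bsub>P\<^esub> ?lc \<beta>) \<oplus>\<^bsub>P\<^esub> (c \<beta> \<odot>\<^bsub>P\<^esub> k \<beta>)) M"
  proof (rule P.finsum_cong')
    fix \<beta> assume \<beta>: "\<beta> \<in> M"
    have "u \<beta> \<odot>\<^bsub>P\<^esub> basis_elt R \<beta> = c \<beta> \<odot>\<^bsub>P\<^esub> (s \<beta> \<odot>\<^bsub>P\<^esub> basis_elt R \<beta>)"
      using \<beta> cc sc bc by (simp add: u_def P.smult_assoc1)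
    also have "\<dots> = (c \<beta> \<odot>\<^bsub>P\<^esub> ?lc \<beta>) \<oplus>\<^bsub>P\<^esub> (c \<beta> \<odot>\<^bsub>P\<^esub> k \<beta>)"
      unfolding eq[OF \<beta>] by (rule P.smult_r_distr[OF cc[OF \<beta>] lcc[OF \<beta>] kc[OF \<beta>]])
    finally show "u \<beta> \<odot>\<^bsub>P\<^esub> basis_elt R \<beta> = (c \<beta> \<odot>\<^bsub>P\<^esub> ?lc \<beta>) \<oplus>\<^bsub>P\<^esub> (c \<beta> \<odot>\<^bsub>P\<^esub> k \<beta>)" .
  qed (use cc lcc kc in auto)
  also have "\<dots> = finsum P (\<lambda>\<beta>. c \<beta> \<odot>\<^bsub>P\<^esub> ?lc \<beta>) M \<oplus>\<^bsub>P\<^esub> finsum P (\<lambda>\<beta>. c \<beta> \<odot>\<^bsub>P\<^esub> k \<beta>) M"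
    using cc lcc kc by (intro P.finsum_addf) auto
  also have "finsum P (\<lambda>\<beta>. c \<beta> \<odot>\<^bsub>P\<^esub> ?lc \<beta>) M
      = finsum P (\<lambda>\<beta>. finsum P (\<lambda>i. (c \<beta> \<otimes> a \<beta> i) \<odot>\<^bsub>P\<^esub> e i) {..<d}) M"
  proof (rule P.finsum_cong')
    show "c \<beta> \<odot>\<^bsub>P\<^esub> ?lc \<beta> = finsum P (\<lambda>i. (c \<beta> \<otimes> a \<beta> i) \<odot>\<^bsub>P\<^esub> e i) {..<d}" if "\<beta> \<in> M" for \<beta>
      by (rule P.finsum_smult_distr[OF cc[OF that] a[OF that] e_closed])
    show "(\<lambda>\<beta>. finsum P (\<lambda>i. (c \<beta> \<otimes> a \<beta> i) \<odot>\<^bsub>P\<^esub> e i) {..<d}) \<in> M \<rightarrow> carrier P"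
      using cc a e_closed by (auto intro!: P.finsum_closed simp: Pi_iff)
  qed simp
  also have "\<dots> = finsum P (\<lambda>i. finsum R (\<lambda>\<beta>. c \<beta> \<otimes> a \<beta> i) M \<odot>\<^bsub>P\<^esub> e i) {..<d}"
    using cc a by (intro P.lincomb_finsum[symmetric] M(2) e_closed) (auto simp: Pi_iff)
  also have "\<dots> \<oplus>\<^bsub>P\<^esub> finsum P (\<lambda>\<beta>. c \<beta> \<odot>\<^bsub>P\<^esub> k \<beta>) M \<in> K0"
    unfolding K0_def P.set_add_iff
  proof (intro bexI refl)
    show "finsum P (\<lambda>\<beta>. c \<beta> \<odot>\<^bsub>P\<^esub> k \<beta>) M \<in> I"
      using cc k by (intro P.submodule_finsum[OF I_sub] Pi_I P.submoduleE(4)[OF I_sub])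
    show "finsum P (\<lambda>i. finsum R (\<lambda>\<beta>. c \<beta> \<otimes> a \<beta> i) M \<odot>\<^bsub>P\<^esub> e i) {..<d} \<in> P.lin d e Q"
      using c(3) by (intro P.lin_I) auto
  qed (rule refl)
  finally have "u \<in> L" using satT_sup[OF K0_sub] by blast
  moreover have "u \<in> mpoly_span n R \<Delta>" using uc su M(1) by (auto simp: mpoly_span_iff)
  ultimately have "u \<beta> \<in> Q" for \<beta> by (rule \<Delta>_indep[rotated])
  then have uQ: "u \<beta> \<in> Q" for \<beta> .
  have "c \<beta> \<in> Q" if "\<beta> \<in> M" for \<beta>
  proof -
    have "c \<beta> \<otimes> s \<beta> \<in> Q" using uQ[of \<beta>] that by (simp add: u_def)
    then show ?thesis using Q.I_prime[OF cc[OF that] sc[OF that]] s[OF that] by blast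
  qed
  then show False using c(2) by blast
qed

lemma \<Delta>_finite: "finite \<Delta>" and card_\<Delta>_le_d: "card \<Delta> \<le> d"
proof -
  show "finite \<Delta>"
  proof (rule ccontr)
    assume "infinite \<Delta>"
    then obtain M where "M \<subseteq> \<Delta>" "finite M" "card M = Suc d"
      using infinite_arbitrarily_large[of \<Delta> "Suc d"] by blast
    then show False using card_\<Delta>_le[of M] by simp
  qed
  then show "card \<Delta> \<le> d" using card_\<Delta>_le by blast
qed

text \<open>The reverse comparison: the \<open>e i\<close> are expanded in the monomials of
  \<open>\<Delta>\<close>, and fewer than \<open>d\<close> of these would force a relation among the
  \<open>e i\<close> in the fibre, against \<open>L_indep\<close>.\<close>

lemma d_le_card_\<Delta>: "d \<le> card \<Delta>"
proof (rule ccontr)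
  assume "\<not> d \<le> card \<Delta>"
  then have card: "card \<Delta> < card {..<d}" by simp
  define \<Phi> where "\<Phi> i w \<longleftrightarrow> fst w \<in> T \<and> fst (snd w) \<in> mpoly_span n R \<Delta> \<and> snd (snd w) \<in> K0 \<and>
      fst w \<odot>\<^bsub>P\<^esub> e i = fst (snd w) \<oplus>\<^bsub>P\<^esub> snd (snd w)" for i w
  have ex: "\<exists>w. \<Phi> i w" if "i < d" for i
  proof -
    have "e i \<in> cl \<Delta>" using e_carr[OF that] \<Delta>_spans by simp
    then obtain s u k where "s \<in> T" "u \<in> mpoly_span n R \<Delta>" "k \<in> K0" "s \<odot>\<^bsub>P\<^esub> e i = u \<oplus>\<^bsub>P\<^esub> k"
      unfolding cl_def P.sat_def P.set_add_iff by blast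
    then have "\<Phi> i (s, u, k)" unfolding \<Phi>_def fst_conv snd_conv by (intro conjI)
    then show ?thesis by (rule exI)
  qed
  define D where "D i = (SOME w. \<Phi> i w)" for i
  have D: "\<Phi> i (D i)" if "i < d" for i
    unfolding D_def by (rule someI_ex[OF ex[OF that]])
  define s where "s i = fst (D i)" for i
  define u where "u i = fst (snd (D i))" for i
  define k where "k i = snd (snd (D i))" for i
  have s: "s i \<in> T" and u: "u i \<in> mpoly_span n R \<Delta>" and k: "k i \<in> K0"
    and eq: "s i \<odot>\<^bsub>P\<^esub> e i = u i \<oplus>\<^bsub>P\<^esub> k i"
    if "i < d" for i using D[OF that] unfolding \<Phi>_def s_def u_def k_def by simp_all
  have uc: "u i \<in> carrier P" if "i < d" for i using u[OF that] by (simp add: mpoly_span_iff)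
  have kc: "k i \<in> carrier P" if "i < d" for i using k[OF that] P.submoduleE(1)[OF K0_sub] by blast
  have uco: "u i \<beta> \<in> carrier R" if "i < d" for i \<beta> by (rule MA_coeff[OF uc[OF that]])
  have sc: "s i \<in> carrier R" if "i < d" for i using s[OF that] by simp
  have uco': "u i \<beta> \<in> carrier R" if "i \<in> {..<d}" "\<beta> \<in> \<Delta>" for i \<beta> using uco that by simp
  obtain c where c: "c \<in> {..<d} \<rightarrow> carrier R" "\<exists>i\<in>{..<d}. c i \<notin> Q"
    "\<forall>\<beta>\<in>\<Delta>. finsum R (\<lambda>i. c i \<otimes> u i \<beta>) {..<d} \<in> Q"
  proof -
    have "\<exists>c. c \<in> {..<d} \<rightarrow> carrier R \<and> (\<exists>i\<in>{..<d}. c i \<notin> Q) \<and>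
        (\<forall>\<beta>\<in>\<Delta>. finsum R (\<lambda>i. c i \<otimes> u i \<beta>) {..<d} \<in> Q)"
      by (rule Q.underdetermined[OF \<Delta>_finite finite_lessThan card]) (rule uco')
    then show ?thesis by (elim exE conjE) (rule that)
  qed
  have cc: "c i \<in> carrier R" if "i < d" for i using c(1) that by auto
  let ?u = "finsum P (\<lambda>i. c i \<odot>\<^bsub>P\<^esub> u i) {..<d}" and ?k = "finsum P (\<lambda>i. c i \<odot>\<^bsub>P\<^esub> k i) {..<d}"
  have "finsum P (\<lambda>i. (c i \<otimes> s i) \<odot>\<^bsub>P\<^esub> e i) {..<d} = finsum P (\<lambda>i. c i \<odot>\<^bsub>P\<^esub> u i \<oplus>\<^bsub>P\<^esub> c i \<odot>\<^bsub>P\<^esub> k i) {..<d}"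
  proof (rule P.finsum_cong')
    fix i assume "i \<in> {..<d}"
    then have i: "i < d" by simp
    have "(c i \<otimes> s i) \<odot>\<^bsub>P\<^esub> e i = c i \<odot>\<^bsub>P\<^esub> (s i \<odot>\<^bsub>P\<^esub> e i)"
      using cc[OF i] sc[OF i] e_carr[OF i] by (simp add: P.smult_assoc1)
    then show "(c i \<otimes> s i) \<odot>\<^bsub>P\<^esub> e i = c i \<odot>\<^bsub>P\<^esub> u i \<oplus>\<^bsub>P\<^esub> c i \<odot>\<^bsub>P\<^esub> k i"
      unfolding eq[OF i] using P.smult_r_distr[OF cc[OF i] uc[OF i] kc[OF i]] by simp
  qed (use cc uc kc in auto)
  also have "\<dots> = ?u \<oplus>\<^bsub>P\<^esub> ?k" using cc uc kc by (intro P.finsum_addf) auto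
  also have "\<dots> \<in> L"
  proof (rule P.submoduleE(5)[OF L_sub])
    have "?k \<in> K0" using cc k by (intro P.submodule_finsum[OF K0_sub] Pi_I P.submoduleE(4)[OF K0_sub]) auto
    then show "?k \<in> L" using satT_sup[OF K0_sub] by blast
    have ucl: "(\<lambda>i. c i \<odot>\<^bsub>P\<^esub> u i) \<in> {..<d} \<rightarrow> carrier P" using cc uc by auto
    \<comment> \<open>Every coefficient of \<open>?u\<close> lies in \<open>Q\<close>: at exponents
      in \<open>\<Delta>\<close> by the choice of \<open>c\<close>, elsewhere because it is
      zero.\<close>
    show "?u \<in> L"
    proof (rule coeffs_Q_L)
      show "?u \<in> carrier P" using ucl by (rule P.finsum_closed)
      fix \<beta>
      have eq: "?u \<beta> = finsum R (\<lambda>i. c i \<otimes> u i \<beta>) {..<d}"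
        unfolding MA_finsum_apply[OF ucl] by (simp add: MA_simps)
      show "?u \<beta> \<in> Q"
      proof (cases "\<beta> \<in> \<Delta>")
        case True then show ?thesis unfolding eq using c(3) by blast
      next
        case False
        have "finsum R (\<lambda>i. c i \<otimes> u i \<beta>) {..<d} = \<zero>"
        proof (rule add.finprod_one_eqI)
          fix i assume "i \<in> {..<d}"
          then have i: "i < d" by simp
          have "\<beta> \<notin> supp (u i)" using u[OF i] False unfolding mpoly_span_iff by blast
          then have "u i \<beta> = \<zero>" using not_supp[of \<beta> "u i"] by blast
          then show "c i \<otimes> u i \<beta> = \<zero>" using cc[OF i] by simp
        qed
        then show ?thesis unfolding eq using Q.zero_closed by simp
      qed
    qed
  qed
  finally have mem: "finsum P (\<lambda>i. (c i \<otimes> s i) \<odot>\<^bsub>P\<^esub> e i) {..<d} \<in> L" .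
  have "c i \<in> Q" if i: "i < d" for i
  proof -
    have "(\<lambda>i. c i \<otimes> s i) \<in> {..<d} \<rightarrow> carrier R" using cc sc by auto
    then have "c i \<otimes> s i \<in> Q" using L_indep[OF _ mem i] by simp
    then show ?thesis using Q.I_prime[OF cc[OF i] sc[OF i]] s[OF i] by blast
  qed
  then show False using c(2) by blast
qed

lemma \<Delta>_size: "\<Delta> \<in> standard_sets_of_size n d"
  using \<Delta>_standard \<Delta>_finite card_\<Delta>_le_d d_le_card_\<Delta> by (simp add: standard_sets_of_size_def)

text \<open>Passes from the fibre to a neighbourhood: \<open>K0\<close> is the sum of
  \<open>lin d e Q\<close> and \<open>I\<close>, and regrouping produces the hypothesis of
  \<open>spans_nearby\<close>.\<close>

lemma cl_spans_nearby:
  assumes "cl Y = carrier P"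
  shows "\<exists>h\<in>T. carrier P \<subseteq> P.sat (range (\<lambda>l::nat. h [^] l)) (mpoly_span n R Y <+>\<^bsub>P\<^esub> I)"
proof (rule spans_nearby)
  let ?W = "mpoly_span n R Y <+>\<^bsub>P\<^esub> I"
  show W: "submodule ?W R P" by (intro P.submodule_set_add mpoly_span_submodule I_sub)
  show "I \<subseteq> ?W" using P.set_add_mem2[OF mpoly_span_submodule I_sub] by blast
  have N: "submodule (?W <+>\<^bsub>P\<^esub> P.lin d e Q) R P" by (intro P.submodule_set_add W lin_Q_sub)
  have WN: "?W \<subseteq> ?W <+>\<^bsub>P\<^esub> P.lin d e Q" using P.set_add_mem1[OF W lin_Q_sub] by blast
  have "K0 \<subseteq> ?W <+>\<^bsub>P\<^esub> P.lin d e Q"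
    unfolding K0_def using WN P.set_add_mem2[OF mpoly_span_submodule I_sub] P.set_add_mem2[OF W lin_Q_sub]
    by (intro P.set_add_subset[OF N]) blast+
  moreover have "mpoly_span n R Y \<subseteq> ?W <+>\<^bsub>P\<^esub> P.lin d e Q"
    using WN P.set_add_mem1[OF mpoly_span_submodule I_sub] by blast
  ultimately have "mpoly_span n R Y <+>\<^bsub>P\<^esub> K0 \<subseteq> ?W <+>\<^bsub>P\<^esub> P.lin d e Q"
    by (intro P.set_add_subset[OF N])
  from P.sat_mono[OF this, of T] show "e i \<in> P.sat T (?W <+>\<^bsub>P\<^esub> P.lin d e Q)" if "i < d" for i
    using e_carr[OF that] assms unfolding cl_def by blast
qed

end

section \<open>The open cover\<close>

context mpoly_hom
begin

text \<open>For a fixed monomial, the scalars that move it into the span form an ideal of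
  \<open>A\<close>. If it were proper it would lie in a prime \<open>p\<close>; but it contains a
  power of \<open>g h\<close>, with \<open>h\<close> outside the preimage of
  \<open>p\<close>.\<close>

lemma span_if_locally_span:
  assumes I: "ideal I B.P"
    and loc: "\<And>p. primeideal p A \<Longrightarrow> \<exists>h\<in>carrier B - spec_map B g p. carrier B.P \<subseteq>
      B.P.sat (range (\<lambda>l::nat. h [^]\<^bsub>B\<^esub> l)) (mpoly_span n B \<Delta> <+>\<^bsub>B.P\<^esub> I)"
  shows "mpoly_span n A \<Delta> <+>\<^bsub>A.P\<^esub> extend I = carrier A.P"
proof (rule A.submodule_carrierI)
  let ?W = "mpoly_span n B \<Delta> <+>\<^bsub>B.P\<^esub> I" and ?V = "mpoly_span n A \<Delta> <+>\<^bsub>A.P\<^esub> extend I"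
  have Is: "submodule I B B.P" by (rule B.P.ideal_submodule[OF I])
  have Ic: "I \<subseteq> carrier B.P" by (rule B.P.submoduleE(1)[OF Is])
  have ext: "submodule (extend I) A A.P" by (rule extend_submodule[OF Ic])
  show V: "submodule ?V A A.P"
    by (intro A.P.submodule_set_add A.mpoly_span_submodule ext)
  note VE = A.P.submoduleE[OF V]
  have WV: "cmap w \<in> ?V" if "w \<in> ?W" for w
  proof -
    obtain u k where uk: "u \<in> mpoly_span n B \<Delta>" "k \<in> I" "w = u \<oplus>\<^bsub>B.P\<^esub> k"
      using \<open>w \<in> ?W\<close> unfolding B.P.set_add_iff by blast
    have "u \<in> carrier B.P" "k \<in> carrier B.P" using uk Ic by (auto simp: B.mpoly_span_iff)
    then have "cmap w = cmap u \<oplus>\<^bsub>A.P\<^esub> cmap k" unfolding uk(3) by (rule cmap_add)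
    then show ?thesis unfolding A.P.set_add_iff
      using cmap_span[OF uk(1)] cmap_in_extend[OF Ic uk(2)] by blast
  qed
  fix x assume x: "x \<in> carrier (expos n)"
  let ?m = "A.mon \<one>\<^bsub>A\<^esub> x"
  have m: "?m \<in> carrier A.P" by (rule A.mon_closed[OF A.one_closed x])
  let ?J = "{a \<in> carrier A. a \<odot>\<^bsub>A.P\<^esub> ?m \<in> ?V}"
  have J: "ideal ?J A"
  proof (rule idealI[OF A.ring_axioms])
    show "subgroup ?J (add_monoid A)"
    proof (rule A.add.subgroupI)
      show "?J \<noteq> {}" using A.P.submodule_zero[OF V] m A.zero_closed A.P.smult_l_null[OF m] by force
      show "\<ominus>\<^bsub>A\<^esub> a \<in> ?J" if "a \<in> ?J" for a
        using that VE(3) m by (simp add: A.P.smult_l_minus)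
      show "a \<oplus>\<^bsub>A\<^esub> b \<in> ?J" if "a \<in> ?J" "b \<in> ?J" for a b
        using that VE(5) m by (simp add: A.P.smult_l_distr)
    qed blast
    show *: "b \<otimes>\<^bsub>A\<^esub> a \<in> ?J" if "a \<in> ?J" "b \<in> carrier A" for a b
      using that VE(4) m by (simp add: A.P.smult_assoc1)
    show "a \<otimes>\<^bsub>A\<^esub> b \<in> ?J" if "a \<in> ?J" "b \<in> carrier A" for a b
      using *[OF that] that by (simp add: A.m_comm)
  qed
  have "\<one>\<^bsub>A\<^esub> \<in> ?J"
  proof (rule ccontr)
    assume "\<one>\<^bsub>A\<^esub> \<notin> ?J"
    then obtain p where p: "primeideal p A" "?J \<subseteq> p" using A.prime_avoiding_one[OF J] by blast
    interpret p: primeideal p A by fact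
    obtain h where h: "h \<in> carrier B - spec_map B g p"
      "carrier B.P \<subseteq> B.P.sat (range (\<lambda>l::nat. h [^]\<^bsub>B\<^esub> l)) ?W" using loc[OF p(1)] by blast
    have hB: "h \<in> carrier B" using h by blast
    have mB: "B.mon \<one>\<^bsub>B\<^esub> x \<in> carrier B.P" by (rule B.mon_closed[OF B.one_closed x])
    then obtain l :: nat where "h [^]\<^bsub>B\<^esub> l \<odot>\<^bsub>B.P\<^esub> B.mon \<one>\<^bsub>B\<^esub> x \<in> ?W"
      using h(2) unfolding B.P.sat_def by blast
    from WV[OF this] have "g h [^]\<^bsub>A\<^esub> l \<odot>\<^bsub>A.P\<^esub> ?m \<in> ?V"
      using hB mB by (simp add: cmap_smult g_pow cmap_mon)
    then have "g h [^]\<^bsub>A\<^esub> l \<in> p" using hB p(2) by auto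
    then have "g h \<in> p" using p.pow_prime hB by blast
    then show False using h(1) by (simp add: spec_map_def)
  qed
  then show "?m \<in> ?V" using m by simp
qed

text \<open>The fibre at \<open>p\<close> is a scalar extension of the fibre at its preimage
  \<open>?Q\<close>. Spanning over \<open>A\<close> is read modulo \<open>p\<close> and brought down
  to \<open>?Q\<close> by \<open>descent\<close>, one monomial at a time;
  \<open>cl_spans_nearby\<close> then spreads it to a neighbourhood of \<open>?Q\<close>.\<close>

lemma locally_span_if_span:
  assumes I: "B.hilb_ideal d I" and p: "primeideal p A"
    and span: "mpoly_span n A \<Delta> <+>\<^bsub>A.P\<^esub> extend I = carrier A.P"
  shows "\<exists>h\<in>carrier B - spec_map B g p. carrier B.P \<subseteq>
      B.P.sat (range (\<lambda>l::nat. h [^]\<^bsub>B\<^esub> l)) (mpoly_span n B \<Delta> <+>\<^bsub>B.P\<^esub> I)"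
proof -
  let ?Q = "spec_map B g p" and ?W = "mpoly_span n B \<Delta> <+>\<^bsub>B.P\<^esub> I"
  have Q: "primeideal ?Q B" by (rule prime_vimage[OF p])
  have Ii: "ideal I B.P" using I by (simp add: B.hilb_ideal_def)
  obtain f e where fe: "f \<in> carrier B - ?Q" "B.ibasis I f d e"
    using I Q unfolding B.hilb_ideal_def by blast
  interpret Q: primeideal ?Q B by (rule Q)
  interpret p: primeideal p A by (rule p)
  interpret Qb: mpoly_basis B n ?Q I f d e
    using Q Ii fe by (simp add: mpoly_basis_def mpoly_basis_axioms_def B.mpoly_ring_axioms)
  have W: "submodule ?W B B.P"
    by (intro B.P.submodule_set_add B.mpoly_span_submodule Qb.I_sub)
  note Wc = B.P.submoduleE(1)[OF W]
  have Ic: "I \<subseteq> carrier B.P" by (rule B.P.submoduleE(1)[OF Qb.I_sub])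
  have IW: "I \<subseteq> ?W" using B.P.set_add_mem2[OF B.mpoly_span_submodule Qb.I_sub] by blast
  have sW: "mpoly_span n B \<Delta> \<subseteq> ?W" using B.P.set_add_mem1[OF B.mpoly_span_submodule Qb.I_sub] by blast
  have "mpoly_span n A \<Delta> \<subseteq> extend ?W"
  proof (rule A.mpoly_span_minimal[OF extend_submodule[OF Wc]])
    fix x assume x: "x \<in> \<Delta>" "x \<in> carrier (expos n)"
    have "cmap (B.mon \<one>\<^bsub>B\<^esub> x) \<in> extend ?W"
      using sW B.mon_in_mpoly_span[OF B.one_closed x(2,1)] by (intro cmap_in_extend[OF Wc]) blast
    then show "A.mon \<one>\<^bsub>A\<^esub> x \<in> extend ?W" by (simp add: cmap_mon)
  qed
  then have "carrier A.P \<subseteq> extend ?W" unfolding span[symmetric]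
    by (rule A.P.set_add_subset[OF extend_submodule[OF Wc]]) (rule extend_mono[OF IW])
  have IK: "I \<subseteq> Qb.K0"
    unfolding Qb.K0_def using B.P.set_add_mem2[OF Qb.lin_Q_sub Qb.I_sub] by blast
  have Wcl: "?W \<subseteq> Qb.cl \<Delta>"
    using IK Qb.K0_cl[of \<Delta>] by (intro B.P.set_add_subset[OF Qb.cl_sub Qb.span_cl]) blast
  have "Qb.cl \<Delta> = carrier B.P"
  proof (rule B.submodule_carrierI[OF Qb.cl_sub])
    fix x assume x: "x \<in> carrier (expos n)"
    let ?v = "B.mon \<one>\<^bsub>B\<^esub> x"
    have v: "?v \<in> carrier B.P" by (rule B.mon_closed[OF B.one_closed x])
    have "cmap ?v \<in> extend ?W" using \<open>carrier A.P \<subseteq> extend ?W\<close> cmap_closed[OF v] by blast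
    then obtain m a w where *: "a \<in> {..<m::nat} \<rightarrow> carrier A" "w \<in> {..<m} \<rightarrow> ?W"
      "cmap ?v = finsum A.P (\<lambda>j. a j \<odot>\<^bsub>A.P\<^esub> cmap (w j)) {..<m}"
      using extend_rep[OF Wc] by blast
    have wc: "w \<in> {..<m} \<rightarrow> carrier B.P" using *(2) Wc by (auto simp: Pi_iff subset_eq)
    \<comment> \<open>\<open>descent\<close> controls finitely many coefficients only, so \<open>?W\<close> is cut down to a submodule
      of elements with support in a fixed finite set.\<close>
    let ?N = "B.P.lin m w (carrier B)"
    have N: "submodule ?N B B.P" by (rule B.P.lin_submodule[OF B.oneideal wc])
    note Nc = B.P.submoduleE(1)[OF N]
    have wN: "w j \<in> ?N" if "j < m" for j
      using B.P.lin_mem[OF B.oneideal B.one_closed that wc] wc that by (simp add: Pi_iff)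
    define E where "E = insert x (\<Union>j<m. B.supp (w j))"
    have E: "finite E" using wc by (auto simp: E_def Pi_iff intro: B.supp_finite)
    have NE: "?N \<subseteq> mpoly_span n B E"
    proof (rule B.P.lin_subset[OF B.mpoly_span_submodule _ subset_refl], rule Pi_I)
      show "w j \<in> mpoly_span n B E" if "j \<in> {..<m}" for j
        using wc that by (auto simp: B.mpoly_span_iff E_def)
    qed
    have NW: "?N \<subseteq> ?W" by (rule B.P.lin_subset[OF W *(2) subset_refl])
    have u: "cmap ?v \<in> extend ?N" unfolding *(3)
    proof (rule A.P.submodule_finsum[OF extend_submodule[OF Nc]], rule Pi_I)
      fix j assume "j \<in> {..<m}"
      then show "a j \<odot>\<^bsub>A.P\<^esub> cmap (w j) \<in> extend ?N"
        using *(1) wN[of j] by (intro extend_smult[OF Nc] cmap_in_extend[OF Nc]) auto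
    qed
    \<comment> \<open>The congruence asked for by \<open>descent\<close> holds with difference zero,
      because \<open>u\<close> is taken to be the image of the monomial itself.\<close>
    have z: "g (?v \<alpha>) \<ominus>\<^bsub>A\<^esub> cmap ?v \<alpha> \<in> p" for \<alpha>
      using p.zero_closed B.MA_coeff[OF v, of \<alpha>] by (simp add: cmap_def a_minus_def A.r_neg)
    obtain s w' where s: "s \<in> carrier B - ?Q" and w': "w' \<in> ?N"
      and d: "\<forall>\<alpha>\<in>E. s \<otimes>\<^bsub>B\<^esub> ?v \<alpha> \<ominus>\<^bsub>B\<^esub> w' \<alpha> \<in> ?Q"
      using descent[OF p E Nc N v u z] by blast
    have sc: "s \<in> carrier B" using s by blast
    have w'c: "w' \<in> carrier B.P" using w' Nc by blast
    let ?r = "s \<odot>\<^bsub>B.P\<^esub> ?v \<ominus>\<^bsub>B.P\<^esub> w'"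
    have svc: "s \<odot>\<^bsub>B.P\<^esub> ?v \<in> carrier B.P" by (rule B.P.smult_closed[OF sc v])
    have rc: "?r \<in> carrier B.P" by (rule B.P.M.minus_closed[OF svc w'c])
    have r: "?r \<in> Qb.cl \<Delta>"
    proof -
      \<comment> \<open>\<open>descent\<close> speaks of exponents in \<open>E\<close> only; outside
        \<open>E\<close> both the monomial and \<open>w'\<close> have coefficient zero.\<close>
      have "?r \<alpha> \<in> ?Q" for \<alpha>
      proof (cases "\<alpha> \<in> E")
        case True
        then show ?thesis using d unfolding B.MA_minus[OF svc w'c] by (simp add: B.MA_simps)
      next
        case False
        have "w' \<alpha> = \<zero>\<^bsub>B\<^esub>" using w' NE False B.not_supp[of \<alpha> w'] by (auto simp: B.mpoly_span_iff subset_eq)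
        moreover have "?v \<alpha> = \<zero>\<^bsub>B\<^esub>" using False by (auto simp: B.mon_apply E_def)
        ultimately have "?r \<alpha> = \<zero>\<^bsub>B\<^esub>"
          unfolding B.MA_minus[OF svc w'c] using sc by (simp add: B.MA_simps a_minus_def)
        then show ?thesis using Q.zero_closed by simp
      qed
      then show ?thesis using Qb.coeffs_Q_L[OF rc] Qb.L_cl[of \<Delta>] by blast
    qed
    have "s \<odot>\<^bsub>B.P\<^esub> ?v = w' \<oplus>\<^bsub>B.P\<^esub> ?r" using svc w'c by algebra
    also have "\<dots> \<in> Qb.cl \<Delta>" using w' NW Wcl r by (intro B.P.submoduleE(5)[OF Qb.cl_sub]) blast+
    finally have "?v \<in> B.P.sat (carrier B - ?Q) (Qb.cl \<Delta>)" unfolding B.P.sat_def using s v by blast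
    then show "?v \<in> Qb.cl \<Delta>" by (rule Qb.cl_sat)
  qed
  then show ?thesis by (rule Qb.cl_spans_nearby)
qed

end

definition (in mpoly_ring) std_locus :: "(nat \<Rightarrow> nat) set \<Rightarrow> ((nat \<Rightarrow> nat) \<Rightarrow> 'a) set \<Rightarrow> 'a set set" where
  "std_locus \<Delta> I = {Q \<in> Spec R. \<exists>h\<in>carrier R - Q.
     carrier P \<subseteq> P.sat (range (\<lambda>l::nat. h [^] l)) (mpoly_span n R \<Delta> <+>\<^bsub>P\<^esub> I)}"

text \<open>The locus is the union of the basic open sets of the admissible \<open>h\<close>, so the
  set of all these \<open>h\<close> is the witness for \<open>zariski_open\<close>.\<close>

lemma (in mpoly_ring) std_locus_open: "zariski_open R (std_locus \<Delta> I)"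
  unfolding zariski_open_def std_locus_def
  by (intro exI[of _ "{h \<in> carrier R.
    carrier P \<subseteq> P.sat (range (\<lambda>l::nat. h [^] l)) (mpoly_span n R \<Delta> <+>\<^bsub>P\<^esub> I)}"]) blast

text \<open>The member that covers a given prime is the standard set read off from the fibre
  there.\<close>

lemma (in mpoly_ring) std_locus_cover:
  assumes I: "hilb_ideal d I"
  shows "(\<Union>\<Delta>\<in>standard_sets_of_size n d. std_locus \<Delta> I) = Spec R"
proof
  show "Spec R \<subseteq> (\<Union>\<Delta>\<in>standard_sets_of_size n d. std_locus \<Delta> I)"
  proof
    fix Q assume Q: "Q \<in> Spec R"
    then have Qp: "primeideal Q R" by (simp add: Spec_def)
    then obtain f e where fe: "f \<in> carrier R - Q" "ibasis I f d e"
      using I unfolding hilb_ideal_def by blast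
    interpret Q: primeideal Q R by (rule Qp)
    interpret Qb: mpoly_basis R n Q I f d e
      using Qp I fe by (simp add: mpoly_basis_def mpoly_basis_axioms_def mpoly_ring_axioms hilb_ideal_def)
    have "Q \<in> std_locus Qb.\<Delta> I"
      unfolding std_locus_def using Q Qb.cl_spans_nearby[OF Qb.\<Delta>_spans] by blast
    then show "Q \<in> (\<Union>\<Delta>\<in>standard_sets_of_size n d. std_locus \<Delta> I)" using Qb.\<Delta>_size by blast
  qed
qed (auto simp: std_locus_def)

lemma is_open_locus_std:
  assumes B: "algebra k B" and I: "I \<in> fobj (Hilb n (card \<Delta>)) B"
  shows "is_open_locus k (Hilb_std n \<Delta>) (Hilb n (card \<Delta>)) B I (mpoly_ring.std_locus B n \<Delta> I)"
proof -
  have c: "cring B" using B by (rule algebra.M_cring)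
  interpret R: mpoly_ring B n by (simp add: mpoly_ring_def c)
  have Ih: "R.hilb_ideal (card \<Delta>) I" using I unfolding Hilb_iff[OF c] .
  then have Ii: "ideal I R.P" by (simp add: R.hilb_ideal_def)
  have "farr (Hilb n (card \<Delta>)) B A g I \<in> fobj (Hilb_std n \<Delta>) A \<longleftrightarrow> spec_map B g ` Spec A \<subseteq> R.std_locus \<Delta> I"
    if A: "algebra k A" and g: "g \<in> alg_hom k B A" for A g
  proof -
    have cA: "cring A" using A by (rule algebra.M_cring)
    interpret mpoly_hom B A n g by (rule alg_mpoly_hom[OF B A g])
    have ext: "A.hilb_ideal (card \<Delta>) (extend I)"
      using Hilb_farr[OF B A g I] unfolding Hilb_iff[OF cA] by simp
    have "farr (Hilb n (card \<Delta>)) B A g I \<in> fobj (Hilb_std n \<Delta>) A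
        \<longleftrightarrow> mpoly_span n A \<Delta> <+>\<^bsub>A.P\<^esub> extend I = carrier A.P"
      unfolding farr_simps Hilb_farr(2)[OF B A g I] Hilb_std_iff[OF cA] using ext by simp
    also have "\<dots> \<longleftrightarrow> spec_map B g ` Spec A \<subseteq> R.std_locus \<Delta> I"
    proof
      assume span: "mpoly_span n A \<Delta> <+>\<^bsub>A.P\<^esub> extend I = carrier A.P"
      show "spec_map B g ` Spec A \<subseteq> R.std_locus \<Delta> I"
      proof (rule image_subsetI)
        fix p assume "p \<in> Spec A"
        then have p: "primeideal p A" by (simp add: Spec_def)
        show "spec_map B g p \<in> R.std_locus \<Delta> I"
          unfolding R.std_locus_def using prime_vimage[OF p] locally_span_if_span[OF Ih p span]
          by (simp add: Spec_def)
      qed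
    next
      assume sub: "spec_map B g ` Spec A \<subseteq> R.std_locus \<Delta> I"
      show "mpoly_span n A \<Delta> <+>\<^bsub>A.P\<^esub> extend I = carrier A.P"
      proof (rule span_if_locally_span[OF Ii])
        fix p assume "primeideal p A"
        then have "p \<in> Spec A" by (simp add: Spec_def)
        then have "spec_map B g p \<in> R.std_locus \<Delta> I" using sub by blast
        then show "\<exists>h\<in>carrier B - spec_map B g p. carrier R.P \<subseteq>
            R.P.sat (range (\<lambda>l::nat. h [^]\<^bsub>B\<^esub> l)) (mpoly_span n B \<Delta> <+>\<^bsub>R.P\<^esub> I)"
          unfolding R.std_locus_def by blast
      qed
    qed
    finally show ?thesis .
  qed
  then show ?thesis unfolding is_open_locus_def using R.std_locus_open by blast
qed

lemma Hilb_std_open_cover: "is_open_cover k (standard_sets_of_size n d) (Hilb_std n) (Hilb n d)"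
proof -
  have locus: "is_open_locus k (Hilb_std n \<Delta>) (Hilb n d) B I (mpoly_ring.std_locus B n \<Delta> I)"
    if "\<Delta> \<in> standard_sets_of_size n d" "algebra k B" "I \<in> fobj (Hilb n d) B" for \<Delta> B I
    using is_open_locus_std[of k B I n \<Delta>] that by (simp add: standard_sets_of_size_def)
  show ?thesis
    unfolding is_open_cover_def
  proof (intro conjI ballI allI impI)
    fix \<Delta> assume D: "\<Delta> \<in> standard_sets_of_size n d"
    then have "is_subfunctor k (Hilb_std n \<Delta>) (Hilb n d)"
      using Hilb_std_subfunctor[of k n \<Delta>] by (simp add: standard_sets_of_size_def)
    then show "is_open_subfunctor k (Hilb_std n \<Delta>) (Hilb n d)"
      unfolding is_open_subfunctor_def using locus[OF D] by blast
  next
    fix B :: "('a, 'a) module" and I assume B: "algebra k B" and I: "I \<in> fobj (Hilb n d) B"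
    have c: "cring B" using B by (rule algebra.M_cring)
    interpret R: mpoly_ring B n by (simp add: mpoly_ring_def c)
    have "R.hilb_ideal d I" using I unfolding Hilb_iff[OF c] .
    then have "(\<Union>\<Delta>\<in>standard_sets_of_size n d. R.std_locus \<Delta> I) = Spec B" by (rule R.std_locus_cover)
    then show "\<exists>U. (\<forall>\<Delta>\<in>standard_sets_of_size n d. is_open_locus k (Hilb_std n \<Delta>) (Hilb n d) B I (U \<Delta>))
        \<and> (\<Union>\<Delta>\<in>standard_sets_of_size n d. U \<Delta>) = Spec B"
      using locus[OF _ B I] by (intro exI[of _ "\<lambda>\<Delta>. R.std_locus \<Delta> I"]) blast
  qed
qed

section \<open>Minimality\<close>

context mpoly_ring
begin

text \<open>The span of the monomials outside \<open>\<Delta>\<close>, written through vanishing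
  coefficients so that membership is tested coefficient by coefficient.\<close>

definition monomial_ideal :: "(nat \<Rightarrow> nat) set \<Rightarrow> ((nat \<Rightarrow> nat) \<Rightarrow> 'a) set" where
  "monomial_ideal \<Delta> = {p \<in> carrier P. \<forall>\<beta>\<in>\<Delta>. p \<beta> = \<zero>}"

text \<open>An exponent outside a standard set stays outside when any exponent is added, so no
  product of terms lands in \<open>\<Delta>\<close>.\<close>

lemma monomial_ideal:
  assumes \<Delta>: "standard_set n \<Delta>"
  shows "ideal (monomial_ideal \<Delta>) P"
proof (rule idealI[OF P.ring_axioms])
  show "subgroup (monomial_ideal \<Delta>) (add_monoid P)"
  proof (rule P.M.add.subgroupI)
    show "monomial_ideal \<Delta> \<noteq> {}" using P.M.zero_closed by (auto simp: monomial_ideal_def MA_simps)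
    show "\<ominus>\<^bsub>P\<^esub> p \<in> monomial_ideal \<Delta>" if "p \<in> monomial_ideal \<Delta>" for p
      using that P.M.a_inv_closed[of p] by (simp add: monomial_ideal_def MA_a_inv)
    show "p \<oplus>\<^bsub>P\<^esub> q \<in> monomial_ideal \<Delta>" if "p \<in> monomial_ideal \<Delta>" "q \<in> monomial_ideal \<Delta>" for p q
      using that P.M.add.m_closed[of p q] by (simp add: monomial_ideal_def MA_simps)
  qed (simp add: monomial_ideal_def subset_eq)
  have mult: "(p \<otimes>\<^bsub>P\<^esub> q) \<beta> = \<zero>"
    if p: "p \<in> monomial_ideal \<Delta>" "q \<in> carrier P" and \<beta>: "\<beta> \<in> \<Delta>" for p q \<beta>
  proof -
    have pc: "p \<in> carrier P" using p by (simp add: monomial_ideal_def)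
    have "(p \<otimes>\<^bsub>P\<^esub> q) \<beta> = finsum R (\<lambda>(y, z). p y \<otimes> q z)
        {(y, z). y \<in> supp p \<and> z \<in> supp q \<and> y \<otimes>\<^bsub>expos n\<^esub> z = \<beta>}" (is "_ = finsum R _ ?S")
      by (rule MA_mult_on) (use pc p(2) in simp_all)
    also have "?S = {}"
    proof -
      have False if yz: "y \<in> supp p" "z \<in> supp q" "y \<otimes>\<^bsub>expos n\<^esub> z = \<beta>" for y z
      proof -
        have "y \<in> carrier (expos n) - \<Delta>" "z \<in> carrier (expos n)"
          using yz p supp_carrier[OF pc] supp_carrier[OF p(2)] by (auto simp: monomial_ideal_def supp_def)
        then have "y \<otimes>\<^bsub>expos n\<^esub> z \<in> carrier (expos n) - \<Delta>" using \<Delta> unfolding standard_set_def by blast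
        then show False using yz(3) \<beta> by blast
      qed
      then show ?thesis by blast
    qed
    finally show ?thesis by simp
  qed
  show "p \<otimes>\<^bsub>P\<^esub> q \<in> monomial_ideal \<Delta>" if p: "p \<in> monomial_ideal \<Delta>" "q \<in> carrier P" for p q
    using p mult[OF p] by (simp add: monomial_ideal_def)
  then show "q \<otimes>\<^bsub>P\<^esub> p \<in> monomial_ideal \<Delta>" if p: "p \<in> monomial_ideal \<Delta>" "q \<in> carrier P" for p q
    using p P.m_comm[of q p] by (simp add: monomial_ideal_def)
qed

lemma monomial_ideal_span:
  assumes \<Delta>: "standard_set n \<Delta>"
  shows "mpoly_span n R \<Delta> <+>\<^bsub>P\<^esub> monomial_ideal \<Delta> = carrier P"
proof (rule submodule_carrierI)
  have I: "submodule (monomial_ideal \<Delta>) R P" by (rule P.ideal_submodule[OF monomial_ideal[OF \<Delta>]])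
  show "submodule (mpoly_span n R \<Delta> <+>\<^bsub>P\<^esub> monomial_ideal \<Delta>) R P"
    by (intro P.submodule_set_add mpoly_span_submodule I)
  fix x assume x: "x \<in> carrier (expos n)"
  note m = mon_closed[OF one_closed x]
  show "mon \<one> x \<in> mpoly_span n R \<Delta> <+>\<^bsub>P\<^esub> monomial_ideal \<Delta>"
  proof (cases "x \<in> \<Delta>")
    case True
    then show ?thesis using P.set_add_mem1[OF mpoly_span_submodule I] mon_in_mpoly_span[OF one_closed x] by blast
  next
    case False
    then have "mon \<one> x \<in> monomial_ideal \<Delta>" using m by (auto simp: monomial_ideal_def mon_apply)
    then show ?thesis using P.set_add_mem2[OF mpoly_span_submodule I] by blast
  qed
qed

text \<open>The monomials in \<open>\<Delta>\<close> form a basis of the quotient over the whole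
  base, so \<open>f = 1\<close> serves at every prime.\<close>

lemma monomial_ideal_hilb:
  assumes \<Delta>: "standard_set n \<Delta>" and fin: "finite \<Delta>"
  shows "hilb_ideal (card \<Delta>) (monomial_ideal \<Delta>)"
proof -
  let ?I = "monomial_ideal \<Delta>" and ?d = "card \<Delta>"
  have X: "\<Delta> \<subseteq> carrier (expos n)" using \<Delta> unfolding standard_set_def by blast
  have I: "submodule ?I R P" by (rule P.ideal_submodule[OF monomial_ideal[OF \<Delta>]])
  obtain b where b: "bij_betw b {..<?d} \<Delta>"
    using ex_bij_betw_nat_finite[OF fin] by (auto simp: atLeast0LessThan)
  let ?e = "\<lambda>i. mon \<one> (b i)"
  have bD: "b i \<in> \<Delta>" if "i < ?d" for i using bij_betwE[OF b] that by blast
  have e: "?e \<in> {..<?d} \<rightarrow> carrier P"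
    using bD X by (intro Pi_I mon_closed[OF one_closed]) blast
  have basis: "ibasis ?I \<one> ?d ?e"
  proof (rule ibasisI[OF e])
    let ?L = "P.lin ?d ?e (carrier R)"
    have L: "submodule ?L R P" by (rule P.lin_submodule[OF oneideal e])
    have LI: "submodule (?L <+>\<^bsub>P\<^esub> ?I) R P" by (intro P.submodule_set_add L I)
    have "mpoly_span n R \<Delta> \<subseteq> ?L"
    proof (rule mpoly_span_minimal[OF L])
      fix x assume x: "x \<in> \<Delta>" "x \<in> carrier (expos n)"
      then obtain i where i: "i < ?d" "x = b i" using b unfolding bij_betw_def by blast
      have "\<one> \<odot>\<^bsub>P\<^esub> ?e i \<in> ?L" by (rule P.lin_mem[OF oneideal one_closed i(1) e])
      then show "mon \<one> x \<in> ?L" using i mon_closed[OF one_closed x(2)] by simp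
    qed
    then have "carrier P \<subseteq> ?L <+>\<^bsub>P\<^esub> ?I"
      unfolding monomial_ideal_span[OF \<Delta>, symmetric]
      using P.set_add_mem1[OF L I] P.set_add_mem2[OF L I] by (intro P.set_add_subset[OF LI]) blast+
    also have "\<dots> \<subseteq> P.sat (range (\<lambda>l::nat. \<one> [^] l)) (?L <+>\<^bsub>P\<^esub> ?I)"
      by (rule P.sat_superset[OF P.mult_closed_powers[OF one_closed] P.submoduleE(1)[OF LI]])
    finally show "carrier P \<subseteq> P.sat (range (\<lambda>l::nat. \<one> [^] l)) (?L <+>\<^bsub>P\<^esub> ?I)" .
    fix c assume c: "c \<in> {..<?d} \<rightarrow> carrier R" and mem: "finsum P (\<lambda>i. c i \<odot>\<^bsub>P\<^esub> ?e i) {..<?d} \<in> ?I"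
    have ce: "(\<lambda>i. c i \<odot>\<^bsub>P\<^esub> ?e i) \<in> {..<?d} \<rightarrow> carrier P"
      using c e by (auto simp: Pi_iff)
    have "c j = \<zero>" if j: "j < ?d" for j
    proof -
      have "\<zero> = finsum P (\<lambda>i. c i \<odot>\<^bsub>P\<^esub> ?e i) {..<?d} (b j)"
        using mem bD[OF j] by (simp add: monomial_ideal_def)
      also have "\<dots> = finsum R (\<lambda>i. (c i \<odot>\<^bsub>P\<^esub> ?e i) (b j)) {..<?d}" by (rule MA_finsum_apply[OF ce])
      also have "\<dots> = finsum R (\<lambda>i. if j = i then c i else \<zero>) {..<?d}"
      proof (rule add.finprod_cong'[OF refl])
        fix i assume i: "i \<in> {..<?d}"
        have "b j = b i \<longleftrightarrow> j = i" using b i j unfolding bij_betw_def inj_on_def by blast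
        then show "(c i \<odot>\<^bsub>P\<^esub> ?e i) (b j) = (if j = i then c i else \<zero>)"
          using c i by (auto simp: MA_simps mon_apply Pi_iff)
      qed (use c in auto)
      also have "\<dots> = c j" using add.finprod_singleton[of j "{..<?d}" c] c j by simp
      finally show ?thesis by simp
    qed
    then show "\<exists>l::nat. \<forall>i<?d. \<one> [^] l \<otimes> c i = \<zero>" by simp
  qed
  show ?thesis unfolding hilb_ideal_def
  proof (intro conjI allI impI monomial_ideal[OF \<Delta>])
    fix Q assume "primeideal Q R"
    then interpret Q: primeideal Q R .
    have "\<one> \<in> carrier R - Q" using Q.one_imp_carrier Q.I_notcarr by blast
    then show "\<exists>f\<in>carrier R - Q. \<exists>e. ibasis ?I f ?d e" using basis by blast
  qed
qed

text \<open>The coefficient one of the monomial of \<open>\<beta>\<close> cannot come from the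
  monomial ideal, so it comes from the summand supported in \<open>\<Delta>'\<close>.\<close>

lemma monomial_ideal_span_subset:
  assumes nz: "\<one> \<noteq> \<zero>" and \<Delta>: "\<Delta> \<subseteq> carrier (expos n)"
    and span: "mpoly_span n R \<Delta>' <+>\<^bsub>P\<^esub> monomial_ideal \<Delta> = carrier P"
  shows "\<Delta> \<subseteq> \<Delta>'"
proof
  fix \<beta> assume \<beta>: "\<beta> \<in> \<Delta>"
  have "mon \<one> \<beta> \<in> mpoly_span n R \<Delta>' <+>\<^bsub>P\<^esub> monomial_ideal \<Delta>"
    unfolding span using \<beta> \<Delta> by (intro mon_closed[OF one_closed]) blast
  then obtain u v where uv: "u \<in> mpoly_span n R \<Delta>'" "v \<in> monomial_ideal \<Delta>" "mon \<one> \<beta> = u \<oplus>\<^bsub>P\<^esub> v"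
    unfolding P.set_add_iff by blast
  have uc: "u \<in> carrier P" "supp u \<subseteq> \<Delta>'" using uv(1) by (auto simp: mpoly_span_iff)
  have "mon \<one> \<beta> \<beta> = u \<beta> \<oplus> v \<beta>" unfolding uv(3) by (simp add: MA_simps)
  then have "u \<beta> = \<one>"
    using uv(2) \<beta> MA_coeff[OF uc(1), of \<beta>] by (simp add: mon_apply monomial_ideal_def)
  then have "\<beta> \<in> supp u" using nz by (simp add: supp_def)
  then show "\<beta> \<in> \<Delta>'" using uc(2) by blast
qed

end

text \<open>The field must have its carrier in the type of \<open>R\<close> to be an object of the
  category. The quotient by a maximal ideal consists of cosets, so its structure is transported back
  along a choice of one representative per coset.\<close>

lemma (in cring) ex_residue_field:
  assumes "\<one> \<noteq> \<zero>"
  shows "\<exists>(F :: 'a ring) h. field F \<and> h \<in> ring_hom R F"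
proof -
  have "\<one> \<notin> {\<zero>}" using assms by simp
  then obtain M where M: "maximalideal M R" using ex_maximalideal[OF zeroideal] by blast
  interpret M: maximalideal M R by (rule M)
  let ?r = "inv_into (carrier R) ((+>) M)"
  interpret F: field "R Quot M" by (rule M.quotient_is_field[OF is_cring])
  have "carrier (R Quot M) \<subseteq> (+>) M ` carrier R" unfolding FactRing_def A_RCOSETS_def' by auto
  then have inj: "inj_on ?r (carrier (R Quot M))" by (rule inj_on_inv_into)
  have "?r \<in> ring_hom (R Quot M) (image_ring ?r (R Quot M))"
    using inj_imp_image_ring_iso[OF inj] by (simp add: ring_iso_def)
  then have "?r \<circ> (+>) M \<in> ring_hom R (image_ring ?r (R Quot M))"
    by (rule ring_hom_trans[OF M.rcos_ring_hom])
  then show ?thesis using F.inj_imp_image_ring_is_field[OF inj] by (intro exI conjI)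
qed

definition alg_of_hom :: "('u \<Rightarrow> 'v) \<Rightarrow> 'v ring \<Rightarrow> ('u, 'v) module" where
  "alg_of_hom h F = \<lparr>carrier = carrier F, mult = mult F, one = \<one>\<^bsub>F\<^esub>, zero = \<zero>\<^bsub>F\<^esub>,
     add = add F, smult = (\<lambda>a x. h a \<otimes>\<^bsub>F\<^esub> x)\<rparr>"

lemma alg_of_hom:
  assumes k: "cring k" and F: "field F" and h: "h \<in> ring_hom k F"
  shows "algebra k (alg_of_hom h F)" "field (alg_of_hom h F)"
proof -
  interpret F: field F by (rule F)
  have hc: "h a \<in> carrier F" if "a \<in> carrier k" for a using ring_hom_closed[OF h that] .
  have c: "cring (alg_of_hom h F)"
    by (rule cring_cong[OF F.is_cring]) (simp_all add: alg_of_hom_def)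
  show "algebra k (alg_of_hom h F)"
  proof (rule algebraI[OF k c])
  qed (auto simp: alg_of_hom_def hc ring_hom_add[OF h] ring_hom_mult[OF h] ring_hom_one[OF h]
      F.l_distr F.r_distr F.m_assoc)
  show "field (alg_of_hom h F)"
  proof (rule cring.cring_fieldI[OF c])
    have "Units (alg_of_hom h F) = Units F" by (simp add: Units_def alg_of_hom_def)
    then show "Units (alg_of_hom h F) = carrier (alg_of_hom h F) - {\<zero>\<^bsub>alg_of_hom h F\<^esub>}"
      using F.field_Units by (simp add: alg_of_hom_def)
  qed
qed

text \<open>The spectrum of a field is one point, so a single remaining member
  \<open>\<Delta>'\<close> must contain the monomial ideal of \<open>\<Delta>\<close> over the
  residue field. This forces \<open>\<Delta>\<close> into \<open>\<Delta>'\<close>, and equal sizes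
  make them the same.\<close>

lemma Hilb_std_cover_minimal:
  fixes k :: "'u ring"
  assumes k: "cring k" "\<one>\<^bsub>k\<^esub> \<noteq> \<zero>\<^bsub>k\<^esub>" and D: "\<Delta> \<in> standard_sets_of_size n d"
  shows "\<not> is_open_cover k (standard_sets_of_size n d - {\<Delta>}) (Hilb_std n) (Hilb n d)"
proof
  assume cover: "is_open_cover k (standard_sets_of_size n d - {\<Delta>}) (Hilb_std n) (Hilb n d)"
  obtain F :: "'u ring" and h where Fh: "field F" "h \<in> ring_hom k F"
    using cring.ex_residue_field[OF k] by blast
  define B where "B = alg_of_hom h F"
  have B: "algebra k B" "field B" unfolding B_def by (rule alg_of_hom[OF k(1) Fh])+
  interpret B: field B by (rule B(2))
  interpret mpoly_ring B n by (simp add: mpoly_ring_def B.is_cring)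
  have \<Delta>: "standard_set n \<Delta>" "finite \<Delta>" "card \<Delta> = d" using D by (simp_all add: standard_sets_of_size_def)
  let ?I = "monomial_ideal \<Delta>" and ?id = "\<lambda>b\<in>carrier B. b"
  have I: "?I \<in> fobj (Hilb n d) B"
    unfolding Hilb_iff[OF B.is_cring] using monomial_ideal_hilb[OF \<Delta>(1,2)] \<Delta>(3) by simp
  have "\<exists>U. (\<forall>\<Delta>'\<in>standard_sets_of_size n d - {\<Delta>}. is_open_locus k (Hilb_std n \<Delta>') (Hilb n d) B ?I (U \<Delta>')) \<and>
      (\<Union>\<Delta>'\<in>standard_sets_of_size n d - {\<Delta>}. U \<Delta>') = Spec B"
    by (rule bspec[OF mp[OF spec[OF conjunct2[OF cover[unfolded is_open_cover_def]]] B(1)] I])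
  then obtain U where U: "\<forall>\<Delta>'\<in>standard_sets_of_size n d - {\<Delta>}.
      is_open_locus k (Hilb_std n \<Delta>') (Hilb n d) B ?I (U \<Delta>')"
    and SpecU: "(\<Union>\<Delta>'\<in>standard_sets_of_size n d - {\<Delta>}. U \<Delta>') = Spec B"
    by (elim exE conjE) (rule that)
  have "{\<zero>\<^bsub>B\<^esub>} \<in> Spec B" using B.zeroprimeideal by (simp add: Spec_def)
  then obtain \<Delta>' where D': "\<Delta>' \<in> standard_sets_of_size n d - {\<Delta>}" and z: "{\<zero>\<^bsub>B\<^esub>} \<in> U \<Delta>'"
    using SpecU by blast
  \<comment> \<open>The defining property of the open locus is applied to the identity homomorphism;
    it turns the fact that the locus contains the point into membership of the ideal in the
    subfunctor.\<close>
  have "spec_map B ?id ` Spec B \<subseteq> U \<Delta>'"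
  proof (rule image_subsetI)
    fix Q assume "Q \<in> Spec B"
    then interpret Q: primeideal Q B by (simp add: Spec_def)
    have "Q = {\<zero>\<^bsub>B\<^esub>}" using B.all_ideals Q.ideal_axioms Q.I_notcarr by blast
    then have "spec_map B ?id Q = {\<zero>\<^bsub>B\<^esub>}" by (auto simp: spec_map_def)
    then show "spec_map B ?id Q \<in> U \<Delta>'" using z by simp
  qed
  moreover have "?id \<in> alg_hom k B B"
  proof -
    interpret algebra k B by (rule B(1))
    show ?thesis by (auto simp: alg_hom_def ring_hom_def)
  qed
  ultimately have "farr (Hilb n d) B B ?id ?I \<in> fobj (Hilb_std n \<Delta>') B"
    using bspec[OF U D'] B(1) unfolding is_open_locus_def by simp
  then have "?I \<in> fobj (Hilb_std n \<Delta>') B"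
    unfolding farr_simps hilb_map_id[OF B(1) monomial_ideal[OF \<Delta>(1)]] .
  then have span: "mpoly_span n B \<Delta>' <+>\<^bsub>P\<^esub> ?I = carrier P"
    unfolding Hilb_std_iff[OF B.is_cring] by simp
  have "\<Delta> \<subseteq> carrier (expos n)" using \<Delta>(1) unfolding standard_set_def by (rule conjunct1)
  then have "\<Delta> \<subseteq> \<Delta>'" by (rule monomial_ideal_span_subset[OF B.one_not_zero _ span])
  moreover have "finite \<Delta>'" "card \<Delta>' = card \<Delta>" using D' \<Delta>(3) by (simp_all add: standard_sets_of_size_def)
  ultimately have "\<Delta> = \<Delta>'" by (intro card_subset_eq) simp_all
  then show False using D' by blast
qed

theorem proposition1:
  fixes k :: "'u ring" and n d :: nat
  assumes "cring k" and "\<one>\<^bsub>k\<^esub> \<noteq> \<zero>\<^bsub>k\<^esub>" and "d > 0"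
  shows "is_open_cover k (standard_sets_of_size n d) (Hilb_std n) (Hilb n d) \<and>
         (\<forall>\<Delta>\<in>standard_sets_of_size n d.
           \<not> is_open_cover k (standard_sets_of_size n d - {\<Delta>}) (Hilb_std n) (Hilb n d))"
  using Hilb_std_open_cover Hilb_std_cover_minimal[OF assms(1,2)] by blast

end
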